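(* Fix the staggered mesh and the time step $\delta t$. Let $(\varepsilon^{(m)})_{m\in\mathbb N}$ be a sequence of positive real numbers tending to zero, let the initial data $(\rho_0^{\varepsilon^{(m)}},\boldsymbol u_0^{\varepsilon^{(m)}})$, $m\in\mathbb N$, be well-prepared (in the sense given in the context), and let $(\rho^{(m)},\boldsymbol u^{(m)})$ be a corresponding sequence of solutions of the pressure correction scheme (PC) with $\varepsilon=\varepsilon^{(m)}$. Then $(\rho^{(m)})_m$ tends to the constant function $1$ in $L^\infty((0,T);L^\gamma(\Omega))$ as $m\to+\infty$. Moreover, for all $q\in[1,\min(2,\gamma)]$ there exists $C>0$ such that $$\|\rho^{(m)}-1\|_{L^\infty((0,T);L^q(\Omega))}\le C\,\varepsilon^{(m)}\qquad\text{for $m$ large enough}.$$ In addition, the sequence $(\boldsymbol u^{(m)},\delta p^{(m)})_m$ tends, in any discrete norm, to the solution $(\boldsymbol u,\delta p)$ of the following pressure correction scheme for the incompressible Navier-Stokes equations: knowing $\delta p^n\in L_{\mathcal M}(\Omega)$ and $\boldsymbol u^n\in\mathbf H_{\mathcal E,0}(\Omega)$, compute $\delta p^{n+1}\in L_{\mathcal M}(\Omega)$ and $\boldsymbol u^{n+1}\in\mathbf H_{\mathcal E,0}(\Omega)$ through (prediction) solve for $\tilde{\boldsymbol u}^{n+1}\in\mathbf H_{\mathcal E,0}(\Omega)$: $$\tfrac1{\delta t}(\tilde{\boldsymbol u}_\sigma^{n+1}-\boldsymbol u_\sigma^n)+\mathbf{div}(\boldsymbol u^n\otimes\tilde{\boldsymbol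 u}^{n+1})_\sigma-\mathbf{div}(\boldsymbol\tau(\tilde{\boldsymbol u}^{n+1}))_\sigma+(\boldsymbol\nabla\delta p^n)_\sigma=0,\quad\forall\sigma\in\mathcal E_{\rm int};$$ (correction) solve for $\delta p^{n+1}$, $\boldsymbol u^{n+1}$: $$\tfrac1{\delta t}(\boldsymbol u_\sigma^{n+1}-\tilde{\boldsymbol u}_\sigma^{n+1})+(\boldsymbol\nabla\delta p^{n+1})_\sigma-(\boldsymbol\nabla\delta p^n)_\sigma=0,\quad\forall\sigma\in\mathcal E_{\rm int},$$ $$\mathrm{div}(\boldsymbol u^{n+1})_K=0,\quad\forall K\in\mathcal M.$$
   Context: Mesh. $d\in\{2,3\}$; $\Omega\subset\mathbb R^d$ is a bounded connected open set, polygonal ($d=2$) or polyhedral ($d=3$). $\mathcal M$ is a finite partition of $\Omega$ into triangles and convex quadrilaterals ($d=2$) or tetrahedra and convex hexahedra ($d=3$); $\mathcal E$ is the set of faces, and each face either lies in $\partial\Omega$ (set $\mathcal E_{\rm ext}$) or is the whole common face $\sigma=K|L$ of two distinct cells (set $\mathcal E_{\rm int}$). $\mathcal E(K)$ is the set of faces of $K$, $\boldsymbol n_{K,\sigma}$ the unit normal to $\sigma$ outward $K$, $|\cdot|$ the measure. Each $K$ is partitioned into half-diamond cells $D_{K,\sigma}$, $\sigma\in\mathcal E(K)$, of equal measure $|K|/\#\mathcal E(K)$ (the cone with basis $\sigma$ and vertex the mass center of $K$ if $K$ is a simplex, rectangle or cuboid; otherwise a given partition with the same connectivities). For $\sigma=K|L$,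 $D_\sigma=D_{K,\sigma}\cup D_{L,\sigma}$ (and $D_\sigma=D_{K,\sigma}$ for $\sigma\in\mathcal E_{\rm ext}\cap\mathcal E(K)$). $\bar{\mathcal E}(D_\sigma)$ is the set of faces of $D_\sigma$ (dual faces); $e=D_\sigma|D_{\sigma'}$ is the dual face separating $D_\sigma$ and $D_{\sigma'}$. Spaces. $L_{\mathcal M}(\Omega)$: functions constant on each $K\in\mathcal M$. $\mathbf H_{\mathcal E,0}(\Omega)$: $\mathbb R^d$-valued functions constant on each $D_\sigma$, with value $0$ for $\sigma\in\mathcal E_{\rm ext}$. Operators. For $\rho\in L_{\mathcal M}(\Omega)$, $\boldsymbol u,\boldsymbol v\in\mathbf H_{\mathcal E,0}(\Omega)$: - $F_{K,\sigma}(\rho,\boldsymbol u)=|\sigma|\rho_\sigma\boldsymbol u_\sigma\cdot\boldsymbol n_{K,\sigma}$ for $\sigma=K|L$, with upwind $\rho_\sigma=\rho_K$ if $\boldsymbol u_\sigma\cdot\boldsymbol n_{K,\sigma}\ge0$, $\rho_\sigma=\rho_L$ otherwise; $F_{K,\sigma}=0$ on external faces; $\mathrm{div}(\rho\boldsymbol u)_K=|K|^{-1}\sum_{\sigma\in\mathcal E(K)}F_{K,\sigma}(\rho,\boldsymbol u)$; $\mathrm{div}(\boldsymbol u)_K=|K|^{-1}\sum_{\sigma\in\mathcal E(K)}|\sigma|\boldsymbol u_\sigma\cdot\boldsymbol n_{K,\sigma}$. - Dual density: $|D_\sigma|\rho_{D_\sigma}=|D_{K,\sigma}|\rho_K+|D_{L,\sigma}|\rho_L$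 for $\sigma=K|L$. - Dual mass fluxes $F_{\sigma,e}(\rho,\boldsymbol u)$: zero if $e\subset\partial\Omega$; otherwise fixed linear combinations, with constant coefficients, of the primal fluxes at neighbouring faces such that, with $\xi_K^\sigma=|D_{K,\sigma}|/|K|$: (i) $F_{K,\sigma}+\sum_{e\in\bar{\mathcal E}(D_\sigma),e\subset K}F_{\sigma,e}=\xi_K^\sigma\sum_{\sigma'\in\mathcal E(K)}F_{K,\sigma'}$ for all $K$, $\sigma\in\mathcal E(K)$; (ii) $F_{\sigma,e}=-F_{\sigma',e}$ for $e=D_\sigma|D_{\sigma'}$; (iii) $|F_{\sigma,e}|\le\max_{\sigma'\in\mathcal E(K)}|F_{K,\sigma'}|$ for $e\subset K$. - $\mathbf{div}(\rho\boldsymbol u\otimes\boldsymbol v)_\sigma=|D_\sigma|^{-1}\sum_{e\in\bar{\mathcal E}(D_\sigma)}F_{\sigma,e}(\rho,\boldsymbol u)\boldsymbol v_e$, $\boldsymbol v_e=\frac12(\boldsymbol v_\sigma+\boldsymbol v_{\sigma'})$ for $e=D_\sigma|D_{\sigma'}$; $\mathbf{div}(\boldsymbol u\otimes\boldsymbol v)$ is this operator with $\rho\equiv1$. - $\mathbf{div}(\boldsymbol\tau(\boldsymbol u))_\sigma=-\frac{\mu}{|D_\sigma|}\sum_K\int_K\boldsymbol\nabla\hat{\boldsymbol u}\cdot\boldsymbol\nabla\zeta_\sigma-\frac{\mu+\lambda}{|D_\sigma|}\sum_K\int_K\mathrm{div}(\hat{\boldsymbol u})\boldsymbol\nabla\zeta_\sigma$,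 with $\mu>0$, $\mu+\lambda>0$, $\hat{\boldsymbol u}=\sum_\sigma\boldsymbol u_\sigma\zeta_\sigma$, and $(\zeta_\sigma)_{\sigma\in\mathcal E}$ the Crouzeix-Raviart (simplicial cells) / parametric Rannacher-Turek (quadrangular, hexahedral cells; reference space spanned by $1,x_i,x_i^2-x_{i+1}^2$, composed with the inverse $Q_1$ mapping) shape functions, with zero mean jump through internal faces and $|\sigma'|^{-1}\int_{\sigma'}\zeta_\sigma=\delta_{\sigma\sigma'}$. - For $q\in L_{\mathcal M}(\Omega)$ and $\sigma=K|L$: $(\boldsymbol\nabla q)_\sigma=\frac{|\sigma|}{|D_\sigma|}(q_L-q_K)\boldsymbol n_{K,\sigma}$. Equation of state: $p=\rho^\gamma$, $\gamma\ge1$; $p^n_K=(\rho^n_K)^\gamma$. $T>0$, $\delta t>0$, $N=\lfloor T/\delta t\rfloor$. Pressure correction scheme (PC) with Mach number $\varepsilon>0$. Initialization: $\rho^0_K=|K|^{-1}\int_K\rho_0^\varepsilon$, $\boldsymbol u_\sigma^0=|\sigma|^{-1}\int_\sigma\boldsymbol u_0^\varepsilon$ ($\sigma\in\mathcal E_{\rm int}$), and $\rho^{-1}$ is given by $\frac1{\delta t}(\rho_K^0-\rho_K^{-1})+\mathrm{div}(\rho^0\boldsymbol u^0)_K=0$ for all $K$ ($\rho^{-1}>0$ for $\varepsilon$ small enough). For $0\le n\le N-1$, with $(\overline{\boldsymbol\nabla p})^n_\sigma=(\rho_{D_\sigma}^n/\rho_{D_\sigma}^{n-1})^{1/2}(\boldsymbol\nabla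 p^n)_\sigma$: find $\tilde{\boldsymbol u}^{n+1}\in\mathbf H_{\mathcal E,0}(\Omega)$ with $$\tfrac1{\delta t}(\rho^n_{D_\sigma}\tilde{\boldsymbol u}^{n+1}_\sigma-\rho^{n-1}_{D_\sigma}\boldsymbol u^n_\sigma)+\mathbf{div}(\rho^n\boldsymbol u^n\otimes\tilde{\boldsymbol u}^{n+1})_\sigma-\mathbf{div}(\boldsymbol\tau(\tilde{\boldsymbol u}^{n+1}))_\sigma+\tfrac1{\varepsilon^2}(\overline{\boldsymbol\nabla p})^n_\sigma=0\ \ \forall\sigma\in\mathcal E_{\rm int},$$ then $\rho^{n+1}\in L_{\mathcal M}(\Omega)$, $\boldsymbol u^{n+1}\in\mathbf H_{\mathcal E,0}(\Omega)$ with $$\tfrac1{\delta t}\rho^n_{D_\sigma}(\boldsymbol u^{n+1}_\sigma-\tilde{\boldsymbol u}^{n+1}_\sigma)+\tfrac1{\varepsilon^2}(\boldsymbol\nabla p^{n+1})_\sigma-\tfrac1{\varepsilon^2}(\overline{\boldsymbol\nabla p})^n_\sigma=0\ \ \forall\sigma\in\mathcal E_{\rm int},$$ $$\tfrac1{\delta t}(\rho_K^{n+1}-\rho_K^n)+\mathrm{div}(\rho^{n+1}\boldsymbol u^{n+1})_K=0\ \ \forall K\in\mathcal M.$$ Well-prepared data: $\rho_0^\varepsilon>0$, $\rho_0^\varepsilon\in L^\infty(\Omega)$, $\boldsymbol u_0^\varepsilon\in H^1_0(\Omega)^d$, and there is $C$ independent of $\varepsilon$ with $\|\boldsymbol u_0^\varepsilon\|_{H^1(\Omega)^d}+\frac1\varepsilon\|\mathrm{div}\,\boldsymbol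 u_0^\varepsilon\|_{L^2(\Omega)}+\frac1{\varepsilon^2}\|\rho_0^\varepsilon-1\|_{L^\infty(\Omega)}\le C$; moreover $\boldsymbol u_0^\varepsilon$ converges in $L^2(\Omega)^d$ to some $\boldsymbol u_0\in L^2(\Omega)^d$. Notation. $\delta p^n_K=(p^n_K-m(p^n))/\varepsilon^2$ with $m(p^n)=|\Omega|^{-1}\sum_K|K|p^n_K$. Discrete solutions are identified with functions piecewise constant in time; the $L^\infty((0,T);L^q)$ norm is the maximum over the discrete times $0\le n\le N$ of the $L^q(\Omega)$ norms. A "discrete norm" is any norm on the (finite-dimensional) space of discrete functions.
   Formalization: Well-prepared data only bound the initial δp^{0,(m)}, so (u,δp) need not converge; convergence is stated along each subsequence where δp^{0,(m)} converges, with that limit as initial pressure (δp of zero mean); every subsequence contains such a one. *)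

theory Defs
  imports "HOL-Analysis.Analysis" "HOL-Probability.Essential_Supremum"
begin

section \<open>Function spaces\<close>

definition in_L2 :: "(real^'n) set \<Rightarrow> (real^'n \<Rightarrow> 'b::euclidean_space) \<Rightarrow> bool" where
  "in_L2 \<Omega> f \<longleftrightarrow> f \<in> borel_measurable (lebesgue_on \<Omega>) \<and>
     integrable (lebesgue_on \<Omega>) (\<lambda>x. (norm (f x))\<^sup>2)"

definition L2_nrm :: "(real^'n) set \<Rightarrow> (real^'n \<Rightarrow> 'b::euclidean_space) \<Rightarrow> real" where
  "L2_nrm \<Omega> f = sqrt (LINT x|lebesgue_on \<Omega>. (norm (f x))\<^sup>2)"

definition Lq_nrm :: "(real^'n) set \<Rightarrow> real \<Rightarrow> (real^'n \<Rightarrow> real) \<Rightarrow> real" where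
  "Lq_nrm \<Omega> q f = (LINT x|lebesgue_on \<Omega>. \<bar>f x\<bar> powr q) powr (1 / q)"

primrec C_k :: "nat \<Rightarrow> ('a::euclidean_space \<Rightarrow> 'b::real_normed_vector) \<Rightarrow> bool" where
  "C_k 0 f \<longleftrightarrow> continuous_on UNIV f"
| "C_k (Suc k) f \<longleftrightarrow> (\<forall>x. f differentiable (at x)) \<and>
     (\<forall>b\<in>Basis. C_k k (\<lambda>x. frechet_derivative f (at x) b))"

text \<open>\<open>test_fun \<Omega>\<close> is the set of smooth functions with compact support in \<open>\<Omega>\<close>, extended by zero
  to the whole space.\<close>

definition test_fun :: "'a::euclidean_space set \<Rightarrow> ('a \<Rightarrow> 'b::real_normed_vector) set" where
  "test_fun \<Omega> = {\<phi>. (\<forall>k. C_k k \<phi>) \<and> compact (closure {x. \<phi> x \<noteq> 0}) \<and> closure {x. \<phi> x \<noteq> 0} \<subseteq> \<Omega>}"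

text \<open>Distributional Jacobian matrix in \<open>L\<^sup>2\<close> of a vector field: the \<open>i\<close>-th column of \<open>J\<close> is the
  derivative in direction \<open>i\<close>.\<close>

definition has_weak_jacobian ::
    "(real^'n) set \<Rightarrow> (real^'n \<Rightarrow> real^'n) \<Rightarrow> (real^'n \<Rightarrow> real^'n^'n) \<Rightarrow> bool" where
  "has_weak_jacobian \<Omega> u J \<longleftrightarrow> in_L2 \<Omega> J \<and>
     (\<forall>\<phi>::real^'n \<Rightarrow> real. \<phi> \<in> test_fun \<Omega> \<longrightarrow>
       (\<forall>i. (LINT x|lebesgue_on \<Omega>. frechet_derivative \<phi> (at x) (axis i 1) *\<^sub>R u x)
          = - (LINT x|lebesgue_on \<Omega>. \<phi> x *\<^sub>R column i (J x))))"

text \<open>The weak Jacobian is unique up to a null set, so that the norms below do not depend on the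
  choice made here.\<close>

definition weak_jacobian :: "(real^'n) set \<Rightarrow> (real^'n \<Rightarrow> real^'n) \<Rightarrow> (real^'n \<Rightarrow> real^'n^'n)" where
  "weak_jacobian \<Omega> u = (SOME J. has_weak_jacobian \<Omega> u J)"

definition weak_div :: "(real^'n) set \<Rightarrow> (real^'n \<Rightarrow> real^'n) \<Rightarrow> real^'n \<Rightarrow> real" where
  "weak_div \<Omega> u x = trace (weak_jacobian \<Omega> u x)"

definition H1 :: "(real^'n) set \<Rightarrow> (real^'n \<Rightarrow> real^'n) set" where
  "H1 \<Omega> = {u. in_L2 \<Omega> u \<and> (\<exists>J. has_weak_jacobian \<Omega> u J)}"

definition H1_nrm :: "(real^'n) set \<Rightarrow> (real^'n \<Rightarrow> real^'n) \<Rightarrow> real" where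
  "H1_nrm \<Omega> u = sqrt ((L2_nrm \<Omega> u)\<^sup>2 + (L2_nrm \<Omega> (weak_jacobian \<Omega> u))\<^sup>2)"

definition H1_approx ::
    "(real^'n) set \<Rightarrow> (nat \<Rightarrow> real^'n \<Rightarrow> real^'n) \<Rightarrow> (real^'n \<Rightarrow> real^'n) \<Rightarrow> bool" where
  "H1_approx \<Omega> \<phi> u \<longleftrightarrow> (\<forall>k. \<phi> k \<in> test_fun \<Omega>) \<and> (\<lambda>k. H1_nrm \<Omega> (\<lambda>x. \<phi> k x - u x)) \<longlonglongrightarrow> 0"

definition H10 :: "(real^'n) set \<Rightarrow> (real^'n \<Rightarrow> real^'n) set" where
  "H10 \<Omega> = {u \<in> H1 \<Omega>. \<exists>\<phi>. H1_approx \<Omega> \<phi> u}"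

section \<open>Integrals over flat faces\<close>

text \<open>A face \<open>\<sigma>\<close> lies in a hyperplane with unit normal \<open>n\<close>. By Fubini's theorem, its surface measure
  is the Lebesgue measure of the right prism of height one \<open>{x + t n | x \<in> \<sigma>, 0 \<le> t \<le> 1}\<close>, and the
  surface integral of \<open>f\<close> is the volume integral over this prism of \<open>f\<close> composed with the orthogonal
  projection onto the hyperplane.\<close>

definition unit_normal :: "(real^'n) set \<Rightarrow> real^'n" where
  "unit_normal \<sigma> = (SOME n. norm n = 1 \<and> (\<forall>x\<in>\<sigma>. \<forall>y\<in>\<sigma>. n \<bullet> (x - y) = 0))"

definition prism :: "(real^'n) set \<Rightarrow> (real^'n) set" where
  "prism \<sigma> = {x + t *\<^sub>R unit_normal \<sigma> | x t. x \<in> \<sigma> \<and> 0 \<le> t \<and> t \<le> 1}"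

definition area :: "(real^'n) set \<Rightarrow> real" where
  "area \<sigma> = measure lebesgue (prism \<sigma>)"

definition face_integral ::
    "(real^'n) set \<Rightarrow> (real^'n \<Rightarrow> 'b::euclidean_space) \<Rightarrow> 'b" where
  "face_integral \<sigma> f = (LINT y|lebesgue_on (prism \<sigma>).
     f (y - (unit_normal \<sigma> \<bullet> (y - (SOME a. a \<in> \<sigma>))) *\<^sub>R unit_normal \<sigma>))"

definition face_mean :: "(real^'n) set \<Rightarrow> (real^'n \<Rightarrow> 'b::euclidean_space) \<Rightarrow> 'b" where
  "face_mean \<sigma> f = (1 / area \<sigma>) *\<^sub>R face_integral \<sigma> f"

text \<open>Mean value over a face of the trace of a function of \<open>H\<^sup>1\<^sub>0\<close>: as the trace itself, it is
  obtained by continuous extension from smooth functions.\<close>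

definition trace_mean :: "(real^'n) set \<Rightarrow> (real^'n) set \<Rightarrow> (real^'n \<Rightarrow> real^'n) \<Rightarrow> real^'n" where
  "trace_mean \<Omega> \<sigma> u = (THE a. \<forall>\<phi>. H1_approx \<Omega> \<phi> u \<longrightarrow> (\<lambda>k. face_mean \<sigma> (\<phi> k)) \<longlonglongrightarrow> a)"

section \<open>The staggered mesh\<close>

type_synonym 'n scalar_field = "(real^'n) set \<Rightarrow> real"        \<comment> \<open>cell-indexed values\<close>
type_synonym 'n vector_field = "(real^'n) set \<Rightarrow> real^'n"     \<comment> \<open>face-indexed values\<close>

text \<open>Cells are closed polytopes, faces are their facets. The components are: the domain; the cells;
  for every non-simplicial cell the image \<open>corners X K S\<close> of the vertex of the unit cube whose
  coordinates in \<open>S\<close> are 1 and the others 0; the half-diamond cells \<open>half_diamond X K \<sigma>\<close>; the constant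
  coefficients \<open>flux_coef X K \<sigma> \<sigma>' \<sigma>''\<close> of the primal flux \<open>F\<^bsub>K,\<sigma>''\<^esub>\<close> in the dual flux \<open>F\<^bsub>\<sigma>,e\<^esub>\<close>
  through \<open>e = D\<^bsub>\<sigma>\<^esub>|D\<^bsub>\<sigma>'\<^esub>\<close>, \<open>e \<subseteq> K\<close>; and the restriction \<open>shape_fn X K \<sigma>\<close> to \<open>K\<close> of the shape function
  attached to \<open>\<sigma>\<close> (which is discontinuous across the faces).\<close>

record ('n::finite) staggered_mesh =
  domain :: "(real^'n) set"
  cells :: "(real^'n) set set"
  corners :: "(real^'n) set \<Rightarrow> 'n set \<Rightarrow> real^'n"
  half_diamond :: "(real^'n) set \<Rightarrow> (real^'n) set \<Rightarrow> (real^'n) set"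
  flux_coef :: "(real^'n) set \<Rightarrow> (real^'n) set \<Rightarrow> (real^'n) set \<Rightarrow> (real^'n) set \<Rightarrow> real"
  shape_fn :: "(real^'n) set \<Rightarrow> (real^'n) set \<Rightarrow> real^'n \<Rightarrow> real"

subsection \<open>Cells and faces\<close>

abbreviation vol :: "(real^'n) set \<Rightarrow> real" where
  "vol A \<equiv> measure lebesgue A"

definition faces :: "(real^'n) set \<Rightarrow> (real^'n) set set" where
  "faces K = {\<sigma>. \<sigma> facet_of K}"

definition all_faces :: "('n::finite) staggered_mesh \<Rightarrow> (real^'n) set set" where
  "all_faces X = (\<Union>K\<in>cells X. faces K)"

definition ext_faces :: "('n::finite) staggered_mesh \<Rightarrow> (real^'n) set set" where
  "ext_faces X = {\<sigma> \<in> all_faces X. \<sigma> \<subseteq> frontier (domain X)}"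

text \<open>\<open>separates X \<sigma> K L\<close> is \<open>\<sigma> = K|L\<close>.\<close>

definition separates ::
    "('n::finite) staggered_mesh \<Rightarrow> (real^'n) set \<Rightarrow> (real^'n) set \<Rightarrow> (real^'n) set \<Rightarrow> bool" where
  "separates X \<sigma> K L \<longleftrightarrow> K \<in> cells X \<and> L \<in> cells X \<and> K \<noteq> L \<and>
     \<sigma> \<in> faces K \<and> \<sigma> \<in> faces L \<and> \<sigma> = K \<inter> L"

definition int_faces :: "('n::finite) staggered_mesh \<Rightarrow> (real^'n) set set" where
  "int_faces X = {\<sigma>. \<exists>K L. separates X \<sigma> K L}"

definition neighbour :: "('n::finite) staggered_mesh \<Rightarrow> (real^'n) set \<Rightarrow> (real^'n) set \<Rightarrow> (real^'n) set" where
  "neighbour X K \<sigma> = (THE L. separates X \<sigma> K L)"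

definition normal :: "(real^'n) set \<Rightarrow> (real^'n) set \<Rightarrow> real^'n" where
  "normal K \<sigma> = (THE n. norm n = 1 \<and> (\<exists>b. K \<subseteq> {x. n \<bullet> x \<le> b} \<and> \<sigma> = K \<inter> {x. n \<bullet> x = b}))"

definition mass_center :: "(real^'n) set \<Rightarrow> real^'n" where
  "mass_center K = (1 / vol K) *\<^sub>R (LINT x|lebesgue_on K. x)"

definition simplicial :: "(real^'n) set \<Rightarrow> bool" where
  "simplicial K \<longleftrightarrow> int CARD('n) simplex K"

text \<open>Rectangle or cuboid, in arbitrary orientation.\<close>

definition cuboid :: "(real^'n) set \<Rightarrow> bool" where
  "cuboid K \<longleftrightarrow> (\<exists>(f :: real^'n \<Rightarrow> real^'n) a b. orthogonal_transformation f \<and> (\<forall>i. 0 < b $ i) \<and>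
     K = (\<lambda>x. a + f x) ` cbox 0 b)"

text \<open>The \<open>Q\<^sub>1\<close> mapping of the unit cube with vertices \<open>c S\<close>.\<close>

definition Q1_map :: "('n set \<Rightarrow> real^'n) \<Rightarrow> real^'n \<Rightarrow> real^'n" where
  "Q1_map c x = (\<Sum>S\<in>UNIV. ((\<Prod>i\<in>S. x $ i) * (\<Prod>i\<in>- S. 1 - x $ i)) *\<^sub>R c S)"

definition ref_face :: "'n \<Rightarrow> bool \<Rightarrow> (real^'n) set" where
  "ref_face i b = {x \<in> cbox 0 1. x $ i = (if b then 1 else 0)}"

definition corner_face :: "('n set \<Rightarrow> real^'n) \<Rightarrow> 'n \<Rightarrow> bool \<Rightarrow> (real^'n) set" where
  "corner_face c i b = convex hull (c ` {S. (i \<in> S) = b})"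

text \<open>Convex quadrilaterals (dimension 2) and convex hexahedra (dimension 3): convex polytopes with
  the vertices and facets of the cube, given by a labelling of the vertices; the \<open>Q\<^sub>1\<close> mapping, whose
  inverse is used for the Rannacher-Turek element, is a nondegenerate parametrization of the cell
  (this is automatic for a convex quadrilateral).\<close>

definition quad_hex :: "(real^'n) set \<Rightarrow> ('n set \<Rightarrow> real^'n) \<Rightarrow> bool" where
  "quad_hex K c \<longleftrightarrow> inj c \<and> K = convex hull (range c) \<and> {x. x extreme_point_of K} = range c \<and>
     faces K = {corner_face c i b | i b. True} \<and>
     bij_betw (Q1_map c) (cbox 0 1) K \<and>
     (\<forall>x\<in>cbox 0 1. invertible (jacobian (Q1_map c) (at x)))"

definition cone_over :: "real^'n \<Rightarrow> (real^'n) set \<Rightarrow> (real^'n) set" where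
  "cone_over a \<sigma> = convex hull (insert a \<sigma>)"

text \<open>A partition of \<open>K\<close> into half-diamond cells with the connectivities of the partition of the cube
  into the cones over its faces: both are related by a homeomorphism respecting faces.\<close>

definition cube_like_partition ::
    "(real^'n) set \<Rightarrow> ('n set \<Rightarrow> real^'n) \<Rightarrow> ((real^'n) set \<Rightarrow> (real^'n) set) \<Rightarrow> bool" where
  "cube_like_partition K c D \<longleftrightarrow> (\<exists>h g. homeomorphism (cbox 0 1) K h g \<and>
     (\<forall>i b. h ` ref_face i b = corner_face c i b \<and>
            h ` cone_over ((1/2) *\<^sub>R 1) (ref_face i b) = D (corner_face c i b)))"

definition half_diamonds :: "('n::finite) staggered_mesh \<Rightarrow> (real^'n) set \<Rightarrow> bool" where
  "half_diamonds X K \<longleftrightarrow>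
     (\<forall>\<sigma>\<in>faces K. half_diamond X K \<sigma> \<in> sets lebesgue \<and>
        vol (half_diamond X K \<sigma>) = vol K / real (card (faces K))) \<and>
     (\<Union>\<sigma>\<in>faces K. half_diamond X K \<sigma>) = K \<and>
     (\<forall>\<sigma>\<in>faces K. \<forall>\<sigma>'\<in>faces K. \<sigma> \<noteq> \<sigma>' \<longrightarrow> negligible (half_diamond X K \<sigma> \<inter> half_diamond X K \<sigma>')) \<and>
     (if simplicial K \<or> cuboid K
      then \<forall>\<sigma>\<in>faces K. half_diamond X K \<sigma> = cone_over (mass_center K) \<sigma>
      else cube_like_partition K (corners X K) (half_diamond X K))"

text \<open>The condition \<open>domain X = interior (closure (domain X))\<close> says that the domain, whose closure is
  a finite union of polytopes, has no slits or punctures, as is understood for a polygonal or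
  polyhedral open set.\<close>

definition is_mesh :: "('n::finite) staggered_mesh \<Rightarrow> bool" where
  "is_mesh X \<longleftrightarrow> (CARD('n) = 2 \<or> CARD('n) = 3) \<and>
     open (domain X) \<and> bounded (domain X) \<and> connected (domain X) \<and> domain X \<noteq> {} \<and>
     domain X = interior (closure (domain X)) \<and>
     finite (cells X) \<and> \<Union> (cells X) = closure (domain X) \<and>
     (\<forall>K\<in>cells X. \<forall>L\<in>cells X. K \<noteq> L \<longrightarrow> interior K \<inter> interior L = {}) \<and>
     (\<forall>K\<in>cells X. simplicial K \<or> quad_hex K (corners X K)) \<and>
     (\<forall>K\<in>cells X. \<forall>\<sigma>\<in>faces K. \<sigma> \<subseteq> frontier (domain X) \<or> (\<exists>L. separates X \<sigma> K L)) \<and>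
     (\<forall>K\<in>cells X. half_diamonds X K)"

definition dual_cell :: "('n::finite) staggered_mesh \<Rightarrow> (real^'n) set \<Rightarrow> (real^'n) set" where
  "dual_cell X \<sigma> = (\<Union>K\<in>{K\<in>cells X. \<sigma> \<in> faces K}. half_diamond X K \<sigma>)"

text \<open>The dual faces \<open>e = D\<^bsub>\<sigma>\<^esub>|D\<^bsub>\<sigma>'\<^esub>\<close> of \<open>D\<^bsub>\<sigma>\<^esub>\<close> included in \<open>K\<close> are indexed by the faces \<open>\<sigma>'\<close>: the
  half-diamonds (cones, up to homeomorphism) of \<open>\<sigma>\<close> and \<open>\<sigma>'\<close> have a common face iff \<open>\<sigma>\<close> and \<open>\<sigma>'\<close> meet
  along a face of codimension 2 of \<open>K\<close>. The dual faces on the boundary carry a zero flux and are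
  left out.\<close>

definition dual_adj :: "(real^'n) set \<Rightarrow> (real^'n) set \<Rightarrow> (real^'n) set set" where
  "dual_adj K \<sigma> = {\<sigma>' \<in> faces K. \<sigma>' \<noteq> \<sigma> \<and> aff_dim (\<sigma> \<inter> \<sigma>') = int CARD('n) - 2}"

section \<open>Discrete spaces and operators\<close>

text \<open>A function constant on the cells (resp. on the dual cells) is given by its values; values
  outside \<open>cells X\<close> (resp. \<open>all_faces X\<close>) are irrelevant.\<close>

definition HE0 :: "('n::finite) staggered_mesh \<Rightarrow> 'n vector_field set" where
  "HE0 X = {u. \<forall>\<sigma>\<in>ext_faces X. u \<sigma> = 0}"

definition cell_fun :: "('n::finite) staggered_mesh \<Rightarrow> 'n scalar_field \<Rightarrow> real^'n \<Rightarrow> real" where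
  "cell_fun X q x = (\<Sum>K\<in>cells X. q K * indicator (interior K) x)"

definition mass_flux ::
    "('n::finite) staggered_mesh \<Rightarrow> 'n scalar_field \<Rightarrow> 'n vector_field \<Rightarrow> (real^'n) set \<Rightarrow> (real^'n) set \<Rightarrow> real" where
  "mass_flux X \<rho> u K \<sigma> =
     (if \<sigma> \<in> int_faces X
      then area \<sigma> * (if u \<sigma> \<bullet> normal K \<sigma> \<ge> 0 then \<rho> K else \<rho> (neighbour X K \<sigma>)) * (u \<sigma> \<bullet> normal K \<sigma>)
      else 0)"

definition mass_div ::
    "('n::finite) staggered_mesh \<Rightarrow> 'n scalar_field \<Rightarrow> 'n vector_field \<Rightarrow> 'n scalar_field" where
  "mass_div X \<rho> u K = (1 / vol K) * (\<Sum>\<sigma>\<in>faces K. mass_flux X \<rho> u K \<sigma>)"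

definition vel_div :: "('n::finite) staggered_mesh \<Rightarrow> 'n vector_field \<Rightarrow> 'n scalar_field" where
  "vel_div X u K = (1 / vol K) * (\<Sum>\<sigma>\<in>faces K. area \<sigma> * (u \<sigma> \<bullet> normal K \<sigma>))"

definition dual_density :: "('n::finite) staggered_mesh \<Rightarrow> 'n scalar_field \<Rightarrow> (real^'n) set \<Rightarrow> real" where
  "dual_density X \<rho> \<sigma> =
     (\<Sum>K\<in>{K\<in>cells X. \<sigma> \<in> faces K}. vol (half_diamond X K \<sigma>) * \<rho> K) / vol (dual_cell X \<sigma>)"

text \<open>\<open>dual_flux X \<rho> u K \<sigma> \<sigma>'\<close> is \<open>F\<^bsub>\<sigma>,e\<^esub>(\<rho>, u)\<close> for the dual face \<open>e = D\<^bsub>\<sigma>\<^esub>|D\<^bsub>\<sigma>'\<^esub> \<subseteq> K\<close>.\<close>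

definition dual_flux ::
    "('n::finite) staggered_mesh \<Rightarrow> 'n scalar_field \<Rightarrow> 'n vector_field \<Rightarrow>
     (real^'n) set \<Rightarrow> (real^'n) set \<Rightarrow> (real^'n) set \<Rightarrow> real" where
  "dual_flux X \<rho> u K \<sigma> \<sigma>' = (\<Sum>\<sigma>''\<in>faces K. flux_coef X K \<sigma> \<sigma>' \<sigma>'' * mass_flux X \<rho> u K \<sigma>'')"

definition dual_fluxes :: "('n::finite) staggered_mesh \<Rightarrow> bool" where
  "dual_fluxes X \<longleftrightarrow> (\<forall>\<rho> u. u \<in> HE0 X \<longrightarrow> (\<forall>K\<in>cells X. \<forall>\<sigma>\<in>faces K.
     mass_flux X \<rho> u K \<sigma> + (\<Sum>\<sigma>'\<in>dual_adj K \<sigma>. dual_flux X \<rho> u K \<sigma> \<sigma>')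
       = vol (half_diamond X K \<sigma>) / vol K * (\<Sum>\<sigma>'\<in>faces K. mass_flux X \<rho> u K \<sigma>') \<and>
     (\<forall>\<sigma>'\<in>dual_adj K \<sigma>.
        dual_flux X \<rho> u K \<sigma> \<sigma>' = - dual_flux X \<rho> u K \<sigma>' \<sigma> \<and>
        \<bar>dual_flux X \<rho> u K \<sigma> \<sigma>'\<bar> \<le> Max ((\<lambda>\<sigma>''. \<bar>mass_flux X \<rho> u K \<sigma>''\<bar>) ` faces K))))"

text \<open>\<open>convection X \<rho> u v\<close> is \<open>div(\<rho> u \<otimes> v)\<close>, with the centered choice of \<open>v\<close> on the dual faces.\<close>

definition convection ::
    "('n::finite) staggered_mesh \<Rightarrow> 'n scalar_field \<Rightarrow> 'n vector_field \<Rightarrow> 'n vector_field \<Rightarrow> 'n vector_field" where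
  "convection X \<rho> u v \<sigma> = (1 / vol (dual_cell X \<sigma>)) *\<^sub>R
     (\<Sum>K\<in>{K\<in>cells X. \<sigma> \<in> faces K}. \<Sum>\<sigma>'\<in>dual_adj K \<sigma>.
        dual_flux X \<rho> u K \<sigma> \<sigma>' *\<^sub>R ((1/2) *\<^sub>R (v \<sigma> + v \<sigma>')))"

text \<open>For \<open>\<sigma> = K|L\<close>; the value does not change when \<open>K\<close> and \<open>L\<close> are exchanged.\<close>

definition press_grad ::
    "('n::finite) staggered_mesh \<Rightarrow> 'n scalar_field \<Rightarrow> (real^'n) set \<Rightarrow> (real^'n) set \<Rightarrow> real^'n" where
  "press_grad X q K \<sigma> =
     (area \<sigma> / vol (dual_cell X \<sigma>) * (q (neighbour X K \<sigma>) - q K)) *\<^sub>R normal K \<sigma>"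

subsection \<open>Finite elements and viscous term\<close>

definition affine_funs :: "(real^'n \<Rightarrow> real) set" where
  "affine_funs = {f. \<exists>a b. f = (\<lambda>x. a + b \<bullet> x)}"

text \<open>The span of \<open>1\<close>, \<open>x\<^sub>i\<close> and \<open>x\<^sub>i\<^sup>2 - x\<^sub>j\<^sup>2\<close> for all \<open>i, j\<close>, which is also the span obtained
  with consecutive indices only.\<close>

definition rannacher_turek_funs :: "(real^'n \<Rightarrow> real) set" where
  "rannacher_turek_funs = {f. \<exists>a b c. f = (\<lambda>x. a + (\<Sum>i\<in>UNIV. b i * x $ i)
      + (\<Sum>i\<in>UNIV. \<Sum>j\<in>UNIV. c i j * ((x $ i)\<^sup>2 - (x $ j)\<^sup>2)))}"

definition local_space :: "('n::finite) staggered_mesh \<Rightarrow> (real^'n) set \<Rightarrow> (real^'n \<Rightarrow> real) set" where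
  "local_space X K =
     (if simplicial K then affine_funs
      else {f. \<exists>g\<in>rannacher_turek_funs. f = g \<circ> inv_into (cbox 0 1) (Q1_map (corners X K))})"

text \<open>Prescribing the mean values on the faces from each side implies that the mean jumps vanish.\<close>

definition shape_functions :: "('n::finite) staggered_mesh \<Rightarrow> bool" where
  "shape_functions X \<longleftrightarrow> (\<forall>K\<in>cells X. \<forall>\<sigma>\<in>all_faces X.
     (\<exists>f\<in>local_space X K. \<forall>x\<in>K. shape_fn X K \<sigma> x = f x) \<and>
     (\<forall>\<sigma>'\<in>faces K. face_mean \<sigma>' (shape_fn X K \<sigma>) = (if \<sigma> = \<sigma>' then 1 else 0)))"

definition reconstruction ::
    "('n::finite) staggered_mesh \<Rightarrow> 'n vector_field \<Rightarrow> (real^'n) set \<Rightarrow> real^'n \<Rightarrow> real^'n" where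
  "reconstruction X u K x = (\<Sum>\<sigma>\<in>all_faces X. shape_fn X K \<sigma> x *\<^sub>R u \<sigma>)"

definition grad :: "(real^'n \<Rightarrow> real) \<Rightarrow> real^'n \<Rightarrow> real^'n" where
  "grad f x = (\<chi> i. frechet_derivative f (at x) (axis i 1))"

definition div_tau ::
    "('n::finite) staggered_mesh \<Rightarrow> real \<Rightarrow> real \<Rightarrow> 'n vector_field \<Rightarrow> 'n vector_field" where
  "div_tau X \<mu> lam u \<sigma> =
     - (\<mu> / vol (dual_cell X \<sigma>)) *\<^sub>R
         (\<Sum>K\<in>cells X. LINT x|lebesgue_on (interior K).
            jacobian (reconstruction X u K) (at x) *v grad (shape_fn X K \<sigma>) x)
     - ((\<mu> + lam) / vol (dual_cell X \<sigma>)) *\<^sub>R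
         (\<Sum>K\<in>cells X. LINT x|lebesgue_on (interior K).
            trace (jacobian (reconstruction X u K) (at x)) *\<^sub>R grad (shape_fn X K \<sigma>) x)"

definition staggered_discretization :: "('n::finite) staggered_mesh \<Rightarrow> bool" where
  "staggered_discretization X \<longleftrightarrow> is_mesh X \<and> dual_fluxes X \<and> shape_functions X"

section \<open>Schemes\<close>

definition pressure :: "real \<Rightarrow> 'n scalar_field \<Rightarrow> 'n scalar_field" where
  "pressure \<gamma> \<rho> K = \<rho> K powr \<gamma>"

definition scaled_grad ::
    "('n::finite) staggered_mesh \<Rightarrow> real \<Rightarrow> 'n scalar_field \<Rightarrow> 'n scalar_field \<Rightarrow>
     (real^'n) set \<Rightarrow> (real^'n) set \<Rightarrow> real^'n" where
  "scaled_grad X \<gamma> \<rho> \<rho>_old K \<sigma> =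
     sqrt (dual_density X \<rho> \<sigma> / dual_density X \<rho>_old \<sigma>) *\<^sub>R press_grad X (pressure \<gamma> \<rho>) K \<sigma>"

text \<open>\<open>\<rho>\<close> is indexed by integers because of the value \<open>\<rho>\<^sup>-\<^sup>1\<close> at the fictitious time step \<open>-1\<close>. The
  equations on an internal face are written from each of its two sides \<open>K\<close>; both are equivalent.
  Positivity of \<open>\<rho>\<close> at the steps \<open>0, \<dots>, N\<close> is a consequence of the upwind mass balance.\<close>

definition PC_solution ::
    "('n::finite) staggered_mesh \<Rightarrow> real \<Rightarrow> real \<Rightarrow> real \<Rightarrow> real \<Rightarrow> nat \<Rightarrow> real \<Rightarrow>
     (real^'n \<Rightarrow> real) \<Rightarrow> (real^'n \<Rightarrow> real^'n) \<Rightarrow>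
     (int \<Rightarrow> 'n scalar_field) \<Rightarrow> (nat \<Rightarrow> 'n vector_field) \<Rightarrow> bool" where
  "PC_solution X \<gamma> \<mu> lam dt N \<epsilon> \<rho>0 u0 \<rho> u \<longleftrightarrow>
     (\<forall>K\<in>cells X. \<rho> 0 K = (1 / vol K) * (LINT x|lebesgue_on K. \<rho>0 x)) \<and>
     (\<forall>n\<le>N. u n \<in> HE0 X) \<and>
     (\<forall>\<sigma>\<in>int_faces X. u 0 \<sigma> = trace_mean (domain X) \<sigma> u0) \<and>
     (\<forall>K\<in>cells X. (1/dt) * (\<rho> 0 K - \<rho> (- 1) K) + mass_div X (\<rho> 0) (u 0) K = 0) \<and>
     (\<exists>ut::nat \<Rightarrow> 'n vector_field. \<forall>n<N.
        ut (Suc n) \<in> HE0 X \<and>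
        (\<forall>K\<in>cells X. \<forall>\<sigma>\<in>faces K \<inter> int_faces X.
           (1/dt) *\<^sub>R (dual_density X (\<rho> (int n)) \<sigma> *\<^sub>R ut (Suc n) \<sigma>
                       - dual_density X (\<rho> (int n - 1)) \<sigma> *\<^sub>R u n \<sigma>)
           + convection X (\<rho> (int n)) (u n) (ut (Suc n)) \<sigma>
           - div_tau X \<mu> lam (ut (Suc n)) \<sigma>
           + (1/\<epsilon>\<^sup>2) *\<^sub>R scaled_grad X \<gamma> (\<rho> (int n)) (\<rho> (int n - 1)) K \<sigma> = 0) \<and>
        (\<forall>K\<in>cells X. \<forall>\<sigma>\<in>faces K \<inter> int_faces X.
           (1/dt) *\<^sub>R (dual_density X (\<rho> (int n)) \<sigma> *\<^sub>R (u (Suc n) \<sigma> - ut (Suc n) \<sigma>))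
           + (1/\<epsilon>\<^sup>2) *\<^sub>R press_grad X (pressure \<gamma> (\<rho> (int n + 1))) K \<sigma>
           - (1/\<epsilon>\<^sup>2) *\<^sub>R scaled_grad X \<gamma> (\<rho> (int n)) (\<rho> (int n - 1)) K \<sigma> = 0) \<and>
        (\<forall>K\<in>cells X. (1/dt) * (\<rho> (int n + 1) K - \<rho> (int n) K)
           + mass_div X (\<rho> (int n + 1)) (u (Suc n)) K = 0))"

text \<open>The incompressible scheme, with initial velocity field \<open>u0\<close> and initial discrete pressure \<open>p0\<close>.
  It determines the pressure up to a constant only; the pressure is normalized to zero mean value,
  as are the \<open>\<delta>p\<^sup>n\<close>. The prediction at the first step involves the initial pressure \<open>p0\<close>, on which
  the whole solution depends: for the low Mach number limit it is the limit of the \<open>\<delta>p\<^sup>0\<close> of the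
  compressible solutions, which are bounded for well-prepared data but need not converge.\<close>

definition incompressible_solution ::
    "('n::finite) staggered_mesh \<Rightarrow> real \<Rightarrow> real \<Rightarrow> real \<Rightarrow> nat \<Rightarrow>
     (real^'n \<Rightarrow> real^'n) \<Rightarrow> 'n scalar_field \<Rightarrow>
     (nat \<Rightarrow> 'n vector_field) \<Rightarrow> (nat \<Rightarrow> 'n scalar_field) \<Rightarrow> bool" where
  "incompressible_solution X \<mu> lam dt N u0 p0 u p \<longleftrightarrow>
     (\<forall>n\<le>N. u n \<in> HE0 X \<and> (\<Sum>K\<in>cells X. vol K * p n K) = 0) \<and>
     (\<forall>\<sigma>\<in>int_faces X. u 0 \<sigma> = trace_mean (domain X) \<sigma> u0) \<and>
     (\<forall>K\<in>cells X. p 0 K = p0 K) \<and>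
     (\<exists>ut::nat \<Rightarrow> 'n vector_field. \<forall>n<N.
        ut (Suc n) \<in> HE0 X \<and>
        (\<forall>K\<in>cells X. \<forall>\<sigma>\<in>faces K \<inter> int_faces X.
           (1/dt) *\<^sub>R (ut (Suc n) \<sigma> - u n \<sigma>)
           + convection X (\<lambda>_. 1) (u n) (ut (Suc n)) \<sigma>
           - div_tau X \<mu> lam (ut (Suc n)) \<sigma>
           + press_grad X (p n) K \<sigma> = 0) \<and>
        (\<forall>K\<in>cells X. \<forall>\<sigma>\<in>faces K \<inter> int_faces X.
           (1/dt) *\<^sub>R (u (Suc n) \<sigma> - ut (Suc n) \<sigma>)
           + press_grad X (p (Suc n)) K \<sigma> - press_grad X (p n) K \<sigma> = 0) \<and>
        (\<forall>K\<in>cells X. vel_div X (u (Suc n)) K = 0))"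

section \<open>Data and convergence\<close>

text \<open>Well-prepared sequence of initial data \<open>(\<rho>0 m, u0 m)\<close> for the Mach numbers \<open>\<epsilon> m\<close>, with \<open>u0 m\<close>
  converging to \<open>u0_lim\<close>. The bound is stated in \<^typ>\<open>ereal\<close>: it contains that \<open>\<rho>0 m\<close> is essentially
  bounded.\<close>

definition well_prepared ::
    "(real^'n) set \<Rightarrow> (nat \<Rightarrow> real) \<Rightarrow> (nat \<Rightarrow> real^'n \<Rightarrow> real) \<Rightarrow> (nat \<Rightarrow> real^'n \<Rightarrow> real^'n) \<Rightarrow>
     (real^'n \<Rightarrow> real^'n) \<Rightarrow> bool" where
  "well_prepared \<Omega> \<epsilon> \<rho>0 u0 u0_lim \<longleftrightarrow>
     (\<forall>m. \<rho>0 m \<in> borel_measurable (lebesgue_on \<Omega>) \<and> (AE x in lebesgue_on \<Omega>. \<rho>0 m x > 0) \<and>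
          u0 m \<in> H10 \<Omega>) \<and>
     (\<exists>C::real. \<forall>m.
        ereal (H1_nrm \<Omega> (u0 m) + 1 / \<epsilon> m * L2_nrm \<Omega> (weak_div \<Omega> (u0 m)))
        + ereal (1 / (\<epsilon> m)\<^sup>2) * esssup (lebesgue_on \<Omega>) (\<lambda>x. ereal \<bar>\<rho>0 m x - 1\<bar>) \<le> ereal C) \<and>
     in_L2 \<Omega> u0_lim \<and> (\<lambda>m. L2_nrm \<Omega> (\<lambda>x. u0 m x - u0_lim x)) \<longlonglongrightarrow> 0"

definition mean_value :: "('n::finite) staggered_mesh \<Rightarrow> 'n scalar_field \<Rightarrow> real" where
  "mean_value X q = (1 / vol (domain X)) * (\<Sum>K\<in>cells X. vol K * q K)"

definition delta_p ::
    "('n::finite) staggered_mesh \<Rightarrow> real \<Rightarrow> real \<Rightarrow> (int \<Rightarrow> 'n scalar_field) \<Rightarrow> nat \<Rightarrow> 'n scalar_field" where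
  "delta_p X \<gamma> \<epsilon> \<rho> n K =
     (pressure \<gamma> (\<rho> (int n)) K - mean_value X (pressure \<gamma> (\<rho> (int n)))) / \<epsilon>\<^sup>2"

text \<open>The norm of \<open>L\<^sup>\<infinity>((0,T); L\<^sup>q(\<Omega>))\<close> of a discrete function.\<close>

definition Linf_Lq_nrm ::
    "('n::finite) staggered_mesh \<Rightarrow> nat \<Rightarrow> real \<Rightarrow> (nat \<Rightarrow> 'n scalar_field) \<Rightarrow> real" where
  "Linf_Lq_nrm X N q w = Max ((\<lambda>n. Lq_nrm (domain X) q (cell_fun X (w n))) ` {..N})"

text \<open>An arbitrary norm on the finite-dimensional space of the discrete functions \<open>(v, q)\<close>, \<open>v n\<close> in
  \<open>HE0 X\<close> and \<open>q n\<close> constant on the cells for \<open>0 \<le> n \<le> N\<close>. Pairs with the same values on the mesh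
  represent the same discrete function; by definiteness and the triangle inequality they have the same
  distance to any other pair.\<close>

definition discrete_velocity :: "('n::finite) staggered_mesh \<Rightarrow> nat \<Rightarrow> (nat \<Rightarrow> 'n vector_field) set" where
  "discrete_velocity X N = {v. \<forall>n\<le>N. v n \<in> HE0 X}"

definition discrete_norm ::
    "('n::finite) staggered_mesh \<Rightarrow> nat \<Rightarrow>
     ((nat \<Rightarrow> 'n vector_field) \<Rightarrow> (nat \<Rightarrow> 'n scalar_field) \<Rightarrow> real) \<Rightarrow> bool" where
  "discrete_norm X N \<nu> \<longleftrightarrow>
     (\<forall>v\<in>discrete_velocity X N. \<forall>q.
        0 \<le> \<nu> v q \<and>
        (\<nu> v q = 0 \<longleftrightarrow> (\<forall>n\<le>N. (\<forall>\<sigma>\<in>all_faces X. v n \<sigma> = 0) \<and> (\<forall>K\<in>cells X. q n K = 0))) \<and>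
        (\<forall>c. \<nu> (\<lambda>n \<sigma>. c *\<^sub>R v n \<sigma>) (\<lambda>n K. c * q n K) = \<bar>c\<bar> * \<nu> v q) \<and>
        (\<forall>v'\<in>discrete_velocity X N. \<forall>q'.
           \<nu> (\<lambda>n \<sigma>. v n \<sigma> + v' n \<sigma>) (\<lambda>n K. q n K + q' n K) \<le> \<nu> v q + \<nu> v' q'))"

definition tends_in_discrete_norms ::
    "('n::finite) staggered_mesh \<Rightarrow> nat \<Rightarrow>
     (nat \<Rightarrow> nat \<Rightarrow> 'n vector_field) \<Rightarrow> (nat \<Rightarrow> nat \<Rightarrow> 'n scalar_field) \<Rightarrow>
     (nat \<Rightarrow> 'n vector_field) \<Rightarrow> (nat \<Rightarrow> 'n scalar_field) \<Rightarrow> bool" where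
  "tends_in_discrete_norms X N U Q u q \<longleftrightarrow>
     (\<forall>\<nu>. discrete_norm X N \<nu> \<longrightarrow>
        (\<lambda>m. \<nu> (\<lambda>n \<sigma>. U m n \<sigma> - u n \<sigma>) (\<lambda>n K. Q m n K - q n K)) \<longlonglongrightarrow> 0)"

end

theory Submission
  imports Defs
begin

text \<open>
  Testing the prediction step with the predicted velocity, the correction step with the corrected velocity
  and the mass balance with the enthalpy gives bounds by induction on the time step: if
  \<open>\<rho>\<^sup>n = 1 + O(\<epsilon>\<^sup>2)\<close> and \<open>u\<^sup>n\<close> is bounded, then so are the new velocities; the correction step shows
  that the jumps of \<open>p\<^sup>n\<^sup>+\<^sup>1\<close> are \<open>O(\<epsilon>\<^sup>2)\<close>, and as the mesh is connected and the mass is conserved,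
  \<open>\<rho>\<^sup>n\<^sup>+\<^sup>1 = 1 + O(\<epsilon>\<^sup>2)\<close>. Along subsequences all unknowns converge, the limit solves the incompressible
  scheme, and this scheme has at most one solution by the same energy argument. The initial velocity
  converges because the mean of a function on a face is controlled by the product of the norms in
  \<open>L\<^sup>2\<close> and \<open>H\<^sup>1\<close> (the divergence theorem on a cell), so that convergence in \<open>L\<^sup>2\<close> and a bound in \<open>H\<^sup>1\<close> suffice;
  the divergence theorem also bounds the discrete divergence of \<open>u\<^sup>0\<close> by \<open>O(\<epsilon>)\<close>.
  Faces are denoted by \<open>Y\<close>.
\<close>

section \<open>Square integrable functions\<close>

text \<open>Mesh and time step are fixed, so constants may deteriorate from step to step as long as
  they do not depend on \<epsilon>. What must be preserved is the order \<epsilon>^2 of the density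
  defect: divided by \<epsilon>^2, the explicit pressure gradient is then a bounded force in the
  next prediction, and its square root factor merely tends to 1. For the density at step -1 only
  convergence to 1 is recorded; it comes from the small discrete divergence of the initial velocity.
  The initial values of delta p are bounded but may oscillate with m, and the limit scheme depends
  on them. Convergence is therefore proved along subsequences on which they converge. Mean traces
  are defined by approximation with test functions. The limit of the initial velocities is known
  only in L^2, so an approximating sequence in H^1 has to be constructed for it; this is the purpose
  of minimising gradients near the limit. Surface integrals are volume integrals over prisms, so the
  divergence theorem on a cell is obtained by translating the cell and integrating over the region
  it sweeps.\<close>

lemma in_L2D:
 assumes "in_L2 W f"
 shows "f \<in> borel_measurable (lebesgue_on W)" "integrable (lebesgue_on W) (%x. (norm (f x))\<^sup>2)"
 using assms by (auto simp: in_L2_def)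

lemma mult_le_sum_squares:
 fixes a b :: real assumes "0 \<le> a" "0 \<le> b" shows "a * b \<le> a\<^sup>2 + b\<^sup>2"
proof -
 have "2 * (a * b) \<le> a\<^sup>2 + b\<^sup>2" using sum_squares_bound[of a b] by simp
 moreover have "0 \<le> a * b" using assms by simp
 ultimately show ?thesis by linarith
qed

lemma in_L2_inner_integrable:
 assumes "in_L2 W f" "in_L2 W g"
 shows "integrable (lebesgue_on W) (%x. f x \<bullet> g x)"
proof (rule Bochner_Integration.integrable_bound)
 show "integrable (lebesgue_on W) (%x. (norm (f x))\<^sup>2 + (norm (g x))\<^sup>2)"
  using assms by (auto simp: in_L2_def)
 show "(%x. f x \<bullet> g x) \<in> borel_measurable (lebesgue_on W)"
  using assms by (auto simp: in_L2_def)
 have "\<bar>f x \<bullet> g x\<bar> \<le> (norm (f x))\<^sup>2 + (norm (g x))\<^sup>2" for x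
 proof -
  have "\<bar>f x \<bullet> g x\<bar> \<le> norm (f x) * norm (g x)" by (rule Cauchy_Schwarz_ineq2)
  also have "... \<le> (norm (f x))\<^sup>2 + (norm (g x))\<^sup>2"
   by (rule mult_le_sum_squares) auto
  finally show ?thesis .
 qed
 then show "AE x in lebesgue_on W. norm (f x \<bullet> g x) \<le> norm ((norm (f x))\<^sup>2 + (norm (g x))\<^sup>2)"
  by simp
qed

lemma in_L2_scaleR:
 assumes "in_L2 W f" shows "in_L2 W (%x. c *\<^sub>R f x)"
 using assms by (auto simp: in_L2_def power_mult_distrib)

lemma in_L2_add:
 assumes "in_L2 W f" "in_L2 W g" shows "in_L2 W (%x. f x + g x)"
proof -
 have "integrable (lebesgue_on W) (%x. (norm (f x))\<^sup>2 + 2 * (f x \<bullet> g x) + (norm (g x))\<^sup>2)"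
  using in_L2_inner_integrable[OF assms] assms by (auto simp: in_L2_def)
 moreover have "(norm (f x + g x))\<^sup>2 = (norm (f x))\<^sup>2 + 2 * (f x \<bullet> g x) + (norm (g x))\<^sup>2" for x
  by (simp add: power2_norm_eq_inner inner_add_left inner_add_right inner_commute)
 ultimately show ?thesis using assms by (auto simp: in_L2_def)
qed

lemma in_L2_diff:
 assumes "in_L2 W f" "in_L2 W g" shows "in_L2 W (%x. f x - g x)"
 using in_L2_add[OF assms(1) in_L2_scaleR[OF assms(2), of "-1"]] by simp

lemma in_L2_bound:
 assumes "in_L2 W f" "g \<in> borel_measurable (lebesgue_on W)" "!!x. norm (g x) \<le> c * norm (f x)"
 shows "in_L2 W g"
 unfolding in_L2_def
proof
 show "integrable (lebesgue_on W) (%x. (norm (g x))\<^sup>2)"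
 proof (rule Bochner_Integration.integrable_bound)
  show "integrable (lebesgue_on W) (%x. c\<^sup>2 * (norm (f x))\<^sup>2)"
   using assms(1) by (auto simp: in_L2_def)
  show "AE x in lebesgue_on W. norm ((norm (g x))\<^sup>2) \<le> norm (c\<^sup>2 * (norm (f x))\<^sup>2)"
   using assms(3) by (auto simp: power_mult_distrib[symmetric] intro!: power_mono AE_I2)
 qed (use assms in auto)
qed (use assms in auto)

lemma in_L2_bounded_linear:
 fixes L :: "'b::euclidean_space => 'c::euclidean_space"
 assumes "in_L2 W f" "bounded_linear L" shows "in_L2 W (%x. L (f x))"
proof -
 obtain c where c: "!!y. norm (L y) \<le> norm y * c"
  using bounded_linear.bounded[OF assms(2)] by blast
 have "L \<in> borel_measurable borel"
  by (intro borel_measurable_continuous_onI linear_continuous_on assms)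
 then have "(%x. L (f x)) \<in> borel_measurable (lebesgue_on W)"
  using in_L2D(1)[OF assms(1)] by (rule measurable_compose[rotated])
 then show ?thesis
  by (rule in_L2_bound[OF assms(1), where c=c]) (use c in \<open>simp add: mult.commute\<close>)
qed

lemma in_L2_scaleR_integrable:
 fixes f :: "real^'n => real" and g :: "real^'n => 'b::euclidean_space"
 assumes "in_L2 W f" "in_L2 W g"
 shows "integrable (lebesgue_on W) (%x. f x *\<^sub>R g x)"
proof (rule Bochner_Integration.integrable_bound)
 show "integrable (lebesgue_on W) (%x. (norm (f x))\<^sup>2 + (norm (g x))\<^sup>2)"
  using assms by (auto simp: in_L2_def)
 show "(%x. f x *\<^sub>R g x) \<in> borel_measurable (lebesgue_on W)"
  using assms by (auto simp: in_L2_def)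
 have "\<bar>f x\<bar> * norm (g x) \<le> (norm (f x))\<^sup>2 + (norm (g x))\<^sup>2" for x
  using mult_le_sum_squares[of "\<bar>f x\<bar>" "norm (g x)"] by simp
 then show "AE x in lebesgue_on W. norm (f x *\<^sub>R g x) \<le> norm ((norm (f x))\<^sup>2 + (norm (g x))\<^sup>2)"
  by simp
qed

lemma L2_nrm_nonneg [simp]: "0 \<le> L2_nrm W f"
 by (simp add: L2_nrm_def)

lemma L2_nrm_sq: "(L2_nrm W f)\<^sup>2 = (LINT x|lebesgue_on W. (norm (f x))\<^sup>2)"
 by (simp add: L2_nrm_def)

lemma L2_nrm_minus_commute: "L2_nrm W (%x. f x - g x) = L2_nrm W (%x. g x - f x)"
 by (simp add: L2_nrm_def norm_minus_commute)

lemma L2_expand: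
 assumes "in_L2 W f" "in_L2 W g"
 shows "(L2_nrm W (%x. f x + g x))\<^sup>2 =
  (L2_nrm W f)\<^sup>2 + 2 * (LINT x|lebesgue_on W. f x \<bullet> g x) + (L2_nrm W g)\<^sup>2"
proof -
 have "(norm (f x + g x))\<^sup>2 = (norm (f x))\<^sup>2 + 2 * (f x \<bullet> g x) + (norm (g x))\<^sup>2" for x
  by (simp add: power2_norm_eq_inner inner_add_left inner_add_right inner_commute)
 then show ?thesis
  using in_L2_inner_integrable[OF assms] assms by (simp add: L2_nrm_sq in_L2_def)
qed

lemma L2_nrm_scaleR: "L2_nrm W (%x. c *\<^sub>R f x) = \<bar>c\<bar> * L2_nrm W f"
 by (simp add: L2_nrm_def power_mult_distrib real_sqrt_mult)

text \<open>The squared norm of f + t g is a nonnegative polynomial A + 2 t c + t^2 B. For B > 0 its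
  minimiser t = -c/B gives c^2 \<le> A B; for B = 0 it is affine, and t = -(A+1)/(2c) would give it
  the value -1.\<close>

lemma L2_Cauchy_Schwarz:
 assumes "in_L2 W f" "in_L2 W g"
 shows "\<bar>LINT x|lebesgue_on W. f x \<bullet> g x\<bar> \<le> L2_nrm W f * L2_nrm W g"
proof -
 define A where "A = (L2_nrm W f)\<^sup>2"
 define B where "B = (L2_nrm W g)\<^sup>2"
 define c where "c = (LINT x|lebesgue_on W. f x \<bullet> g x)"
 have q: "0 \<le> A + 2 * t * c + t\<^sup>2 * B" for t
 proof -
  have "0 \<le> (L2_nrm W (%x. f x + t *\<^sub>R g x))\<^sup>2" by simp
  also have "... = A + 2 * t * c + t\<^sup>2 * B"
   using L2_expand[OF assms(1) in_L2_scaleR[OF assms(2), of t]]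
   by (simp add: L2_nrm_scaleR power_mult_distrib A_def B_def c_def)
  finally show ?thesis .
 qed
 have "c\<^sup>2 \<le> A * B"
 proof (cases "B = 0")
  case True
  have "c = 0"
  proof (rule ccontr)
   assume "c \<noteq> 0"
   then have "2 * (- (A + 1) / (2 * c)) * c = - (A + 1)" by simp
   then show False using q[of "- (A + 1) / (2 * c)"] True by simp
  qed
  then show ?thesis using True by simp
 next
  case False
  then have "B > 0" by (simp add: B_def)
  then show ?thesis using q[of "- c / B"]
   by (simp add: power2_eq_square field_simps)
 qed
 then have "sqrt (c\<^sup>2) \<le> sqrt (A * B)" by (rule real_sqrt_le_mono)
 then show ?thesis by (simp add: A_def B_def c_def real_sqrt_mult)
qed

lemma L2_nrm_triangle:
 assumes "in_L2 W f" "in_L2 W g"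
 shows "L2_nrm W (%x. f x + g x) \<le> L2_nrm W f + L2_nrm W g"
proof (rule power2_le_imp_le)
 show "(L2_nrm W (%x. f x + g x))\<^sup>2 \<le> (L2_nrm W f + L2_nrm W g)\<^sup>2"
  using L2_Cauchy_Schwarz[OF assms] by (simp add: L2_expand[OF assms] power2_sum abs_le_iff)
qed simp

lemma L2_nrm_triangle_diff:
 assumes "in_L2 W f" "in_L2 W g"
 shows "L2_nrm W (%x. f x - g x) \<le> L2_nrm W f + L2_nrm W g"
 using L2_nrm_triangle[OF assms(1) in_L2_scaleR[OF assms(2), of "-1"]]
  L2_nrm_scaleR[of W "-1" g] by simp

lemma L2_nrm_triangle3:
 assumes "in_L2 W f" "in_L2 W g" "in_L2 W h"
 shows "L2_nrm W (%x. f x - h x) \<le> L2_nrm W (%x. f x - g x) + L2_nrm W (%x. g x - h x)"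
 using L2_nrm_triangle[OF in_L2_diff[OF assms(1,2)] in_L2_diff[OF assms(2,3)]] by simp

lemma L2_nrm_mono:
 assumes "in_L2 W f" "in_L2 W g" "!!x. x \<in> W ==> norm (g x) \<le> c * norm (f x)" "0 \<le> c"
 shows "L2_nrm W g \<le> c * L2_nrm W f"
proof -
 have "(L2_nrm W g)\<^sup>2 \<le> (LINT x|lebesgue_on W. c\<^sup>2 * (norm (f x))\<^sup>2)"
  unfolding L2_nrm_sq
 proof (rule integral_mono)
  fix x assume "x \<in> space (lebesgue_on W)"
  then have "x \<in> W" by (simp add: space_restrict_space)
  then have "norm (g x) \<le> c * norm (f x)" by (rule assms(3))
  then show "(norm (g x))\<^sup>2 \<le> c\<^sup>2 * (norm (f x))\<^sup>2"
   by (simp add: power_mult_distrib[symmetric] power_mono)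
 qed (use assms in \<open>auto simp: in_L2_def\<close>)
 also have "... = (c * L2_nrm W f)\<^sup>2" by (simp add: power_mult_distrib L2_nrm_sq)
 finally show ?thesis by (rule power2_le_imp_le) (use assms in simp)
qed

section \<open>Smooth functions\<close>

lemma frechet_derivativeI: "(f has_derivative F) (at x) ==> frechet_derivative f (at x) = F"
 using frechet_derivative_at by metis

lemma frechet_derivative_has: "f differentiable (at x) ==> (f has_derivative frechet_derivative f (at x)) (at x)"
 by (simp add: frechet_derivative_works)

lemma C_k_Suc_D: "C_k (Suc k) f ==> C_k k f"
proof (induction k arbitrary: f)
 case 0
 then show ?case
  by (auto intro!: continuous_at_imp_continuous_on differentiable_imp_continuous_within)
next
 case (Suc k)
 then show ?case by (metis C_k.simps(2))
qed

lemma C_k_continuous: "C_k k f ==> continuous_on UNIV f"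
proof (induction k)
 case (Suc k)
 then show ?case using C_k_Suc_D by blast
qed simp

lemma C_k_const [simp]: "C_k k (%x. c)"
 by (induction k arbitrary: c) (auto simp: frechet_derivative_const)

lemma C_k_add: "C_k k f ==> C_k k g ==> C_k k (%x. f x + g x)"
proof (induction k arbitrary: f g)
 case 0
 then show ?case by (auto intro: continuous_on_add)
next
 case (Suc k)
 have "frechet_derivative (%x. f x + g x) (at x)
  = (%h. frechet_derivative f (at x) h + frechet_derivative g (at x) h)" for x
  using Suc.prems by (intro frechet_derivativeI has_derivative_add frechet_derivative_has) auto
 then show ?case using Suc by auto
qed

lemma C_k_bounded_linear: "bounded_linear L ==> C_k k f ==> C_k k (%x. L (f x))"
proof (induction k arbitrary: f)
 case 0
 then show ?case by (auto intro: bounded_linear.continuous_on)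
next
 case (Suc k)
 have d: "((%x. L (f x)) has_derivative (%h. L (frechet_derivative f (at x) h))) (at x)" for x
  using Suc.prems by (intro bounded_linear.has_derivative[OF Suc.prems(1)] frechet_derivative_has) auto
 then have "frechet_derivative (%x. L (f x)) (at x) = (%h. L (frechet_derivative f (at x) h))" for x
  by (rule frechet_derivativeI)
 then show ?case using Suc d by (auto simp: differentiable_def)
qed

lemma C_k_scaleR: 
 fixes f :: "'a::euclidean_space => real" and g :: "'a => 'b::real_normed_vector"
 shows "C_k k f ==> C_k k g ==> C_k k (%x. f x *\<^sub>R g x)"
proof (induction k arbitrary: f g)
 case 0
 then show ?case by (auto intro: continuous_on_scaleR)
next
 case (Suc k)
 have d: "((%x. f x *\<^sub>R g x) has_derivative
  (%h. f x *\<^sub>R frechet_derivative g (at x) h + frechet_derivative f (at x) h *\<^sub>R g x)) (at x)" for x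
  using Suc.prems by (intro has_derivative_scaleR frechet_derivative_has) auto
 then have "frechet_derivative (%x. f x *\<^sub>R g x) (at x)
  = (%h. f x *\<^sub>R frechet_derivative g (at x) h + frechet_derivative f (at x) h *\<^sub>R g x)" for x
  by (rule frechet_derivativeI)
 moreover have "C_k k f" "C_k k g" using Suc.prems by (blast intro: C_k_Suc_D)+
 then have "C_k k (%x. f x *\<^sub>R frechet_derivative g (at x) b + frechet_derivative f (at x) b *\<^sub>R g x)"
  if "b \<in> Basis" for b
  using Suc.prems that by (intro C_k_add Suc.IH) simp_all
 moreover have "(%x. f x *\<^sub>R g x) differentiable (at x)" for x
  using d by (auto simp: differentiable_def)
 ultimately show ?case by simp
qed

lemma C_k_sum: "(!!i. i \<in> I ==> C_k k (f i)) ==> C_k k (%x. \<Sum>i\<in>I. f i x)"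
 by (induction I rule: infinite_finite_induct) (auto intro!: C_k_add)

lemma C_k_prod:
 fixes f :: "'i => 'a::euclidean_space => real"
 shows "(!!i. i \<in> I ==> C_k k (f i)) ==> C_k k (%x. \<Prod>i\<in>I. f i x)"
 using C_k_scaleR[where 'b=real and ?'a='a] by (induction I rule: infinite_finite_induct) auto

text \<open>\<open>C_k\<close> mentions derivatives along basis vectors only; by linearity the
  regularity passes to every direction, as is needed for test functions differentiated along an
  arbitrary v.\<close>

lemma frechet_derivative_expand:
 assumes "f differentiable (at x)"
 shows "frechet_derivative f (at x) v = (\<Sum>b\<in>Basis. (v \<bullet> b) *\<^sub>R frechet_derivative f (at x) b)"
proof -
 interpret linear "frechet_derivative f (at x)"
  using assms by (simp add: linear_frechet_derivative)
 have "frechet_derivative f (at x) v = frechet_derivative f (at x) (\<Sum>b\<in>Basis. (v \<bullet> b) *\<^sub>R b)"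
  by (simp add: euclidean_representation)
 then show ?thesis by (simp add: sum scaleR)
qed

lemma C_k_frechet: "C_k (Suc k) f ==> C_k k (%x. frechet_derivative f (at x) v)"
 by (subst frechet_derivative_expand) (auto intro!: C_k_sum C_k_bounded_linear[OF bounded_linear_scaleR_right])

section \<open>Test functions\<close>

text \<open>Any compact subset of W outside which the function vanishes can replace the closed
  support, so sums, products and derivatives are treated without computing closures.\<close>

lemma test_funI:
 assumes "!!k. C_k k \<phi>" "compact S" "S \<subseteq> W" "!!x. x \<notin> S ==> \<phi> x = 0"
 shows "\<phi> \<in> test_fun W"
proof -
 have "closure {x. \<phi> x \<noteq> 0} \<subseteq> S"
  using assms by (intro closure_minimal) (auto intro: compact_imp_closed)
 moreover then have "compact (closure {x. \<phi> x \<noteq> 0})"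
  using compact_Int_closed[OF assms(2), of "closure {x. \<phi> x \<noteq> 0}"] by (simp add: Int_absorb1)
 ultimately show ?thesis using assms by (auto simp: test_fun_def)
qed

lemma test_funE:
 assumes "\<phi> \<in> test_fun W"
 obtains S where "!!k. C_k k \<phi>" "compact S" "S \<subseteq> W" "!!x. x \<notin> S ==> \<phi> x = 0"
proof (rule that[of "closure {x. \<phi> x \<noteq> 0}"])
 show "x \<notin> closure {x. \<phi> x \<noteq> 0} ==> \<phi> x = 0" for x
  using closure_subset[of "{x. \<phi> x \<noteq> 0}"] by blast
qed (use assms in \<open>auto simp: test_fun_def\<close>)

lemma test_fun_C_k: "\<phi> \<in> test_fun W ==> C_k k \<phi>"
 by (simp add: test_fun_def)

lemma test_fun_differentiable: "\<phi> \<in> test_fun W ==> \<phi> differentiable (at x)"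
 using test_fun_C_k[of \<phi> W 1] by simp

lemma test_fun_continuous: "\<phi> \<in> test_fun W ==> continuous_on UNIV \<phi>"
 using test_fun_C_k C_k_continuous by blast

lemma test_fun_add:
 assumes "f \<in> test_fun W" "g \<in> test_fun W" shows "(%x. f x + g x) \<in> test_fun W"
proof -
 obtain S T where *: "compact S" "S \<subseteq> W" "!!x. x \<notin> S ==> f x = 0"
  "compact T" "T \<subseteq> W" "!!x. x \<notin> T ==> g x = 0"
  using test_funE[OF assms(1)] test_funE[OF assms(2)] by metis
 show ?thesis
  by (rule test_funI[where S="S \<union> T"])
   (use * C_k_add[OF test_fun_C_k[OF assms(1)] test_fun_C_k[OF assms(2)]] in auto)
qed

lemma test_fun_bounded_linear:
 assumes "f \<in> test_fun W" "bounded_linear L" shows "(%x. L (f x)) \<in> test_fun W"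
proof -
 obtain S where *: "compact S" "S \<subseteq> W" "!!x. x \<notin> S ==> f x = 0"
  using test_funE[OF assms(1)] by metis
 show ?thesis
  by (rule test_funI[where S="S"])
   (use * C_k_bounded_linear[OF assms(2) test_fun_C_k[OF assms(1)]] linear_simps(3)[OF assms(2)] in auto)
qed

lemma test_fun_scaleR: "f \<in> test_fun W ==> (%x. c *\<^sub>R f x) \<in> test_fun W"
 by (rule test_fun_bounded_linear[OF _ bounded_linear_scaleR_right])

lemma test_fun_diff:
 assumes "f \<in> test_fun W" "g \<in> test_fun W" shows "(%x. f x - g x) \<in> test_fun W"
 using test_fun_add[OF assms(1) test_fun_scaleR[OF assms(2), of "-1"]] by simp

lemma test_fun_mult:
 fixes f :: "'a::euclidean_space => real" and g :: "'a => 'b::real_normed_vector"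
 assumes "f \<in> test_fun W" "g \<in> test_fun W" shows "(%x. f x *\<^sub>R g x) \<in> test_fun W"
proof -
 obtain S where *: "compact S" "S \<subseteq> W" "!!x. x \<notin> S ==> f x = 0"
  using test_funE[OF assms(1)] by metis
 show ?thesis
  by (rule test_funI[where S="S"])
   (use * C_k_scaleR[OF test_fun_C_k[OF assms(1)] test_fun_C_k[OF assms(2)]] in auto)
qed

lemma test_fun_sum:
 assumes "!!i. i \<in> I ==> f i \<in> test_fun W" 
 shows "(%x. \<Sum>i\<in>I. f i x) \<in> test_fun W"
proof -
 have "(%x. 0) \<in> test_fun W" by (rule test_funI[where S="{}"]) auto
 then show ?thesis
  using assms by (induction I rule: infinite_finite_induct) (auto intro!: test_fun_add)
qed

lemma test_fun_frechet:
 assumes "f \<in> test_fun W" shows "(%x. frechet_derivative f (at x) v) \<in> test_fun W"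
proof -
 obtain S where *: "compact S" "S \<subseteq> W" "!!x. x \<notin> S ==> f x = 0"
  using test_funE[OF assms(1)] by metis
 have "frechet_derivative f (at x) v = 0" if "x \<notin> S" for x
 proof -
  have "open (- S)" using * by (simp add: compact_imp_closed open_Compl)
  then have "(f has_derivative (%h. 0)) (at x)"
   by (rule has_derivative_transform_within_open[OF has_derivative_const]) (use * that in auto)
  then show ?thesis by (simp add: frechet_derivativeI)
 qed
 then show ?thesis
  by (intro test_funI[where S="S"]) (use * C_k_frechet[OF test_fun_C_k[OF assms]] in auto)
qed

lemma test_fun_bounded:
 assumes "f \<in> test_fun W" obtains B where "0 \<le> B" "!!x. norm (f x) \<le> B"
proof -
 obtain S where *: "compact S" "S \<subseteq> W" "!!x. x \<notin> S ==> f x = 0"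
  using test_funE[OF assms(1)] by metis
 have "compact (f ` S)"
  using test_fun_continuous[OF assms] * by (meson compact_continuous_image continuous_on_subset subset_UNIV)
 then obtain B where "!!y. y \<in> f ` S ==> norm y \<le> B"
  using compact_imp_bounded bounded_iff by metis
 then have "norm (f x) \<le> max B 0" for x using *(3)[of x] by (cases "x \<in> S") (force, simp)
 then show ?thesis using that[of "max B 0"] by auto
qed

lemma continuous_in_L2:
 fixes f :: "real^'n => 'b::euclidean_space"
 assumes "continuous_on UNIV f" "bounded W" "W \<in> sets lebesgue"
 shows "in_L2 W f"
 unfolding in_L2_def
proof
 have "f \<in> borel_measurable lebesgue"
  by (rule measurable_completion) (use assms(1) in \<open>auto intro: borel_measurable_continuous_onI\<close>)
 then show m: "f \<in> borel_measurable (lebesgue_on W)" by (rule measurable_restrict_space1)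
 have "compact (f ` closure W)"
  using assms by (intro compact_continuous_image) (auto intro: continuous_on_subset)
 then obtain B where B: "!!y. y \<in> f ` closure W ==> norm y \<le> B"
  using compact_imp_bounded bounded_iff by metis
 have fm: "W \<in> lmeasurable" using assms bounded_set_imp_lmeasurable by blast
 show "integrable (lebesgue_on W) (%x. (norm (f x))\<^sup>2)"
 proof (rule Bochner_Integration.integrable_bound[where f="%x. B\<^sup>2"])
  show "integrable (lebesgue_on W) (%x. B\<^sup>2)"
   using fm by (intro finite_measure.integrable_const finite_measure_lebesgue_on)
  show "AE x in lebesgue_on W. norm ((norm (f x))\<^sup>2) \<le> norm (B\<^sup>2)"
  proof (rule AE_I2)
   fix x assume "x \<in> space (lebesgue_on W)"
   then have "x \<in> closure W" using closure_subset by (auto simp: space_restrict_space)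
   then have "norm (f x) \<le> B" using B by auto
   then show "norm ((norm (f x))\<^sup>2) \<le> norm (B\<^sup>2)" by (simp add: power_mono)
  qed
 qed (use m in auto)
qed

lemma test_fun_in_L2:
 fixes f :: "real^'n => 'b::euclidean_space"
 assumes "f \<in> test_fun W" "bounded W" "open W" shows "in_L2 W f"
 using assms by (intro continuous_in_L2 test_fun_continuous) (auto simp: lmeasurable_open fmeasurableD)

section \<open>Bump functions\<close>

lemma poly_mult_exp_tendsto_0:
 fixes p :: "real poly"
 assumes "0 < a"
 shows "((%s. poly p s * exp (- (a * s))) \<longlongrightarrow> 0) at_top"
proof -
 have "((%s. s ^ k * exp (- (a * s))) \<longlongrightarrow> 0) at_top" for k
 proof -
  have "filterlim (%s. a * s) at_top at_top"
   by (rule filterlim_tendsto_pos_mult_at_top[OF tendsto_const assms filterlim_ident])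
  then have "((%s. (a * s) ^ k / exp (a * s)) \<longlongrightarrow> 0) at_top"
   using filterlim_compose[OF tendsto_power_div_exp_0] by blast
  then have "((%s. (1 / a ^ k) * ((a * s) ^ k / exp (a * s))) \<longlongrightarrow> (1 / a ^ k) * 0) at_top"
   by (rule tendsto_mult_left)
  moreover have "(1 / a ^ k) * ((a * s) ^ k / exp (a * s)) = s ^ k * exp (- (a * s))" for s
   using assms by (simp add: power_mult_distrib exp_minus field_simps)
  ultimately show ?thesis by simp
 qed
 then have "((%s. \<Sum>i\<le>degree p. coeff p i * (s ^ i * exp (- (a * s)))) \<longlongrightarrow> (\<Sum>i\<le>degree p. coeff p i * 0)) at_top"
  by (intro tendsto_sum tendsto_mult_left)
 then show ?thesis by (simp add: poly_altdef sum_distrib_right mult.assoc)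
qed

text \<open>The functions p(1/t) exp(-a/t), extended by zero to t \<le> 0. Letting p range over all
  polynomials makes the family closed under differentiation, so smoothness follows by induction on
  the order.\<close>

definition flat_exp :: "real => real poly => real => real" where
 "flat_exp a p t = (if t > 0 then poly p (1 / t) * exp (- (a * (1 / t))) else 0)"

lemma flat_exp_tendsto_0:
 assumes "0 < a" shows "(flat_exp a p \<longlongrightarrow> 0) (at 0)"
proof (rule filterlim_split_at)
 have "((%t. poly p (inverse t) * exp (- (a * inverse t))) \<longlongrightarrow> 0) (at_right 0)"
  by (rule filterlim_compose[OF poly_mult_exp_tendsto_0[OF assms] filterlim_inverse_at_top_right])
 then show "(flat_exp a p \<longlongrightarrow> 0) (at_right 0)"
  by (rule tendsto_cong[THEN iffD1, rotated])
   (auto simp: eventually_at_filter flat_exp_def inverse_eq_divide)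
 show "(flat_exp a p \<longlongrightarrow> 0) (at_left 0)"
  by (rule tendsto_eventually) (auto simp: eventually_at_filter flat_exp_def)
qed

lemma flat_exp_has_derivative:
 assumes "0 < a"
 shows "(flat_exp a p has_real_derivative flat_exp a ([:0, 0, 1:] * (smult a p - pderiv p)) t) (at t)"
proof -
 consider "t > 0" | "t < 0" | "t = 0" by linarith
 then show ?thesis
 proof cases
  case 1
  have d1: "((%t. poly p (1 / t)) has_real_derivative poly (pderiv p) (1 / t) * (- 1 / t\<^sup>2)) (at t)"
   by (rule DERIV_chain2[OF poly_DERIV]) (use 1 in \<open>auto intro!: derivative_eq_intros simp: power2_eq_square\<close>)
  have d2: "((%t. exp (- (a * (1 / t)))) has_real_derivative exp (- (a * (1 / t))) * (a / t\<^sup>2)) (at t)"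
   using 1 by (auto intro!: derivative_eq_intros simp: power2_eq_square)
  have "(flat_exp a p has_real_derivative
   poly (pderiv p) (1 / t) * (- 1 / t\<^sup>2) * exp (- (a * (1 / t))) + exp (- (a * (1 / t))) * (a / t\<^sup>2) * poly p (1 / t)) (at t)"
   by (rule has_field_derivative_transform_within_open[OF DERIV_mult[OF d1 d2], of "{0<..}"])
    (use 1 in \<open>auto simp: flat_exp_def\<close>)
  then show ?thesis
   by (rule DERIV_cong) (use 1 in \<open>simp add: flat_exp_def field_simps power2_eq_square\<close>)
 next
  case 2
  have "(flat_exp a p has_real_derivative 0) (at t)"
   by (rule has_field_derivative_transform_within_open[of "%_. 0" _ _ "{..<0}"])
    (use 2 in \<open>auto simp: flat_exp_def\<close>)
  then show ?thesis using 2 by (simp add: flat_exp_def)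
 next
  case 3
  \<comment> \<open>Dividing by t multiplies p by the variable: off zero the difference quotient is
    again a flat function, with \<open>[:0, 1:] * p\<close> in place of p.\<close>
  have "((%t. (flat_exp a p t - flat_exp a p 0) / (t - 0)) \<longlongrightarrow> 0) (at 0)"
   by (rule tendsto_cong[THEN iffD1, OF _ flat_exp_tendsto_0[OF assms, of "[:0, 1:] * p"]])
    (auto simp: eventually_at_filter flat_exp_def)
  then show ?thesis using 3 by (simp add: has_field_derivative_iff flat_exp_def)
 qed
qed

lemma C_k_flat_exp:
 fixes i :: "'n::finite"
 assumes "0 < a" shows "C_k k (%x::real^'n. flat_exp a p (c + s * x $ i))"
proof (induction k arbitrary: p)
 case 0
 have "continuous_on UNIV (flat_exp a p)"
  using flat_exp_has_derivative[OF assms] by (auto intro!: DERIV_continuous_on[where D="%t. flat_exp a ([:0, 0, 1:] * (smult a p - pderiv p)) t"])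
 moreover have "continuous_on UNIV (%x::real^'n. c + s * x $ i)" by (intro continuous_intros)
 ultimately have "continuous_on UNIV (%x::real^'n. flat_exp a p (c + s * x $ i))"
  by (rule continuous_on_compose2) simp
 then show ?case by simp
next
 case (Suc k)
 define q where "q = [:0, 0, 1:] * (smult a p - pderiv p)"
 have d: "((%x::real^'n. flat_exp a p (c + s * x $ i)) has_derivative
   (%h. (s * h $ i) * flat_exp a q (c + s * x $ i))) (at x)" for x :: "real^'n"
 proof -
  have "(flat_exp a p has_derivative (%h. h * flat_exp a q (c + s * x $ i))) (at (c + s * x $ i))"
  proof -
   have "(%h. h * flat_exp a q (c + s * x $ i)) = (*) (flat_exp a q (c + s * x $ i))"
    by (auto simp: mult.commute)
   moreover have "(flat_exp a p has_derivative (*) (flat_exp a q (c + s * x $ i))) (at (c + s * x $ i))"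
    using flat_exp_has_derivative[OF assms, of p "c + s * x $ i"]
    by (simp only: has_field_derivative_def q_def)
   ultimately show ?thesis by (simp only:)
  qed
  moreover have "((%x::real^'n. c + s * x $ i) has_derivative (%h. s * h $ i)) (at x)"
   by (auto intro!: derivative_eq_intros bounded_linear_imp_has_derivative[OF bounded_linear_vec_nth])
  ultimately show ?thesis using has_derivative_compose by blast
 qed
 then have "frechet_derivative (%x::real^'n. flat_exp a p (c + s * x $ i)) (at x)
  = (%h. (s * h $ i) * flat_exp a q (c + s * x $ i))" for x :: "real^'n"
  by (rule frechet_derivativeI)
 then show ?case
  using d C_k_bounded_linear[OF bounded_linear_mult_right Suc.IH] by (auto simp: differentiable_def)
qed

text \<open>As \<open>a\<close> tends to zero, the bump tends to the indicator function of the open box.\<close>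

definition bump :: "real => real^'n => real^'n => real^'n => real" where
 "bump a l r x = (\<Prod>i\<in>UNIV. flat_exp a 1 (x $ i - l $ i) * flat_exp a 1 (r $ i - x $ i))"

lemma bump_test_fun:
 assumes "0 < a" "cbox l r \<subseteq> W" shows "bump a l r \<in> test_fun W"
proof (rule test_funI)
 have "C_k k (%x. flat_exp a 1 (- (l $ i) + 1 * x $ i) *\<^sub>R flat_exp a 1 (r $ i + - 1 * x $ i))" for k i
  using assms by (intro C_k_scaleR C_k_flat_exp)
 then have "C_k k (%x. \<Prod>i\<in>UNIV. flat_exp a 1 (- (l $ i) + 1 * x $ i) *\<^sub>R flat_exp a 1 (r $ i + - 1 * x $ i))" for k
  by (intro C_k_prod)
 then show "C_k k (bump a l r)" for k
  by (simp add: bump_def[abs_def])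
 show "bump a l r x = 0" if x: "x \<notin> cbox l r" for x
 proof -
  obtain i where "\<not> (l $ i \<le> x $ i \<and> x $ i \<le> r $ i)" using x unfolding mem_box_cart by blast
  then have "flat_exp a 1 (x $ i - l $ i) * flat_exp a 1 (r $ i - x $ i) = 0"
   by (auto simp: flat_exp_def)
  then show ?thesis unfolding bump_def by (intro prod_zero bexI[of _ i]) auto
 qed
qed (use assms in auto)

lemma flat_exp_1_bounds: "0 < a ==> 0 \<le> flat_exp a 1 t \<and> flat_exp a 1 t \<le> 1"
 by (simp add: flat_exp_def)

lemma bump_bounds:
 assumes "0 < a" shows "\<bar>bump a l r x\<bar> \<le> 1"
proof -
 have "0 \<le> bump a l r x"
  unfolding bump_def using flat_exp_1_bounds[OF assms] by (intro prod_nonneg) auto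
 moreover have "bump a l r x \<le> (\<Prod>i\<in>(UNIV::'a set). 1)"
  unfolding bump_def using flat_exp_1_bounds[OF assms]
  by (intro prod_mono) (auto intro!: mult_le_one)
 ultimately show ?thesis by simp
qed

lemma bump_tendsto:
 "(%j. bump (1 / real (Suc j)) l r x) \<longlonglongrightarrow> indicator (box l r) x"
proof -
 have f: "(%j. flat_exp (1 / real (Suc j)) 1 t) \<longlonglongrightarrow> indicator {0<..} t" for t
 proof (cases "t > 0")
  case True
  have "(%j. exp (- (1 / real (Suc j) * (1 / t)))) \<longlonglongrightarrow> exp (- (0 * (1 / t)))"
   by (intro tendsto_intros LIMSEQ_inverse_real_of_nat[unfolded inverse_eq_divide])
  then show ?thesis using True by (simp add: flat_exp_def)
 qed (simp add: flat_exp_def)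
 have "(%j. bump (1 / real (Suc j)) l r x) \<longlonglongrightarrow>
  (\<Prod>i\<in>UNIV. indicator {0<..} (x $ i - l $ i) * indicator {0<..} (r $ i - x $ i))"
  unfolding bump_def by (intro tendsto_prod tendsto_mult f)
 also have "(\<Prod>i\<in>UNIV. indicator {0<..} (x $ i - l $ i) * indicator {0<..} (r $ i - x $ i))
   = (indicator (box l r) x :: real)"
 proof (cases "x \<in> box l r")
  case False
  then obtain i where "\<not> (l $ i < x $ i \<and> x $ i < r $ i)" unfolding mem_box_cart by blast
  then have "indicator {0<..} (x $ i - l $ i) * indicator {0<..} (r $ i - x $ i) = (0::real)" by auto
  then have "(\<Prod>i\<in>UNIV. indicator {0<..} (x $ i - l $ i) * indicator {0<..} (r $ i - x $ i)) = (0::real)"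
   by (intro prod_zero bexI[of _ i]) auto
  then show ?thesis using False by simp
 qed (auto simp: mem_box_cart)
 finally show ?thesis .
qed

section \<open>Functions orthogonal to all test functions\<close>

text \<open>Open boxes form an intersection-stable generator of the Borel sets, and the sets over
  which h integrates to zero contain them. The total integral is the one over the box carrying h,
  hence zero, which settles complements; countable additivity settles disjoint unions.\<close>

lemma AE_zero_of_box_integrals:
 fixes h :: "'a::euclidean_space => real"
 assumes h: "integrable lborel h" and c: "!!x. x \<notin> box l r ==> h x = 0"
  and z: "!!a b. (LINT x:box a b|lborel. h x) = 0"
 shows "AE x in lborel. h x = 0"
proof (rule density_unique_real[OF h integrable_zero])
 have int: "set_integrable lborel A h" if "A \<in> sets borel" for A
  using integrable_mult_indicator[OF _ h, of A] that by (simp add: set_integrable_def)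
 have U: "(LINT x|lborel. h x) = 0"
 proof -
  have "(LINT x|lborel. h x) = (LINT x:box l r|lborel. h x)"
   unfolding set_lebesgue_integral_def
   by (intro Bochner_Integration.integral_cong) (use c in \<open>auto simp: indicator_def\<close>)
  then show ?thesis using z by simp
 qed
 fix A :: "'a set" assume "A \<in> sets lborel"
 have BS: "sets (borel :: 'a measure) = sigma_sets UNIV (range (%(a, b). box a b))"
  by (subst borel_eq_box) simp
 have A: "A \<in> sigma_sets UNIV (range (%(a, b). box a b))"
  using \<open>A \<in> sets lborel\<close> BS by simp
 have IS: "Int_stable (range (%(a, b). box a b :: 'a set))"
  by (auto simp: Int_stable_def box_Int_box)
 have P: "range (%(a, b). box a b :: 'a set) \<subseteq> Pow UNIV" by simp
 from IS P A have "(LINT x:A|lborel. h x) = 0"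
 proof (induct rule: sigma_sets_induct_disjoint)
  case empty
  show ?case by (simp add: set_lebesgue_integral_def)
 next
  case (basic A)
  then show ?case using z by auto
 next
  case (compl A)
  then have m: "A \<in> sets borel" using BS by simp
  have "(LINT x:UNIV - A|lborel. h x) = (LINT x|lborel. h x - indicator A x *\<^sub>R h x)"
   unfolding set_lebesgue_integral_def
   by (intro Bochner_Integration.integral_cong) (auto simp: indicator_def)
  also have "... = 0" using int[OF m] h compl U by (simp add: set_integrable_def set_lebesgue_integral_def)
  finally show ?case .
 next
  case (union A)
  then have m: "A i \<in> sets borel" for i using BS by auto
  have "(LINT x:(\<Union>i. A i)|lborel. h x) = (\<Sum>i. (LINT x:(A i)|lborel. h x))"
   using union m by (intro lebesgue_integral_countable_add int) (auto simp: disjoint_family_on_def)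
  then show ?case using union by simp
 qed
 then show "(LINT x:A|lborel. h x) = (LINT x:A|lborel. 0)"
  by (simp add: set_lebesgue_integral_def)
qed

text \<open>The bumps on a box converge boundedly to its indicator, so h has zero integral over
  every box whose closure lies in W and vanishes almost everywhere in such boxes. Countably many of
  them exhaust W up to a null set.\<close>

lemma du_Bois_Reymond:
 fixes h :: "real^'n => real"
 assumes W: "open W" and h: "integrable (lebesgue_on W) h"
  and z: "!!\<psi>. \<psi> \<in> test_fun W ==> (LINT x|lebesgue_on W. \<psi> x * h x) = 0"
 shows "AE x in lebesgue_on W. h x = 0"
proof -
 have W': "W \<inter> space lebesgue \<in> sets lebesgue" "W \<in> sets lebesgue"
  using W by (auto simp: lmeasurable_open)
 define g where "g x = indicator W x *\<^sub>R h x" for x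
 have g: "integrable lebesgue g"
  using h by (simp add: integrable_restrict_space[OF W'(1)] g_def[abs_def])
 have box0: "(LINT x|lebesgue. indicator (box a b) x *\<^sub>R g x) = 0" if "cbox a b \<subseteq> W" for a b
 proof -
  define B where "B j x = bump (1 / real (Suc j)) a b x" for j x
  have Bt: "B j \<in> test_fun W" for j
   unfolding B_def[abs_def] by (rule bump_test_fun) (use that in auto)
  have Bm: "B j \<in> borel_measurable lebesgue" for j
   using test_fun_continuous[OF Bt] by (intro measurable_completion) (auto intro!: borel_measurable_continuous_onI)
  have "(%j. LINT x|lebesgue. B j x *\<^sub>R g x) \<longlonglongrightarrow> (LINT x|lebesgue. indicator (box a b) x *\<^sub>R g x)"
  proof (rule integral_dominated_convergence[where w="%x. norm (g x)"])
   show "AE x in lebesgue. (%j. B j x *\<^sub>R g x) \<longlonglongrightarrow> indicator (box a b) x *\<^sub>R g x"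
    unfolding B_def by (intro AE_I2 tendsto_scaleR bump_tendsto tendsto_const)
   show "AE x in lebesgue. norm (B j x *\<^sub>R g x) \<le> norm (g x)" for j
    unfolding B_def using bump_bounds[of "1 / real (Suc j)" a b]
    by (intro AE_I2) (auto intro!: mult_left_le_one_le simp: abs_mult)
   show "(%x. B j x *\<^sub>R g x) \<in> borel_measurable lebesgue" for j
    using Bm g by auto
   show "(%x. indicator (box a b) x *\<^sub>R g x) \<in> borel_measurable lebesgue"
    by (intro borel_measurable_scaleR borel_measurable_indicator borel_measurable_integrable[OF g]) simp
  qed (use g in auto)
  moreover have "(LINT x|lebesgue. B j x *\<^sub>R g x) = 0" for j
   using z[OF Bt] by (simp add: integral_restrict_space[OF W'(1)] g_def algebra_simps)
  ultimately show ?thesis by (simp add: LIMSEQ_const_iff)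
 qed
 have AE_box: "AE x in lebesgue. x \<in> box l r \<longrightarrow> g x = 0" if "cbox l r \<subseteq> W" for l r
 proof -
  define g1 where "g1 x = indicator (box l r) x *\<^sub>R g x" for x
  have g1: "integrable lebesgue g1"
   unfolding g1_def by (rule integrable_mult_indicator[OF _ g]) simp
  \<comment> \<open>A Borel representative, because the argument by generating boxes takes place in
    \<open>lborel\<close>. Multiplying it by the indicator of the box confines it to the box also on
    the exceptional null set.\<close>
  obtain g0 where g0: "g0 \<in> borel_measurable lborel" "AE x in lborel. g1 x = g0 x"
   using completion_ex_borel_measurable_real[OF borel_measurable_integrable[OF g1]] by auto
  define g' where "g' x = indicator (box l r) x *\<^sub>R g0 x" for x
  have g'm: "g' \<in> borel_measurable lborel"
   unfolding g'_def using g0 by (auto intro!: borel_measurable_scaleR borel_measurable_indicator)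
  have eq: "AE x in lebesgue. g1 x = g' x"
   using AE_completion[OF g0(2)] by eventually_elim (auto simp: g'_def g1_def indicator_def)
  have "integrable lebesgue g'"
   using g1 eq g'm by (subst integrable_cong_AE[symmetric, of g1]) (auto intro: measurable_completion)
  then have g'i: "integrable lborel g'"
   using g'm by (simp add: integrable_completion)
  have "AE x in lborel. g' x = 0"
  proof (rule AE_zero_of_box_integrals[OF g'i])
   show "g' x = 0" if "x \<notin> box l r" for x using that by (simp add: g'_def)
   fix a b
   \<comment> \<open>The closed box must stay inside W for \<open>box0\<close> to apply. An empty
     intersection is therefore represented by the box from 1 to 0, whose closed version is empty as
     well.\<close>
   obtain a' b' where ab: "box a b \<inter> box l r = box a' b'" "cbox a' b' \<subseteq> cbox l r"
   proof (cases "box a b \<inter> box l r = {}")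
    case True
    moreover have "box (1::real^'n) 0 = {}" "cbox (1::real^'n) 0 = {}"
     by (simp_all add: interval_eq_empty_cart)
    ultimately show thesis using that[of "1" "0"] by simp
   next
    case False
    then have "closure (box a b \<inter> box l r) \<subseteq> cbox l r"
     by (intro closure_minimal) (auto simp: box_subset_cbox[THEN subsetD])
    moreover obtain a' b' where "box a b \<inter> box l r = box a' b'" by (simp add: box_Int_box)
    ultimately show thesis using that[of a' b'] False by (auto simp: closure_box)
   qed
   have "(LINT x:box a b|lborel. g' x) = (LINT x|lebesgue. indicator (box a b) x *\<^sub>R g' x)"
    unfolding set_lebesgue_integral_def using g'm
    by (intro integral_completion[symmetric]) (auto intro!: borel_measurable_scaleR borel_measurable_indicator)
   also have "... = (LINT x|lebesgue. indicator (box a' b') x *\<^sub>R g x)"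
   proof (rule integral_cong_AE)
    show "AE x in lebesgue. indicator (box a b) x *\<^sub>R g' x = indicator (box a' b') x *\<^sub>R g x"
     using eq
    proof eventually_elim
     case (elim x)
     have "indicator (box a b) x * indicator (box l r) x = (indicator (box a' b') x :: real)"
      by (simp add: indicator_inter_arith[symmetric] ab(1))
     then show ?case using elim
      by (auto simp: g1_def g'_def indicator_def split: if_splits)
    qed
    show "(%x. indicator (box a b) x *\<^sub>R g' x) \<in> borel_measurable lebesgue"
     using g'm by (intro measurable_completion) (auto intro!: borel_measurable_scaleR borel_measurable_indicator)
    show "(%x. indicator (box a' b') x *\<^sub>R g x) \<in> borel_measurable lebesgue"
     by (intro borel_measurable_scaleR borel_measurable_indicator borel_measurable_integrable[OF g]) simp
   qed
   also have "... = 0" using box0 ab(2) that by blast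
   finally show "(LINT x:box a b|lborel. g' x) = 0" .
  qed
  then have "AE x in lebesgue. g' x = 0" by (rule AE_completion)
  with eq show ?thesis by eventually_elim (auto simp: g1_def)
 qed
 obtain \<D> where D: "countable \<D>" "\<D> \<subseteq> Pow W" "!!X. X \<in> \<D> ==> \<exists>a b. X = cbox a b" "\<Union>\<D> = W"
  using open_countable_Union_open_cbox[OF W] by metis
 have "AE x in lebesgue. x \<in> X \<longrightarrow> g x = 0" if X: "X \<in> \<D>" for X
 proof -
  obtain a b where ab: "X = cbox a b" using D X by blast
  then have "AE x in lebesgue. x \<in> box a b \<longrightarrow> g x = 0" using AE_box D X by auto
  moreover have "AE x in lebesgue. x \<notin> cbox a b - box a b"
   by (rule AE_not_in) (use negligible_frontier_interval[of a b] in \<open>simp add: negligible_iff_null_sets\<close>)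
  ultimately show ?thesis unfolding ab by eventually_elim auto
 qed
 then have "AE x in lebesgue. \<forall>X\<in>\<D>. x \<in> X \<longrightarrow> g x = 0"
  by (subst AE_ball_countable[OF D(1)]) blast
 then have "AE x in lebesgue. x \<in> W \<longrightarrow> h x = 0"
 proof eventually_elim
  case (elim x)
  show ?case
  proof
   assume "x \<in> W"
   then obtain X where "X \<in> \<D>" "x \<in> X" using D(4) by blast
   then have "g x = 0" using elim by blast
   then show "h x = 0" using \<open>x \<in> W\<close> by (simp add: g_def)
  qed
 qed
 then show ?thesis using W' by (simp add: AE_restrict_space_iff)
qed

section \<open>Weak Jacobians\<close>

lemma integral_lebesgue_on_support:
 fixes f :: "'a::euclidean_space => 'b::euclidean_space"
 assumes "W \<in> sets lebesgue" "f \<in> borel_measurable borel" "!!x. x \<notin> W ==> f x = 0"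
 shows "(LINT x|lebesgue_on W. f x) = (LINT x|lborel. f x)"
proof -
 have "(LINT x|lebesgue_on W. f x) = (LINT x|lebesgue. indicator W x *\<^sub>R f x)"
  using assms by (intro integral_restrict_space) simp
 also have "... = (LINT x|lebesgue. f x)"
  by (intro Bochner_Integration.integral_cong) (use assms in \<open>auto simp: indicator_def\<close>)
 also have "... = (LINT x|lborel. f x)"
  using assms by (intro integral_completion) simp
 finally show ?thesis .
qed

lemma integral_lborel_translation:
 fixes f :: "'a::euclidean_space => 'b::euclidean_space"
 assumes "f \<in> borel_measurable borel"
 shows "(LINT x|lborel. f (c + x)) = (LINT x|lborel. f x)"
proof -
 have "(LINT x|lborel. f x) = (LINT x|distr lborel borel ((+) c). f x)"
  by (simp add: lborel_distr_plus)
 also have "... = (LINT x|lborel. f (c + x))"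
  by (rule integral_distr) (use assms in auto)
 finally show ?thesis by simp
qed

lemma norm_diff_le_of_directional_bound:
 fixes f :: "'a::euclidean_space => 'b::euclidean_space"
 assumes "!!x. f differentiable (at x)" "!!x. norm (frechet_derivative f (at x) v) \<le> B"
 shows "norm (f (x + t *\<^sub>R v) - f x) \<le> B * \<bar>t\<bar>"
proof -
 have d: "((%s. f (x + s *\<^sub>R v)) has_derivative (%h. h *\<^sub>R frechet_derivative f (at (x + s *\<^sub>R v)) v)) (at s within UNIV)" for s
 proof -
  have "((%s. x + s *\<^sub>R v) has_derivative (%h. h *\<^sub>R v)) (at s)"
   by (auto intro!: derivative_eq_intros)
  from has_derivative_compose[OF this frechet_derivative_has[OF assms(1)]]
  have "((%s. f (x + s *\<^sub>R v)) has_derivative (%h. frechet_derivative f (at (x + s *\<^sub>R v)) (h *\<^sub>R v))) (at s)" .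
  then show ?thesis using linear_frechet_derivative[OF assms(1)] by (simp add: linear_scale)
 qed
 have "onorm (%h::real. h *\<^sub>R frechet_derivative f (at (x + s *\<^sub>R v)) v) \<le> B" for s
 proof (rule onorm_le)
  show "norm (h *\<^sub>R frechet_derivative f (at (x + s *\<^sub>R v)) v) \<le> B * norm h" for h :: real
   using mult_left_mono[OF assms(2)[of "x + s *\<^sub>R v"], of "\<bar>h\<bar>"] by (simp add: mult.commute)
 qed
 from differentiable_bound[OF convex_UNIV d this, of t 0] show ?thesis by simp
qed

lemma difference_quotient_sequence:
 fixes f :: "'a::euclidean_space => 'b::euclidean_space"
 assumes "f differentiable (at x)"
 shows "(%k. real (Suc k) *\<^sub>R (f (x + (1 / real (Suc k)) *\<^sub>R v) - f x)) \<longlonglongrightarrow> frechet_derivative f (at x) v"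
proof -
  have "((%s. x + s *\<^sub>R v) has_derivative (%h. h *\<^sub>R v)) (at 0)"
   by (auto intro!: derivative_eq_intros)
  moreover have "(f has_derivative frechet_derivative f (at x)) (at (x + 0 *\<^sub>R v))"
   using frechet_derivative_has[OF assms] by simp
  ultimately have "((%s. f (x + s *\<^sub>R v)) has_derivative (%h. frechet_derivative f (at x) (h *\<^sub>R v))) (at 0)"
   using has_derivative_compose by blast
  then have "((%s. norm (f (x + s *\<^sub>R v) - f x - s *\<^sub>R frechet_derivative f (at x) v) / norm s) \<longlongrightarrow> 0) (at 0)"
   using linear_frechet_derivative[OF assms]
   by (simp add: has_derivative_at linear_scale)
  then have "((%s. norm ((f (x + s *\<^sub>R v) - f x) /\<^sub>R s - frechet_derivative f (at x) v)) \<longlongrightarrow> 0) (at 0)"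
  proof (rule tendsto_cong[THEN iffD1, rotated])
   show "\<forall>\<^sub>F s in at 0. norm (f (x + s *\<^sub>R v) - f x - s *\<^sub>R frechet_derivative f (at x) v) / norm s
     = norm ((f (x + s *\<^sub>R v) - f x) /\<^sub>R s - frechet_derivative f (at x) v)"
    unfolding eventually_at_filter
   proof (intro always_eventually allI impI)
    fix s :: real assume "s \<noteq> 0"
    then have "(f (x + s *\<^sub>R v) - f x) /\<^sub>R s - frechet_derivative f (at x) v = (f (x + s *\<^sub>R v) - f x - s *\<^sub>R frechet_derivative f (at x) v) /\<^sub>R s"
     by (simp add: scaleR_right_diff_distrib)
    then show "norm (f (x + s *\<^sub>R v) - f x - s *\<^sub>R frechet_derivative f (at x) v) / norm s
     = norm ((f (x + s *\<^sub>R v) - f x) /\<^sub>R s - frechet_derivative f (at x) v)"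
     by (simp add: divide_inverse)
   qed
  qed
  then have "((%s. (f (x + s *\<^sub>R v) - f x) /\<^sub>R s) \<longlongrightarrow> frechet_derivative f (at x) v) (at 0)"
   by (rule LIM_zero_cancel[OF tendsto_norm_zero_cancel])
  moreover have "filterlim (%k. 1 / real (Suc k)) (at 0) sequentially"
   using LIMSEQ_inverse_real_of_nat by (auto simp: filterlim_at inverse_eq_divide)
  ultimately have "(%k. (f (x + (1 / real (Suc k)) *\<^sub>R v) - f x) /\<^sub>R (1 / real (Suc k))) \<longlonglongrightarrow> frechet_derivative f (at x) v"
   by (rule filterlim_compose)
  then show ?thesis by simp
qed

text \<open>Difference quotients of f have integral zero by translation invariance. They are bounded
  by B and, the steps being at most \<open>norm v\<close>, vanish outside the ball of radius
  \<open>R + norm v\<close>, so dominated convergence applies.\<close>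

lemma integral_frechet_derivative_test_fun:
 fixes f :: "real^'n => 'b::euclidean_space"
 assumes "f \<in> test_fun W" "W \<in> sets lebesgue"
 shows "(LINT x|lebesgue_on W. frechet_derivative f (at x) v) = 0"
proof -
 obtain S where S: "compact S" "S \<subseteq> W" "!!x. x \<notin> S ==> f x = 0"
  using test_funE[OF assms(1)] by metis
 define g where "g x = frechet_derivative f (at x) v" for x
 have gt: "g \<in> test_fun W" unfolding g_def[abs_def] by (rule test_fun_frechet[OF assms(1)])
 obtain B where B: "0 \<le> B" "!!x. norm (g x) \<le> B" using test_fun_bounded[OF gt] by blast
 obtain R where R: "!!x. x \<in> S ==> norm x \<le> R" using S(1) compact_imp_bounded bounded_iff by metis
 have cf: "continuous_on UNIV f" and cg: "continuous_on UNIV g"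
  using assms(1) gt by (auto intro: test_fun_continuous)
 have mf: "f \<in> borel_measurable borel" and mg: "g \<in> borel_measurable borel"
  using cf cg by (auto intro: borel_measurable_continuous_onI)
 have intf: "integrable lborel f"
 proof -
  have "integrable lborel (%x. indicator S x *\<^sub>R f x)"
   using borel_integrable_compact[OF S(1) continuous_on_subset[OF cf subset_UNIV]] .
  moreover have "(%x. indicator S x *\<^sub>R f x) = f" using S(3) by (auto simp: indicator_def)
  ultimately show ?thesis by simp
 qed
 have intfs: "integrable lborel (%x. f (c + x))" for c
  using integrable_distr[of "(+) c" lborel borel f] intf by (simp add: lborel_distr_plus)
 define d where "d k x = real (Suc k) *\<^sub>R (f ((1 / real (Suc k)) *\<^sub>R v + x) - f x)" for k x
 have d0: "(LINT x|lborel. d k x) = 0" for k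
  using intf intfs integral_lborel_translation[OF mf] by (simp add: d_def)
 have "(%k. LINT x|lborel. d k x) \<longlonglongrightarrow> (LINT x|lborel. g x)"
 proof (rule integral_dominated_convergence[where w="%x. indicator (cball 0 (R + norm v)) x *\<^sub>R B"])
  show "integrable lborel (%x::real^'n. indicator (cball 0 (R + norm v)) x *\<^sub>R B)"
   by (rule borel_integrable_compact) auto
  show "g \<in> borel_measurable lborel" using mg by simp
  show "d k \<in> borel_measurable lborel" for k
   using mf unfolding d_def[abs_def] by measurable
  show "AE x in lborel. (%k. d k x) \<longlonglongrightarrow> g x"
  proof (rule AE_I2)
   fix x
   show "(%k. d k x) \<longlonglongrightarrow> g x"
    using difference_quotient_sequence[OF test_fun_differentiable[OF assms(1)], of x v]
    by (simp add: d_def g_def add.commute)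
  qed
  show "AE x in lborel. norm (d k x) \<le> indicator (cball 0 (R + norm v)) x *\<^sub>R B" for k
  proof (rule AE_I2)
   fix x
   have "norm (f ((1 / real (Suc k)) *\<^sub>R v + x) - f x) \<le> B * (1 / real (Suc k))"
    using norm_diff_le_of_directional_bound[OF test_fun_differentiable[OF assms(1)] B(2)[unfolded g_def], of x "1 / real (Suc k)"]
    by (simp add: add.commute)
   then have "real (Suc k) * norm (f ((1 / real (Suc k)) *\<^sub>R v + x) - f x) \<le> real (Suc k) * (B * (1 / real (Suc k)))"
    by (rule mult_left_mono) simp
   then have bd: "norm (d k x) \<le> B" unfolding d_def norm_scaleR by simp
   show "norm (d k x) \<le> indicator (cball 0 (R + norm v)) x *\<^sub>R B"
   proof (cases "x \<in> cball 0 (R + norm v)")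
    case False
    then have n: "R + norm v < norm x" by (simp add: dist_norm)
    have "norm ((1 / real (Suc k)) *\<^sub>R v) \<le> norm v"
     unfolding norm_scaleR by (rule mult_left_le_one_le) auto
    moreover have "norm x - norm ((1 / real (Suc k)) *\<^sub>R v) \<le> norm ((1 / real (Suc k)) *\<^sub>R v + x)"
     by (metis add.commute norm_diff_ineq)
    ultimately have "R < norm ((1 / real (Suc k)) *\<^sub>R v + x)" using n by linarith
    moreover have "R < norm x" using n norm_ge_zero[of v] by linarith
    ultimately have "f ((1 / real (Suc k)) *\<^sub>R v + x) = 0" "f x = 0"
     using R S(3) by (meson not_less)+
    then show ?thesis using B(1) by (simp add: d_def)
   qed (use bd in simp)
  qed
 qed
 then have "(LINT x|lborel. g x) = 0" by (simp add: d0 LIMSEQ_const_iff)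
 moreover have "g x = 0" if "x \<notin> W" for x using test_funE[OF gt] that by (metis subsetD)
 ultimately show ?thesis
  using integral_lebesgue_on_support[OF assms(2) mg] by (simp add: g_def)
qed

lemma column_jacobian:
 "column i (jacobian f (at x)) = frechet_derivative f (at x) (axis i 1)"
 by (simp add: column_def jacobian_def matrix_def vec_eq_iff)

lemma bounded_linear_column: "bounded_linear (%A::real^'n^'m. column i A)"
 by (intro linear_conv_bounded_linear[THEN iffD1] linearI) (auto simp: column_def vec_eq_iff)

lemma test_fun_jacobian:
 fixes \<phi> :: "real^'n => real^'m"
 assumes "\<phi> \<in> test_fun W"
 shows "(%x. jacobian \<phi> (at x)) \<in> test_fun W"
proof -
 have "bounded_linear (%y::real^'m. (\<chi> r s. if s = i then y $ r else 0) :: real^'n^'m)" for i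
  by (intro linear_conv_bounded_linear[THEN iffD1] linearI) (auto simp: vec_eq_iff)
 from test_fun_bounded_linear[OF test_fun_frechet[OF assms] this]
 have "(%x. \<Sum>i\<in>UNIV. (\<chi> r s. if s = i then frechet_derivative \<phi> (at x) (axis i 1) $ r else 0) :: real^'n^'m) \<in> test_fun W"
  by (intro test_fun_sum)
 moreover have "(\<Sum>i\<in>UNIV. (\<chi> r s. if s = i then frechet_derivative \<phi> (at x) (axis i 1) $ r else 0) :: real^'n^'m)
   = jacobian \<phi> (at x)" for x
  by (simp add: vec_eq_iff jacobian_def matrix_def)
 ultimately show ?thesis by simp
qed

lemma jacobian_scaleR_diff:
 fixes f g :: "real^'n => real^'m"
 assumes "f differentiable (at x)" "g differentiable (at x)"
 shows "jacobian (%x. f x - g x) (at x) = jacobian f (at x) - jacobian g (at x)"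
  "jacobian (%x. f x + g x) (at x) = jacobian f (at x) + jacobian g (at x)"
  "jacobian (%x. c *\<^sub>R f x) (at x) = c *\<^sub>R jacobian f (at x)"
proof -
 note d = frechet_derivative_has[OF assms(1)] frechet_derivative_has[OF assms(2)]
 show "jacobian (%x. f x - g x) (at x) = jacobian f (at x) - jacobian g (at x)"
  using frechet_derivativeI[OF has_derivative_diff[OF d]]
  by (simp add: jacobian_def matrix_def vec_eq_iff)
 show "jacobian (%x. f x + g x) (at x) = jacobian f (at x) + jacobian g (at x)"
  using frechet_derivativeI[OF has_derivative_add[OF d]]
  by (simp add: jacobian_def matrix_def vec_eq_iff)
 show "jacobian (%x. c *\<^sub>R f x) (at x) = c *\<^sub>R jacobian f (at x)"
  using frechet_derivativeI[OF has_derivative_scaleR_right[OF d(1)]]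
  by (simp add: jacobian_def matrix_def vec_eq_iff)
qed

context
 fixes W :: "(real^'n) set"
 assumes W: "open W" "bounded W"
begin

lemma W_sets: "W \<in> sets lebesgue"
 using W by (simp add: lmeasurable_open fmeasurableD)

lemma in_L2_test_fun: "f \<in> test_fun W ==> in_L2 W (f :: real^'n => 'b::euclidean_space)"
 using test_fun_in_L2 W by blast

lemma in_L2_integrable:
 assumes "in_L2 W f" shows "integrable (lebesgue_on W) f"
proof -
 have "in_L2 W (%x. 1::real)" by (rule continuous_in_L2) (use W W_sets in auto)
 from in_L2_scaleR_integrable[OF this assms] show ?thesis by simp
qed

lemma test_fun_weak_jacobian:
 assumes "\<phi> \<in> test_fun W"
 shows "has_weak_jacobian W \<phi> (%x. jacobian \<phi> (at x))"
 unfolding has_weak_jacobian_def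
proof (intro conjI allI impI)
 show "in_L2 W (%x. jacobian \<phi> (at x))"
  by (intro in_L2_test_fun test_fun_jacobian assms)
 fix \<psi> :: "real^'n => real" and i assume \<psi>: "\<psi> \<in> test_fun W"
 have "frechet_derivative (%x. \<psi> x *\<^sub>R \<phi> x) (at x)
  = (%h. \<psi> x *\<^sub>R frechet_derivative \<phi> (at x) h + frechet_derivative \<psi> (at x) h *\<^sub>R \<phi> x)" for x
  by (intro frechet_derivativeI has_derivative_scaleR frechet_derivative_has)
   (use assms \<psi> in \<open>auto intro: test_fun_differentiable\<close>)
 then have "0 = (LINT x|lebesgue_on W. \<psi> x *\<^sub>R frechet_derivative \<phi> (at x) (axis i 1)
   + frechet_derivative \<psi> (at x) (axis i 1) *\<^sub>R \<phi> x)"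
  using integral_frechet_derivative_test_fun[OF test_fun_mult[OF \<psi> assms] W_sets, of "axis i 1"] by simp
 also have "... = (LINT x|lebesgue_on W. \<psi> x *\<^sub>R frechet_derivative \<phi> (at x) (axis i 1))
   + (LINT x|lebesgue_on W. frechet_derivative \<psi> (at x) (axis i 1) *\<^sub>R \<phi> x)"
  by (intro Bochner_Integration.integral_add in_L2_scaleR_integrable in_L2_test_fun \<psi> assms test_fun_frechet)
 finally show "(LINT x|lebesgue_on W. frechet_derivative \<psi> (at x) (axis i 1) *\<^sub>R \<phi> x)
   = - (LINT x|lebesgue_on W. \<psi> x *\<^sub>R column i (jacobian \<phi> (at x)))"
  by (simp add: column_jacobian eq_neg_iff_add_eq_0 add.commute)
qed

lemma has_weak_jacobian_diff:
 assumes "in_L2 W u" "in_L2 W v" "has_weak_jacobian W u J" "has_weak_jacobian W v J'"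
 shows "has_weak_jacobian W (%x. u x - v x) (%x. J x - J' x)"
 unfolding has_weak_jacobian_def
proof (intro conjI allI impI)
 have J: "in_L2 W J" "in_L2 W J'" using assms by (auto simp: has_weak_jacobian_def)
 then show "in_L2 W (%x. J x - J' x)" by (rule in_L2_diff)
 fix \<psi> :: "real^'n => real" and i assume \<psi>: "\<psi> \<in> test_fun W"
 have col: "column i (J x - J' x) = column i (J x) - column i (J' x)" for x
  by (simp add: linear_simps[OF bounded_linear_column])
 have "integrable (lebesgue_on W) (%x. frechet_derivative \<psi> (at x) (axis i 1) *\<^sub>R u x)"
  "integrable (lebesgue_on W) (%x. frechet_derivative \<psi> (at x) (axis i 1) *\<^sub>R v x)"
  "integrable (lebesgue_on W) (%x. \<psi> x *\<^sub>R column i (J x))"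
  "integrable (lebesgue_on W) (%x. \<psi> x *\<^sub>R column i (J' x))"
  by (intro in_L2_scaleR_integrable in_L2_test_fun \<psi> test_fun_frechet assms
    in_L2_bounded_linear[OF _ bounded_linear_column] J)+
 then show "(LINT x|lebesgue_on W. frechet_derivative \<psi> (at x) (axis i 1) *\<^sub>R (u x - v x))
   = - (LINT x|lebesgue_on W. \<psi> x *\<^sub>R column i (J x - J' x))"
  using assms \<psi> by (simp add: has_weak_jacobian_def scaleR_right_diff_distrib col)
qed

text \<open>The fundamental lemma is applied to every matrix entry of the difference. Uniqueness
  lets the Jacobian picked by the choice operator in \<open>weak_jacobian\<close> be replaced by an
  explicit one in every norm.\<close>

lemma weak_jacobian_unique:
 assumes "has_weak_jacobian W u J" "has_weak_jacobian W u J'"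
 shows "AE x in lebesgue_on W. J x = J' x"
proof -
 have J: "in_L2 W J" "in_L2 W J'" using assms by (auto simp: has_weak_jacobian_def)
 have D: "in_L2 W (%x. J x - J' x)" by (rule in_L2_diff[OF J])
 have "AE x in lebesgue_on W. (J x - J' x) $ k $ i = 0" for k i
 proof (rule du_Bois_Reymond[OF W(1)])
  have bl: "bounded_linear (%A::real^'n^'n. A $ k $ i)"
   by (intro bounded_linear_compose[OF bounded_linear_vec_nth] bounded_linear_vec_nth)
  show "integrable (lebesgue_on W) (%x. (J x - J' x) $ k $ i)"
   by (rule in_L2_integrable[OF in_L2_bounded_linear[OF D bl]])
  fix \<psi> :: "real^'n => real" assume \<psi>: "\<psi> \<in> test_fun W"
  have i: "integrable (lebesgue_on W) (%x. \<psi> x *\<^sub>R column i (J x))"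
   "integrable (lebesgue_on W) (%x. \<psi> x *\<^sub>R column i (J' x))"
   by (intro in_L2_scaleR_integrable in_L2_test_fun \<psi> in_L2_bounded_linear[OF _ bounded_linear_column] J)+
  have "(LINT x|lebesgue_on W. \<psi> x * (J x - J' x) $ k $ i)
    = (LINT x|lebesgue_on W. (\<psi> x *\<^sub>R column i (J x) - \<psi> x *\<^sub>R column i (J' x)) $ k)"
   by (intro Bochner_Integration.integral_cong) (auto simp: column_def algebra_simps)
  also have "... = (LINT x|lebesgue_on W. \<psi> x *\<^sub>R column i (J x) - \<psi> x *\<^sub>R column i (J' x)) $ k"
   using i by (intro integral_bounded_linear[OF bounded_linear_vec_nth] Bochner_Integration.integrable_diff)
  also have "... = 0" using i assms \<psi> by (simp add: has_weak_jacobian_def)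
  finally show "(LINT x|lebesgue_on W. \<psi> x * (J x - J' x) $ k $ i) = 0" .
 qed
 then have "AE x in lebesgue_on W. \<forall>k i. (J x - J' x) $ k $ i = 0"
  by (simp add: AE_all_countable)
 then show ?thesis by eventually_elim (auto simp: vec_eq_iff)
qed

lemma L2_nrm_cong_AE:
 assumes "AE x in lebesgue_on W. f x = g x" "in_L2 W f" "in_L2 W g"
 shows "L2_nrm W f = L2_nrm W g"
proof -
 have "(LINT x|lebesgue_on W. (norm (f x))\<^sup>2) = (LINT x|lebesgue_on W. (norm (g x))\<^sup>2)"
  by (rule integral_cong_AE) (use assms in \<open>auto simp: in_L2_def\<close>)
 then show ?thesis by (simp add: L2_nrm_def)
qed

lemma has_weak_jacobian_weak_jacobian:
 assumes "has_weak_jacobian W u J" shows "has_weak_jacobian W u (weak_jacobian W u)"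
 unfolding weak_jacobian_def using someI[of "has_weak_jacobian W u" J] assms by simp

lemma L2_nrm_weak_jacobian:
 assumes "has_weak_jacobian W u J"
 shows "L2_nrm W (weak_jacobian W u) = L2_nrm W J"
 using L2_nrm_cong_AE[OF weak_jacobian_unique[OF has_weak_jacobian_weak_jacobian[OF assms] assms]]
  has_weak_jacobian_weak_jacobian[OF assms] assms
 by (simp add: has_weak_jacobian_def)

text \<open>The norm of H^1 contains a chosen Jacobian of each difference. This form separates two
  L^2 limits that involve classical Jacobians of the test functions and one fixed J.\<close>

lemma H1_approx_iff:
 assumes "in_L2 W u" "has_weak_jacobian W u J"
 shows "H1_approx W \<phi> u \<longleftrightarrow> (\<forall>k. \<phi> k \<in> test_fun W) \<and>
  (%k. L2_nrm W (%x. \<phi> k x - u x)) \<longlonglongrightarrow> 0 \<and> (%k. L2_nrm W (%x. jacobian (\<phi> k) (at x) - J x)) \<longlonglongrightarrow> 0"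
proof (cases "\<forall>k. \<phi> k \<in> test_fun W")
 case True
 define a where "a k = L2_nrm W (%x. \<phi> k x - u x)" for k
 define b where "b k = L2_nrm W (%x. jacobian (\<phi> k) (at x) - J x)" for k
 have e: "H1_nrm W (%x. \<phi> k x - u x) = sqrt ((a k)\<^sup>2 + (b k)\<^sup>2)" for k
 proof -
  have "\<phi> k \<in> test_fun W" using True by simp
  then have "has_weak_jacobian W (%x. \<phi> k x - u x) (%x. jacobian (\<phi> k) (at x) - J x)"
   by (intro has_weak_jacobian_diff assms in_L2_test_fun test_fun_weak_jacobian)
  then show ?thesis by (simp add: H1_nrm_def L2_nrm_weak_jacobian a_def b_def)
 qed
 have "(%k. sqrt ((a k)\<^sup>2 + (b k)\<^sup>2)) \<longlonglongrightarrow> 0 \<longleftrightarrow> a \<longlonglongrightarrow> 0 \<and> b \<longlonglongrightarrow> 0"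
 proof
  assume l: "(%k. sqrt ((a k)\<^sup>2 + (b k)\<^sup>2)) \<longlonglongrightarrow> 0"
  show "a \<longlonglongrightarrow> 0 \<and> b \<longlonglongrightarrow> 0"
  proof
   show "a \<longlonglongrightarrow> 0"
    by (rule Lim_null_comparison[OF _ l]) (auto simp: a_def intro!: always_eventually real_le_rsqrt)
   show "b \<longlonglongrightarrow> 0"
    by (rule Lim_null_comparison[OF _ l]) (auto simp: b_def intro!: always_eventually real_le_rsqrt)
  qed
 next
  assume "a \<longlonglongrightarrow> 0 \<and> b \<longlonglongrightarrow> 0"
  then have "(%k. sqrt ((a k)\<^sup>2 + (b k)\<^sup>2)) \<longlonglongrightarrow> sqrt (0\<^sup>2 + 0\<^sup>2)" by (intro tendsto_intros) auto
  then show "(%k. sqrt ((a k)\<^sup>2 + (b k)\<^sup>2)) \<longlonglongrightarrow> 0" by simp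
 qed
 then show ?thesis using True by (simp add: H1_approx_def e flip: a_def b_def)
next
 case False
 then show ?thesis unfolding H1_approx_def by blast
qed

end

section \<open>Facets of full-dimensional polytopes\<close>

text \<open>Each of the two hyperplanes equals the affine hull of S. Moving from p by the part of n2
  orthogonal to n1 therefore stays in both, which forces the inner product of n1 and n2 to be 1 or
  -1.\<close>

lemma hyperplane_normal_unique:
 fixes n1 n2 :: "'a::euclidean_space"
 assumes n: "norm n1 = 1" "norm n2 = 1" and S: "aff_dim S = int DIM('a) - 1" "S \<noteq> {}"
  and s1: "S \<subseteq> {x. n1 \<bullet> x = b1}" and s2: "S \<subseteq> {x. n2 \<bullet> x = b2}"
 shows "n1 = n2 \<or> n1 = - n2"
proof -
 have nz: "n1 \<noteq> 0" "n2 \<noteq> 0" using n by auto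
 have h1: "affine hull S = {x. n1 \<bullet> x = b1}"
  using S s1 nz by (intro affine_dim_equal hull_minimal) (auto simp: aff_dim_hyperplane affine_hyperplane)
 have h2: "affine hull S = {x. n2 \<bullet> x = b2}"
  using S s2 nz by (intro affine_dim_equal hull_minimal) (auto simp: aff_dim_hyperplane affine_hyperplane)
 obtain p where "p \<in> S" using S by auto
 then have p: "n1 \<bullet> p = b1" "n2 \<bullet> p = b2" using s1 s2 by auto
 have q: "n1 \<bullet> n1 = 1" "n2 \<bullet> n2 = 1" using n by (auto simp: norm_eq_1)
 define c where "c = n1 \<bullet> n2"
 have "p + (n2 - c *\<^sub>R n1) \<in> {x. n1 \<bullet> x = b1}"
  using p q by (simp add: inner_add_right inner_diff_right c_def)
 then have "n2 \<bullet> (p + (n2 - c *\<^sub>R n1)) = b2" using h1 h2 by auto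
 then have "c * c = 1"
  using p q by (simp add: inner_add_right inner_diff_right c_def inner_commute)
 then consider "c = 1" | "c = -1" by (metis mult_cancel_right1 square_eq_1_iff)
 then show ?thesis
 proof cases
  case 1
  then have "(norm (n1 - n2))\<^sup>2 = 0"
   unfolding power2_norm_eq_inner using q c_def by (simp add: inner_diff_left inner_diff_right inner_commute)
  then show ?thesis by simp
 next
  case 2
  then have "(norm (n1 + n2))\<^sup>2 = 0"
   unfolding power2_norm_eq_inner using q c_def by (simp add: inner_add_left inner_add_right inner_commute)
  then show ?thesis by (simp add: add_eq_0_iff)
 qed
qed

text \<open>The constant of the supporting hyperplane through the facet, the same for every point of
  the facet. Since the chosen point depends on Y alone, the offsets of two cells sharing Y are
  opposite as soon as their normals are.\<close>

definition offset :: "(real^'n) set => (real^'n) set => real" where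
 "offset K Y = normal K Y \<bullet> (SOME a. a \<in> Y)"

locale full_polytope =
 fixes K :: "(real^'n) set"
 assumes polytope: "polytope K" and nonempty_interior: "interior K \<noteq> {}"
begin

lemma polyhedron: "polyhedron K"
 by (simp add: polytope polytope_imp_polyhedron)

lemma compact: "compact K"
 by (simp add: polytope polytope_imp_compact)

lemma closed: "closed K"
 by (simp add: compact compact_imp_closed)

lemma convex: "convex K"
 by (simp add: polytope polytope_imp_convex)

lemma finite_faces: "finite (faces K)"
 using finite_polytope_facets[OF polytope] by (simp add: faces_def)

lemma aff_dim_K: "aff_dim K = int CARD('n)"
 using aff_dim_nonempty_interior[OF nonempty_interior] by simp

lemma facesD:
 assumes "Y \<in> faces K"
 shows "Y facet_of K" "Y face_of K" "Y \<noteq> {}" "Y \<subseteq> K" "aff_dim Y = int CARD('n) - 1" "compact Y" "convex Y"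
proof -
 show f: "Y facet_of K" using assms by (simp add: faces_def)
 then show "Y face_of K" "Y \<noteq> {}" "aff_dim Y = int CARD('n) - 1"
  by (auto simp: facet_of_def aff_dim_K)
 then show "Y \<subseteq> K" "compact Y" "convex Y"
  by (simp_all add: face_of_imp_subset face_of_imp_compact[OF convex compact] face_of_imp_convex)
qed

lemma normal_exists:
 assumes "Y \<in> faces K"
 shows "\<exists>!n. norm n = 1 \<and> (\<exists>b. K \<subseteq> {x. n \<bullet> x \<le> b} \<and> Y = K \<inter> {x. n \<bullet> x = b})"
proof -
 obtain a b where ab: "a \<noteq> 0" "K \<subseteq> {x. a \<bullet> x \<le> b}" "Y = K \<inter> {x. a \<bullet> x = b}"
  using facet_of_polyhedron[OF polyhedron facesD(1)[OF assms]] by metis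
 define n where "n = a /\<^sub>R norm a"
 have 1: "norm n = 1" using ab by (simp add: n_def)
 have "a \<bullet> x \<le> b \<longleftrightarrow> n \<bullet> x \<le> b / norm a" "a \<bullet> x = b \<longleftrightarrow> n \<bullet> x = b / norm a" for x
  using ab by (auto simp: n_def divide_inverse mult.commute)
 then have 2: "K \<subseteq> {x. n \<bullet> x \<le> b / norm a}" "Y = K \<inter> {x. n \<bullet> x = b / norm a}"
  using ab by auto
 show ?thesis
 proof (rule ex1I[of _ n])
  show "norm n = 1 \<and> (\<exists>b. K \<subseteq> {x. n \<bullet> x \<le> b} \<and> Y = K \<inter> {x. n \<bullet> x = b})"
   using 1 2 by blast
  fix m assume "norm m = 1 \<and> (\<exists>b. K \<subseteq> {x. m \<bullet> x \<le> b} \<and> Y = K \<inter> {x. m \<bullet> x = b})"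
  then obtain b' where m: "norm m = 1" "K \<subseteq> {x. m \<bullet> x \<le> b'}" "Y = K \<inter> {x. m \<bullet> x = b'}" by blast
  have "m = n \<or> m = - n"
   by (rule hyperplane_normal_unique[OF m(1) 1, of Y b' "b / norm a"]) (use m 2 facesD[OF assms] in auto)
  \<comment> \<open>With the opposite normal the cell would be squeezed into a hyperplane and have
    empty interior.\<close>
  moreover have "m \<noteq> - n"
  proof
   assume mn: "m = - n"
   obtain p where "p \<in> Y" using facesD[OF assms] by auto
   then have "b' = - (b / norm a)" using m(3) 2(2) mn by auto
   then have "K \<subseteq> {x. n \<bullet> x = b / norm a}" using m(2) 2(1) mn by fastforce
   then have "interior K \<subseteq> interior {x. n \<bullet> x = b / norm a}" by (rule interior_mono)
   moreover have "interior {x. n \<bullet> x = b / norm a} = {}"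
    using 1 by (intro interior_hyperplane) auto
   ultimately show False using nonempty_interior by blast
  qed
  ultimately show "m = n" by blast
 qed
qed

lemma normal_offset:
 assumes "Y \<in> faces K"
 shows "norm (normal K Y) = 1" "!!x. x \<in> K ==> normal K Y \<bullet> x \<le> offset K Y"
  "!!x. x \<in> Y \<longleftrightarrow> x \<in> K \<and> normal K Y \<bullet> x = offset K Y"
proof -
 have *: "norm (normal K Y) = 1 \<and> (\<exists>b. K \<subseteq> {x. normal K Y \<bullet> x \<le> b} \<and> Y = K \<inter> {x. normal K Y \<bullet> x = b})"
  unfolding normal_def by (rule theI'[OF normal_exists[OF assms]])
 then obtain b where b: "K \<subseteq> {x. normal K Y \<bullet> x \<le> b}" "Y = K \<inter> {x. normal K Y \<bullet> x = b}" by blast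
 have "(SOME a. a \<in> Y) \<in> Y" using facesD(3)[OF assms] by (simp add: some_in_eq)
 then have "offset K Y = b" using b by (auto simp: offset_def)
 then show "norm (normal K Y) = 1" "!!x. x \<in> K ==> normal K Y \<bullet> x \<le> offset K Y"
  "!!x. x \<in> Y \<longleftrightarrow> x \<in> K \<and> normal K Y \<bullet> x = offset K Y" using * b by auto
qed

lemma interiorI_iff: "x \<in> interior K \<longleftrightarrow> x \<in> K \<and> (\<forall>Y\<in>faces K. x \<notin> Y)"
proof -
 have "rel_interior K = interior K" by (rule rel_interior_nonempty_interior[OF nonempty_interior])
 then have "K - interior K = \<Union> (faces K)"
  using rel_boundary_of_polyhedron[OF polyhedron] by (simp add: faces_def)
 then show ?thesis using interior_subset[of K] by auto
qed

lemma frontier_faces: "frontier K = \<Union> (faces K)"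
 using interiorI_iff facesD(4) closed by (auto simp: frontier_def)

text \<open>A segment from an interior point a to a point x outside K meets a facet before reaching
  x. The constraint of this facet is strict at a, so if it held at x it would be strict at the
  crossing point too.\<close>

lemma halfspaces_iff: "x \<in> K \<longleftrightarrow> (\<forall>Y\<in>faces K. normal K Y \<bullet> x \<le> offset K Y)"
proof
 assume "\<forall>Y\<in>faces K. normal K Y \<bullet> x \<le> offset K Y"
 show "x \<in> K"
 proof (rule ccontr)
  assume x: "x \<notin> K"
  obtain a where a: "a \<in> interior K" using nonempty_interior by auto
  then have aK: "a \<in> K" using interior_subset by auto
  have "closed_segment a x \<inter> frontier K \<noteq> {}"
   by (rule connected_Int_frontier) (use x aK in auto)
  then obtain y where y: "y \<in> closed_segment a x" "y \<in> frontier K" by auto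
  then obtain Y where Y: "Y \<in> faces K" "y \<in> Y" using frontier_faces by auto
  obtain s where s: "0 \<le> s" "s \<le> 1" "y = (1 - s) *\<^sub>R a + s *\<^sub>R x"
   using y by (auto simp: closed_segment_def)
  have n: "normal K Y \<bullet> y = offset K Y" using normal_offset Y by auto
  have "normal K Y \<bullet> a < offset K Y"
   using normal_offset[OF Y(1)] a interiorI_iff Y by (metis less_eq_real_def)
  moreover have "normal K Y \<bullet> x \<le> offset K Y" using \<open>\<forall>Y\<in>faces K. _ Y\<close> Y by auto
  moreover have "s < 1"
  proof (rule ccontr)
   assume "\<not> s < 1"
   then have "y = x" using s by simp
   then show False using y x closed frontier_subset_closed by blast
  qed
  ultimately have "(1 - s) * (normal K Y \<bullet> a) + s * (normal K Y \<bullet> x) < (1 - s) * offset K Y + s * offset K Y"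
   using s by (intro add_less_le_mono mult_strict_left_mono mult_left_mono) auto
  then show False using n s by (simp add: inner_add_right algebra_simps)
 qed
qed (use normal_offset in auto)

text \<open>The intersection is a face of K and a proper face of at least one of the two facets, and
  passing to a proper face lowers the dimension.\<close>

lemma aff_dim_facet_Int:
 assumes "Y \<in> faces K" "\<tau> \<in> faces K" "Y \<noteq> \<tau>"
 shows "aff_dim (Y \<inter> \<tau>) \<le> int CARD('n) - 2"
proof -
 have f: "(Y \<inter> \<tau>) face_of K" using facesD assms by (intro face_of_Int) auto
 have "Y \<inter> \<tau> \<noteq> Y \<or> Y \<inter> \<tau> \<noteq> \<tau>" using assms by auto
 then show ?thesis
 proof
  assume n: "Y \<inter> \<tau> \<noteq> Y"
  have "(Y \<inter> \<tau>) face_of Y" by (rule face_of_subset[OF f]) (use facesD assms in auto)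
  then show ?thesis using face_of_aff_dim_lt[of Y "Y \<inter> \<tau>"] n facesD[OF assms(1)] by auto
 next
  assume n: "Y \<inter> \<tau> \<noteq> \<tau>"
  have "(Y \<inter> \<tau>) face_of \<tau>" by (rule face_of_subset[OF f]) (use facesD assms in auto)
  then show ?thesis using face_of_aff_dim_lt[of \<tau> "Y \<inter> \<tau>"] n facesD[OF assms(2)] by auto
 qed
qed

text \<open>The constraints of all other facets are strict at y and stay strict in a small
  ball.\<close>

lemma local_halfspace:
 assumes "Y \<in> faces K" "y \<in> Y" "!!\<tau>. \<tau> \<in> faces K ==> \<tau> \<noteq> Y ==> y \<notin> \<tau>"
 obtains e where "e > 0" "!!x. x \<in> ball y e ==> x \<in> K \<longleftrightarrow> normal K Y \<bullet> x \<le> offset K Y"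
proof -
 have "open (\<Inter>\<tau>\<in>faces K - {Y}. {x. normal K \<tau> \<bullet> x < offset K \<tau>})"
  using finite_faces by (intro open_INT) (auto simp: open_halfspace_lt)
 moreover have "y \<in> (\<Inter>\<tau>\<in>faces K - {Y}. {x. normal K \<tau> \<bullet> x < offset K \<tau>})"
 proof -
  have yK: "y \<in> K" using assms facesD(4) by blast
  have "normal K \<tau> \<bullet> y < offset K \<tau>" if t: "\<tau> \<in> faces K" "\<tau> \<noteq> Y" for \<tau>
  proof -
   have "normal K \<tau> \<bullet> y \<noteq> offset K \<tau>"
    using normal_offset(3)[OF t(1), of y] assms(3)[OF t] yK by simp
   then show ?thesis using normal_offset(2)[OF t(1) yK] by simp
  qed
  then show ?thesis by simp
 qed
 ultimately obtain e where e: "e > 0" "ball y e \<subseteq> (\<Inter>\<tau>\<in>faces K - {Y}. {x. normal K \<tau> \<bullet> x < offset K \<tau>})"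
  by (rule openE)
 have "x \<in> K \<longleftrightarrow> normal K Y \<bullet> x \<le> offset K Y" if "x \<in> ball y e" for x
 proof -
  have "normal K \<tau> \<bullet> x < offset K \<tau>" if "\<tau> \<in> faces K" "\<tau> \<noteq> Y" for \<tau>
   using e(2) \<open>x \<in> ball y e\<close> that by auto
  then show ?thesis using halfspaces_iff[of x] assms(1) by (metis less_imp_le)
 qed
 then show thesis using e(1) that by blast
qed

text \<open>The normal used in the surface measure is chosen from the face alone and carries no
  orientation, so it matches the outward normal of a cell only up to sign.\<close>

lemma unit_normal_facet:
 assumes "Y \<in> faces K"
 shows "unit_normal Y = normal K Y \<or> unit_normal Y = - normal K Y"
  "norm (unit_normal Y) = 1" "!!x y. x \<in> Y ==> y \<in> Y ==> unit_normal Y \<bullet> x = unit_normal Y \<bullet> y"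
proof -
 have e: "norm (normal K Y) = 1 \<and> (\<forall>x\<in>Y. \<forall>y\<in>Y. normal K Y \<bullet> (x - y) = 0)"
  using normal_offset[OF assms] by (auto simp: inner_diff_right)
 have u: "norm (unit_normal Y) = 1 \<and> (\<forall>x\<in>Y. \<forall>y\<in>Y. unit_normal Y \<bullet> (x - y) = 0)"
  unfolding unit_normal_def
  using someI[of "%n. norm n = 1 \<and> (\<forall>x\<in>Y. \<forall>y\<in>Y. n \<bullet> (x - y) = 0)", OF e] .
 have u1: "unit_normal Y \<bullet> x = unit_normal Y \<bullet> y" if "x \<in> Y" "y \<in> Y" for x y
 proof -
  have "unit_normal Y \<bullet> (x - y) = 0" using u that by blast
  then show ?thesis by (simp add: inner_diff_right)
 qed
 obtain a where a: "a \<in> Y" using facesD(3)[OF assms] by auto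
 show "unit_normal Y = normal K Y \<or> unit_normal Y = - normal K Y"
 proof (rule hyperplane_normal_unique)
  show "Y \<subseteq> {x. unit_normal Y \<bullet> x = unit_normal Y \<bullet> a}"
   using u1 a by blast
  show "Y \<subseteq> {x. normal K Y \<bullet> x = offset K Y}"
   using normal_offset(3)[OF assms] by blast
  show "aff_dim Y = int DIM(real^'n) - 1" "Y \<noteq> {}"
   using facesD(3,5)[OF assms] by simp_all
 qed (rule conjunct1[OF u], rule normal_offset(1)[OF assms])
 show "norm (unit_normal Y) = 1" by (rule conjunct1[OF u])
 show "!!x y. x \<in> Y ==> y \<in> Y ==> unit_normal Y \<bullet> x = unit_normal Y \<bullet> y" by (rule u1)
qed

end

text \<open>Adding the single point p + w raises the dimension of the affine hull by at most one, so
  the lines through S in direction w lie in a proper affine subspace. It is applied to intersections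
  of two facets.\<close>

lemma negligible_cylinder:
 fixes S :: "(real^'n) set"
 assumes "aff_dim S \<le> int CARD('n) - 2"
 shows "negligible {x + s *\<^sub>R w | x s. x \<in> S}"
proof (cases "S = {}")
 case False
 then obtain p where p: "p \<in> S" by auto
 define A where "A = affine hull (insert (p + w) S)"
 have pA: "p \<in> A" "p + w \<in> A" "S \<subseteq> A" using p by (auto simp: A_def hull_inc)
 have "aff_dim A < int CARD('n)"
  using assms by (simp add: A_def aff_dim_insert)
 then have "interior A = {}"
  using aff_dim_nonempty_interior[of A] by fastforce
 moreover have "convex A" by (simp add: A_def affine_imp_convex)
 moreover have "closed A" by (simp add: A_def closed_affine_hull)
 ultimately have "negligible A"
  using negligible_convex_frontier[of A] by (simp add: frontier_def)
 moreover have "{x + s *\<^sub>R w | x s. x \<in> S} \<subseteq> A"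
 proof clarify
  fix x s assume "x \<in> S"
  then have "x + s *\<^sub>R ((p + w) - p) \<in> A"
   using pA by (intro mem_affine_3_minus) (auto simp: A_def)
  then show "x + s *\<^sub>R w \<in> A" by simp
 qed
 ultimately show ?thesis using negligible_subset by blast
qed simp

section \<open>Change of variables by rank one perturbations of the identity\<close>

text \<open>An orthogonal map carrying u to a multiple of a basis vector turns the perturbed
  identity into a map that differs from the identity in column k only, and
  \<open>cramer_lemma\<close> reads off the determinant of such a matrix.\<close>

lemma det_rank_one:
 fixes u w :: "real^'m::{finite,wellorder}"
 shows "det (matrix (%x. x + (u \<bullet> x) *\<^sub>R w)) = 1 + u \<bullet> w"
proof (cases "u = 0")
 case True
 then show ?thesis by (simp add: matrix_id_mat_1[unfolded id_def])
next
 case False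
 then obtain k where "u $ k \<noteq> 0" by (auto simp: vec_eq_iff)
 obtain Q where Q: "orthogonal_transformation Q" "Q u = norm u *\<^sub>R axis k (1::real)"
  by (rule orthogonal_transformation_exists[of u "norm u *\<^sub>R axis k 1"]) auto
 define f where "f = (%x. x + (u \<bullet> x) *\<^sub>R w)"
 define z where "z = axis k 1 + norm u *\<^sub>R Q w"
 have lQ: "linear Q" and lf: "linear f"
  using Q by (auto simp: orthogonal_transformation_def f_def intro!: linearI simp: inner_add_right algebra_simps)
 define A where "A = (\<chi> i j. if j = k then z $ i else mat 1 $ i $ j)"
 have dA: "det A = z $ k"
  using cramer_lemma[of k "mat 1" z] by (simp add: A_def cong: if_cong)
 have "A *v (Q x) = Q (f x)" for x
 proof -
  have "Q (f x) = Q x + (u \<bullet> x) *\<^sub>R Q w"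
   using lQ by (simp add: f_def linear_add linear_scale)
  moreover have "u \<bullet> x = Q u \<bullet> Q x"
   using Q(1) by (simp add: orthogonal_transformation_def)
  moreover have "Q u \<bullet> Q x = norm u * Q x $ k" by (simp add: Q(2) inner_axis' )
  moreover have "A *v y = y + (norm u * y $ k) *\<^sub>R Q w" for y
  proof -
   have "(A *v y) $ i = y $ i + (norm u * y $ k) * Q w $ i" for i
   proof -
    have "(A *v y) $ i = (\<Sum>j\<in>UNIV. (if j = k then z $ i else mat 1 $ i $ j) * y $ j)"
     by (simp add: A_def matrix_vector_mult_def)
    also have "... = (\<Sum>j\<in>UNIV. (if i = j then y $ j else 0) + (if j = k then norm u * Q w $ i * y $ j else 0))"
     by (intro sum.cong) (auto simp: z_def mat_def axis_def algebra_simps)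
    finally show ?thesis by (simp add: sum.distrib algebra_simps)
   qed
   then show ?thesis by (simp add: vec_eq_iff)
  qed
  ultimately show ?thesis by simp
 qed
 then have "(%x. A *v x) \<circ> Q = Q \<circ> f" by auto
 then have "matrix ((%x. A *v x) \<circ> Q) = matrix (Q \<circ> f)" by simp
 then have "A ** matrix Q = matrix Q ** matrix f"
  using lQ lf by (simp add: matrix_compose matrix_vector_mul_linear)
 then have "det A * det (matrix Q) = det (matrix Q) * det (matrix f)"
  by (metis det_mul)
 moreover have "det (matrix Q) \<noteq> 0"
 proof -
  have "\<bar>det (matrix Q)\<bar> = 1" using Q(1) by simp
  then show ?thesis by linarith
 qed
 ultimately have "det (matrix f) = z $ k" using dA by simp
 also have "... = 1 + norm u *\<^sub>R axis k 1 \<bullet> Q w" by (simp add: z_def inner_axis')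
 also have "norm u *\<^sub>R axis k 1 \<bullet> Q w = u \<bullet> w"
  using Q by (simp add: orthogonal_transformation_def flip: Q(2))
 finally show ?thesis by (simp add: f_def)
qed

text \<open>Volumes and determinants are related over a well-ordered index type; renaming
  coordinates along a bijection transports the result to the index type of the mesh.\<close>

lemma lborel_relabel:
 fixes p :: "'m::finite => 'n::finite"
 assumes "bij p"
 shows "distr lborel borel (%x::real^'n. \<chi> i. x $ p i) = (lborel :: (real^'m) measure)"
proof (rule lborel_eqI[symmetric])
 let ?R = "%x::real^'n. (\<chi> i. x $ p i) :: real^'m"
 define q where "q = inv p"
 have pq: "p (q j) = j" "q (p i) = i" for i j
  using assms by (auto simp: q_def bij_is_surj surj_f_inv_f bij_is_inj inv_f_f)
 fix l r :: "real^'m" assume lr: "!!b. b \<in> Basis ==> l \<bullet> b \<le> r \<bullet> b"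
 then have lr': "l $ i \<le> r $ i" for i
  using lr[of "axis i 1"] by (simp add: inner_axis)
 define l' where "l' = (\<chi> j. l $ q j)"
 define r' where "r' = (\<chi> j. r $ q j)"
 have m: "?R \<in> borel_measurable borel"
  by (intro borel_measurable_continuous_onI continuous_intros)
 have "?R -` box l r = box l' r'"
  by (auto simp: mem_box_cart l'_def r'_def) (metis pq)+
 then have "emeasure (distr lborel borel ?R) (box l r) = emeasure lborel (box l' r')"
  using m by (simp add: emeasure_distr)
 also have "... = ennreal (\<Prod>b\<in>Basis. (r' - l') \<bullet> b)"
  by (rule emeasure_lborel_box) (auto simp: Basis_vec_def l'_def r'_def inner_axis lr')
 also have "(\<Prod>b\<in>Basis. (r' - l') \<bullet> b) = (\<Prod>j\<in>UNIV. (r - l) $ q j)"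
  by (simp add: Basis_vec_def inner_axis axis_eq_axis prod.UNION_disjoint l'_def r'_def)
 also have "... = (\<Prod>i\<in>UNIV. (r - l) $ i)"
  by (rule prod.reindex_bij_betw[of q UNIV UNIV "%i. (r - l) $ i"]) (use assms in \<open>simp add: q_def bij_imp_bij_inv\<close>)
 also have "... = (\<Prod>b\<in>Basis. (r - l) \<bullet> b)"
  by (simp add: Basis_vec_def inner_axis axis_eq_axis prod.UNION_disjoint)
 finally show "emeasure (distr lborel borel ?R) (box l r) = ennreal (\<Prod>b\<in>Basis. (r - l) \<bullet> b)" .
qed simp

lemma lborel_rank_one_wellorder:
 fixes u w c :: "real^'m::{finite,wellorder}"
 assumes "1 + u \<bullet> w \<noteq> 0"
 shows "lborel = density (distr lborel borel (%x. x + (u \<bullet> x) *\<^sub>R w + c)) (%_. ennreal \<bar>1 + u \<bullet> w\<bar>)"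
proof (rule lborel_eqI)
 define L where "L = (%x. x + (u \<bullet> x) *\<^sub>R w)"
 have lL: "linear L" by (auto simp: L_def intro!: linearI simp: inner_add_right algebra_simps)
 define d where "d = \<bar>1 + u \<bullet> w\<bar>"
 have d0: "d > 0" using assms by (simp add: d_def)
 have "det (matrix L) \<noteq> 0" using det_rank_one[of u w] assms by (simp add: L_def)
 then have inj: "inj L" using lL by (simp add: det_nz_iff_inj)
 then have surj: "surj L" using lL linear_injective_imp_surjective by blast
 have m: "L \<in> borel_measurable borel" "(%x. L x + c) \<in> borel_measurable borel"
  using linear_continuous_on[of L UNIV] lL
  by (auto intro!: borel_measurable_continuous_onI continuous_on_add simp: linear_conv_bounded_linear)
 fix l r :: "real^'m::{finite,wellorder}" assume lr: "!!b. b \<in> Basis ==> l \<bullet> b \<le> r \<bullet> b"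
 define S where "S = (%x. L x + c) -` box l r"
 have Sb: "S \<in> sets borel" using measurable_sets[OF m(2), of "box l r"] by (simp add: S_def)
 have LS: "L ` S = (%y. - c + y) ` box l r"
 proof (rule set_eqI)
  fix y
  obtain x where x: "y = L x" using surj by (metis surjD)
  have "L x \<in> L ` S \<longleftrightarrow> x \<in> S" using inj by (simp add: inj_image_mem_iff)
  also have "... \<longleftrightarrow> y + c \<in> box l r" by (simp add: S_def x)
  also have "... \<longleftrightarrow> y \<in> (%y. - c + y) ` box l r" by (force simp: image_iff)
  finally show "y \<in> L ` S \<longleftrightarrow> y \<in> (%y. - c + y) ` box l r" by (simp add: x)
 qed
 \<comment> \<open>Boundedness, which comes from the invertibility of L, gives S finite measure, so
   the volume formula for linear images applies.\<close>
 have bS: "bounded S"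
 proof -
  obtain g where g: "linear g" "g \<circ> L = id" using linear_injective_left_inverse[OF lL inj] by blast
  have "S = g ` (L ` S)" using g(2) by (simp add: image_comp)
  moreover have "bounded (L ` S)" unfolding LS by (intro bounded_translation bounded_box)
  ultimately show ?thesis using bounded_linear_image[of "L ` S" g] g(1) by (simp add: linear_conv_bounded_linear)
 qed
 have Sl: "S \<in> lmeasurable" by (rule bounded_set_imp_lmeasurable[OF bS]) (use Sb in simp)
 have "measure lebesgue (box l r) = measure lebesgue (L ` S)"
  by (simp only: LS measure_translation)
 also have "... = d * measure lebesgue S"
  using measure_linear_image[OF lL Sl] det_rank_one[of u w] by (simp add: d_def L_def)
 finally have eq: "measure lebesgue (box l r) = d * measure lebesgue S" .
 have "emeasure (density (distr lborel borel (%x. L x + c)) (%_. ennreal d)) (box l r) = ennreal d * emeasure lborel S"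
  using m by (simp add: emeasure_density_const emeasure_distr S_def)
 also have "emeasure lborel S = ennreal (measure lebesgue S)"
 proof -
  have "emeasure lborel S = emeasure lebesgue S" using Sb by simp
  then show ?thesis using Sl by (simp add: emeasure_eq_measure2)
 qed
 also have "ennreal d * ennreal (measure lebesgue S) = ennreal (measure lebesgue (box l r))"
  using d0 by (simp add: eq ennreal_mult)
 also have "... = ennreal (measure lborel (box l r))" by (simp add: measure_completion)
 also have "... = ennreal (\<Prod>b\<in>Basis. (r - l) \<bullet> b)"
  using lr by (simp add: measure_def prod_nonneg inner_diff_left)
 finally show "emeasure (density (distr lborel borel (%x. x + (u \<bullet> x) *\<^sub>R w + c)) (%_. ennreal \<bar>1 + u \<bullet> w\<bar>)) (box l r)
  = ennreal (\<Prod>b\<in>Basis. (r - l) \<bullet> b)" by (simp add: L_def d_def)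
qed simp

lemma lborel_rank_one_bij:
 fixes u w c :: "real^'n::finite" and p :: "'m::{finite,wellorder} => 'n"
 assumes "bij p" "1 + u \<bullet> w \<noteq> 0"
 shows "lborel = density (distr lborel borel (%x. x + (u \<bullet> x) *\<^sub>R w + c)) (%_. ennreal \<bar>1 + u \<bullet> w\<bar>)"
proof -
 define q where "q = inv p"
 have q: "bij q" using assms(1) by (simp add: q_def bij_imp_bij_inv)
 have pq: "p (q j) = j" "q (p i) = i" for i j
  using assms by (auto simp: q_def bij_is_surj surj_f_inv_f bij_is_inj inv_f_f)
 define R where "R = (%x::real^'n. (\<chi> i. x $ p i))"
 define S where "S = (%x. (\<chi> j. x $ q j) :: real^'n)"
 have inner: "R x \<bullet> y = x \<bullet> S y" for x y
 proof -
  have "R x \<bullet> y = (\<Sum>i\<in>UNIV. x $ p i * y $ q (p i))" by (simp add: inner_vec_def R_def pq)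
  also have "... = (\<Sum>j\<in>UNIV. x $ j * y $ q j)"
   using assms(1) by (rule sum.reindex_bij_betw)
  finally show ?thesis by (simp add: inner_vec_def S_def)
 qed
 have SR: "S (R x) = x" for x by (simp add: S_def R_def pq vec_eq_iff)
 have mS: "S \<in> borel_measurable borel"
  unfolding S_def by (intro borel_measurable_continuous_onI continuous_intros)
 define T where "T = (%x. x + (u \<bullet> x) *\<^sub>R w + c)"
 define T' where "T' = (%x. x + (R u \<bullet> x) *\<^sub>R R w + R c)"
 have mT: "T \<in> borel_measurable borel" "T' \<in> borel_measurable borel"
  unfolding T_def T'_def by (intro borel_measurable_continuous_onI continuous_intros)+
 define d where "d = \<bar>1 + u \<bullet> w\<bar>"
 have d: "d = \<bar>1 + R u \<bullet> R w\<bar>" by (simp add: d_def inner SR)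
 have ST: "S \<circ> T' = T \<circ> S"
  by (rule ext, simp add: T_def T'_def inner vec_eq_iff) (simp add: S_def R_def pq)
 have lS: "distr lborel borel S = lborel"
  unfolding S_def by (rule lborel_relabel[OF q])
 have lT': "lborel = density (distr lborel borel T') (%_. ennreal d)"
  unfolding T'_def d by (rule lborel_rank_one_wellorder) (use assms(2) in \<open>simp add: inner SR\<close>)
 have "lborel = distr (density (distr lborel borel T') (%_. ennreal d)) borel S"
  using lS lT' by simp
 also have "... = density (distr (distr lborel borel T') borel S) (%_. ennreal d)"
  using mS by (subst density_distr) auto
 also have "distr (distr lborel borel T') borel S = distr lborel borel (S \<circ> T')"
  using mS mT by (subst distr_distr) auto
 also have "... = distr (distr lborel borel S) borel T"
  using mS mT by (subst distr_distr) (auto simp: ST)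
 finally show ?thesis by (simp add: lS T_def d_def)
qed

text \<open>In the dimensions considered, the numeral types \<open>2\<close> and \<open>3\<close>
  serve as well-ordered index types.\<close>

lemma lborel_rank_one:
 fixes u w c :: "real^'n"
 assumes "CARD('n) = 2 \<or> CARD('n) = 3" "1 + u \<bullet> w \<noteq> 0"
 shows "lborel = density (distr lborel borel (%x. x + (u \<bullet> x) *\<^sub>R w + c)) (%_. ennreal \<bar>1 + u \<bullet> w\<bar>)"
 using assms(1)
proof
 assume "CARD('n) = 2"
 then obtain p :: "2 => 'n" where "bij p"
  using finite_same_card_bij[of "UNIV :: 2 set" "UNIV :: 'n set"] by auto
 then show ?thesis using assms(2) by (rule lborel_rank_one_bij)
next
 assume "CARD('n) = 3"
 then obtain p :: "3 => 'n" where "bij p"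
  using finite_same_card_bij[of "UNIV :: 3 set" "UNIV :: 'n set"] by auto
 then show ?thesis using assms(2) by (rule lborel_rank_one_bij)
qed

lemma integral_rank_one:
 fixes u w c :: "real^'n" and f :: "real^'n => 'b::euclidean_space"
 assumes "CARD('n) = 2 \<or> CARD('n) = 3" "1 + u \<bullet> w \<noteq> 0" "f \<in> borel_measurable borel"
 shows "(LINT x|lborel. f x) = \<bar>1 + u \<bullet> w\<bar> *\<^sub>R (LINT x|lborel. f (x + (u \<bullet> x) *\<^sub>R w + c))"
proof -
 have m: "(%x. x + (u \<bullet> x) *\<^sub>R w + c) \<in> borel_measurable borel"
  by (intro borel_measurable_continuous_onI continuous_intros)
 have "(LINT x|lborel. f x) = (LINT x|density (distr lborel borel (%x. x + (u \<bullet> x) *\<^sub>R w + c)) (%_. ennreal \<bar>1 + u \<bullet> w\<bar>). f x)"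
  using lborel_rank_one[OF assms(1,2)] by simp
 also have "... = (LINT x|distr lborel borel (%x. x + (u \<bullet> x) *\<^sub>R w + c). \<bar>1 + u \<bullet> w\<bar> *\<^sub>R f x)"
  using assms(3) by (subst integral_density) auto
 also have "... = (LINT x|lborel. \<bar>1 + u \<bullet> w\<bar> *\<^sub>R f (x + (u \<bullet> x) *\<^sub>R w + c))"
  using assms(3) m by (subst integral_distr) auto
 finally show ?thesis by simp
qed

section \<open>The divergence theorem on a polytope\<close>

lemma compact_cylinder:
 fixes S :: "'a::real_normed_vector set"
 assumes "compact S" shows "compact {x + s *\<^sub>R w | x s. x \<in> S \<and> 0 \<le> s \<and> s \<le> (t::real)}"
proof -
 have "compact ((%(x, s). x + s *\<^sub>R w) ` (S \<times> {0..t}))"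
  using assms by (intro compact_continuous_image compact_Times)
   (auto simp: case_prod_unfold intro!: continuous_intros)
 also have "(%(x, s). x + s *\<^sub>R w) ` (S \<times> {0..t}) = {x + s *\<^sub>R w | x s. x \<in> S \<and> 0 \<le> s \<and> s \<le> t}"
  by force
 finally show ?thesis .
qed

context full_polytope
begin

section \<open>Prisms over facets and their slanted images\<close>

lemma compact_prism: "Y \<in> faces K ==> compact (prism Y)"
 unfolding prism_def using compact_cylinder facesD(6) by blast

lemma prism_sets: "Y \<in> faces K ==> prism Y \<in> sets borel"
 by (intro borel_closed compact_imp_closed compact_prism)

text \<open>Signed distance to the hyperplane of the face. Subtracting \<open>height Y y\<close>
  times the unit normal is the orthogonal projection that occurs in
  \<open>face_integral\<close>.\<close>

definition height :: "(real^'n) set => real^'n => real" where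
 "height Y y = unit_normal Y \<bullet> (y - (SOME a. a \<in> Y))"

lemma height_prism:
 assumes "Y \<in> faces K" "x \<in> Y"
 shows "height Y (x + s *\<^sub>R unit_normal Y) = s"
proof -
 have "(SOME a. a \<in> Y) \<in> Y" using assms by (simp add: some_in_eq) blast
 then have "unit_normal Y \<bullet> x = unit_normal Y \<bullet> (SOME a. a \<in> Y)"
  using unit_normal_facet(3)[OF assms(1)] assms(2) by blast
 moreover have "unit_normal Y \<bullet> unit_normal Y = 1"
  using unit_normal_facet(2)[OF assms(1)] by (simp add: norm_eq_1)
 ultimately show ?thesis by (simp add: height_def inner_add_right inner_diff_right)
qed

lemma face_integral_lborel:
 fixes f :: "real^'n => 'b::euclidean_space"
 assumes "Y \<in> faces K" "f \<in> borel_measurable borel"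
 shows "face_integral Y f = (LINT y|lborel. indicator (prism Y) y *\<^sub>R f (y - height Y y *\<^sub>R unit_normal Y))"
proof -
 have m: "(%y. y - height Y y *\<^sub>R unit_normal Y) \<in> borel_measurable borel"
  unfolding height_def by (intro borel_measurable_continuous_onI continuous_intros)
 have b: "(%y. indicator (prism Y) y *\<^sub>R f (y - height Y y *\<^sub>R unit_normal Y)) \<in> borel_measurable borel"
  using measurable_compose[OF m assms(2)] prism_sets[OF assms(1)]
  by (intro borel_measurable_scaleR borel_measurable_indicator) auto
 have "face_integral Y f = (LINT y|lebesgue_on (prism Y). indicator (prism Y) y *\<^sub>R f (y - height Y y *\<^sub>R unit_normal Y))"
  unfolding face_integral_def height_def[symmetric]
  by (intro Bochner_Integration.integral_cong) (auto simp: space_restrict_space)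
 also have "... = (LINT y|lborel. indicator (prism Y) y *\<^sub>R f (y - height Y y *\<^sub>R unit_normal Y))"
  by (rule integral_lebesgue_on_support[OF _ b]) (use prism_sets[OF assms(1)] in auto)
 finally show ?thesis .
qed

text \<open>The affine map sending the prism over \<open>Y\<close> to the slanted one \<open>{x + s w | x \<in> Y, 0 \<le> s \<le> t}\<close>.\<close>

definition slant :: "(real^'n) set => real^'n => real => real^'n => real^'n" where
 "slant Y w t y = y - height Y y *\<^sub>R unit_normal Y + (t * height Y y) *\<^sub>R w"

definition slanted_prism :: "(real^'n) set => real^'n => real => (real^'n) set" where
 "slanted_prism Y w t = {x + s *\<^sub>R w | x s. x \<in> Y \<and> 0 \<le> s \<and> s \<le> t}"

lemma slant_prism:
 assumes "Y \<in> faces K" "x \<in> Y"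
 shows "slant Y w t (x + s *\<^sub>R unit_normal Y) = x + (t * s) *\<^sub>R w"
 using height_prism[OF assms, of s] by (simp add: slant_def)

lemma unit_normal_inner_pos:
 assumes "Y \<in> faces K" "w \<bullet> normal K Y > 0"
 shows "\<bar>unit_normal Y \<bullet> w\<bar> = w \<bullet> normal K Y"
 using unit_normal_facet(1)[OF assms(1)] assms(2) by (auto simp: inner_commute)

text \<open>The direction w crosses the hyperplane of Y, which makes slanting injective. A point
  mapped into the slanted prism therefore coincides with the point y' of the prism read off from the
  representation x + s w of its image.\<close>

lemma slant_in_slanted_prism:
 assumes Y: "Y \<in> faces K" and w: "w \<bullet> normal K Y > 0" and t: "t > 0"
 shows "slant Y w t y \<in> slanted_prism Y w t \<longleftrightarrow> y \<in> prism Y"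
proof
 assume "y \<in> prism Y"
 then obtain x s where xs: "y = x + s *\<^sub>R unit_normal Y" "x \<in> Y" "0 \<le> s" "s \<le> 1" by (auto simp: prism_def)
 then have "slant Y w t y = x + (t * s) *\<^sub>R w" "0 \<le> t * s" "t * s \<le> t"
  using slant_prism[OF Y] t by (auto simp: mult_left_le)
 then show "slant Y w t y \<in> slanted_prism Y w t" using xs unfolding slanted_prism_def by blast
next
 assume "slant Y w t y \<in> slanted_prism Y w t"
 then obtain x s where xs: "slant Y w t y = x + s *\<^sub>R w" "x \<in> Y" "0 \<le> s" "s \<le> t"
  by (auto simp: slanted_prism_def)
 define y' where "y' = x + (s / t) *\<^sub>R unit_normal Y"
 have eq: "slant Y w t y' = slant Y w t y"
  using slant_prism[OF Y xs(2), of w t "s / t"] t xs(1) by (simp add: y'_def)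
 have u1: "unit_normal Y \<bullet> unit_normal Y = 1"
  using unit_normal_facet(2)[OF Y] by (simp add: norm_eq_1)
 have hd: "height Y y - height Y y' = unit_normal Y \<bullet> (y - y')"
  by (simp add: height_def inner_diff_right)
 have "slant Y w t y - slant Y w t y' = (y - y') - (height Y y - height Y y') *\<^sub>R unit_normal Y + (t * (height Y y - height Y y')) *\<^sub>R w"
  by (simp add: slant_def algebra_simps)
 then have z: "(y - y') - (height Y y - height Y y') *\<^sub>R unit_normal Y + (t * (height Y y - height Y y')) *\<^sub>R w = 0"
  using eq by simp
 \<comment> \<open>Pairing with the unit normal cancels the first two terms and leaves t times the
   height difference times the normal component of w.\<close>
 then have "unit_normal Y \<bullet> ((y - y') - (height Y y - height Y y') *\<^sub>R unit_normal Y + (t * (height Y y - height Y y')) *\<^sub>R w) = 0"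
  by simp
 then have "t * (height Y y - height Y y') * (unit_normal Y \<bullet> w) = 0"
  using hd u1 by (simp add: inner_add_right inner_diff_right)
 moreover have "unit_normal Y \<bullet> w \<noteq> 0" using unit_normal_inner_pos[OF Y w] w by auto
 ultimately have "height Y y - height Y y' = 0" using t by simp
 then have "y = y'" using z by simp
 moreover have "y' \<in> prism Y"
  unfolding y'_def prism_def using xs t by (intro CollectI exI[of _ x] exI[of _ "s / t"]) auto
 ultimately show "y \<in> prism Y" by simp
qed

lemma slanted_prism_sets: "Y \<in> faces K ==> slanted_prism Y w t \<in> sets borel"
 unfolding slanted_prism_def
 by (intro borel_closed compact_imp_closed compact_cylinder facesD)

text \<open>Slanting is a translation composed with the rank one perturbation of the identity given
  by u and t w - u. Since u is a unit vector, the determinant is t times the inner product of u and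
  w.\<close>

lemma integral_slanted_prism:
 fixes f :: "real^'n => 'b::euclidean_space"
 assumes card: "CARD('n) = 2 \<or> CARD('n) = 3"
  and Y: "Y \<in> faces K" and w: "w \<bullet> normal K Y > 0" and t: "t > 0" and f: "f \<in> borel_measurable borel"
 shows "(LINT x|lborel. indicator (slanted_prism Y w t) x *\<^sub>R f x)
  = (t * (w \<bullet> normal K Y)) *\<^sub>R (LINT y|lborel. indicator (prism Y) y *\<^sub>R f (slant Y w t y))"
proof -
 define u where "u = unit_normal Y"
 define a where "a = (SOME a. a \<in> Y)"
 have u1: "u \<bullet> u = 1" using unit_normal_facet(2)[OF Y] by (simp add: norm_eq_1 u_def)
 have d: "1 + u \<bullet> (t *\<^sub>R w - u) = t * (u \<bullet> w)" by (simp add: inner_diff_right u1)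
 have n0: "\<bar>u \<bullet> w\<bar> = w \<bullet> normal K Y" using unit_normal_inner_pos[OF Y w] by (simp add: u_def)
 have s: "slant Y w t y = y + (u \<bullet> y) *\<^sub>R (t *\<^sub>R w - u) + (- (u \<bullet> a)) *\<^sub>R (t *\<^sub>R w - u)" for y
  by (simp add: slant_def height_def u_def a_def inner_diff_right algebra_simps)
 have i: "indicator (slanted_prism Y w t) (slant Y w t y) = (indicator (prism Y) y :: real)" for y
  using slant_in_slanted_prism[OF Y w t] by (simp add: indicator_def)
 have m: "(%x. indicator (slanted_prism Y w t) x *\<^sub>R f x) \<in> borel_measurable borel"
  using f slanted_prism_sets[OF Y] by (intro borel_measurable_scaleR borel_measurable_indicator)
 have "(LINT x|lborel. indicator (slanted_prism Y w t) x *\<^sub>R f x)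
  = \<bar>1 + u \<bullet> (t *\<^sub>R w - u)\<bar> *\<^sub>R (LINT y|lborel. indicator (slanted_prism Y w t) (slant Y w t y) *\<^sub>R f (slant Y w t y))"
  unfolding s by (rule integral_rank_one[OF card _ m]) (use d n0 w t in auto)
 also have "\<bar>1 + u \<bullet> (t *\<^sub>R w - u)\<bar> = t * (w \<bullet> normal K Y)"
  using t n0 by (simp add: d abs_mult)
 finally show ?thesis by (simp only: i)
qed

text \<open>The part of the translate K + t w that lies outside K: to first order in t, a layer over
  the facets facing w whose thickness is t times the normal component of w. It carries the boundary
  terms of the divergence theorem.\<close>

definition swept :: "real^'n => real => (real^'n) set" where
 "swept w t = {x. x - t *\<^sub>R w \<in> K \<and> x \<notin> K}"

lemma swept_sets: "swept w t \<in> sets borel"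
proof -
 have "(%x. x - t *\<^sub>R w) -` K \<in> sets borel"
  by (rule borel_closed, rule continuous_closed_vimage[OF closed]) (intro continuous_intros)
 moreover have "K \<in> sets borel" using closed by (rule borel_closed)
 moreover have "swept w t = (%x. x - t *\<^sub>R w) -` K - K" by (auto simp: swept_def)
 ultimately show ?thesis by simp
qed

text \<open>The segment from x - t w to x leaves the cell at the least crossing time s among the
  facets whose constraint is violated at x. The exit point satisfies all constraints, lies on that
  facet, and x is above it in direction w.\<close>

lemma swept_cover:
 assumes "x \<in> swept w t" "t > 0"
 obtains Y where "Y \<in> faces K" "w \<bullet> normal K Y > 0" "x \<in> slanted_prism Y w t"
proof -
 define z where "z = x - t *\<^sub>R w"
 have z: "z \<in> K" "x \<notin> K" using assms by (auto simp: swept_def z_def)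
 define V where "V = {Y\<in>faces K. normal K Y \<bullet> x > offset K Y}"
 have V: "finite V" "V \<noteq> {}" using finite_faces halfspaces_iff[of x] z by (auto simp: V_def not_le)
 define s where "s Y = (offset K Y - normal K Y \<bullet> z) / (normal K Y \<bullet> w)" for Y
 have x: "x = z + t *\<^sub>R w" by (simp add: z_def)
 have Vp: "normal K Y \<bullet> w > 0" "0 \<le> s Y" "s Y \<le> t" if "Y \<in> V" for Y
 proof -
  have 1: "normal K Y \<bullet> z \<le> offset K Y" using that normal_offset(2) z by (auto simp: V_def)
  have 2: "offset K Y < normal K Y \<bullet> z + t * (normal K Y \<bullet> w)"
   using that by (simp add: V_def x inner_add_right)
  then have "t * (normal K Y \<bullet> w) > 0" using 1 by linarith
  then show p: "normal K Y \<bullet> w > 0" using assms(2) by (simp add: zero_less_mult_iff)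
  show "0 \<le> s Y" using 1 p by (simp add: s_def)
  show "s Y \<le> t" using 2 p by (simp add: s_def pos_divide_le_eq)
 qed
 obtain Y where Y: "Y \<in> V" "!!\<tau>. \<tau> \<in> V ==> s Y \<le> s \<tau>"
  using arg_min_if_finite[OF V, of s] by (metis not_le)
 define y where "y = z + s Y *\<^sub>R w"
 have "normal K \<tau> \<bullet> y \<le> offset K \<tau>" if \<tau>: "\<tau> \<in> faces K" for \<tau>
 proof (cases "\<tau> \<in> V")
  case True
  have "s Y * (normal K \<tau> \<bullet> w) \<le> s \<tau> * (normal K \<tau> \<bullet> w)"
   using Y(2)[OF True] Vp(1)[OF True] by (simp add: mult_right_mono)
  also have "... = offset K \<tau> - normal K \<tau> \<bullet> z" using Vp(1)[OF True] by (simp add: s_def)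
  finally show ?thesis by (simp add: y_def inner_add_right)
 next
  case False
  then have a: "normal K \<tau> \<bullet> z + t * (normal K \<tau> \<bullet> w) \<le> offset K \<tau>"
   using \<tau> by (simp add: V_def x inner_add_right)
  have b: "normal K \<tau> \<bullet> z \<le> offset K \<tau>" using normal_offset(2)[OF \<tau>] z by simp
  have "s Y * (normal K \<tau> \<bullet> w) \<le> max 0 (t * (normal K \<tau> \<bullet> w))"
  proof (cases "normal K \<tau> \<bullet> w \<ge> 0")
   case True
   then have "s Y * (normal K \<tau> \<bullet> w) \<le> t * (normal K \<tau> \<bullet> w)"
    using Vp(3)[OF Y(1)] by (simp add: mult_right_mono)
   then show ?thesis by simp
  next
   case False
   then have "s Y * (normal K \<tau> \<bullet> w) \<le> 0"
    using Vp(2)[OF Y(1)] by (simp add: mult_nonneg_nonpos)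
   then show ?thesis by simp
  qed
  then show ?thesis using a b by (simp add: y_def inner_add_right)
 qed
 then have "y \<in> K" using halfspaces_iff by blast
 moreover have "normal K Y \<bullet> y = offset K Y"
  using Vp(1)[OF Y(1)] by (simp add: y_def s_def inner_add_right)
 moreover have sf: "Y \<in> faces K" using Y by (simp add: V_def)
 ultimately have "y \<in> Y" using normal_offset(3) by blast
 moreover have "x = y + (t - s Y) *\<^sub>R w" by (simp add: y_def x algebra_simps)
 ultimately have "x \<in> slanted_prism Y w t"
  unfolding slanted_prism_def using Vp(2,3)[OF Y(1)] by (intro CollectI exI[of _ y] exI[of _ "t - s Y"]) auto
 then show thesis using that sf Vp(1)[OF Y(1)] by (simp add: inner_commute)
qed

text \<open>Two base points below the same z differ by a multiple of w. Both facets face w, so their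
  supporting inequalities bound this multiple from both sides by zero; the overlap thus lies over
  the intersection of the facets.\<close>

lemma slanted_prism_Int:
 assumes "Y \<in> faces K" "\<tau> \<in> faces K" "Y \<noteq> \<tau>" "w \<bullet> normal K Y > 0" "w \<bullet> normal K \<tau> > 0"
 shows "negligible (slanted_prism Y w t \<inter> slanted_prism \<tau> w t)"
proof (rule negligible_subset[OF negligible_cylinder[OF aff_dim_facet_Int[OF assms(1-3)]]])
 show "slanted_prism Y w t \<inter> slanted_prism \<tau> w t \<subseteq> {x + s *\<^sub>R w | x s. x \<in> Y \<inter> \<tau>}"
 proof
  fix z assume "z \<in> slanted_prism Y w t \<inter> slanted_prism \<tau> w t"
  then have z: "z \<in> slanted_prism Y w t" "z \<in> slanted_prism \<tau> w t" by auto
  obtain x s where x: "z = x + s *\<^sub>R w" "x \<in> Y"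
   using z(1) unfolding slanted_prism_def by blast
  obtain y r where "z = y + r *\<^sub>R w" "y \<in> \<tau>"
   using z(2) unfolding slanted_prism_def by blast
  note * = x this
  have K: "x \<in> K" "y \<in> K" using * facesD(4) assms by auto
  have "normal K Y \<bullet> y \<le> normal K Y \<bullet> x" "normal K \<tau> \<bullet> x \<le> normal K \<tau> \<bullet> y"
   using normal_offset[OF assms(1)] normal_offset[OF assms(2)] * K by metis+
  moreover have "y = x + (s - r) *\<^sub>R w" using * by (simp add: algebra_simps)
  ultimately have "(s - r) * (w \<bullet> normal K Y) \<le> 0" "0 \<le> (s - r) * (w \<bullet> normal K \<tau>)"
   by (simp_all add: inner_add_right inner_commute)
  then have "s = r" using assms(4,5) by (simp add: mult_le_0_iff zero_le_mult_iff)
  then have "x = y" using * by simp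
  then show "z \<in> {x + s *\<^sub>R w | x s. x \<in> Y \<inter> \<tau>}" using * by blast
 qed
qed

end

lemma AE_lborel_not_negligible: "negligible N ==> AE x in lborel. x \<notin> N"
 using AE_not_in[of N lebesgue] by (simp add: negligible_iff_null_sets AE_completion_iff)

context full_polytope
begin

text \<open>The excluded points are the base of the prism and the parts over intersections with
  other facets. Off this null set the cell is a half space near the base point, which gives the
  pointwise limit in the sweep argument.\<close>

lemma face_base_null:
 assumes "Y \<in> faces K"
 shows "AE y in lborel. y \<in> prism Y \<longrightarrow> (\<exists>x s. y = x + s *\<^sub>R unit_normal Y \<and> x \<in> Y \<and> 0 < s \<and> s \<le> 1
  \<and> (\<forall>\<tau>\<in>faces K. \<tau> \<noteq> Y \<longrightarrow> x \<notin> \<tau>))"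
proof -
 have n1: "negligible {x + s *\<^sub>R unit_normal Y | x s. x \<in> Y \<inter> \<tau>}" if "\<tau> \<in> faces K - {Y}" for \<tau>
  using that by (intro negligible_cylinder aff_dim_facet_Int assms) auto
 have "normal K Y \<noteq> 0" using normal_offset(1)[OF assms] by auto
 then have "negligible {x. normal K Y \<bullet> x = offset K Y}" by (intro negligible_hyperplane) simp
 moreover have "Y \<subseteq> {x. normal K Y \<bullet> x = offset K Y}" using normal_offset(3)[OF assms] by blast
 ultimately have "negligible Y" by (rule negligible_subset)
 then have n: "negligible (Y \<union> (\<Union>\<tau>\<in>faces K - {Y}. {x + s *\<^sub>R unit_normal Y | x s. x \<in> Y \<inter> \<tau>}))"
  using n1 finite_faces by (intro negligible_Un negligible_Union) auto
 show ?thesis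
  using AE_lborel_not_negligible[OF n]
 proof eventually_elim
  case (elim y)
  show ?case
  proof
   assume "y \<in> prism Y"
   then obtain x s where y: "y = x + s *\<^sub>R unit_normal Y" "x \<in> Y" "0 \<le> s" "s \<le> 1"
    unfolding prism_def by blast
   have "s \<noteq> 0" using elim y by auto
   moreover have "x \<notin> \<tau>" if "\<tau> \<in> faces K" "\<tau> \<noteq> Y" for \<tau>
    using elim y that by blast
   ultimately show "\<exists>x s. y = x + s *\<^sub>R unit_normal Y \<and> x \<in> Y \<and> 0 < s \<and> s \<le> 1
     \<and> (\<forall>\<tau>\<in>faces K. \<tau> \<noteq> Y \<longrightarrow> x \<notin> \<tau>)"
    using y by (intro exI[of _ x] exI[of _ s]) auto
  qed
 qed
qed

text \<open>Up to null overlaps the slanted prisms over the facets facing w cover the swept region.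
  A slanted prism may stick out of that region near the edges of the facet, so the indicator of
  \<open>swept\<close> is kept in the integrand.\<close>

lemma swept_integral:
 fixes f :: "real^'n => 'b::euclidean_space"
 assumes card: "CARD('n) = 2 \<or> CARD('n) = 3" and t: "t > 0" and f: "continuous_on UNIV f"
 shows "(LINT x|lborel. indicator (swept w t) x *\<^sub>R f x) =
  (\<Sum>Y\<in>{Y\<in>faces K. w \<bullet> normal K Y > 0}. (t * (w \<bullet> normal K Y)) *\<^sub>R
   (LINT y|lborel. indicator (prism Y) y *\<^sub>R (indicator (swept w t) (slant Y w t y) *\<^sub>R f (slant Y w t y))))"
  (is "_ = (\<Sum>Y\<in>?P. _)")
proof -
 have fin: "finite ?P" using finite_faces by simp
 define N where "N = (\<Union>(Y, \<tau>)\<in>{(Y, \<tau>)\<in>?P \<times> ?P. Y \<noteq> \<tau>}. slanted_prism Y w t \<inter> slanted_prism \<tau> w t)"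
 have "negligible N"
  unfolding N_def using fin
  by (intro negligible_Union finite_imageI)
   (auto intro!: slanted_prism_Int intro: finite_subset[OF _ finite_cartesian_product[OF fin fin]])
 then have ae: "AE x in lborel. x \<notin> N" by (rule AE_lborel_not_negligible)
 have fb: "f \<in> borel_measurable borel" using f by (rule borel_measurable_continuous_onI)
 define g where "g x = indicator (swept w t) x *\<^sub>R f x" for x
 have gm: "g \<in> borel_measurable borel"
  unfolding g_def by (intro borel_measurable_scaleR borel_measurable_indicator swept_sets fb)
 have gi: "integrable lborel (%x. indicator (slanted_prism Y w t) x *\<^sub>R g x)" if "Y \<in> ?P" for Y
 proof -
  have "compact (slanted_prism Y w t)" 
   unfolding slanted_prism_def using that by (intro compact_cylinder facesD) auto
  then have "integrable lborel (%x. indicator (slanted_prism Y w t) x *\<^sub>R f x)"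
   using continuous_on_subset[OF f subset_UNIV] by (rule borel_integrable_compact)
  from integrable_mult_indicator[OF _ this, of "swept w t"] swept_sets
  have "integrable lborel (%x. indicator (swept w t) x *\<^sub>R indicator (slanted_prism Y w t) x *\<^sub>R f x)" by simp
  then show ?thesis by (simp add: g_def mult.commute)
 qed
 have "(LINT x|lborel. g x) = (LINT x|lborel. (\<Sum>Y\<in>?P. indicator (slanted_prism Y w t) x *\<^sub>R g x))"
 proof (rule integral_cong_AE)
  show "g \<in> borel_measurable lborel" using gm by simp
  show "(%x. \<Sum>Y\<in>?P. indicator (slanted_prism Y w t) x *\<^sub>R g x) \<in> borel_measurable lborel"
   using gi by (intro borel_measurable_sum borel_measurable_integrable)
  show "AE x in lborel. g x = (\<Sum>Y\<in>?P. indicator (slanted_prism Y w t) x *\<^sub>R g x)"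
   using ae
  proof eventually_elim
   case (elim x)
   show ?case
   proof (cases "x \<in> swept w t")
    case True
    then obtain Y where Y: "Y \<in> ?P" "x \<in> slanted_prism Y w t" using swept_cover[OF _ t] by blast
    have o: "x \<notin> slanted_prism \<tau> w t" if "\<tau> \<in> ?P - {Y}" for \<tau>
     using elim Y that unfolding N_def by blast
    have "(\<Sum>\<tau>\<in>?P. indicator (slanted_prism \<tau> w t) x *\<^sub>R g x) = indicator (slanted_prism Y w t) x *\<^sub>R g x
     + (\<Sum>\<tau>\<in>?P - {Y}. indicator (slanted_prism \<tau> w t) x *\<^sub>R g x)"
     by (rule sum.remove[OF fin Y(1)])
    also have "(\<Sum>\<tau>\<in>?P - {Y}. indicator (slanted_prism \<tau> w t) x *\<^sub>R g x) = 0"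
     by (rule sum.neutral) (use o in simp)
    finally show ?thesis using Y by simp
   qed (simp add: g_def)
  qed
 qed
 also have "... = (\<Sum>Y\<in>?P. LINT x|lborel. indicator (slanted_prism Y w t) x *\<^sub>R g x)"
  using gi by (rule Bochner_Integration.integral_sum)
 also have "... = (\<Sum>Y\<in>?P. (t * (w \<bullet> normal K Y)) *\<^sub>R
   (LINT y|lborel. indicator (prism Y) y *\<^sub>R g (slant Y w t y)))"
  by (intro sum.cong refl integral_slanted_prism[OF card _ _ t gm]) auto
 finally show ?thesis by (simp add: g_def)
qed

text \<open>The factor t of the change of variables cancels the division by the step, and almost
  every slanted point is eventually swept and tends to its projection on the facet. The shift by z
  accounts for the part of the cell that is left behind, where f is evaluated at a translated
  point.\<close>

lemma swept_limit:
 fixes f :: "real^'n => 'b::euclidean_space"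
 assumes card: "CARD('n) = 2 \<or> CARD('n) = 3" and f: "continuous_on UNIV f" and B: "!!x. norm (f x) \<le> B"
 shows "(%k. real (Suc k) *\<^sub>R (LINT x|lborel. indicator (swept w (1 / real (Suc k))) x *\<^sub>R f (x + (1 / real (Suc k)) *\<^sub>R z)))
  \<longlonglongrightarrow> (\<Sum>Y\<in>{Y\<in>faces K. w \<bullet> normal K Y > 0}. (w \<bullet> normal K Y) *\<^sub>R face_integral Y f)"
  (is "_ \<longlonglongrightarrow> (\<Sum>Y\<in>?P. _)")
proof -
 define t where "t k = 1 / real (Suc k)" for k
 have t: "t k > 0" "real (Suc k) * t k = 1" for k by (simp_all add: t_def)
 have t0: "t \<longlonglongrightarrow> 0" unfolding t_def[abs_def] using LIMSEQ_inverse_real_of_nat by (simp add: inverse_eq_divide)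
 have fb: "f \<in> borel_measurable borel" using f by (rule borel_measurable_continuous_onI)
 define G where "G Y k y = indicator (prism Y) y *\<^sub>R (indicator (swept w (t k)) (slant Y w (t k) y) *\<^sub>R f (slant Y w (t k) y + t k *\<^sub>R z))" for Y k y
 have slant_m: "slant Y w s \<in> borel_measurable borel" for Y s
  unfolding slant_def height_def by (intro borel_measurable_continuous_onI continuous_intros)
 have eq: "real (Suc k) *\<^sub>R (LINT x|lborel. indicator (swept w (t k)) x *\<^sub>R f (x + t k *\<^sub>R z))
  = (\<Sum>Y\<in>?P. (w \<bullet> normal K Y) *\<^sub>R (LINT y|lborel. G Y k y))" for k
 proof -
  have c: "continuous_on UNIV (%x. f (x + t k *\<^sub>R z))"
   by (rule continuous_on_compose2[OF f]) (auto intro!: continuous_intros)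
  have "real (Suc k) *\<^sub>R (LINT x|lborel. indicator (swept w (t k)) x *\<^sub>R f (x + t k *\<^sub>R z))
   = (\<Sum>Y\<in>?P. (real (Suc k) * t k * (w \<bullet> normal K Y)) *\<^sub>R (LINT y|lborel. G Y k y))"
   unfolding swept_integral[OF card t(1) c] G_def by (simp add: scaleR_sum_right mult.assoc)
  then show ?thesis by (simp only: t(2) mult_1)
 qed
 have "(%k. LINT y|lborel. G Y k y) \<longlonglongrightarrow> face_integral Y f" if "Y \<in> ?P" for Y
 proof -
  have Y: "Y \<in> faces K" and wn: "w \<bullet> normal K Y > 0" using that by auto
  show ?thesis
   unfolding face_integral_lborel[OF Y fb]
  proof (rule integral_dominated_convergence[where w="%y. indicator (prism Y) y *\<^sub>R B"])
   show "integrable lborel (%y. indicator (prism Y) y *\<^sub>R B)"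
    by (rule borel_integrable_compact[OF compact_prism[OF Y]]) auto
   show "G Y k \<in> borel_measurable lborel" for k
   proof -
    have "(%y. indicator (swept w (t k)) (slant Y w (t k) y) :: real) \<in> borel_measurable borel"
     using measurable_compose[OF slant_m borel_measurable_indicator[OF swept_sets]] .
    moreover have "(%y. f (slant Y w (t k) y + t k *\<^sub>R z)) \<in> borel_measurable borel"
     using slant_m by (intro measurable_compose[OF _ fb] borel_measurable_add) auto
    ultimately show ?thesis
     unfolding G_def[abs_def] using prism_sets[OF Y]
     by (simp add: borel_measurable_scaleR borel_measurable_indicator)
   qed
   have "height Y \<in> borel_measurable borel"
    unfolding height_def by (intro borel_measurable_continuous_onI continuous_intros)
   then have "(%y. f (y - height Y y *\<^sub>R unit_normal Y)) \<in> borel_measurable borel"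
    by (intro measurable_compose[OF _ fb] borel_measurable_diff borel_measurable_scaleR) auto
   then show "(%y. indicator (prism Y) y *\<^sub>R f (y - height Y y *\<^sub>R unit_normal Y)) \<in> borel_measurable lborel"
    using prism_sets[OF Y] by (simp add: borel_measurable_scaleR borel_measurable_indicator)
   show "AE y in lborel. norm (G Y k y) \<le> indicator (prism Y) y *\<^sub>R B" for k
    using B order_trans[OF norm_ge_zero B] by (intro AE_I2) (auto simp: G_def indicator_def)
   show "AE y in lborel. (%k. G Y k y) \<longlonglongrightarrow> indicator (prism Y) y *\<^sub>R f (y - height Y y *\<^sub>R unit_normal Y)"
    using face_base_null[OF Y]
   proof eventually_elim
    case (elim y)
    show ?case
    proof (cases "y \<in> prism Y")
     case True
     then obtain x s where y: "y = x + s *\<^sub>R unit_normal Y" "x \<in> Y" "0 < s" "s \<le> 1"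
      and x: "!!\<tau>. \<tau> \<in> faces K ==> \<tau> \<noteq> Y ==> x \<notin> \<tau>" using elim by blast
     have sl: "slant Y w (t k) y = x + (t k * s) *\<^sub>R w" for k
      using slant_prism[OF Y y(2)] y(1) by simp
     obtain e where e: "e > 0" "!!x'. x' \<in> ball x e ==> x' \<in> K \<longleftrightarrow> normal K Y \<bullet> x' \<le> offset K Y"
      using local_halfspace[OF Y y(2) x] by blast
     have nx: "normal K Y \<bullet> x = offset K Y" using normal_offset(3)[OF Y] y by blast
     have "(%k. x - (t k * (1 - s)) *\<^sub>R w) \<longlonglongrightarrow> x - (0 * (1 - s)) *\<^sub>R w"
      by (intro tendsto_intros t0)
     then have "\<forall>\<^sub>F k in sequentially. x - (t k * (1 - s)) *\<^sub>R w \<in> ball x e"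
      using e(1) by (intro topological_tendstoD) auto
     \<comment> \<open>Near x the cell is a half space: the point lies beyond the facet because s >
       0, and after subtracting t w it is on the inner side because s \<le> 1.\<close>
     then have "\<forall>\<^sub>F k in sequentially. x + (t k * s) *\<^sub>R w \<in> swept w (t k)"
     proof eventually_elim
      case (elim k)
      have K1: "x - (t k * (1 - s)) *\<^sub>R w \<in> K"
       using e(2)[OF elim] nx t(1)[of k] y(4) wn
       by (simp add: inner_diff_right inner_commute)
      have e1: "x + (t k * s) *\<^sub>R w - t k *\<^sub>R w = x - (t k * (1 - s)) *\<^sub>R w"
       by (simp add: algebra_simps)
      have "x + (t k * s) *\<^sub>R w - t k *\<^sub>R w \<in> K" by (simp only: e1 K1)
      moreover have "x + (t k * s) *\<^sub>R w \<notin> K"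
      proof
       assume "x + (t k * s) *\<^sub>R w \<in> K"
       then have "(t k * s) * (w \<bullet> normal K Y) \<le> 0"
        using normal_offset(2)[OF Y] nx by (fastforce simp: inner_add_right inner_commute)
       moreover have "(t k * s) * (w \<bullet> normal K Y) > 0" using t(1)[of k] y(3) wn by simp
       ultimately show False by simp
      qed
      ultimately show ?case unfolding swept_def by blast
     qed
     then have ev: "\<forall>\<^sub>F k in sequentially. f (x + (t k * s) *\<^sub>R w + t k *\<^sub>R z) = G Y k y"
      by eventually_elim (simp add: G_def sl True)
     have "(%k. x + (t k * s) *\<^sub>R w + t k *\<^sub>R z) \<longlonglongrightarrow> x + (0 * s) *\<^sub>R w + 0 *\<^sub>R z"
      by (intro tendsto_intros t0)
     then have "(%k. f (x + (t k * s) *\<^sub>R w + t k *\<^sub>R z)) \<longlonglongrightarrow> f x"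
      using continuous_on_tendsto_compose[OF f] by auto
     then have "(%k. G Y k y) \<longlonglongrightarrow> f x" using ev by (rule Lim_transform_eventually)
     moreover have "y - height Y y *\<^sub>R unit_normal Y = x"
      using height_prism[OF Y y(2), of s] y(1) by simp
     ultimately show ?thesis using True by simp
    qed (simp add: G_def)
   qed
  qed
 qed
 then have "(%k. \<Sum>Y\<in>?P. (w \<bullet> normal K Y) *\<^sub>R (LINT y|lborel. G Y k y))
  \<longlonglongrightarrow> (\<Sum>Y\<in>?P. (w \<bullet> normal K Y) *\<^sub>R face_integral Y f)"
  by (intro tendsto_sum tendsto_scaleR tendsto_const)
 then show ?thesis by (simp only: eq[symmetric] t_def)
qed

text \<open>After a translation, the integral of f(x + t v) - f(x) over K is the integral of f over
  K + t v minus that over K. The gained part is swept in direction v; the lost part, shifted back by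
  t v, is swept in direction -v. Their limits collect the facets with positive and negative normal
  component of v.\<close>

theorem divergence_polytope:
 fixes f :: "real^'n => 'b::euclidean_space"
 assumes card: "CARD('n) = 2 \<or> CARD('n) = 3" and f: "f \<in> test_fun UNIV"
 shows "(LINT x|lebesgue_on K. frechet_derivative f (at x) v) = (\<Sum>Y\<in>faces K. (v \<bullet> normal K Y) *\<^sub>R face_integral Y f)"
proof -
 define t where "t k = 1 / real (Suc k)" for k
 define g where "g x = frechet_derivative f (at x) v" for x
 have gt: "g \<in> test_fun UNIV" unfolding g_def[abs_def] by (rule test_fun_frechet[OF f])
 obtain B where B: "0 \<le> B" "!!x. norm (f x) \<le> B" using test_fun_bounded[OF f] by blast
 obtain B' where B': "0 \<le> B'" "!!x. norm (g x) \<le> B'" using test_fun_bounded[OF gt] by blast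
 have cf: "continuous_on UNIV f" by (rule test_fun_continuous[OF f])
 have cg: "continuous_on UNIV g" by (rule test_fun_continuous[OF gt])
 have Ks: "K \<in> sets borel" using closed by (rule borel_closed)
 have ci: "integrable lborel (%x. indicator K x *\<^sub>R h x)" if "continuous_on UNIV h" for h :: "real^'n => 'b"
  using continuous_on_subset[OF that subset_UNIV] by (rule borel_integrable_compact[OF compact])
 have cft: "continuous_on UNIV (%x. f (x + c))" for c
  by (rule continuous_on_compose2[OF cf]) (auto intro!: continuous_intros)
 have "(%k. LINT x|lborel. indicator K x *\<^sub>R (real (Suc k) *\<^sub>R (f (x + t k *\<^sub>R v) - f x)))
   \<longlonglongrightarrow> (LINT x|lborel. indicator K x *\<^sub>R g x)"
 proof (rule integral_dominated_convergence[where w="%x. indicator K x *\<^sub>R B'"])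
  show "integrable lborel (%x. indicator K x *\<^sub>R B')"
   by (rule borel_integrable_compact[OF compact]) auto
  show "(%x. indicator K x *\<^sub>R g x) \<in> borel_measurable lborel"
   using ci[OF cg] by (rule borel_measurable_integrable)
  show "(%x. indicator K x *\<^sub>R (real (Suc k) *\<^sub>R (f (x + t k *\<^sub>R v) - f x))) \<in> borel_measurable lborel" for k
   by (intro borel_measurable_integrable ci continuous_on_scaleR continuous_on_diff continuous_on_const cft cf)
  show "AE x in lborel. norm (indicator K x *\<^sub>R (real (Suc k) *\<^sub>R (f (x + t k *\<^sub>R v) - f x))) \<le> indicator K x *\<^sub>R B'" for k
  proof (rule AE_I2)
   fix x
   have "norm (f (x + t k *\<^sub>R v) - f x) \<le> B' * t k"
    using norm_diff_le_of_directional_bound[OF test_fun_differentiable[OF f] B'(2)[unfolded g_def], of x "t k"]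
    by (simp add: t_def)
   then have "real (Suc k) * norm (f (x + t k *\<^sub>R v) - f x) \<le> real (Suc k) * (B' * t k)"
    by (rule mult_left_mono) simp
   then have "norm (real (Suc k) *\<^sub>R (f (x + t k *\<^sub>R v) - f x)) \<le> B'"
    unfolding norm_scaleR by (simp add: t_def)
   then show "norm (indicator K x *\<^sub>R (real (Suc k) *\<^sub>R (f (x + t k *\<^sub>R v) - f x))) \<le> indicator K x *\<^sub>R B'"
    by (simp add: indicator_def)
  qed
  show "AE x in lborel. (%k. indicator K x *\<^sub>R (real (Suc k) *\<^sub>R (f (x + t k *\<^sub>R v) - f x))) \<longlonglongrightarrow> indicator K x *\<^sub>R g x"
   unfolding t_def g_def
   by (intro AE_I2 tendsto_scaleR tendsto_const difference_quotient_sequence test_fun_differentiable[OF f])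
 qed
 moreover have "(LINT x|lborel. indicator K x *\<^sub>R (real (Suc k) *\<^sub>R (f (x + t k *\<^sub>R v) - f x)))
  = real (Suc k) *\<^sub>R (LINT x|lborel. indicator (swept v (t k)) x *\<^sub>R f (x + t k *\<^sub>R 0))
   - real (Suc k) *\<^sub>R (LINT x|lborel. indicator (swept (- v) (t k)) x *\<^sub>R f (x + t k *\<^sub>R v))" for k
 proof -
  define c where "c = t k *\<^sub>R v"
  have i: "integrable lborel (%x. indicator K x *\<^sub>R f (x + c))" "integrable lborel (%x. indicator K x *\<^sub>R f x)"
   by (intro ci cft cf)+
  have m: "(%x. x - c) -` K \<in> sets borel"
   by (rule borel_closed, rule continuous_closed_vimage[OF closed]) (intro continuous_intros)
  have bm: "(%x. indicator ((%x. x - c) -` K) x *\<^sub>R f x) \<in> borel_measurable borel"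
   by (intro borel_measurable_scaleR borel_measurable_indicator borel_measurable_continuous_onI m cf)
  have "integrable (distr lborel borel ((+) c)) (%x. indicator ((%x. x - c) -` K) x *\<^sub>R f x)"
   using i(1) bm by (subst integrable_distr_eq) (auto simp: add.commute indicator_def)
  then have i2: "integrable lborel (%x. indicator ((%x. x - c) -` K) x *\<^sub>R f x)"
   by (simp add: lborel_distr_plus)
  have e1: "(LINT x|lborel. indicator K x *\<^sub>R f (x + c)) = (LINT x|lborel. indicator ((%x. x - c) -` K) x *\<^sub>R f x)"
   using integral_lborel_translation[OF bm, of c] by (simp add: indicator_def add.commute)
  have ii: "integrable lborel (%x. indicator (swept v (t k)) x *\<^sub>R f x)"
   "integrable lborel (%x. indicator {x\<in>K. x - c \<notin> K} x *\<^sub>R f x)"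
  proof -
   have e: "(%x. indicator (swept v (t k)) x *\<^sub>R f x) = (%x. indicator (- K) x *\<^sub>R indicator ((%x. x - c) -` K) x *\<^sub>R f x)"
    by (auto simp: indicator_def swept_def c_def)
   show "integrable lborel (%x. indicator (swept v (t k)) x *\<^sub>R f x)"
    unfolding e using Ks by (intro integrable_mult_indicator i2) simp
   have e': "(%x. indicator {x\<in>K. x - c \<notin> K} x *\<^sub>R f x) = (%x. indicator (- ((%x. x - c) -` K)) x *\<^sub>R indicator K x *\<^sub>R f x)"
    by (auto simp: indicator_def)
   show "integrable lborel (%x. indicator {x\<in>K. x - c \<notin> K} x *\<^sub>R f x)"
    unfolding e' using m by (intro integrable_mult_indicator i(2)) simp
  qed
  have "(LINT x|lborel. indicator K x *\<^sub>R (f (x + c) - f x))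
    = (LINT x|lborel. indicator ((%x. x - c) -` K) x *\<^sub>R f x) - (LINT x|lborel. indicator K x *\<^sub>R f x)"
   using i e1 by (simp add: scaleR_right_diff_distrib)
  also have "... = (LINT x|lborel. indicator ((%x. x - c) -` K) x *\<^sub>R f x - indicator K x *\<^sub>R f x)"
   using i i2 by simp
  also have "... = (LINT x|lborel. indicator (swept v (t k)) x *\<^sub>R f x - indicator {x\<in>K. x - c \<notin> K} x *\<^sub>R f x)"
   by (intro Bochner_Integration.integral_cong) (auto simp: swept_def c_def indicator_def)
  also have "... = (LINT x|lborel. indicator (swept v (t k)) x *\<^sub>R f x) - (LINT x|lborel. indicator {x\<in>K. x - c \<notin> K} x *\<^sub>R f x)"
   using ii by simp
  also have "(LINT x|lborel. indicator {x\<in>K. x - c \<notin> K} x *\<^sub>R f x) = (LINT x|lborel. indicator (swept (- v) (t k)) x *\<^sub>R f (x + c))"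
   using integral_lborel_translation[OF borel_measurable_integrable[OF ii(2), simplified], of c]
   by (simp add: indicator_def swept_def c_def add.commute conj_commute)
  finally have d: "(LINT x|lborel. indicator K x *\<^sub>R (f (x + c) - f x)) =
   (LINT x|lborel. indicator (swept v (t k)) x *\<^sub>R f x) - (LINT x|lborel. indicator (swept (- v) (t k)) x *\<^sub>R f (x + c))" .
  have "(LINT x|lborel. indicator K x *\<^sub>R (real (Suc k) *\<^sub>R (f (x + c) - f x)))
   = (LINT x|lborel. real (Suc k) *\<^sub>R (indicator K x *\<^sub>R (f (x + c) - f x)))"
   by (simp add: mult.commute)
  also have "... = real (Suc k) *\<^sub>R (LINT x|lborel. indicator K x *\<^sub>R (f (x + c) - f x))"
   by (rule integral_scaleR_right)
  finally show ?thesis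
   unfolding d by (simp add: c_def scaleR_right_diff_distrib)
 qed
 ultimately have L: "(%k. real (Suc k) *\<^sub>R (LINT x|lborel. indicator (swept v (t k)) x *\<^sub>R f (x + t k *\<^sub>R 0))
   - real (Suc k) *\<^sub>R (LINT x|lborel. indicator (swept (- v) (t k)) x *\<^sub>R f (x + t k *\<^sub>R v)))
  \<longlonglongrightarrow> (LINT x|lborel. indicator K x *\<^sub>R g x)" by simp
 have R: "(%k. real (Suc k) *\<^sub>R (LINT x|lborel. indicator (swept v (t k)) x *\<^sub>R f (x + t k *\<^sub>R 0))
   - real (Suc k) *\<^sub>R (LINT x|lborel. indicator (swept (- v) (t k)) x *\<^sub>R f (x + t k *\<^sub>R v)))
  \<longlonglongrightarrow> (\<Sum>Y\<in>{Y\<in>faces K. v \<bullet> normal K Y > 0}. (v \<bullet> normal K Y) *\<^sub>R face_integral Y f)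
   - (\<Sum>Y\<in>{Y\<in>faces K. (- v) \<bullet> normal K Y > 0}. ((- v) \<bullet> normal K Y) *\<^sub>R face_integral Y f)"
  unfolding t_def by (intro tendsto_diff swept_limit[OF card cf B(2)])
 have "(LINT x|lborel. indicator K x *\<^sub>R g x) = (\<Sum>Y\<in>{Y\<in>faces K. v \<bullet> normal K Y > 0}. (v \<bullet> normal K Y) *\<^sub>R face_integral Y f)
   - (\<Sum>Y\<in>{Y\<in>faces K. (- v) \<bullet> normal K Y > 0}. ((- v) \<bullet> normal K Y) *\<^sub>R face_integral Y f)"
  using LIMSEQ_unique[OF L R] .
 also have "... = (\<Sum>Y\<in>faces K. (if v \<bullet> normal K Y > 0 then (v \<bullet> normal K Y) *\<^sub>R face_integral Y f else 0)
   - (if (- v) \<bullet> normal K Y > 0 then ((- v) \<bullet> normal K Y) *\<^sub>R face_integral Y f else 0))"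
  by (simp only: sum_subtractf sum.inter_filter[OF finite_faces])
 also have "... = (\<Sum>Y\<in>faces K. (v \<bullet> normal K Y) *\<^sub>R face_integral Y f)"
  by (intro sum.cong) (auto simp: not_less)
 also have "(LINT x|lborel. indicator K x *\<^sub>R g x) = (LINT x|lebesgue_on K. g x)"
 proof -
  have "(LINT x|lebesgue_on K. g x) = (LINT x|lebesgue. indicator K x *\<^sub>R g x)"
   using Ks by (intro integral_restrict_space) simp
  also have "... = (LINT x|lborel. indicator K x *\<^sub>R g x)"
   using borel_measurable_integrable[OF ci[OF cg]] by (intro integral_completion) simp
  finally show ?thesis by simp
 qed
 finally show ?thesis by (simp add: g_def)
qed

end

section \<open>Trace inequality\<close>

lemma norm_column_le_norm:
 fixes A :: "real^'n^'m" shows "norm (column i A) \<le> norm A"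
proof -
 have "(norm (column i A))\<^sup>2 = (\<Sum>k\<in>UNIV. (A $ k $ i)\<^sup>2)"
  unfolding power2_norm_eq_inner by (simp add: inner_vec_def column_def power2_eq_square)
 also have "... \<le> (\<Sum>k\<in>UNIV. \<Sum>j\<in>UNIV. (A $ k $ j)\<^sup>2)"
  by (intro sum_mono member_le_sum) auto
 also have "... = (norm A)\<^sup>2"
  unfolding power2_norm_eq_inner by (simp add: inner_vec_def power2_eq_square)
 finally show ?thesis by (rule power2_le_imp_le) simp
qed

lemma test_fun_mult_smooth:
 fixes f :: "'a::euclidean_space => real" and g :: "'a => real"
 assumes "f \<in> test_fun W" "!!k. C_k k g" shows "(%x. f x * g x) \<in> test_fun W"
proof -
 obtain S where *: "compact S" "S \<subseteq> W" "!!x. x \<notin> S ==> f x = 0"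
  using test_funE[OF assms(1)] by metis
 show ?thesis
  by (rule test_funI[where S="S"])
   (use * C_k_scaleR[OF test_fun_C_k[OF assms(1)] assms(2)] in auto)
qed

lemma C_k_nth: "C_k k (%x::real^'n. x $ i - c)"
proof -
 have "((%x::real^'n. x $ i - c) has_derivative (%h. h $ i)) (at x)" for x
  by (auto intro!: derivative_eq_intros bounded_linear_imp_has_derivative[OF bounded_linear_vec_nth])
 moreover from this have "frechet_derivative (%x::real^'n. x $ i - c) (at x) = (%h. h $ i)" for x
  by (rule frechet_derivativeI)
 ultimately show ?thesis
  by (cases k) (auto simp: differentiable_def intro!: continuous_intros)
qed

context full_polytope
begin

section \<open>Integrals and means over a facet\<close>

lemma convex_prism: "Y \<in> faces K ==> convex (prism Y)"
proof -
 assume "Y \<in> faces K"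
 then have "convex ((%(x, s). x + s *\<^sub>R unit_normal Y) ` (Y \<times> {0..1}))"
  using facesD by (intro convex_linear_image convex_Times)
   (auto intro!: linearI simp: algebra_simps)
 moreover have "(%(x, s). x + s *\<^sub>R unit_normal Y) ` (Y \<times> {0..1}) = prism Y"
  unfolding prism_def by force
 ultimately show ?thesis by simp
qed

text \<open>Y spans a hyperplane and its lift by the unit normal leaves this hyperplane, so the
  convex prism has full dimension and hence interior points.\<close>

lemma area_pos:
 assumes "Y \<in> faces K" shows "area Y > 0"
proof -
 obtain p where p: "p \<in> Y" using facesD(3)[OF assms] by auto
 have s: "Y \<subseteq> prism Y"
 proof
  fix x assume "x \<in> Y"
  then show "x \<in> prism Y" unfolding prism_def by (intro CollectI exI[of _ x] exI[of _ 0]) simp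
 qed
 have pu: "p + unit_normal Y \<in> prism Y"
  unfolding prism_def using p by (intro CollectI exI[of _ p] exI[of _ 1]) simp
 have "affine hull Y \<subseteq> {x. unit_normal Y \<bullet> x = unit_normal Y \<bullet> p}"
  using unit_normal_facet(3)[OF assms _ p] by (intro hull_minimal affine_hyperplane) blast
 moreover have "unit_normal Y \<bullet> unit_normal Y = 1"
  using unit_normal_facet(2)[OF assms] by (simp add: norm_eq_1)
 ultimately have "p + unit_normal Y \<notin> affine hull Y" by (auto simp: inner_add_right)
 then have "aff_dim (insert (p + unit_normal Y) Y) = int CARD('n)"
  using facesD(5)[OF assms] by (simp add: aff_dim_insert)
 moreover have "aff_dim (insert (p + unit_normal Y) Y) \<le> aff_dim (prism Y)"
  using s pu by (intro aff_dim_subset) auto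
 ultimately have "aff_dim (prism Y) = int DIM(real^'n)"
  using aff_dim_le_DIM[of "prism Y"] by simp
 then have "affine hull prism Y = UNIV" by (rule aff_dim_eq_full[THEN iffD1])
 then have "rel_interior (prism Y) = interior (prism Y)" by (rule rel_interior_interior)
 then have "interior (prism Y) \<noteq> {}"
  using convex_prism[OF assms] s p rel_interior_eq_empty by blast
 then have "\<not> negligible (interior (prism Y))" by (intro open_not_negligible) auto
 then have "\<not> negligible (prism Y)" using interior_subset negligible_subset by blast
 moreover have "prism Y \<in> lmeasurable" by (rule lmeasurable_compact[OF compact_prism[OF assms]])
 ultimately show ?thesis
  unfolding area_def by (simp add: negligible_iff_measure0 zero_less_measure_iff)
qed

lemma prism_projection:
 assumes "Y \<in> faces K" "y \<in> prism Y"
 shows "y - height Y y *\<^sub>R unit_normal Y \<in> Y"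
proof -
 obtain x s where y: "y = x + s *\<^sub>R unit_normal Y" "x \<in> Y" using assms(2) unfolding prism_def by blast
 then show ?thesis using height_prism[OF assms(1) y(2), of s] by simp
qed

lemma face_integral_cong:
 assumes "Y \<in> faces K" "!!x. x \<in> Y ==> f x = g x"
 shows "face_integral Y f = face_integral Y g"
 unfolding face_integral_def height_def[symmetric]
 by (intro Bochner_Integration.integral_cong refl assms(2) prism_projection[OF assms(1)])
  (simp add: space_restrict_space)

lemma continuous_projection:
 assumes "continuous_on UNIV f"
 shows "continuous_on UNIV (%y. f (y - height Y y *\<^sub>R unit_normal Y))"
 by (rule continuous_on_compose2[OF assms]) (auto simp: height_def intro!: continuous_intros)

lemma prism_in_L2:
 fixes f :: "real^'n => 'b::euclidean_space"
 assumes "Y \<in> faces K" "continuous_on UNIV f"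
 shows "in_L2 (prism Y) (%y. f (y - height Y y *\<^sub>R unit_normal Y))"
 using compact_prism[OF assms(1)] prism_sets[OF assms(1)]
 by (intro continuous_in_L2 continuous_projection assms) (auto simp: compact_imp_bounded)

lemma face_integrable:
 fixes f :: "real^'n => 'b::euclidean_space"
 assumes "Y \<in> faces K" "continuous_on UNIV f"
 shows "integrable (lebesgue_on (prism Y)) (%y. f (y - height Y y *\<^sub>R unit_normal Y))"
 using in_L2_scaleR_integrable[OF prism_in_L2[OF assms(1), of "%_. 1::real"] prism_in_L2[OF assms]] by simp

lemma face_integral_linear:
 fixes f g :: "real^'n => 'b::euclidean_space"
 assumes "Y \<in> faces K" "continuous_on UNIV f" "continuous_on UNIV g"
 shows "face_integral Y (%x. f x - g x) = face_integral Y f - face_integral Y g"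
  "face_integral Y (%x. f x + g x) = face_integral Y f + face_integral Y g"
  "face_integral Y (%x. c *\<^sub>R f x) = c *\<^sub>R face_integral Y f"
 using face_integrable[OF assms(1,2)] face_integrable[OF assms(1,3)]
 by (simp_all add: face_integral_def flip: height_def)

lemma face_mean_diff:
 fixes f g :: "real^'n => 'b::euclidean_space"
 assumes "Y \<in> faces K" "continuous_on UNIV f" "continuous_on UNIV g"
 shows "face_mean Y (%x. f x - g x) = face_mean Y f - face_mean Y g"
 by (simp add: face_mean_def face_integral_linear[OF assms] scaleR_right_diff_distrib)

lemma face_integral_sum:
 fixes f :: "'i => real^'n => 'b::euclidean_space"
 assumes "Y \<in> faces K" "!!i. i \<in> I ==> continuous_on UNIV (f i)"
 shows "face_integral Y (%x. \<Sum>i\<in>I. f i x) = (\<Sum>i\<in>I. face_integral Y (f i))"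
 unfolding face_integral_def height_def[symmetric]
 by (rule Bochner_Integration.integral_sum) (intro face_integrable assms)

lemma face_integral_nonneg:
 fixes f :: "real^'n => real"
 assumes "Y \<in> faces K" "!!x. x \<in> Y ==> 0 \<le> f x" shows "0 \<le> face_integral Y f"
 unfolding face_integral_def height_def[symmetric]
 by (rule Bochner_Integration.integral_nonneg)
  (use assms prism_projection in \<open>auto simp: space_restrict_space\<close>)

lemma norm_face_integral_le:
 fixes f :: "real^'n => 'b::euclidean_space"
 assumes "Y \<in> faces K" "continuous_on UNIV f"
 shows "(norm (face_integral Y f))\<^sup>2 \<le> area Y * face_integral Y (%x. (norm (f x))\<^sup>2)"
proof -
 define g where "g y = f (y - height Y y *\<^sub>R unit_normal Y)" for y
 have n: "continuous_on UNIV (%x. norm (f x))" using assms(2) by (intro continuous_on_norm)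
 have "norm (face_integral Y f) \<le> (LINT y|lebesgue_on (prism Y). norm (g y))"
  unfolding face_integral_def height_def[symmetric] g_def by (rule integral_norm_bound)
 also have "... = (LINT y|lebesgue_on (prism Y). norm (g y) \<bullet> (1::real))" by simp
 also have "... \<le> L2_nrm (prism Y) (%y. norm (g y)) * L2_nrm (prism Y) (%y. 1::real)"
  using L2_Cauchy_Schwarz[OF prism_in_L2[OF assms(1) n] prism_in_L2[OF assms(1), of "%_. 1::real"]]
  by (simp add: g_def abs_le_iff)
 finally have "(norm (face_integral Y f))\<^sup>2 \<le> (L2_nrm (prism Y) (%y. norm (g y)) * L2_nrm (prism Y) (%y. 1::real))\<^sup>2"
  by (rule power_mono) simp
 also have "... = face_integral Y (%x. (norm (f x))\<^sup>2) * (L2_nrm (prism Y) (%y. 1::real))\<^sup>2"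
  by (simp add: power_mult_distrib L2_nrm_sq face_integral_def g_def flip: height_def)
 also have "(L2_nrm (prism Y) (%y. 1::real))\<^sup>2 = area Y"
  using prism_sets[OF assms(1)] by (simp add: L2_nrm_sq area_def measure_restrict_space)
 finally show ?thesis by (simp add: mult.commute)
qed

text \<open>Divergence theorem for the field \<open>|f|\<^sup>2 (x - a)\<close>, whose flux through every face is positive when
 \<open>a\<close> is an interior point.\<close>

lemma trace_identity:
 fixes f :: "real^'n => real^'m"
 assumes card: "CARD('n) = 2 \<or> CARD('n) = 3" and f: "f \<in> test_fun UNIV"
 shows "(\<Sum>Y\<in>faces K. (offset K Y - normal K Y \<bullet> a) * face_integral Y (%x. (norm (f x))\<^sup>2))
  = (LINT x|lebesgue_on K. (\<Sum>i\<in>UNIV. (norm (f x))\<^sup>2 + 2 * (f x \<bullet> frechet_derivative f (at x) (axis i 1)) * (x $ i - a $ i)))"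
proof -
 define N where "N x = (norm (f x))\<^sup>2" for x
 have Nd: "(N has_derivative (%h. 2 * (f x \<bullet> frechet_derivative f (at x) h))) (at x)" for x
  unfolding N_def power2_norm_eq_inner
  using has_derivative_inner[OF frechet_derivative_has frechet_derivative_has, OF test_fun_differentiable[OF f] test_fun_differentiable[OF f], of x]
  by (simp add: inner_commute)
 have Nt: "N \<in> test_fun UNIV"
 proof -
  have "bounded_linear (%y::real^'m. y $ j)" for j by (rule bounded_linear_vec_nth)
  then have "(%x. \<Sum>j\<in>UNIV. f x $ j *\<^sub>R f x $ j) \<in> test_fun UNIV"
   by (intro test_fun_sum test_fun_mult test_fun_bounded_linear[OF f])
  moreover have "N = (%x. \<Sum>j\<in>UNIV. f x $ j *\<^sub>R f x $ j)"
   by (auto simp: N_def power2_norm_eq_inner inner_vec_def)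
  ultimately show ?thesis by simp
 qed
 define g where "g i x = N x * (x $ i - a $ i)" for i x
 have gt: "g i \<in> test_fun UNIV" for i
  unfolding g_def by (intro test_fun_mult_smooth Nt C_k_nth)
 have gc: "continuous_on UNIV (g i)" for i by (rule test_fun_continuous[OF gt])
 have gd: "frechet_derivative (g i) (at x) (axis i 1) = N x + 2 * (f x \<bullet> frechet_derivative f (at x) (axis i 1)) * (x $ i - a $ i)" for i x
 proof -
  have "((%x::real^'n. x $ i - a $ i) has_derivative (%h. h $ i)) (at x)"
   by (auto intro!: derivative_eq_intros bounded_linear_imp_has_derivative[OF bounded_linear_vec_nth])
  from has_derivative_mult[OF Nd this]
  have "(g i has_derivative (%h. N x * h $ i + 2 * (f x \<bullet> frechet_derivative f (at x) h) * (x $ i - a $ i))) (at x)"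
   by (simp add: g_def[abs_def])
  from frechet_derivativeI[OF this] show ?thesis by simp
 qed
 have dt: "(%x. frechet_derivative (g i) (at x) (axis i 1)) \<in> test_fun UNIV" for i
  by (rule test_fun_frechet[OF gt])
 have ints: "integrable (lebesgue_on K) (%x. frechet_derivative (g i) (at x) (axis i 1))" for i
 proof -
  have Kb: "bounded K" "K \<in> sets lebesgue" using compact compact_imp_bounded closed by auto
  have "in_L2 K (%x. 1::real)" by (rule continuous_in_L2) (use Kb in auto)
  from in_L2_scaleR_integrable[OF this continuous_in_L2[OF test_fun_continuous[OF dt] Kb]]
  show ?thesis by simp
 qed
 have "(\<Sum>i\<in>UNIV. LINT x|lebesgue_on K. frechet_derivative (g i) (at x) (axis i 1))
   = (\<Sum>i\<in>UNIV. \<Sum>Y\<in>faces K. normal K Y $ i * face_integral Y (g i))"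
  using divergence_polytope[OF card gt] by (simp add: inner_axis')
 also have "... = (\<Sum>Y\<in>faces K. \<Sum>i\<in>UNIV. normal K Y $ i * face_integral Y (g i))"
  by (rule sum.swap)
 also have "... = (\<Sum>Y\<in>faces K. (offset K Y - normal K Y \<bullet> a) * face_integral Y N)"
 proof (rule sum.cong[OF refl])
  fix Y assume Y: "Y \<in> faces K"
  have "(\<Sum>i\<in>UNIV. normal K Y $ i * face_integral Y (g i)) = (\<Sum>i\<in>UNIV. face_integral Y (%x. normal K Y $ i *\<^sub>R g i x))"
   using face_integral_linear(3)[OF Y gc gc] by simp
  also have "... = face_integral Y (%x. \<Sum>i\<in>UNIV. normal K Y $ i *\<^sub>R g i x)"
   by (rule face_integral_sum[symmetric, OF Y]) (intro continuous_on_scaleR continuous_on_const gc)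
  also have "... = face_integral Y (%x. (offset K Y - normal K Y \<bullet> a) *\<^sub>R N x)"
  proof (rule face_integral_cong[OF Y])
   fix x assume "x \<in> Y"
   then have "normal K Y \<bullet> x = offset K Y" using normal_offset(3)[OF Y] by blast
   then have "offset K Y - normal K Y \<bullet> a = (\<Sum>i\<in>UNIV. normal K Y $ i * (x $ i - a $ i))"
    by (simp add: inner_vec_def right_diff_distrib sum_subtractf)
   then show "(\<Sum>i\<in>UNIV. normal K Y $ i *\<^sub>R g i x) = (offset K Y - normal K Y \<bullet> a) *\<^sub>R N x"
    by (simp add: g_def sum_distrib_left sum_distrib_right ac_simps)
  qed
  also have "... = (offset K Y - normal K Y \<bullet> a) * face_integral Y N"
   using face_integral_linear(3)[OF Y test_fun_continuous[OF Nt] test_fun_continuous[OF Nt]] by simp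
  finally show "(\<Sum>i\<in>UNIV. normal K Y $ i * face_integral Y (g i)) = (offset K Y - normal K Y \<bullet> a) * face_integral Y N" .
 qed
 also have "(\<Sum>i\<in>UNIV. LINT x|lebesgue_on K. frechet_derivative (g i) (at x) (axis i 1))
  = (LINT x|lebesgue_on K. (\<Sum>i\<in>UNIV. frechet_derivative (g i) (at x) (axis i 1)))"
  using ints by (rule Bochner_Integration.integral_sum[symmetric])
 finally show ?thesis by (simp add: gd N_def)
qed

text \<open>Both sides are compared with the integral over the whole space, which equals the one
  over W because f vanishes outside W.\<close>

lemma L2_nrm_le_domain:
 fixes f :: "real^'n => 'b::euclidean_space"
 assumes "continuous_on UNIV f" "bounded W" "open W" "!!x. x \<notin> W ==> f x = 0"
 shows "L2_nrm K f \<le> L2_nrm W f"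
proof -
 define g where "g x = (norm (f x))\<^sup>2" for x
 have gc: "continuous_on UNIV g" unfolding g_def using assms(1) by (intro continuous_intros)
 have gm: "g \<in> borel_measurable borel" using gc by (rule borel_measurable_continuous_onI)
 have Ks: "K \<in> sets borel" using closed by (rule borel_closed)
 have gi: "integrable lborel g"
 proof -
  have "integrable lborel (%x. indicator (closure W) x *\<^sub>R g x)"
   using assms gc by (intro borel_integrable_compact) (auto intro: continuous_on_subset)
  moreover have "indicator (closure W) x *\<^sub>R g x = g x" for x
   using assms(4)[of x] closure_subset[of W] by (auto simp: indicator_def g_def)
  ultimately show ?thesis by (simp only:)
 qed
 have "(LINT x|lebesgue_on K. g x) = (LINT x|lebesgue. indicator K x *\<^sub>R g x)"
  using Ks by (intro integral_restrict_space) simp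
 also have "... = (LINT x|lborel. indicator K x *\<^sub>R g x)"
  using Ks gm by (intro integral_completion) simp
 also have "... \<le> (LINT x|lborel. g x)"
 proof (intro integral_mono integrable_mult_indicator gi)
  have "0 \<le> g x" for x by (simp add: g_def)
  then show "indicator K x *\<^sub>R g x \<le> g x" for x by (simp add: indicator_def)
 qed (use Ks in simp)
 also have "... = (LINT x|lebesgue_on W. g x)"
  by (rule integral_lebesgue_on_support[symmetric]) (use assms in \<open>simp_all add: gm lmeasurable_open fmeasurableD\<close>, simp add: g_def assms(4))
 finally show ?thesis by (simp add: L2_nrm_def g_def)
qed

text \<open>In the trace identity all face terms are nonnegative, so each one is bounded by the
  volume integral. The gradient enters there only through its product with f, which is why only the
  product of the two norms appears.\<close>

lemma trace_inequality:
 assumes card: "CARD('n) = 2 \<or> CARD('n) = 3" and W: "open W" "bounded W" and Y: "Y \<in> faces K"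
 obtains C where "0 \<le> C" "!!f :: real^'n => real^'n. f \<in> test_fun W ==>
  (norm (face_mean Y f))\<^sup>2 \<le> C * ((L2_nrm W f)\<^sup>2 + L2_nrm W f * L2_nrm W (%x. jacobian f (at x)))"
proof -
 obtain a where a: "a \<in> interior K" using nonempty_interior by auto
 have h: "offset K \<tau> - normal K \<tau> \<bullet> a > 0" if "\<tau> \<in> faces K" for \<tau>
  using a normal_offset(2,3)[OF that, of a] interiorI_iff that by (auto simp: less_le)
 obtain R where R: "R > 0" "!!x. x \<in> K ==> norm x \<le> R"
  using compact compact_imp_bounded bounded_pos by metis
 define R' where "R' = R + norm a"
 have R': "\<bar>x $ i - a $ i\<bar> \<le> R'" "R' > 0" if "x \<in> K" for x i
  using component_le_norm_cart[of "x - a" i] norm_triangle_ineq4[of x a] R(2)[OF that] R(1)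
  by (auto simp: R'_def add_pos_nonneg)
 define n where "n = real CARD('n)"
 have n0: "n > 0" by (simp add: n_def)
 \<comment> \<open>The summand n comes from the divergence of x - a, the other one from 2 f . Df
   with the components of x - a bounded by R'. Dividing by the distance \<open>hs\<close> of a to
   the facet and by its area turns the bound into one for the squared mean.\<close>
 define C0 where "C0 = n + 2 * R' * n"
 have C0: "0 \<le> C0" using n0 R(1) by (simp add: C0_def R'_def)
 define hs where "hs = offset K Y - normal K Y \<bullet> a"
 have hs: "hs > 0" using h[OF Y] by (simp add: hs_def)
 have ar: "area Y > 0" by (rule area_pos[OF Y])
 have Kb: "bounded K" "K \<in> sets lebesgue" using compact compact_imp_bounded closed by auto
 show thesis
 proof (rule that[of "C0 / (hs * area Y)"])
  show "0 \<le> C0 / (hs * area Y)" using C0 hs ar by simp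
  fix f :: "real^'n => real^'n" assume f: "f \<in> test_fun W"
  then have fU: "f \<in> test_fun UNIV" by (auto simp: test_fun_def)
  have fc: "continuous_on UNIV f" by (rule test_fun_continuous[OF f])
  define D where "D i x = frechet_derivative f (at x) (axis i 1)" for i x
  have Dt: "D i \<in> test_fun W" for i unfolding D_def[abs_def] by (rule test_fun_frechet[OF f])
  have fL: "in_L2 K f" and DL: "in_L2 K (D i)" for i
   using Kb by (auto intro!: continuous_in_L2 fc test_fun_continuous[OF Dt])
  define A where "A = L2_nrm W f"
  define B where "B = L2_nrm W (%x. jacobian f (at x))"
  have AB: "0 \<le> A" "0 \<le> B" by (simp_all add: A_def B_def)
  have z: "g x = 0" if "g \<in> test_fun W" "x \<notin> W" for g :: "real^'n => real^'n" and x
   using test_funE[OF that(1)] that(2) by (metis subsetD)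
  have nf: "L2_nrm K f \<le> A" unfolding A_def using z[OF f] W by (intro L2_nrm_le_domain fc) auto
  have nD: "L2_nrm K (D i) \<le> B" for i
  proof -
   have "L2_nrm K (D i) \<le> L2_nrm W (D i)"
    using z[OF Dt] W by (intro L2_nrm_le_domain test_fun_continuous[OF Dt]) auto
   also have "... \<le> 1 * B"
    unfolding B_def
   proof (rule L2_nrm_mono)
    show "in_L2 W (%x. jacobian f (at x))" "in_L2 W (D i)"
     using W by (auto intro!: test_fun_in_L2 test_fun_jacobian f Dt)
    fix x
    have "norm (column i (jacobian f (at x))) \<le> norm (jacobian f (at x))"
     by (rule norm_column_le_norm)
    then show "norm (D i x) \<le> 1 * norm (jacobian f (at x))" by (simp add: column_jacobian D_def)
   qed simp
   finally show ?thesis by simp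
  qed
  have nonneg: "0 \<le> face_integral \<tau> (%x. (norm (f x))\<^sup>2)" if "\<tau> \<in> faces K" for \<tau>
   by (rule face_integral_nonneg[OF that]) simp
  have i1: "integrable (lebesgue_on K) (%x. (norm (f x))\<^sup>2)" using fL by (simp add: in_L2_def)
  have i2: "integrable (lebesgue_on K) (%x. norm (f x) * norm (D i x))" for i
  proof -
   have "in_L2 K (%x. norm (f x))" "in_L2 K (%x. norm (D i x))"
    using Kb by (auto intro!: continuous_in_L2 continuous_on_norm fc test_fun_continuous[OF Dt])
   from in_L2_inner_integrable[OF this] show ?thesis by simp
  qed
  have c2: "(LINT x|lebesgue_on K. norm (f x) * norm (D i x)) \<le> A * B" for i
  proof -
   have "in_L2 K (%x. norm (f x))" "in_L2 K (%x. norm (D i x))"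
    using Kb by (auto intro!: continuous_in_L2 continuous_on_norm fc test_fun_continuous[OF Dt])
   from L2_Cauchy_Schwarz[OF this]
   have "(LINT x|lebesgue_on K. norm (f x) * norm (D i x)) \<le> L2_nrm K f * L2_nrm K (D i)"
    by (simp add: L2_nrm_def)
   also have "... \<le> A * B" using nf nD AB by (intro mult_mono) auto
   finally show ?thesis .
  qed
  have "hs * face_integral Y (%x. (norm (f x))\<^sup>2) \<le> (\<Sum>\<tau>\<in>faces K. (offset K \<tau> - normal K \<tau> \<bullet> a) * face_integral \<tau> (%x. (norm (f x))\<^sup>2))"
   unfolding hs_def using h nonneg finite_faces Y
   by (intro member_le_sum) (auto intro!: mult_nonneg_nonneg simp: less_imp_le)
  also have "... = (LINT x|lebesgue_on K. (\<Sum>i\<in>UNIV. (norm (f x))\<^sup>2 + 2 * (f x \<bullet> D i x) * (x $ i - a $ i)))"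
   unfolding trace_identity[OF card fU] D_def ..
  also have "... \<le> (LINT x|lebesgue_on K. (\<Sum>i\<in>UNIV. (norm (f x))\<^sup>2 + 2 * R' * (norm (f x) * norm (D i x))))"
  proof (rule integral_mono_AE')
   show "integrable (lebesgue_on K) (%x. \<Sum>i\<in>UNIV. (norm (f x))\<^sup>2 + 2 * R' * (norm (f x) * norm (D i x)))"
    using i1 i2 by auto
   show "AE x in lebesgue_on K. (\<Sum>i\<in>UNIV. (norm (f x))\<^sup>2 + 2 * (f x \<bullet> D i x) * (x $ i - a $ i))
    \<le> (\<Sum>i\<in>UNIV. (norm (f x))\<^sup>2 + 2 * R' * (norm (f x) * norm (D i x)))"
   proof (intro AE_I2 sum_mono)
    fix x i assume "x \<in> space (lebesgue_on K)"
    then have x: "x \<in> K" by (simp add: space_restrict_space)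
    have "\<bar>f x \<bullet> D i x\<bar> * \<bar>x $ i - a $ i\<bar> \<le> (norm (f x) * norm (D i x)) * R'"
     using R'(1)[OF x] Cauchy_Schwarz_ineq2 by (intro mult_mono) auto
    then have "(f x \<bullet> D i x) * (x $ i - a $ i) \<le> (norm (f x) * norm (D i x)) * R'"
     by (metis abs_ge_self abs_mult order_trans)
    then show "(norm (f x))\<^sup>2 + 2 * (f x \<bullet> D i x) * (x $ i - a $ i) \<le> (norm (f x))\<^sup>2 + 2 * R' * (norm (f x) * norm (D i x))"
     by (simp add: mult.commute mult.left_commute)
   qed
   show "AE x in lebesgue_on K. 0 \<le> (\<Sum>i\<in>UNIV. (norm (f x))\<^sup>2 + 2 * R' * (norm (f x) * norm (D i x)))"
    using R(1) by (intro AE_I2 sum_nonneg) (auto simp: R'_def)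
  qed
  also have "... = (\<Sum>i\<in>(UNIV::'n set). (L2_nrm K f)\<^sup>2 + 2 * R' * (LINT x|lebesgue_on K. norm (f x) * norm (D i x)))"
   using i1 i2 by (simp add: L2_nrm_sq)
  also have "... \<le> (\<Sum>i\<in>(UNIV::'n set). A\<^sup>2 + 2 * R' * (A * B))"
   using nf c2 R(1) by (intro sum_mono add_mono mult_left_mono power_mono) (auto simp: R'_def)
  also have "... = n * A\<^sup>2 + 2 * R' * n * (A * B)" by (simp add: n_def algebra_simps)
  also have "... \<le> C0 * A\<^sup>2 + C0 * (A * B)"
   using n0 R(1) AB by (intro add_mono mult_right_mono) (auto simp: C0_def R'_def)
  finally have le: "hs * face_integral Y (%x. (norm (f x))\<^sup>2) \<le> C0 * (A\<^sup>2 + A * B)" by (simp add: algebra_simps)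
  have "(norm (face_mean Y f))\<^sup>2 = (norm (face_integral Y f))\<^sup>2 / (area Y)\<^sup>2"
   using ar by (simp add: face_mean_def power_divide)
  also have "... \<le> (area Y * face_integral Y (%x. (norm (f x))\<^sup>2)) / (area Y)\<^sup>2"
   by (intro divide_right_mono norm_face_integral_le Y fc) simp
  also have "... = (hs * face_integral Y (%x. (norm (f x))\<^sup>2)) / (hs * area Y)"
   using hs ar by (simp add: power2_eq_square)
  also have "... \<le> (C0 * (A\<^sup>2 + A * B)) / (hs * area Y)"
   using le hs ar by (intro divide_right_mono) auto
  finally show "(norm (face_mean Y f))\<^sup>2 \<le> C0 / (hs * area Y) * ((L2_nrm W f)\<^sup>2 + L2_nrm W f * L2_nrm W (%x. jacobian f (at x)))"
   by (simp add: A_def B_def)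
 qed
qed

text \<open>The divergence theorem, applied componentwise, identifies the sum with the integral of
  the divergence over K, and Cauchy-Schwarz against the constant 1 bounds that integral.\<close>

lemma divergence_face_means:
 assumes card: "CARD('n) = 2 \<or> CARD('n) = 3" and W: "open W" "bounded W"
  and f: "f \<in> test_fun W"
 shows "\<bar>\<Sum>Y\<in>faces K. area Y * (face_mean Y f \<bullet> normal K Y)\<bar> \<le> sqrt (vol K) * L2_nrm W (%x. trace (jacobian f (at x)))"
proof -
 have fU: "f \<in> test_fun UNIV" using f by (auto simp: test_fun_def)
 have bl: "bounded_linear (trace :: real^'n^'n => real)"
  by (intro linear_conv_bounded_linear[THEN iffD1] linearI) (auto simp: trace_def sum.distrib sum_distrib_left)
 define d where "d x = trace (jacobian f (at x))" for x
 have dt: "d \<in> test_fun W" unfolding d_def[abs_def] by (intro test_fun_bounded_linear[OF _ bl] test_fun_jacobian f)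
 have Kb: "bounded K" "K \<in> sets lebesgue" using compact compact_imp_bounded closed by auto
 have Di: "integrable (lebesgue_on K) (%x. frechet_derivative f (at x) v)" for v
 proof -
  have "in_L2 K (%x. 1::real)" by (rule continuous_in_L2) (use Kb in auto)
  from in_L2_scaleR_integrable[OF this continuous_in_L2[OF test_fun_continuous[OF test_fun_frechet[OF f]] Kb]]
  show ?thesis by simp
 qed
 have "(LINT x|lebesgue_on K. d x) = (LINT x|lebesgue_on K. (\<Sum>i\<in>UNIV. frechet_derivative f (at x) (axis i 1) $ i))"
  by (simp add: d_def trace_def jacobian_def matrix_def)
 also have "... = (\<Sum>i\<in>UNIV. LINT x|lebesgue_on K. frechet_derivative f (at x) (axis i 1) $ i)"
  by (rule Bochner_Integration.integral_sum) (rule integrable_bounded_linear[OF bounded_linear_vec_nth Di])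
 also have "... = (\<Sum>i\<in>UNIV. (LINT x|lebesgue_on K. frechet_derivative f (at x) (axis i 1)) $ i)"
  by (intro sum.cong refl integral_bounded_linear[OF bounded_linear_vec_nth Di])
 also have "... = (\<Sum>i\<in>UNIV. \<Sum>Y\<in>faces K. normal K Y $ i * face_integral Y f $ i)"
  by (simp add: divergence_polytope[OF card fU] inner_axis')
 also have "... = (\<Sum>Y\<in>faces K. \<Sum>i\<in>UNIV. normal K Y $ i * face_integral Y f $ i)" by (rule sum.swap)
 also have "... = (\<Sum>Y\<in>faces K. area Y * (face_mean Y f \<bullet> normal K Y))"
  using area_pos by (intro sum.cong refl) (force simp: face_mean_def inner_vec_def mult.commute sum_distrib_left)
 finally have "(\<Sum>Y\<in>faces K. area Y * (face_mean Y f \<bullet> normal K Y)) = (LINT x|lebesgue_on K. (1::real) \<bullet> d x)" by simp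
 also have "\<bar>...\<bar> \<le> L2_nrm K (%x. 1::real) * L2_nrm K d"
  by (rule L2_Cauchy_Schwarz) (use Kb in \<open>auto intro!: continuous_in_L2 test_fun_continuous[OF dt]\<close>)
 also have "L2_nrm K (%x. 1::real) = sqrt (vol K)"
  using Kb by (simp add: L2_nrm_def measure_restrict_space)
 also have "L2_nrm K d \<le> L2_nrm W d"
 proof (rule L2_nrm_le_domain[OF test_fun_continuous[OF dt] W(2,1)])
  show "d x = 0" if "x \<notin> W" for x using test_funE[OF dt] that by (metis subsetD)
 qed
 finally show ?thesis by (simp add: d_def[abs_def] mult_left_mono)
qed

end

section \<open>Completeness of \<open>L\<^sup>2\<close>\<close>

lemma L2_scaleR_bound:
 fixes f :: "real^'n => real" and g :: "real^'n => 'b::euclidean_space"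
 assumes "in_L2 W f" "in_L2 W g"
 shows "norm (LINT x|lebesgue_on W. f x *\<^sub>R g x) \<le> L2_nrm W f * L2_nrm W g"
proof -
 have n: "in_L2 W (%x. \<bar>f x\<bar>)" "in_L2 W (%x. norm (g x))"
  using assms by (auto simp: in_L2_def)
 have "norm (LINT x|lebesgue_on W. f x *\<^sub>R g x) \<le> (LINT x|lebesgue_on W. norm (f x *\<^sub>R g x))"
  by (rule integral_norm_bound)
 also have "... = (LINT x|lebesgue_on W. \<bar>f x\<bar> \<bullet> norm (g x))" by simp
 also have "... \<le> L2_nrm W (%x. \<bar>f x\<bar>) * L2_nrm W (%x. norm (g x))"
  using L2_Cauchy_Schwarz[OF n] by linarith
 finally show ?thesis by (simp add: L2_nrm_def)
qed

lemma L2_nn_integral: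
 assumes "in_L2 W f"
 shows "(\<integral>\<^sup>+x. ennreal ((norm (f x))\<^sup>2) \<partial>lebesgue_on W) = ennreal ((L2_nrm W f)\<^sup>2)"
 using assms unfolding L2_nrm_sq in_L2_def by (intro nn_integral_eq_integral) auto

lemma in_L2_of_nn_integral:
 assumes "f \<in> borel_measurable (lebesgue_on W)" "(\<integral>\<^sup>+x. ennreal ((norm (f x))\<^sup>2) \<partial>lebesgue_on W) \<le> ennreal (e\<^sup>2)" "0 \<le> e"
 shows "in_L2 W f" "L2_nrm W f \<le> e"
proof -
 show L: "in_L2 W f"
  unfolding in_L2_def
 proof
  show "integrable (lebesgue_on W) (%x. (norm (f x))\<^sup>2)"
   by (rule integrableI_bounded) (use assms in \<open>auto simp: le_less_trans\<close>)
 qed (rule assms)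
 have "ennreal ((L2_nrm W f)\<^sup>2) \<le> ennreal (e\<^sup>2)" using L2_nn_integral[OF L] assms by simp
 then have "(L2_nrm W f)\<^sup>2 \<le> e\<^sup>2" by (simp add: ennreal_le_iff)
 then show "L2_nrm W f \<le> e" using assms(3) by (rule power2_le_imp_le)
qed

text \<open>Riesz-Fischer. W has finite measure, so a subsequence with L^2 increments at most 2^-i
  has increments summable in L^1 and converges almost everywhere; Fatou's lemma then compares each f
  j with the limit.\<close>

lemma L2_complete:
 fixes f :: "nat => real^'n => 'b::euclidean_space"
 assumes W: "bounded W" "W \<in> sets lebesgue" and f: "!!k. in_L2 W (f k)"
  and C: "!!e. e > 0 ==> \<exists>M. \<forall>j\<ge>M. \<forall>k\<ge>M. L2_nrm W (%x. f j x - f k x) < e"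
 obtains g where "in_L2 W g" "(%k. L2_nrm W (%x. f k x - g x)) \<longlonglongrightarrow> 0"
proof -
 let ?M = "lebesgue_on W"
 have one: "in_L2 W (%x. 1::real)" by (rule continuous_in_L2) (use W in auto)
 have "\<exists>M. \<forall>j\<ge>M. \<forall>k\<ge>M. L2_nrm W (%x. f j x - f k x) < (1/2) ^ i" for i
  by (rule C) simp
 then obtain M where M: "!!i j k. j \<ge> M i ==> k \<ge> M i ==> L2_nrm W (%x. f j x - f k x) < (1/2) ^ i" by metis
 \<comment> \<open>The maximum makes the indices strictly increasing and keeps each one beyond its
   threshold.\<close>
 define s where "s = rec_nat (M 0) (%i a. max (Suc a) (M (Suc i)))"
 have s0: "s i \<ge> M i" for i by (cases i) (auto simp: s_def)
 have sS: "s (Suc i) > s i" for i by (simp add: s_def)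
 have sm: "strict_mono s" using sS by (simp add: strict_mono_Suc_iff)
 define h where "h i x = f (s (Suc i)) x - f (s i) x" for i x
 have hL: "in_L2 W (h i)" for i unfolding h_def by (intro in_L2_diff f)
 have hn: "L2_nrm W (h i) \<le> (1/2) ^ i" for i
  unfolding h_def using M[of i "s (Suc i)" "s i"] s0[of i] sS[of i] by simp
 have hm: "(%x. norm (h i x)) \<in> borel_measurable ?M" for i using hL[of i] by (auto simp: in_L2_def)
 define c where "c = L2_nrm W (%x. 1::real)"
 have hnL: "in_L2 W (%x. norm (h i x))" for i using hL[of i] by (auto simp: in_L2_def)
 have hi: "integrable ?M (%x. norm (h i x))" for i
  using in_L2_inner_integrable[OF hnL one] by simp
 have hb: "(LINT x|?M. norm (h i x)) \<le> (1/2) ^ i * c" for i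
 proof -
  have "(LINT x|?M. norm (h i x) \<bullet> (1::real)) \<le> L2_nrm W (%x. norm (h i x)) * c"
   using L2_Cauchy_Schwarz[OF hnL[of i] one] unfolding c_def by linarith
  also have "... \<le> (1/2) ^ i * c"
   using hn[of i] by (intro mult_right_mono) (simp_all add: L2_nrm_def c_def)
  finally show ?thesis by simp
 qed
 have "(\<integral>\<^sup>+x. (\<Sum>i. ennreal (norm (h i x))) \<partial>?M) = (\<Sum>i. \<integral>\<^sup>+x. ennreal (norm (h i x)) \<partial>?M)"
  using hm by (intro nn_integral_suminf) auto
 also have "... = (\<Sum>i. ennreal (LINT x|?M. norm (h i x)))"
  using hi by (simp add: nn_integral_eq_integral)
 also have "... \<le> (\<Sum>i. ennreal ((1/2) ^ i * c))"
  using hb by (intro suminf_le) (auto simp: ennreal_leI)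
 also have "... = ennreal (\<Sum>i. (1/2) ^ i * c)"
  by (intro suminf_ennreal2) (auto simp: c_def intro!: summable_mult2 summable_geometric)
 finally have "(\<integral>\<^sup>+x. (\<Sum>i. ennreal (norm (h i x))) \<partial>?M) < \<infinity>"
  by (simp add: le_less_trans)
 then have "AE x in ?M. (\<Sum>i. ennreal (norm (h i x))) \<noteq> \<infinity>"
  using hm by (intro nn_integral_PInf_AE) auto
 then have sA: "AE x in ?M. summable (%i. h i x)"
 proof eventually_elim
  case (elim x)
  then have "summable (%i. norm (h i x))" by (intro summable_suminf_not_top) (auto simp: top_ennreal.rep_eq)
  then show ?case by (rule summable_norm_cancel)
 qed
 define g where "g x = lim (%k. f (s k) x)" for x
 have gm: "g \<in> borel_measurable ?M"
  unfolding g_def[abs_def] using f by (intro borel_measurable_lim_metric) (auto simp: in_L2_def)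
 have lA: "AE x in ?M. (%k. f (s k) x) \<longlonglongrightarrow> g x"
  using sA
 proof eventually_elim
  case (elim x)
  have "(%k. f (s 0) x + (\<Sum>i<k. h i x)) \<longlonglongrightarrow> f (s 0) x + (\<Sum>i. h i x)"
   using elim by (intro tendsto_add tendsto_const summable_LIMSEQ)
  moreover have "f (s 0) x + (\<Sum>i<k. h i x) = f (s k) x" for k
   by (simp add: h_def sum_lessThan_telescope[of "%i. f (s i) x"])
  ultimately have "(%k. f (s k) x) \<longlonglongrightarrow> f (s 0) x + (\<Sum>i. h i x)" by simp
  then show ?case unfolding g_def using limI by metis
 qed
 have key: "in_L2 W (%x. f j x - g x) \<and> L2_nrm W (%x. f j x - g x) \<le> (1/2) ^ i" if "j \<ge> M i" for i j
 proof -
  have m: "(%x. f j x - g x) \<in> borel_measurable ?M" using f[of j] gm by (auto simp: in_L2_def)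
  have "(%y::'b. ennreal ((norm y)\<^sup>2)) \<in> borel_measurable borel" by measurable
  then have mk: "(%x. ennreal ((norm (f j x - f (s k) x))\<^sup>2)) \<in> borel_measurable ?M" for k
   by (rule measurable_compose[OF in_L2D(1)[OF in_L2_diff[OF f f]]])
  have "(\<integral>\<^sup>+x. ennreal ((norm (f j x - g x))\<^sup>2) \<partial>?M) = (\<integral>\<^sup>+x. liminf (%k. ennreal ((norm (f j x - f (s k) x))\<^sup>2)) \<partial>?M)"
  proof (rule nn_integral_cong_AE)
   show "AE x in ?M. ennreal ((norm (f j x - g x))\<^sup>2) = liminf (%k. ennreal ((norm (f j x - f (s k) x))\<^sup>2))"
    using lA
   proof eventually_elim
    case (elim x)
    have "(%k. ennreal ((norm (f j x - f (s k) x))\<^sup>2)) \<longlonglongrightarrow> ennreal ((norm (f j x - g x))\<^sup>2)"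
     by (intro tendsto_ennrealI tendsto_power tendsto_norm tendsto_diff tendsto_const elim)
    then show ?case by (rule lim_imp_Liminf[OF trivial_limit_sequentially, symmetric])
   qed
  qed
  also have "... \<le> liminf (%k. \<integral>\<^sup>+x. ennreal ((norm (f j x - f (s k) x))\<^sup>2) \<partial>?M)"
   by (rule nn_integral_liminf[OF mk])
  also have "... \<le> ennreal (((1/2) ^ i)\<^sup>2)"
  proof (rule Liminf_le)
   have "\<forall>\<^sub>F k in sequentially. k \<ge> M i" by (rule eventually_ge_at_top)
   then have "\<forall>\<^sub>F k in sequentially. (\<integral>\<^sup>+x. ennreal ((norm (f j x - f (s k) x))\<^sup>2) \<partial>?M) \<le> ennreal (((1/2) ^ i)\<^sup>2)"
   proof eventually_elim
    case (elim k)
    then have "s k \<ge> M i" using seq_suble[OF sm, of k] by linarith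
    then have "L2_nrm W (%x. f j x - f (s k) x) \<le> (1/2) ^ i" using M[OF that, of "s k"] by simp
    then have "(L2_nrm W (%x. f j x - f (s k) x))\<^sup>2 \<le> ((1/2) ^ i)\<^sup>2" by (rule power_mono) simp
    then show ?case unfolding L2_nn_integral[OF in_L2_diff[OF f f]] by (rule ennreal_leI)
   qed
   then show "\<forall>\<^sub>F k in sequentially. (\<integral>\<^sup>+x. ennreal ((norm (f j x - f (s k) x))\<^sup>2) \<partial>?M) \<le> ennreal (((1/2) ^ i)\<^sup>2)" .
  qed simp
  finally show ?thesis using in_L2_of_nn_integral[OF m, of "(1/2) ^ i"] by auto
 qed
 have gL: "in_L2 W g"
  using in_L2_diff[OF f conjunct1[OF key[of 0 "M 0"]], of "M 0"] by simp
 have "(%k. L2_nrm W (%x. f k x - g x)) \<longlonglongrightarrow> 0"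
 proof (rule LIMSEQ_I)
  fix e :: real assume "e > 0"
  then obtain i where i: "(1/2) ^ i < e" using real_arch_pow_inv[of e "1/2"] by auto
  have "\<forall>k\<ge>M i. norm (L2_nrm W (%x. f k x - g x) - 0) < e" using key i by fastforce
  then show "\<exists>no. \<forall>k\<ge>no. norm (L2_nrm W (%x. f k x - g x) - 0) < e" by blast
 qed
 then show thesis using that gL by blast
qed

section \<open>Weak closedness of \<open>H\<^sup>1\<^sub>0\<close>\<close>

lemma has_weak_jacobian_limit:
 assumes W: "open W" "bounded W" and w: "!!k. w k \<in> test_fun W" and u: "in_L2 W u" and J: "in_L2 W J"
  and wu: "(%k. L2_nrm W (%x. w k x - u x)) \<longlonglongrightarrow> 0"
  and wJ: "(%k. L2_nrm W (%x. jacobian (w k) (at x) - J x)) \<longlonglongrightarrow> 0"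
 shows "has_weak_jacobian W u J"
 unfolding has_weak_jacobian_def
proof (intro conjI allI impI J)
 fix \<psi> :: "real^'a => real" and i assume \<psi>: "\<psi> \<in> test_fun W"
 define d where "d x = frechet_derivative \<psi> (at x) (axis i 1)" for x
 have dt: "d \<in> test_fun W" unfolding d_def[abs_def] by (rule test_fun_frechet[OF \<psi>])
 have T: "in_L2 W f" if "f \<in> test_fun W" for f :: "real^'a => 'c::euclidean_space"
  using test_fun_in_L2[OF that] W by blast
 have wj: "in_L2 W (%x. jacobian (w k) (at x))" for k by (intro T test_fun_jacobian w)
 have 1: "(%k. LINT x|lebesgue_on W. d x *\<^sub>R w k x) \<longlonglongrightarrow> (LINT x|lebesgue_on W. d x *\<^sub>R u x)"
 proof (rule LIM_zero_cancel, rule Lim_null_comparison)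
  show "(%k. L2_nrm W d * L2_nrm W (%x. w k x - u x)) \<longlonglongrightarrow> 0"
   using tendsto_mult_left[OF wu, of "L2_nrm W d"] by simp
  have "(LINT x|lebesgue_on W. d x *\<^sub>R w k x) - (LINT x|lebesgue_on W. d x *\<^sub>R u x)
    = (LINT x|lebesgue_on W. d x *\<^sub>R (w k x - u x))" for k
   using in_L2_scaleR_integrable[OF T[OF dt] T[OF w]] in_L2_scaleR_integrable[OF T[OF dt] u]
   by (simp add: scaleR_right_diff_distrib)
  then show "\<forall>\<^sub>F k in sequentially. norm ((LINT x|lebesgue_on W. d x *\<^sub>R w k x) - (LINT x|lebesgue_on W. d x *\<^sub>R u x))
    \<le> L2_nrm W d * L2_nrm W (%x. w k x - u x)"
   using L2_scaleR_bound[OF T[OF dt] in_L2_diff[OF T[OF w] u]] by (simp add: always_eventually)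
 qed
 have 2: "(%k. LINT x|lebesgue_on W. \<psi> x *\<^sub>R column i (jacobian (w k) (at x))) \<longlonglongrightarrow> (LINT x|lebesgue_on W. \<psi> x *\<^sub>R column i (J x))"
 proof (rule LIM_zero_cancel, rule Lim_null_comparison)
  show "(%k. L2_nrm W \<psi> * L2_nrm W (%x. jacobian (w k) (at x) - J x)) \<longlonglongrightarrow> 0"
   using tendsto_mult_left[OF wJ, of "L2_nrm W \<psi>"] by simp
  have c: "in_L2 W (%x. column i (jacobian (w k) (at x)))" "in_L2 W (%x. column i (J x))"
   "in_L2 W (%x. column i (jacobian (w k) (at x) - J x))" for k
   by (intro in_L2_bounded_linear[OF _ bounded_linear_column] wj J in_L2_diff)+
  have e: "(LINT x|lebesgue_on W. \<psi> x *\<^sub>R column i (jacobian (w k) (at x))) - (LINT x|lebesgue_on W. \<psi> x *\<^sub>R column i (J x))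
    = (LINT x|lebesgue_on W. \<psi> x *\<^sub>R column i (jacobian (w k) (at x) - J x))" for k
   using in_L2_scaleR_integrable[OF T[OF \<psi>] c(1)] in_L2_scaleR_integrable[OF T[OF \<psi>] c(2)]
   by (simp add: scaleR_right_diff_distrib linear_simps[OF bounded_linear_column])
  have "norm (LINT x|lebesgue_on W. \<psi> x *\<^sub>R column i (jacobian (w k) (at x) - J x)) \<le> L2_nrm W \<psi> * L2_nrm W (%x. jacobian (w k) (at x) - J x)" for k
  proof -
   have "L2_nrm W (%x. column i (jacobian (w k) (at x) - J x)) \<le> 1 * L2_nrm W (%x. jacobian (w k) (at x) - J x)"
    by (rule L2_nrm_mono[OF in_L2_diff[OF wj J] c(3)]) (simp_all add: norm_column_le_norm)
   then show ?thesis
    using L2_scaleR_bound[OF T[OF \<psi>] c(3)[of k]] by (smt (verit) L2_nrm_nonneg mult_left_mono)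
  qed
  then show "\<forall>\<^sub>F k in sequentially. norm ((LINT x|lebesgue_on W. \<psi> x *\<^sub>R column i (jacobian (w k) (at x))) - (LINT x|lebesgue_on W. \<psi> x *\<^sub>R column i (J x)))
    \<le> L2_nrm W \<psi> * L2_nrm W (%x. jacobian (w k) (at x) - J x)"
   unfolding e by (simp add: always_eventually)
 qed
 have "(LINT x|lebesgue_on W. d x *\<^sub>R w k x) = - (LINT x|lebesgue_on W. \<psi> x *\<^sub>R column i (jacobian (w k) (at x)))" for k
  using test_fun_weak_jacobian[OF W w[of k]] \<psi> unfolding has_weak_jacobian_def d_def by blast
 then have "(%k. LINT x|lebesgue_on W. d x *\<^sub>R w k x) \<longlonglongrightarrow> - (LINT x|lebesgue_on W. \<psi> x *\<^sub>R column i (J x))"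
  using tendsto_minus[OF 2] by simp
 then show "(LINT x|lebesgue_on W. frechet_derivative \<psi> (at x) (axis i 1) *\<^sub>R u x) = - (LINT x|lebesgue_on W. \<psi> x *\<^sub>R column i (J x))"
  using LIMSEQ_unique[OF 1] unfolding d_def by blast
qed

text \<open>The functions closest to \<open>u\<close> in \<open>L\<^sup>2\<close> with almost minimal gradient form a Cauchy sequence in \<open>H\<^sup>1\<close>, by
 the parallelogram law.\<close>

lemma H10_weak_limit:
 assumes W: "open W" "bounded W" and \<phi>: "!!m. \<phi> m \<in> test_fun W" and u: "in_L2 W u"
  and \<phi>u: "(%m. L2_nrm W (%x. \<phi> m x - u x)) \<longlonglongrightarrow> 0"
  and C: "!!m. L2_nrm W (%x. jacobian (\<phi> m) (at x)) \<le> C"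
 obtains J w where "has_weak_jacobian W u J" "H1_approx W w u"
proof -
 let ?D = "%f::real^'a => real^'a. L2_nrm W (%x. jacobian f (at x))"
 define A where "A n = {f \<in> test_fun W. L2_nrm W (%x. f x - u x) \<le> 1 / real (Suc n)}" for n
 define d where "d n = Inf ((%f. (?D f)\<^sup>2) ` A n)" for n
 have T: "in_L2 W f" if "f \<in> test_fun W" for f :: "real^'a => 'c::euclidean_space"
  using test_fun_in_L2[OF that] W by blast
 have ne: "\<exists>f\<in>A n. (?D f)\<^sup>2 \<le> C\<^sup>2" for n
 proof -
  have "\<forall>\<^sub>F m in sequentially. L2_nrm W (%x. \<phi> m x - u x) < 1 / real (Suc n)"
   by (rule order_tendstoD(2)[OF \<phi>u]) simp
  then obtain m where "L2_nrm W (%x. \<phi> m x - u x) < 1 / real (Suc n)"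
   using eventually_happens[of _ sequentially] by auto
  then have "\<phi> m \<in> A n" using \<phi> by (simp add: A_def)
  moreover have "(?D (\<phi> m))\<^sup>2 \<le> C\<^sup>2" by (rule power_mono[OF C]) simp
  ultimately show ?thesis by blast
 qed
 have bb: "bdd_below ((%f. (?D f)\<^sup>2) ` A n)" for n by (rule bdd_belowI[of _ 0]) auto
 have dle: "d n \<le> (?D f)\<^sup>2" if "f \<in> A n" for f n
  unfolding d_def using that bb by (intro cInf_lower) auto
 have dmono: "d n \<le> d m" if "n \<le> m" for n m
 proof -
  have "1 / real (Suc m) \<le> 1 / real (Suc n)" using that by (intro divide_left_mono) auto
  then have "A m \<subseteq> A n" by (auto simp: A_def)
  then show ?thesis unfolding d_def using bb ne by (intro cInf_superset_mono image_mono) auto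
 qed
 have dC: "d n \<le> C\<^sup>2" for n using ne[of n] dle by force
 \<comment> \<open>The admissible sets shrink, so the infima increase; the bounded gradients of the
   given sequence keep them below C^2. Their convergence is what makes the almost minimisers a
   Cauchy sequence.\<close>
 have "incseq d" using dmono by (simp add: incseq_def)
 then obtain L where "d \<longlonglongrightarrow> L" using incseq_convergent[of d "C\<^sup>2"] dC by metis
 then have "convergent d" by (auto simp: convergent_def)
 then have dCauchy: "Cauchy d" by (rule convergent_Cauchy)
 have "\<exists>f. f \<in> A n \<and> (?D f)\<^sup>2 < d n + 1 / real (Suc n)" for n
 proof -
  have "Inf ((%f. (?D f)\<^sup>2) ` A n) < d n + 1 / real (Suc n)" by (simp add: d_def)
  then have "\<exists>y\<in>(%f. (?D f)\<^sup>2) ` A n. y < d n + 1 / real (Suc n)"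
   using ne bb by (subst (asm) cInf_less_iff) auto
  then show ?thesis by blast
 qed
 then obtain w where w: "!!n. w n \<in> A n" "!!n. (?D (w n))\<^sup>2 < d n + 1 / real (Suc n)" by metis
 have wt: "w n \<in> test_fun W" for n using w(1) by (simp add: A_def)
 have jL: "in_L2 W (%x. jacobian (w n) (at x))" for n by (intro T test_fun_jacobian wt)
 have wu: "(%n. L2_nrm W (%x. w n x - u x)) \<longlonglongrightarrow> 0"
 proof (rule Lim_null_comparison)
  show "\<forall>\<^sub>F n in sequentially. norm (L2_nrm W (%x. w n x - u x)) \<le> 1 / real (Suc n)"
   using w(1) by (simp add: A_def)
  show "(%n. 1 / real (Suc n)) \<longlonglongrightarrow> 0" using LIMSEQ_inverse_real_of_nat by (simp add: inverse_eq_divide)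
 qed
 have par: "(L2_nrm W (%x. jacobian (w n) (at x) - jacobian (w m) (at x)))\<^sup>2 \<le> 2 * (d m - d n) + 4 / real (Suc n)"
  if "n \<le> m" for n m
 proof -
  define a where "a x = jacobian (w n) (at x)" for x
  define b where "b x = jacobian (w m) (at x)" for x
  have ab: "in_L2 W a" "in_L2 W b" unfolding a_def b_def by (rule jL)+
  have p: "(L2_nrm W (%x. a x - b x))\<^sup>2 = 2 * (L2_nrm W a)\<^sup>2 + 2 * (L2_nrm W b)\<^sup>2 - (L2_nrm W (%x. a x + b x))\<^sup>2"
  proof -
   have "(L2_nrm W (%x. a x + (- 1) *\<^sub>R b x))\<^sup>2 = (L2_nrm W a)\<^sup>2 + 2 * (LINT x|lebesgue_on W. a x \<bullet> ((- 1) *\<^sub>R b x)) + (L2_nrm W (%x. (- 1) *\<^sub>R b x))\<^sup>2"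
    by (rule L2_expand[OF ab(1) in_L2_scaleR[OF ab(2)]])
   moreover have "L2_nrm W (%x. (- 1) *\<^sub>R b x) = L2_nrm W b" using L2_nrm_scaleR[of W "-1" b] by simp
   ultimately show ?thesis using L2_expand[OF ab] by simp
  qed
  \<comment> \<open>The midpoint is admissible at level n because n \<le> m, so its energy is at
    least d n; the parallelogram law then bounds the distance of the two gradients by the excess
    energies.\<close>
  define v where "v x = (1/2) *\<^sub>R (w n x + w m x)" for x
  have mn: "1 / real (Suc m) \<le> 1 / real (Suc n)" using that by (intro divide_left_mono) auto
  have "v \<in> A n"
  proof -
   have "L2_nrm W (%x. v x - u x) = L2_nrm W (%x. (1/2) *\<^sub>R ((w n x - u x) + (w m x - u x)))"
   proof -
    have "v x - u x = (1/2) *\<^sub>R ((w n x - u x) + (w m x - u x))" for x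
     by (simp add: v_def algebra_simps flip: scaleR_2)
    then show ?thesis by simp
   qed
   also have "... = (1/2) * L2_nrm W (%x. (w n x - u x) + (w m x - u x))" by (subst L2_nrm_scaleR) simp
   also have "... \<le> (1/2) * (1 / real (Suc n) + 1 / real (Suc n))"
    using L2_nrm_triangle[OF in_L2_diff[OF T[OF wt] u] in_L2_diff[OF T[OF wt] u], of n m] w(1)[of n] w(1)[of m] mn
    by (simp add: A_def)
   finally show ?thesis unfolding A_def v_def by (auto intro!: test_fun_scaleR test_fun_add wt)
  qed
  then have "d n \<le> (?D v)\<^sup>2" by (rule dle)
  also have "?D v = (1/2) * L2_nrm W (%x. a x + b x)"
  proof -
   have "jacobian v (at x) = (1/2) *\<^sub>R (a x + b x)" for x
   proof -
    note dw = test_fun_differentiable[OF wt]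
    have "jacobian v (at x) = (1/2) *\<^sub>R jacobian (%x. w n x + w m x) (at x)"
     unfolding v_def[abs_def] by (rule jacobian_scaleR_diff(3)[OF differentiable_add[OF dw dw] dw])
    also have "jacobian (%x. w n x + w m x) (at x) = a x + b x"
     unfolding a_def b_def by (rule jacobian_scaleR_diff(2)[OF dw dw])
    finally show ?thesis .
   qed
   then show ?thesis by (simp add: L2_nrm_scaleR)
  qed
  finally have "4 * d n \<le> (L2_nrm W (%x. a x + b x))\<^sup>2" by (simp add: power2_eq_square)
  moreover have "(L2_nrm W a)\<^sup>2 < d n + 1 / real (Suc n)" "(L2_nrm W b)\<^sup>2 < d m + 1 / real (Suc m)"
   using w(2)[of n] w(2)[of m] by (simp_all only: a_def[abs_def] b_def[abs_def])
  ultimately have "(L2_nrm W (%x. a x - b x))\<^sup>2 \<le> 2 * (d m - d n) + 4 * (1 / real (Suc n))"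
   unfolding p using mn by (simp add: algebra_simps del: of_nat_Suc)
  then show ?thesis by (simp add: a_def b_def)
 qed
 have small: "\<exists>M. \<forall>j\<ge>M. \<forall>k\<ge>M. L2_nrm W (%x. jacobian (w j) (at x) - jacobian (w k) (at x)) < e" if "e > 0" for e
 proof -
  \<comment> \<open>The estimate \<open>par\<close> contributes less than 2 e' + 4 e' = 6 e', which
    8 e' = e^2 dominates.\<close>
  define e' where "e' = e\<^sup>2 / 8"
  have e': "e' > 0" using that by (simp add: e'_def)
  obtain M1 where M1: "!!j k. j \<ge> M1 ==> k \<ge> M1 ==> \<bar>d j - d k\<bar> < e'"
   using dCauchy e' unfolding Cauchy_def dist_real_def by blast
  obtain M2 where M2: "1 / real (Suc M2) < e'" using nat_approx_posE[OF e'] by metis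
  have *: "L2_nrm W (%x. jacobian (w j) (at x) - jacobian (w k) (at x)) < e" if jk: "j \<ge> max M1 M2" "j \<le> k" for j k
  proof -
   have "1 / real (Suc j) \<le> 1 / real (Suc M2)" using jk by (intro divide_left_mono) auto
   then have q: "4 / real (Suc j) < 4 * e'" using M2 by simp
   have "d k - d j < e'" using M1[of k j] jk by auto
   then have "(L2_nrm W (%x. jacobian (w j) (at x) - jacobian (w k) (at x)))\<^sup>2 < e\<^sup>2"
   proof -
    note par[OF jk(2)]
    also have "2 * (d k - d j) + 4 / real (Suc j) < 2 * e' + 4 * e'"
     using q \<open>d k - d j < e'\<close> by (intro add_strict_mono) simp_all
    also have "... \<le> e\<^sup>2" by (simp add: e'_def)
    finally show ?thesis .
   qed
   then show ?thesis using \<open>e > 0\<close> by (meson less_imp_le power_less_imp_less_base)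
  qed
  have "L2_nrm W (%x. jacobian (w j) (at x) - jacobian (w k) (at x)) < e" if "j \<ge> max M1 M2" "k \<ge> max M1 M2" for j k
   using *[of j k] *[of k j] that L2_nrm_minus_commute[of W "%x. jacobian (w j) (at x)" "%x. jacobian (w k) (at x)"]
   by (cases "j \<le> k") auto
  then show ?thesis by blast
 qed
 have Ws: "W \<in> sets lebesgue" using W by (simp add: lmeasurable_open fmeasurableD)
 obtain J where J: "in_L2 W J" "(%k. L2_nrm W (%x. jacobian (w k) (at x) - J x)) \<longlonglongrightarrow> 0"
  by (rule L2_complete[OF W(2) Ws jL small]) blast
 have wJ: "has_weak_jacobian W u J" by (rule has_weak_jacobian_limit[OF W wt u J(1) wu J(2)])
 moreover have "H1_approx W w u" unfolding H1_approx_iff[OF W u wJ] using wt wu J(2) by simp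
 ultimately show thesis by (rule that)
qed

section \<open>Face means of traces\<close>

lemma in_L2_weak_jacobian:
 assumes "open W" "bounded W" "u \<in> H1 W"
 shows "in_L2 W u" "has_weak_jacobian W u (weak_jacobian W u)" "in_L2 W (weak_jacobian W u)"
proof -
 obtain J where J: "in_L2 W u" "has_weak_jacobian W u J" using assms by (auto simp: H1_def)
 show "in_L2 W u" by (rule J)
 show w: "has_weak_jacobian W u (weak_jacobian W u)"
  by (rule has_weak_jacobian_weak_jacobian[OF assms(1,2) J(2)])
 then show "in_L2 W (weak_jacobian W u)" by (simp add: has_weak_jacobian_def)
qed

context full_polytope
begin

lemma face_mean_diff_bound:
 assumes card: "CARD('n) = 2 \<or> CARD('n) = 3" and W: "open W" "bounded W" and Y: "Y \<in> faces K"
 obtains C where "0 \<le> C" "!!f g :: real^'n => real^'n. f \<in> test_fun W ==> g \<in> test_fun W ==>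
  (norm (face_mean Y f - face_mean Y g))\<^sup>2 \<le> C * ((L2_nrm W (%x. f x - g x))\<^sup>2 +
   L2_nrm W (%x. f x - g x) * L2_nrm W (%x. jacobian f (at x) - jacobian g (at x)))"
proof -
 obtain C where C: "0 \<le> C" "!!f :: real^'n => real^'n. f \<in> test_fun W ==>
  (norm (face_mean Y f))\<^sup>2 \<le> C * ((L2_nrm W f)\<^sup>2 + L2_nrm W f * L2_nrm W (%x. jacobian f (at x)))"
  by (rule trace_inequality[OF card W Y]) (rule that)
 show thesis
 proof (rule that[OF C(1)])
  fix f g :: "real^'n => real^'n" assume fg: "f \<in> test_fun W" "g \<in> test_fun W"
  have "jacobian (%x. f x - g x) (at x) = jacobian f (at x) - jacobian g (at x)" for x
   by (rule jacobian_scaleR_diff(1)) (use fg in \<open>auto intro: test_fun_differentiable\<close>)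
  then show "(norm (face_mean Y f - face_mean Y g))\<^sup>2 \<le> C * ((L2_nrm W (%x. f x - g x))\<^sup>2 +
   L2_nrm W (%x. f x - g x) * L2_nrm W (%x. jacobian f (at x) - jacobian g (at x)))"
   using C(2)[OF test_fun_diff[OF fg]] face_mean_diff[OF Y test_fun_continuous[OF fg(1)] test_fun_continuous[OF fg(2)]]
   by simp
 qed
qed

text \<open>The trace inequality makes the face means of approximating test functions a Cauchy
  sequence whose limit does not depend on the approximation, so the definite description in
  \<open>trace_mean\<close> denotes it.\<close>

lemma trace_mean_LIMSEQ:
 assumes card: "CARD('n) = 2 \<or> CARD('n) = 3" and W: "open W" "bounded W" and Y: "Y \<in> faces K"
  and u: "u \<in> H1 W" and \<phi>: "H1_approx W \<phi> u"
 shows "(%k. face_mean Y (\<phi> k)) \<longlonglongrightarrow> trace_mean W Y u"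
proof -
 obtain C where C: "0 \<le> C" "!!f g :: real^'n => real^'n. f \<in> test_fun W ==> g \<in> test_fun W ==>
  (norm (face_mean Y f - face_mean Y g))\<^sup>2 \<le> C * ((L2_nrm W (%x. f x - g x))\<^sup>2 +
   L2_nrm W (%x. f x - g x) * L2_nrm W (%x. jacobian f (at x) - jacobian g (at x)))"
  by (rule face_mean_diff_bound[OF card W Y]) (rule that)
 define J where "J = weak_jacobian W u"
 note uJ = in_L2_weak_jacobian[OF W u, folded J_def]
 define e where "e f = L2_nrm W (%x. f x - u x) + L2_nrm W (%x. jacobian f (at x) - J x)" for f
 have e0: "0 \<le> e f" for f by (simp add: e_def)
 have T: "in_L2 W f" if "f \<in> test_fun W" for f :: "real^'n => 'c::euclidean_space"
  using test_fun_in_L2[OF that] W by blast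
 have key: "norm (face_mean Y f - face_mean Y g) \<le> sqrt (2 * C) * (e f + e g)"
  if fg: "f \<in> test_fun W" "g \<in> test_fun W" for f g
 proof -
  define a where "a = L2_nrm W (%x. f x - g x)"
  define b where "b = L2_nrm W (%x. jacobian f (at x) - jacobian g (at x))"
  have "a \<le> L2_nrm W (%x. f x - u x) + L2_nrm W (%x. u x - g x)"
   unfolding a_def by (rule L2_nrm_triangle3) (use fg uJ T in auto)
  also have "... \<le> e f + e g" using L2_nrm_minus_commute[of W u g] by (simp add: e_def)
  finally have a: "0 \<le> a" "a \<le> e f + e g" by (simp_all add: a_def)
  have "b \<le> L2_nrm W (%x. jacobian f (at x) - J x) + L2_nrm W (%x. J x - jacobian g (at x))"
   unfolding b_def by (rule L2_nrm_triangle3) (use uJ T[OF test_fun_jacobian[OF fg(1)]] T[OF test_fun_jacobian[OF fg(2)]] in auto)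
  also have "... \<le> e f + e g" using L2_nrm_minus_commute[of W J "%x. jacobian g (at x)"] by (simp add: e_def)
  finally have b: "0 \<le> b" "b \<le> e f + e g" by (simp_all add: b_def)
  have "(norm (face_mean Y f - face_mean Y g))\<^sup>2 \<le> C * (a\<^sup>2 + a * b)" using C(2)[OF fg] by (simp add: a_def b_def)
  also have "... \<le> C * ((e f + e g)\<^sup>2 + (e f + e g) * (e f + e g))"
   using a b C(1) by (intro mult_left_mono add_mono power_mono mult_mono) auto
  also have "... = (sqrt (2 * C) * (e f + e g))\<^sup>2"
  proof -
   have "(sqrt (2 * C))\<^sup>2 = 2 * C" using C(1) by simp
   then show ?thesis unfolding power_mult_distrib by (simp add: power2_eq_square)
  qed
  finally show ?thesis
   by (rule power2_le_imp_le) (use C(1) e0[of f] e0[of g] in simp)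
 qed
 have et: "(%k. e (\<psi> k)) \<longlonglongrightarrow> 0" "!!k. \<psi> k \<in> test_fun W" if "H1_approx W \<psi> u" for \<psi>
  using that H1_approx_iff[OF W uJ(1,2), of \<psi>] tendsto_add[of "%k. L2_nrm W (%x. \<psi> k x - u x)" 0]
  by (auto simp: e_def)
 have "Cauchy (%k. face_mean Y (\<phi> k))"
 proof (rule CauchyI)
  fix \<delta> :: real assume \<delta>: "\<delta> > 0"
  have "(%k. sqrt (2 * C) * (e (\<phi> k))) \<longlonglongrightarrow> sqrt (2 * C) * 0" by (intro tendsto_mult_left et \<phi>)
  then have "\<forall>\<^sub>F k in sequentially. sqrt (2 * C) * e (\<phi> k) < \<delta> / 2" using \<delta> by (intro order_tendstoD) auto
  then obtain M where M: "!!k. k \<ge> M ==> sqrt (2 * C) * e (\<phi> k) < \<delta> / 2"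
   unfolding eventually_sequentially by blast
  have "norm (face_mean Y (\<phi> m) - face_mean Y (\<phi> n)) < \<delta>" if "m \<ge> M" "n \<ge> M" for m n
   using key[OF et(2)[OF \<phi>] et(2)[OF \<phi>], of m n] M[OF that(1)] M[OF that(2)] by (simp add: distrib_left)
  then show "\<exists>M. \<forall>m\<ge>M. \<forall>n\<ge>M. norm (face_mean Y (\<phi> m) - face_mean Y (\<phi> n)) < \<delta>" by blast
 qed
 then obtain a where a: "(%k. face_mean Y (\<phi> k)) \<longlonglongrightarrow> a" using Cauchy_convergent convergent_def by metis
 have all: "(%k. face_mean Y (\<psi> k)) \<longlonglongrightarrow> a" if \<psi>: "H1_approx W \<psi> u" for \<psi>
 proof -
  have "(%k. face_mean Y (\<psi> k) - face_mean Y (\<phi> k)) \<longlonglongrightarrow> 0"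
  proof (rule Lim_null_comparison)
   show "\<forall>\<^sub>F k in sequentially. norm (face_mean Y (\<psi> k) - face_mean Y (\<phi> k)) \<le> sqrt (2 * C) * (e (\<psi> k) + e (\<phi> k))"
    by (intro always_eventually allI key et \<phi> \<psi>)
   have "(%k. sqrt (2 * C) * (e (\<psi> k) + e (\<phi> k))) \<longlonglongrightarrow> sqrt (2 * C) * (0 + 0)"
    by (intro tendsto_mult_left tendsto_add et \<phi> \<psi>)
   then show "(%k. sqrt (2 * C) * (e (\<psi> k) + e (\<phi> k))) \<longlonglongrightarrow> 0" by simp
  qed
  from tendsto_add[OF this a] show ?thesis by simp
 qed
 have "trace_mean W Y u = a"
  unfolding trace_mean_def
 proof (rule the_equality)
  show "\<forall>\<phi>. H1_approx W \<phi> u \<longrightarrow> (%k. face_mean Y (\<phi> k)) \<longlonglongrightarrow> a" using all by blast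
  fix b assume "\<forall>\<phi>. H1_approx W \<phi> u \<longrightarrow> (%k. face_mean Y (\<phi> k)) \<longlonglongrightarrow> b"
  then show "b = a" using \<phi> a LIMSEQ_unique by blast
 qed
 then show ?thesis using a by simp
qed

lemma trace_mean_divergence:
 assumes card: "CARD('n) = 2 \<or> CARD('n) = 3" and W: "open W" "bounded W" and u: "u \<in> H10 W"
 shows "\<bar>\<Sum>Y\<in>faces K. area Y * (trace_mean W Y u \<bullet> normal K Y)\<bar> \<le> sqrt (vol K) * L2_nrm W (weak_div W u)"
proof -
 have u1: "u \<in> H1 W" using u by (simp add: H10_def)
 obtain \<phi> where \<phi>: "H1_approx W \<phi> u" using u by (auto simp: H10_def)
 define J where "J = weak_jacobian W u"
 note uJ = in_L2_weak_jacobian[OF W u1, folded J_def]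
 have t: "!!k. \<phi> k \<in> test_fun W" and l: "(%k. L2_nrm W (%x. jacobian (\<phi> k) (at x) - J x)) \<longlonglongrightarrow> 0"
  using \<phi> unfolding H1_approx_iff[OF W uJ(1,2)] by auto
 have bl: "bounded_linear (trace :: real^'n^'n => real)"
  by (intro linear_conv_bounded_linear[THEN iffD1] linearI) (auto simp: trace_def sum.distrib sum_distrib_left)
 obtain c where c: "!!A :: real^'n^'n. norm (trace A) \<le> norm A * c" "0 \<le> c"
  using bounded_linear.nonneg_bounded[OF bl] by blast
 have jL: "in_L2 W (%x. jacobian (\<phi> k) (at x))" for k
  using test_fun_in_L2[OF test_fun_jacobian[OF t]] W by blast
 have b: "\<bar>\<Sum>Y\<in>faces K. area Y * (face_mean Y (\<phi> k) \<bullet> normal K Y)\<bar>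
  \<le> sqrt (vol K) * (c * L2_nrm W (%x. jacobian (\<phi> k) (at x) - J x) + L2_nrm W (weak_div W u))" for k
 proof -
  have "L2_nrm W (%x. trace (jacobian (\<phi> k) (at x))) = L2_nrm W (%x. trace (jacobian (\<phi> k) (at x) - J x) + trace (J x))"
   by (simp add: linear_simps[OF bl])
  also have "... \<le> L2_nrm W (%x. trace (jacobian (\<phi> k) (at x) - J x)) + L2_nrm W (%x. trace (J x))"
   by (intro L2_nrm_triangle in_L2_bounded_linear[OF _ bl] in_L2_diff jL uJ)
  also have "L2_nrm W (%x. trace (jacobian (\<phi> k) (at x) - J x)) \<le> c * L2_nrm W (%x. jacobian (\<phi> k) (at x) - J x)"
   by (rule L2_nrm_mono[OF in_L2_diff[OF jL uJ(3)] in_L2_bounded_linear[OF in_L2_diff[OF jL uJ(3)] bl]])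
    (use c in \<open>auto simp: mult.commute\<close>)
  also have "(%x. trace (J x)) = weak_div W u" by (auto simp: weak_div_def J_def)
  finally have "L2_nrm W (%x. trace (jacobian (\<phi> k) (at x))) \<le> c * L2_nrm W (%x. jacobian (\<phi> k) (at x) - J x) + L2_nrm W (weak_div W u)"
   by simp
  then show ?thesis
   using divergence_face_means[OF card W t[of k]] by (meson mult_left_mono order_trans real_sqrt_ge_zero measure_nonneg)
 qed
 have "(%k. \<bar>\<Sum>Y\<in>faces K. area Y * (face_mean Y (\<phi> k) \<bullet> normal K Y)\<bar>)
  \<longlonglongrightarrow> \<bar>\<Sum>Y\<in>faces K. area Y * (trace_mean W Y u \<bullet> normal K Y)\<bar>"
  by (intro tendsto_rabs tendsto_sum tendsto_mult_left tendsto_inner tendsto_const trace_mean_LIMSEQ[OF card W _ u1 \<phi>])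
 moreover have "(%k. sqrt (vol K) * (c * L2_nrm W (%x. jacobian (\<phi> k) (at x) - J x) + L2_nrm W (weak_div W u)))
  \<longlonglongrightarrow> sqrt (vol K) * (c * 0 + L2_nrm W (weak_div W u))"
  by (intro tendsto_mult_left tendsto_add tendsto_const l)
 ultimately have "\<bar>\<Sum>Y\<in>faces K. area Y * (trace_mean W Y u \<bullet> normal K Y)\<bar> \<le> sqrt (vol K) * (c * 0 + L2_nrm W (weak_div W u))"
  using b by (intro LIMSEQ_le) auto
 then show ?thesis by simp
qed

end

text \<open>The trace inequality only involves the product of the two norms.\<close>

lemma trace_mean_weak_limit:
 fixes W :: "(real^'n) set"
 assumes card: "CARD('n) = 2 \<or> CARD('n) = 3" and W: "open W" "bounded W"
  and u: "!!m. u m \<in> H10 W" "!!m. L2_nrm W (weak_jacobian W (u m)) \<le> C"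
  and v: "in_L2 W v" "(%m. L2_nrm W (%x. u m x - v x)) \<longlonglongrightarrow> 0"
  and K: "full_polytope K" and Y: "Y \<in> faces K"
 shows "(%m. trace_mean W Y (u m)) \<longlonglongrightarrow> trace_mean W Y v"
proof -
 interpret full_polytope K by (rule K)
 have u1: "u m \<in> H1 W" for m using u(1) by (simp add: H10_def)
 define J where "J m = weak_jacobian W (u m)" for m
 have uJ: "in_L2 W (u m)" "has_weak_jacobian W (u m) (J m)" "in_L2 W (J m)" for m
  unfolding J_def by (rule in_L2_weak_jacobian[OF W u1])+
 have T: "in_L2 W f" if "f \<in> test_fun W" for f :: "real^'n => 'c::euclidean_space"
  using test_fun_in_L2[OF that] W by blast
 \<comment> \<open>A test function close to \<open>u m\<close> in H^1 whose face mean is also close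
   to the mean trace. The mean traces are thereby replaced by face means of test functions that
   converge in L^2 and have bounded gradients.\<close>
 define P where "P m f \<longleftrightarrow> f \<in> test_fun W \<and> L2_nrm W (%x. f x - u m x) < 1 / real (Suc m)
  \<and> L2_nrm W (%x. jacobian f (at x) - J m x) < 1 / real (Suc m)
  \<and> dist (face_mean Y f) (trace_mean W Y (u m)) < 1 / real (Suc m)" for m f
 have "\<exists>f. P m f" for m
 proof -
  obtain \<phi> where \<phi>: "H1_approx W \<phi> (u m)" using u(1) by (auto simp: H10_def)
  have p: "1 / real (Suc m) > 0" by simp
  have t: "\<phi> k \<in> test_fun W" for k using \<phi> by (simp add: H1_approx_def)
  have "\<forall>\<^sub>F k in sequentially. L2_nrm W (%x. \<phi> k x - u m x) < 1 / real (Suc m)"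
   "\<forall>\<^sub>F k in sequentially. L2_nrm W (%x. jacobian (\<phi> k) (at x) - J m x) < 1 / real (Suc m)"
   using \<phi> unfolding H1_approx_iff[OF W uJ(1,2)] by (auto intro: order_tendstoD(2) simp del: of_nat_Suc)
  moreover have "\<forall>\<^sub>F k in sequentially. dist (face_mean Y (\<phi> k)) (trace_mean W Y (u m)) < 1 / real (Suc m)"
   by (rule tendstoD[OF trace_mean_LIMSEQ[OF card W Y u1 \<phi>] p])
  ultimately have "\<forall>\<^sub>F k in sequentially. L2_nrm W (%x. \<phi> k x - u m x) < 1 / real (Suc m)
  \<and> L2_nrm W (%x. jacobian (\<phi> k) (at x) - J m x) < 1 / real (Suc m)
  \<and> dist (face_mean Y (\<phi> k)) (trace_mean W Y (u m)) < 1 / real (Suc m)"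
   by (intro eventually_conj)
  then obtain k where "L2_nrm W (%x. \<phi> k x - u m x) < 1 / real (Suc m)
  \<and> L2_nrm W (%x. jacobian (\<phi> k) (at x) - J m x) < 1 / real (Suc m)
  \<and> dist (face_mean Y (\<phi> k)) (trace_mean W Y (u m)) < 1 / real (Suc m)"
   using eventually_happens'[OF sequentially_bot] by blast
  then have "P m (\<phi> k)" unfolding P_def using t by blast
  then show ?thesis by blast
 qed
 then obtain f where "!!m. P m (f m)" by metis
 then have f: "!!m. f m \<in> test_fun W" "!!m. L2_nrm W (%x. f m x - u m x) < 1 / real (Suc m)"
  "!!m. L2_nrm W (%x. jacobian (f m) (at x) - J m x) < 1 / real (Suc m)"
  "!!m. dist (face_mean Y (f m)) (trace_mean W Y (u m)) < 1 / real (Suc m)"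
  unfolding P_def by simp_all
 have inv0: "(%m. 1 / real (Suc m)) \<longlonglongrightarrow> 0" using LIMSEQ_inverse_real_of_nat by (simp add: inverse_eq_divide)
 have fv: "(%m. L2_nrm W (%x. f m x - v x)) \<longlonglongrightarrow> 0"
 proof (rule Lim_null_comparison)
  show "(%m. 1 / real (Suc m) + L2_nrm W (%x. u m x - v x)) \<longlonglongrightarrow> 0"
   using tendsto_add[OF inv0 v(2)] by simp
  show "\<forall>\<^sub>F m in sequentially. norm (L2_nrm W (%x. f m x - v x)) \<le> 1 / real (Suc m) + L2_nrm W (%x. u m x - v x)"
  proof (intro always_eventually allI)
   fix m
   have "L2_nrm W (%x. f m x - v x) \<le> L2_nrm W (%x. f m x - u m x) + L2_nrm W (%x. u m x - v x)"
    by (rule L2_nrm_triangle3[OF T[OF f(1)] uJ(1) v(1)])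
   then show "norm (L2_nrm W (%x. f m x - v x)) \<le> 1 / real (Suc m) + L2_nrm W (%x. u m x - v x)"
    using f(2)[of m] by simp
  qed
 qed
 have jf: "L2_nrm W (%x. jacobian (f m) (at x)) \<le> C + 1" for m
 proof -
  have "L2_nrm W (%x. (jacobian (f m) (at x) - J m x) + J m x) \<le> L2_nrm W (%x. jacobian (f m) (at x) - J m x) + L2_nrm W (J m)"
   by (intro L2_nrm_triangle in_L2_diff T test_fun_jacobian f uJ)
  then have "L2_nrm W (%x. jacobian (f m) (at x)) \<le> L2_nrm W (%x. jacobian (f m) (at x) - J m x) + L2_nrm W (J m)"
   by simp
  also have "... \<le> 1 / real (Suc m) + C"
   using f(3)[of m] u(2)[of m] unfolding J_def by (rule add_mono[OF less_imp_le])
  also have "... \<le> C + 1" by simp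
  finally show ?thesis .
 qed
 obtain J' w where J': "has_weak_jacobian W v J'" and w: "H1_approx W w v"
  using H10_weak_limit[OF W f(1) v(1) fv jf] by blast
 have v1: "v \<in> H1 W" using v(1) J' by (auto simp: H1_def)
 have wt: "!!k. w k \<in> test_fun W" and wv: "(%k. L2_nrm W (%x. w k x - v x)) \<longlonglongrightarrow> 0"
  and wJ: "(%k. L2_nrm W (%x. jacobian (w k) (at x) - J' x)) \<longlonglongrightarrow> 0"
  using w unfolding H1_approx_iff[OF W v(1) J'] by auto
 have J'L: "in_L2 W J'" using J' by (simp add: has_weak_jacobian_def)
 obtain C' where C': "0 \<le> C'" "!!f g :: real^'n => real^'n. f \<in> test_fun W ==> g \<in> test_fun W ==>
  (norm (face_mean Y f - face_mean Y g))\<^sup>2 \<le> C' * ((L2_nrm W (%x. f x - g x))\<^sup>2 +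
   L2_nrm W (%x. f x - g x) * L2_nrm W (%x. jacobian f (at x) - jacobian g (at x)))"
  by (rule face_mean_diff_bound[OF card W Y]) (rule that)
 \<comment> \<open>The L^2 distances are below a, which tends to zero, and the gradient distances
   below b, which converges; only a^2 + a b enters the bound.\<close>
 have 1: "(%m. face_mean Y (f m) - face_mean Y (w m)) \<longlonglongrightarrow> 0"
 proof -
  define a where "a m = L2_nrm W (%x. f m x - v x) + L2_nrm W (%x. w m x - v x)" for m
  define b where "b m = (C + 1) + (L2_nrm W (%x. jacobian (w m) (at x) - J' x) + L2_nrm W J')" for m
  have a: "a \<longlonglongrightarrow> 0" unfolding a_def[abs_def] using tendsto_add[OF fv wv] by simp
  have b: "b \<longlonglongrightarrow> (C + 1) + (0 + L2_nrm W J')" unfolding b_def[abs_def] by (intro tendsto_add tendsto_const wJ)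
  have "(norm (face_mean Y (f m) - face_mean Y (w m)))\<^sup>2 \<le> C' * ((a m)\<^sup>2 + a m * b m)" for m
  proof -
   have "L2_nrm W (%x. f m x - w m x) \<le> a m"
    using L2_nrm_triangle3[OF T[OF f(1)] v(1) T[OF wt], of m m] L2_nrm_minus_commute[of W "w m" v] by (simp add: a_def)
   moreover have "L2_nrm W (%x. jacobian (f m) (at x) - jacobian (w m) (at x)) \<le> b m"
   proof -
    have "L2_nrm W (%x. jacobian (f m) (at x) - jacobian (w m) (at x)) \<le> L2_nrm W (%x. jacobian (f m) (at x)) + L2_nrm W (%x. jacobian (w m) (at x))"
     by (intro L2_nrm_triangle_diff T test_fun_jacobian f wt)
    moreover have "L2_nrm W (%x. (jacobian (w m) (at x) - J' x) + J' x) \<le> L2_nrm W (%x. jacobian (w m) (at x) - J' x) + L2_nrm W J'"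
     by (intro L2_nrm_triangle in_L2_diff T test_fun_jacobian wt J'L)
    ultimately show ?thesis using jf[of m] by (simp add: b_def)
   qed
   ultimately have "C' * ((L2_nrm W (%x. f m x - w m x))\<^sup>2 + L2_nrm W (%x. f m x - w m x) * L2_nrm W (%x. jacobian (f m) (at x) - jacobian (w m) (at x)))
    \<le> C' * ((a m)\<^sup>2 + a m * b m)"
    using C'(1) by (intro mult_left_mono add_mono power_mono mult_mono) (auto simp: a_def)
   then show ?thesis using C'(2)[OF f(1) wt, of m m] by linarith
  qed
  then have le: "\<forall>\<^sub>F m in sequentially. norm ((norm (face_mean Y (f m) - face_mean Y (w m)))\<^sup>2) \<le> C' * ((a m)\<^sup>2 + a m * b m)"
   by (intro always_eventually allI) simp
  have "(%m. C' * ((a m)\<^sup>2 + a m * b m)) \<longlonglongrightarrow> C' * (0\<^sup>2 + 0 * ((C + 1) + (0 + L2_nrm W J')))"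
   by (intro tendsto_intros a b)
  then have "(%m. C' * ((a m)\<^sup>2 + a m * b m)) \<longlonglongrightarrow> 0" by simp
  with le have "(%m. (norm (face_mean Y (f m) - face_mean Y (w m)))\<^sup>2) \<longlonglongrightarrow> 0"
   by (rule Lim_null_comparison)
  then have "(%m. sqrt ((norm (face_mean Y (f m) - face_mean Y (w m)))\<^sup>2)) \<longlonglongrightarrow> sqrt 0" by (rule tendsto_real_sqrt)
  then show ?thesis by (simp add: tendsto_norm_zero_iff)
 qed
 have 2: "(%m. trace_mean W Y (u m) - face_mean Y (f m)) \<longlonglongrightarrow> 0"
 proof (rule Lim_null_comparison[OF always_eventually inv0], rule allI)
  fix m
  show "norm (trace_mean W Y (u m) - face_mean Y (f m)) \<le> 1 / real (Suc m)"
   using f(4)[of m] unfolding dist_commute[of "face_mean Y (f m)"] unfolding dist_norm by (rule less_imp_le)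
 qed
 have 3: "(%m. face_mean Y (w m)) \<longlonglongrightarrow> trace_mean W Y v"
  by (rule trace_mean_LIMSEQ[OF card W Y v1 w])
 from tendsto_add[OF tendsto_add[OF 2 1] 3] show ?thesis by simp
qed

section \<open>Geometry of the mesh\<close>

lemma full_polytope_simplicial:
 fixes K :: "(real^'n) set"
 assumes "simplicial K" shows "full_polytope K"
proof
 obtain C where C: "\<not> affine_dependent C" "int (card C) = int CARD('n) + 1" "K = convex hull C"
  using assms by (auto simp: simplicial_def simplex)
 then have "finite C" by (simp add: aff_independent_finite)
 then show "polytope K" using C(3) by (auto simp: polytope_def)
 have "aff_dim K = int DIM(real^'n)"
  using C aff_dim_affine_independent[OF C(1)] by (simp add: aff_dim_convex_hull)
 then have "affine hull K = UNIV" by (rule aff_dim_eq_full[THEN iffD1])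
 then have "rel_interior K = interior K" by (rule rel_interior_interior)
 moreover have "K \<noteq> {}" "convex K" using C by (auto simp: convex_convex_hull)
 ultimately show "interior K \<noteq> {}" using rel_interior_eq_empty by blast
qed

lemma continuous_Q1_map: "continuous_on S (Q1_map c)"
 unfolding Q1_map_def by (intro continuous_intros)

text \<open>By invariance of domain the injective continuous \<open>Q1_map\<close> sends the open
  cube onto an open subset of K, which gives interior points.\<close>

lemma full_polytope_quad_hex:
 fixes K :: "(real^'n) set"
 assumes "quad_hex K c" shows "full_polytope K"
proof
 have "K = convex hull (range c)" using assms by (simp add: quad_hex_def)
 then show "polytope K"
  unfolding polytope_def by (intro exI[of _ "range c"] conjI finite_imageI finite_class.finite_UNIV)
 have b: "bij_betw (Q1_map c) (cbox 0 1) K" using assms unfolding quad_hex_def by blast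
 have "inj_on (Q1_map c) (box 0 1)"
  using bij_betw_imp_inj_on[OF b] box_subset_cbox by (rule inj_on_subset)
 then have "open (Q1_map c ` box 0 1)"
  by (rule invariance_of_domain[OF continuous_Q1_map open_box])
 moreover have "Q1_map c ` box 0 1 \<subseteq> K"
  using bij_betw_imp_surj_on[OF b] box_subset_cbox[of 0 1] by blast
 ultimately have "Q1_map c ` box 0 1 \<subseteq> interior K" by (rule interior_maximal[rotated])
 moreover have "box (0::real^'n) 1 \<noteq> {}" by (simp add: interval_ne_empty_cart)
 ultimately show "interior K \<noteq> {}" by blast
qed

text \<open>A face of K that meets the relative interior of Y contains Y, whereas distinct facets
  intersect in a lower dimension.\<close>

lemma (in full_polytope) rel_interior_facet:
 assumes "Y \<in> faces K" "y \<in> rel_interior Y" "\<tau> \<in> faces K" "\<tau> \<noteq> Y"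
 shows "y \<notin> \<tau>"
proof
 assume "y \<in> \<tau>"
 then have "Y \<subseteq> \<tau>" using subset_of_face_of[of \<tau> K Y] facesD assms by blast
 then have "Y \<inter> \<tau> = Y" by auto
 then show False using aff_dim_facet_Int[OF assms(1,3)] assms(4) facesD(5)[OF assms(1)] by simp
qed

lemma (in full_polytope) closure_interior: "closure (interior K) = K"
 using convex_closure_interior[OF convex nonempty_interior] closed by simp

lemma (in full_polytope) vol_pos: "vol K > 0"
proof -
 have "\<not> negligible (interior K)" using nonempty_interior by (intro open_not_negligible) auto
 then have "\<not> negligible K" using interior_subset negligible_subset by blast
 then show ?thesis using lmeasurable_compact[OF compact]
  by (simp add: negligible_iff_measure0 zero_less_measure_iff)
qed

locale mesh =
 fixes X :: "('n::finite) staggered_mesh"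
 assumes mesh: "is_mesh X"
begin

lemma card: "CARD('n) = 2 \<or> CARD('n) = 3"
 and open_domain: "open (domain X)" and bounded_domain: "bounded (domain X)"
 and connected_domain: "connected (domain X)" and domain_nonempty: "domain X \<noteq> {}"
 and domain_regular: "interior (closure (domain X)) = domain X"
 and finite_cells: "finite (cells X)" and Union_cells: "\<Union> (cells X) = closure (domain X)"
 and interior_disjoint: "!!K L. K \<in> cells X ==> L \<in> cells X ==> K \<noteq> L ==> interior K \<inter> interior L = {}"
 and cell_shape: "!!K. K \<in> cells X ==> simplicial K \<or> quad_hex K (corners X K)"
 and face_cases: "!!K Y. K \<in> cells X ==> Y \<in> faces K ==> Y \<subseteq> frontier (domain X) \<or> (\<exists>L. separates X Y K L)"
 and half_diamonds_cell: "!!K. K \<in> cells X ==> half_diamonds X K"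
 using mesh unfolding is_mesh_def by simp_all

lemma cell_full: "K \<in> cells X ==> full_polytope K"
 using cell_shape full_polytope_simplicial full_polytope_quad_hex by blast

lemma interior_cell_subset: "K \<in> cells X ==> interior K \<subseteq> domain X"
 using interior_mono[of K "closure (domain X)"] Union_cells domain_regular by blast

lemma interior_Int_cell:
 assumes "K \<in> cells X" "L \<in> cells X" "K \<noteq> L" shows "interior K \<inter> L = {}"
proof -
 have "interior K \<inter> closure (interior L) = {}"
  using interior_disjoint[OF assms] by (simp add: open_Int_closure_eq_empty)
 then show ?thesis by (simp add: full_polytope.closure_interior[OF cell_full[OF assms(2)]])
qed

lemma ball_Int_interior_cell:
 assumes "M \<in> cells X" "y \<in> M" "e > 0" shows "ball y e \<inter> interior M \<noteq> {}"
proof -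
 have "y \<in> closure (interior M)"
  using full_polytope.closure_interior[OF cell_full[OF assms(1)]] assms(2) by simp
 then obtain z where "z \<in> interior M" "dist z y < e" using assms(3) unfolding closure_approachable by blast
 then have "z \<in> ball y e \<inter> interior M" by (simp add: dist_commute)
 then show ?thesis by blast
qed

lemma negligible_cell_Int:
 assumes "K \<in> cells X" "L \<in> cells X" "K \<noteq> L" shows "negligible (K \<inter> L)"
proof (rule negligible_subset)
 show "negligible (frontier K)"
  by (rule negligible_convex_frontier[OF full_polytope.convex[OF cell_full[OF assms(1)]]])
 show "K \<inter> L \<subseteq> frontier K"
  using interior_Int_cell[OF assms] closure_subset[of K] by (auto simp: frontier_def)
qed

lemma finite_faces: "K \<in> cells X ==> finite (faces K)"
 by (rule full_polytope.finite_faces[OF cell_full])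

text \<open>A boundary point lies in some cell but not in its interior, since interiors of cells are
  contained in the domain; hence the boundary is covered by the frontiers of finitely many convex
  sets.\<close>

lemma negligible_frontier_domain: "negligible (frontier (domain X))"
proof (rule negligible_subset)
 show "negligible (\<Union>K\<in>cells X. frontier K)"
  using finite_cells by (intro negligible_Union)
   (auto intro: negligible_convex_frontier full_polytope.convex[OF cell_full])
 show "frontier (domain X) \<subseteq> (\<Union>K\<in>cells X. frontier K)"
 proof
  fix x assume "x \<in> frontier (domain X)"
  then have x: "x \<in> closure (domain X)" "x \<notin> domain X"
   using interior_open[OF open_domain] by (auto simp: frontier_def)
  then obtain K where K: "K \<in> cells X" "x \<in> K" using Union_cells by blast
  then have "x \<notin> interior K" using interior_cell_subset x by blast
  then have "x \<in> frontier K" using K closure_subset[of K] by (auto simp: frontier_def)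
  then show "x \<in> (\<Union>K\<in>cells X. frontier K)" using K by blast
 qed
qed

lemma lmeasurable_cell: "K \<in> cells X ==> K \<in> lmeasurable"
 using full_polytope.compact[OF cell_full] by (rule lmeasurable_compact)

lemma vol_domain: "vol (domain X) = (\<Sum>K\<in>cells X. vol K)"
proof -
 have "vol (domain X) = vol (\<Union> (cells X))"
  using measure_closure[OF bounded_domain negligible_frontier_domain] Union_cells by simp
 also have "... = (\<Sum>K\<in>cells X. vol K)"
  by (rule measure_negligible_finite_Union[OF finite_cells lmeasurable_cell])
   (auto simp: pairwise_def intro: negligible_cell_Int)
 finally show ?thesis .
qed

lemma vol_pos: "K \<in> cells X ==> vol K > 0"
 by (rule full_polytope.vol_pos[OF cell_full])

lemma cells_nonempty: "cells X \<noteq> {}"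
 using Union_cells domain_nonempty closure_subset[of "domain X"] by auto

lemma vol_domain_pos: "vol (domain X) > 0"
 unfolding vol_domain using finite_cells cells_nonempty vol_pos by (intro sum_pos) auto

lemma area_pos: "K \<in> cells X ==> Y \<in> faces K ==> area Y > 0"
 by (rule full_polytope.area_pos[OF cell_full])

subsection \<open>Adjacent cells\<close>

text \<open>Two cells on the same side of a common facet would overlap near a relative interior point of it.\<close>

lemma normal_opposite:
 assumes K: "K \<in> cells X" "L \<in> cells X" "K \<noteq> L" and Y: "Y \<in> faces K" "Y \<in> faces L"
 shows "normal L Y = - normal K Y"
proof -
 interpret K: full_polytope K by (rule cell_full[OF K(1)])
 interpret L: full_polytope L by (rule cell_full[OF K(2)])
 have "normal L Y = normal K Y \<or> normal L Y = - normal K Y"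
 proof (rule hyperplane_normal_unique)
  show "Y \<subseteq> {x. normal L Y \<bullet> x = offset L Y}" using L.normal_offset(3)[OF Y(2)] by blast
  show "Y \<subseteq> {x. normal K Y \<bullet> x = offset K Y}" using K.normal_offset(3)[OF Y(1)] by blast
 qed (use K.facesD[OF Y(1)] K.normal_offset(1)[OF Y(1)] L.normal_offset(1)[OF Y(2)] in simp_all)
 moreover have "normal L Y \<noteq> normal K Y"
 proof
  assume eq: "normal L Y = normal K Y"
  then have eqo: "offset L Y = offset K Y" by (simp add: offset_def)
  obtain y where y: "y \<in> rel_interior Y"
   using K.facesD[OF Y(1)] rel_interior_eq_empty by blast
  then have yY: "y \<in> Y" using rel_interior_subset by blast
  obtain e1 where e1: "e1 > 0" "!!x. x \<in> ball y e1 ==> x \<in> K \<longleftrightarrow> normal K Y \<bullet> x \<le> offset K Y"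
   using K.local_halfspace[OF Y(1) yY K.rel_interior_facet[OF Y(1) y]] by blast
  obtain e2 where e2: "e2 > 0" "!!x. x \<in> ball y e2 ==> x \<in> L \<longleftrightarrow> normal L Y \<bullet> x \<le> offset L Y"
   using L.local_halfspace[OF Y(2) yY L.rel_interior_facet[OF Y(2) y]] by blast
  have "y \<in> K" using yY K.facesD(4)[OF Y(1)] by blast
  then have "ball y (min e1 e2) \<inter> interior K \<noteq> {}"
   using e1(1) e2(1) by (intro ball_Int_interior_cell K(1)) simp_all
  then obtain z where z: "z \<in> ball y (min e1 e2)" "z \<in> interior K" by blast
  then have "z \<in> K" using interior_subset by blast
  then have "z \<in> L" using e1(2)[of z] e2(2)[of z] z(1) eq eqo by simp
  then show False using interior_Int_cell[OF K] z(2) by blast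
 qed
 ultimately show ?thesis by blast
qed

text \<open>Three cells at one face would have pairwise opposite normals, which forces the normal to
  vanish.\<close>

lemma at_most_two_cells:
 assumes "K \<in> cells X" "L \<in> cells X" "M \<in> cells X" "Y \<in> faces K" "Y \<in> faces L" "Y \<in> faces M" "K \<noteq> L"
 shows "M = K \<or> M = L"
proof (rule ccontr)
 assume "\<not> (M = K \<or> M = L)"
 then have ne: "K \<noteq> M" "L \<noteq> M" by auto
 have "normal M Y = - normal K Y" by (rule normal_opposite[OF assms(1,3) ne(1) assms(4,6)])
 moreover have "normal M Y = - normal L Y" by (rule normal_opposite[OF assms(2,3) ne(2) assms(5,6)])
 moreover have "normal L Y = - normal K Y" by (rule normal_opposite[OF assms(1,2,7,4,5)])
 ultimately have "normal K Y + normal K Y = 0" by (simp add: eq_neg_iff_add_eq_0)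
 then have "normal K Y = 0" by (simp flip: scaleR_2)
 then show False using full_polytope.normal_offset(1)[OF cell_full[OF assms(1)] assms(4)] by simp
qed

lemma separatesD:
 assumes "separates X Y K L"
 shows "K \<in> cells X" "L \<in> cells X" "K \<noteq> L" "Y \<in> faces K" "Y \<in> faces L"
  "neighbour X K Y = L" "separates X Y L K" "Y \<in> int_faces X" "{M\<in>cells X. Y \<in> faces M} = {K, L}"
proof -
 show c: "K \<in> cells X" "L \<in> cells X" "K \<noteq> L" "Y \<in> faces K" "Y \<in> faces L"
  using assms by (auto simp: separates_def)
 show "separates X Y L K" using assms by (auto simp: separates_def)
 show "Y \<in> int_faces X" using assms by (auto simp: int_faces_def)
 show "{M\<in>cells X. Y \<in> faces M} = {K, L}" using c at_most_two_cells by blast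
 show "neighbour X K Y = L"
  unfolding neighbour_def
 proof (rule the_equality)
  show "separates X Y K L" by (rule assms)
  fix M assume "separates X Y K M"
  then show "M = L" using c at_most_two_cells[of K L M Y] by (auto simp: separates_def)
 qed
qed

lemma int_face_separates:
 assumes "K \<in> cells X" "Y \<in> faces K" "Y \<in> int_faces X"
 shows "separates X Y K (neighbour X K Y)"
proof -
 obtain K' L where s: "separates X Y K' L" using assms(3) by (auto simp: int_faces_def)
 have "K \<in> {M\<in>cells X. Y \<in> faces M}" using assms by simp
 then have "K = K' \<or> K = L" using separatesD(9)[OF s] by simp
 then show ?thesis using s separatesD(6,7)[OF s] separatesD(6)[OF separatesD(7)[OF s]] by auto
qed

lemma neighbour_props:
 assumes "K \<in> cells X" "Y \<in> faces K" "Y \<in> int_faces X"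
 shows "neighbour X K Y \<in> cells X" "Y \<in> faces (neighbour X K Y)"
  "neighbour X (neighbour X K Y) Y = K" "normal (neighbour X K Y) Y = - normal K Y"
  "neighbour X K Y \<noteq> K" "{M\<in>cells X. Y \<in> faces M} = {K, neighbour X K Y}"
proof -
 note s = int_face_separates[OF assms]
 note d = separatesD[OF s]
 show "neighbour X K Y \<in> cells X" "Y \<in> faces (neighbour X K Y)" "neighbour X K Y \<noteq> K"
  "{M\<in>cells X. Y \<in> faces M} = {K, neighbour X K Y}" using d by auto
 show "neighbour X (neighbour X K Y) Y = K" by (rule separatesD(6)[OF d(7)])
 show "normal (neighbour X K Y) Y = - normal K Y" by (rule normal_opposite) (use d in auto)
qed

lemma all_faces_cases:
 assumes "K \<in> cells X" "Y \<in> faces K" shows "Y \<in> int_faces X \<or> Y \<in> ext_faces X"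
 using face_cases[OF assms] assms by (auto simp: ext_faces_def int_faces_def all_faces_def)

lemma finite_all_faces: "finite (all_faces X)"
 unfolding all_faces_def using finite_cells finite_faces by blast

lemma int_faces_subset: "int_faces X \<subseteq> all_faces X"
 by (auto simp: int_faces_def all_faces_def separates_def)

lemma finite_int_faces: "finite (int_faces X)"
 using finite_subset[OF int_faces_subset finite_all_faces] .

lemma HE0_zero: "u \<in> HE0 X ==> Y \<in> all_faces X ==> Y \<notin> int_faces X ==> u Y = 0"
 using all_faces_cases by (auto simp: HE0_def all_faces_def)

definition int_face_set :: "(real^'n) set => (real^'n) set set" where
 "int_face_set K = faces K \<inter> int_faces X"

text \<open>Passing to the neighbour is an involution on the pairs of a cell and one of its internal
  faces. Combined with fluxes that change sign under it, this is discrete integration by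
  parts.\<close>

lemma sum_neighbour_swap:
 fixes g :: "(real^'n) set => (real^'n) set => 'b::comm_monoid_add"
 shows "(\<Sum>K\<in>cells X. \<Sum>Y\<in>int_face_set K. g K Y) = (\<Sum>K\<in>cells X. \<Sum>Y\<in>int_face_set K. g (neighbour X K Y) Y)"
proof -
 have fin: "\<forall>K\<in>cells X. finite (int_face_set K)" using finite_faces by (auto simp: int_face_set_def)
 show ?thesis
  unfolding sum.Sigma[OF finite_cells fin]
  by (rule sum.reindex_bij_witness[where i="%(K, Y). (neighbour X K Y, Y)" and j="%(K, Y). (neighbour X K Y, Y)"])
   (auto simp: int_face_set_def neighbour_props)
qed

lemma sum_int_faces:
 fixes g :: "(real^'n) set => (real^'n) set => 'b::comm_monoid_add"
 shows "(\<Sum>Y\<in>int_faces X. \<Sum>K\<in>{K\<in>cells X. Y \<in> faces K}. g K Y) = (\<Sum>K\<in>cells X. \<Sum>Y\<in>int_face_set K. g K Y)"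
proof -
 have "int_face_set K = {Y \<in> int_faces X. Y \<in> faces K}" for K by (auto simp: int_face_set_def)
 then show ?thesis
  using sum.swap_restrict[OF finite_cells finite_int_faces, of g "%K Y. Y \<in> faces K"] by simp
qed

lemma sum_all_faces:
 fixes g :: "(real^'n) set => (real^'n) set => 'b::comm_monoid_add"
 shows "(\<Sum>Y\<in>all_faces X. \<Sum>K\<in>{K\<in>cells X. Y \<in> faces K}. g K Y) = (\<Sum>K\<in>cells X. \<Sum>Y\<in>faces K. g K Y)"
proof -
 have "(\<Sum>K\<in>cells X. \<Sum>Y\<in>{Y \<in> all_faces X. Y \<in> faces K}. g K Y) = (\<Sum>K\<in>cells X. \<Sum>Y\<in>faces K. g K Y)"
 proof (rule sum.cong[OF refl])
  fix K assume "K \<in> cells X"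
  then have "{Y \<in> all_faces X. Y \<in> faces K} = faces K" by (auto simp: all_faces_def)
  then show "(\<Sum>Y\<in>{Y \<in> all_faces X. Y \<in> faces K}. g K Y) = (\<Sum>Y\<in>faces K. g K Y)" by simp
 qed
 then show ?thesis
  using sum.swap_restrict[OF finite_cells finite_all_faces, of g "%K Y. Y \<in> faces K"] by simp
qed

subsection \<open>Half-diamonds\<close>

lemma vol_half_diamond:
 assumes "K \<in> cells X" "Y \<in> faces K"
 shows "vol (half_diamond X K Y) > 0" "half_diamond X K Y \<subseteq> K" "half_diamond X K Y \<in> lmeasurable"
proof -
 note H = half_diamonds_cell[OF assms(1), unfolded half_diamonds_def]
 have h: "half_diamond X K Y \<in> sets lebesgue" "vol (half_diamond X K Y) = vol K / real (card (faces K))"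
  "(\<Union>Y\<in>faces K. half_diamond X K Y) = K"
  using bspec[OF conjunct1[OF H] assms(2)] conjunct1[OF conjunct2[OF H]] by simp_all
 have "card (faces K) > 0" using finite_faces[OF assms(1)] assms(2) by (auto simp: card_gt_0_iff)
 then show "vol (half_diamond X K Y) > 0" using h(2) vol_pos[OF assms(1)] by simp
 show s: "half_diamond X K Y \<subseteq> K" using h(3) assms(2) by blast
 show "half_diamond X K Y \<in> lmeasurable"
  using s h(1) lmeasurable_cell[OF assms(1)] fmeasurableI2 by blast
qed

lemma vol_dual_cell: "vol (dual_cell X Y) = (\<Sum>K\<in>{K\<in>cells X. Y \<in> faces K}. vol (half_diamond X K Y))"
 unfolding dual_cell_def
proof (rule measure_negligible_finite_Union_image)
 show "finite {K \<in> cells X. Y \<in> faces K}" using finite_cells by simp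
 show "half_diamond X K Y \<in> lmeasurable" if "K \<in> {K \<in> cells X. Y \<in> faces K}" for K
  using that vol_half_diamond by auto
 show "pairwise (%K L. negligible (half_diamond X K Y \<inter> half_diamond X L Y)) {K \<in> cells X. Y \<in> faces K}"
  unfolding pairwise_def
 proof (intro ballI impI)
  fix K L assume "K \<in> {K \<in> cells X. Y \<in> faces K}" "L \<in> {K \<in> cells X. Y \<in> faces K}" "K \<noteq> L"
  then show "negligible (half_diamond X K Y \<inter> half_diamond X L Y)"
   by (intro negligible_subset[OF negligible_cell_Int[of K L]]) (use vol_half_diamond(2) in auto)
 qed
qed

lemma vol_dual_cell_pos: "Y \<in> all_faces X ==> vol (dual_cell X Y) > 0"
 unfolding vol_dual_cell using finite_cells vol_half_diamond
 by (intro sum_pos) (auto simp: all_faces_def)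

subsection \<open>Connectedness of the adjacency graph\<close>

text \<open>A segment joining two cells can be chosen to avoid all intersections of two facets of a cell;
 it then passes from cell to cell through internal faces.\<close>

lemma constant_of_equal_neighbours:
 fixes q :: "(real^'n) set => 'b"
 assumes q: "!!K Y. K \<in> cells X ==> Y \<in> faces K ==> Y \<in> int_faces X ==> q (neighbour X K Y) = q K"
  and K0: "K0 \<in> cells X" and L0: "L0 \<in> cells X"
 shows "q L0 = q K0"
proof (rule ccontr)
 assume neq: "q L0 \<noteq> q K0"
 \<comment> \<open>If q were not constant, the cells would split into two families with closed
   unions covering the connected domain, so the unions meet. The contradiction arises at a meeting
   point where two cells of the first family fill a whole neighbourhood.\<close>
 define A where "A = {K\<in>cells X. q K = q K0}"
 define B where "B = {K\<in>cells X. q K \<noteq> q K0}"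
 have AB: "finite A" "finite B" "K0 \<in> A" "L0 \<in> B" "A \<union> B = cells X" "A \<inter> B = {}"
  using finite_cells neq K0 L0 by (auto simp: A_def B_def)
 have cl: "closed (\<Union>A)" "closed (\<Union>B)"
  using AB full_polytope.closed[OF cell_full] by (auto intro!: closed_Union)
 have cov: "domain X \<subseteq> \<Union>A \<union> \<Union>B" using Union_cells closure_subset[of "domain X"] AB(5) by blast
 have meet: "\<exists>y\<in>S. y \<in> \<Union>A \<and> y \<in> \<Union>B"
  if "connected S" "S \<subseteq> domain X" "S \<inter> \<Union>A \<noteq> {}" "S \<inter> \<Union>B \<noteq> {}" for S
 proof (rule ccontr)
  assume "\<not> (\<exists>y\<in>S. y \<in> \<Union>A \<and> y \<in> \<Union>B)"
  then have "\<Union>A \<inter> \<Union>B \<inter> S = {}" by blast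
  then show False using that cl cov unfolding connected_closed by (metis Int_commute order_trans)
 qed
 have inA: "domain X \<inter> \<Union>A \<noteq> {}" "domain X \<inter> \<Union>B \<noteq> {}"
 proof -
  have "interior K0 \<noteq> {}" "interior L0 \<noteq> {}" using cell_full K0 L0 full_polytope.nonempty_interior by blast+
  then show "domain X \<inter> \<Union>A \<noteq> {}" "domain X \<inter> \<Union>B \<noteq> {}"
   using interior_cell_subset K0 L0 interior_subset AB(3,4) by blast+
 qed
 obtain x where x: "x \<in> domain X" "x \<in> \<Union>A" "x \<in> \<Union>B" using meet[OF connected_domain _ inA] by blast
 obtain K where K: "K \<in> A" "x \<in> K" using x by blast
 obtain L where L: "L \<in> B" "x \<in> L" using x by blast
 have KX: "K \<in> cells X" and LX: "L \<in> cells X" using K L AB(5) by blast+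
 obtain r where r: "r > 0" "ball x r \<subseteq> domain X" using open_domain x(1) openE by blast
 obtain a where a: "a \<in> ball x r" "a \<in> interior K" using ball_Int_interior_cell[OF KX K(2) r(1)] by blast
 \<comment> \<open>The pairs of distinct facets whose intersections are to be avoided. Together with
   a, each intersection spans at most a hyperplane, so almost every endpoint b in the second cell
   gives a segment that misses all of them.\<close>
 define I where "I = {(Y, \<tau>). \<exists>C\<in>cells X. Y \<in> faces C \<and> \<tau> \<in> faces C \<and> Y \<noteq> \<tau>}"
 have "I \<subseteq> all_faces X \<times> all_faces X" by (auto simp: I_def all_faces_def)
 then have finI: "finite I" using finite_all_faces finite_subset by blast
 have low: "negligible (affine hull (insert a (Y \<inter> \<tau>)))" if st: "(Y, \<tau>) \<in> I" for Y \<tau>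
 proof -
  obtain C where C: "C \<in> cells X" "Y \<in> faces C" "\<tau> \<in> faces C" "Y \<noteq> \<tau>" using st by (auto simp: I_def)
  have "aff_dim (Y \<inter> \<tau>) \<le> int CARD('n) - 2"
   by (rule full_polytope.aff_dim_facet_Int[OF cell_full[OF C(1)] C(2-4)])
  then have "aff_dim (affine hull (insert a (Y \<inter> \<tau>))) < int CARD('n)" by (simp add: aff_dim_insert)
  then have "interior (affine hull (insert a (Y \<inter> \<tau>))) = {}"
   using aff_dim_nonempty_interior[of "affine hull (insert a (Y \<inter> \<tau>))"] by fastforce
  then show ?thesis
   using negligible_convex_frontier[of "affine hull (insert a (Y \<inter> \<tau>))"]
   by (simp add: frontier_def affine_imp_convex closed_affine_hull)
 qed
 have neg: "negligible (\<Union>(Y, \<tau>)\<in>I. affine hull (insert a (Y \<inter> \<tau>)))"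
  using finI low by (intro negligible_Union) auto
 have "\<not> negligible (ball x r \<inter> interior L)" using ball_Int_interior_cell[OF LX L(2) r(1)] by (intro open_not_negligible) auto
 then have "\<not> ball x r \<inter> interior L \<subseteq> (\<Union>(Y, \<tau>)\<in>I. affine hull (insert a (Y \<inter> \<tau>)))"
  using neg negligible_subset by blast
 then obtain b where b: "b \<in> ball x r" "b \<in> interior L" "!!Y \<tau>. (Y, \<tau>) \<in> I ==> b \<notin> affine hull (insert a (Y \<inter> \<tau>))"
  by blast
 have avoid: "y \<notin> Y \<inter> \<tau>" if y: "y \<in> closed_segment a b" and st: "(Y, \<tau>) \<in> I" for y Y \<tau>
 proof
  assume e: "y \<in> Y \<inter> \<tau>"
  obtain t where t: "0 \<le> t" "t \<le> 1" "y = (1 - t) *\<^sub>R a + t *\<^sub>R b" using y by (auto simp: closed_segment_def)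
  obtain C where C: "C \<in> cells X" "Y \<in> faces C" using st by (auto simp: I_def)
  have "t \<noteq> 0"
  proof
   assume "t = 0"
   then have "a \<in> Y" using t e by simp
   then have "a \<in> C" "a \<notin> interior C"
    using full_polytope.facesD(4)[OF cell_full[OF C(1)] C(2)] full_polytope.interiorI_iff[OF cell_full[OF C(1)]] C(2) by blast+
   then show False using a(2) interior_Int_cell[OF KX C(1)] by blast
  qed
  moreover have "y - a = t *\<^sub>R (b - a)" using t(3) by (simp add: algebra_simps)
  ultimately have "b = a + (1 / t) *\<^sub>R (y - a)" by simp
  moreover have "a + (1 / t) *\<^sub>R (y - a) \<in> affine hull (insert a (Y \<inter> \<tau>))"
   using e by (intro mem_affine_3_minus) (auto simp: hull_inc)
  ultimately show False using b(3)[OF st] by simp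
 qed
 have seg: "closed_segment a b \<subseteq> domain X"
  using a(1) b(1) r(2) closed_segment_subset[OF a(1) b(1) convex_ball] by blast
 have "closed_segment a b \<inter> \<Union>A \<noteq> {}" "closed_segment a b \<inter> \<Union>B \<noteq> {}"
  using a(2) b(2) interior_subset K(1) L(1) ends_in_segment by blast+
 then obtain y where y: "y \<in> closed_segment a b" "y \<in> \<Union>A" "y \<in> \<Union>B"
  using meet[OF connected_segment(1) seg] by blast
 obtain K' where K': "K' \<in> A" "y \<in> K'" using y by blast
 obtain L' where L': "L' \<in> B" "y \<in> L'" using y by blast
 have K'X: "K' \<in> cells X" and L'X: "L' \<in> cells X" and KL': "K' \<noteq> L'" using K' L' AB by blast+
 interpret K': full_polytope K' by (rule cell_full[OF K'X])
 have "y \<notin> interior K'" using interior_Int_cell[OF K'X L'X KL'] L'(2) by blast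
 then obtain Y where Y: "Y \<in> faces K'" "y \<in> Y" using K'.interiorI_iff K'(2) by blast
 have "y \<notin> frontier (domain X)"
  using y(1) seg interior_open[OF open_domain] by (auto simp: frontier_def)
 then obtain M where M: "separates X Y K' M" using face_cases[OF K'X Y(1)] Y(2) by blast
 note Md = separatesD[OF M]
 have "q M = q K'" using q[OF K'X Y(1) Md(8)] Md(6) by simp
 then have MA: "M \<in> A" using K'(1) Md(2) by (simp add: A_def)
 interpret M: full_polytope M by (rule cell_full[OF Md(2)])
 have yM: "y \<in> M" using M.facesD(4)[OF Md(5)] Y(2) by blast
 have oK: "y \<notin> \<tau>" if "\<tau> \<in> faces K'" "\<tau> \<noteq> Y" for \<tau>
  using avoid[OF y(1), of Y \<tau>] Y that K'X by (auto simp: I_def)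
 have oM: "y \<notin> \<tau>" if "\<tau> \<in> faces M" "\<tau> \<noteq> Y" for \<tau>
  using avoid[OF y(1), of Y \<tau>] Y that Md(2,5) by (auto simp: I_def)
 obtain e1 where e1: "e1 > 0" "!!z. z \<in> ball y e1 ==> z \<in> K' \<longleftrightarrow> normal K' Y \<bullet> z \<le> offset K' Y"
  using K'.local_halfspace[OF Y oK] by blast
 obtain e2 where e2: "e2 > 0" "!!z. z \<in> ball y e2 ==> z \<in> M \<longleftrightarrow> normal M Y \<bullet> z \<le> offset M Y"
  using M.local_halfspace[OF Md(5) Y(2) oM] by blast
 have nM: "normal M Y = - normal K' Y" by (rule normal_opposite[OF K'X Md(2) Md(3) Y(1) Md(5)])
 then have "offset M Y = - offset K' Y" by (simp add: offset_def)
 have "min e1 e2 > 0" using e1(1) e2(1) by simp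
 from ball_Int_interior_cell[OF L'X L'(2) this]
 obtain z where z: "z \<in> ball y (min e1 e2)" "z \<in> interior L'" by blast
 \<comment> \<open>Near y the two cells are complementary closed half spaces and together fill a
   ball, while the interior of L' has points in every ball around y.\<close>
 have "z \<in> K' \<or> z \<in> M"
  using e1(2)[of z] e2(2)[of z] z(1) nM \<open>offset M Y = - offset K' Y\<close> by auto
 moreover have "L' \<noteq> K'" "L' \<noteq> M" using KL' L'(1) MA AB(6) by auto
 ultimately show False
  using interior_Int_cell[OF L'X K'X] interior_Int_cell[OF L'X Md(2)] z(2) by blast
qed

end

section \<open>The viscous term\<close>

text \<open>Regularity inside a single cell, where the shape functions are smooth although they jump
  across faces. Boundedness of the gradient makes it square integrable over the cell.\<close>

definition bounded_smooth_on :: "(real^'n) set => (real^'n => real) => bool" where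
 "bounded_smooth_on U f \<longleftrightarrow> (\<forall>x\<in>U. f differentiable (at x)) \<and> continuous_on U (grad f) \<and> bounded (grad f ` U)"

lemma bounded_smooth_on_cong:
 assumes "open U" "!!x. x \<in> U ==> f x = g x" "bounded_smooth_on U g"
 shows "bounded_smooth_on U f"
proof -
 have d: "(f has_derivative frechet_derivative g (at x)) (at x)" if "x \<in> U" for x
 proof (rule has_derivative_transform_within_open[OF _ assms(1) that])
  show "(g has_derivative frechet_derivative g (at x)) (at x)"
   using assms(3) that by (intro frechet_derivative_has) (simp add: bounded_smooth_on_def)
 qed (use assms(2) in simp)
 then have e: "grad f x = grad g x" if "x \<in> U" for x
  using frechet_derivativeI[OF d[OF that]] by (simp add: grad_def)
 have "continuous_on U (grad f)"
  using assms(3) e continuous_on_cong[OF refl, of U "grad f" "grad g"] by (simp add: bounded_smooth_on_def)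
 moreover have "grad f ` U = grad g ` U" using e by (rule image_cong[OF refl])
 ultimately show ?thesis
  using assms(3) d by (auto simp: bounded_smooth_on_def differentiable_def)
qed

lemma C_k_nth0: "C_k k (%x::real^'n. x $ i)"
 using C_k_nth[of k i 0] by simp

lemma C_k_rannacher_turek:
 fixes g :: "real^'n::finite => real"
 assumes "g \<in> rannacher_turek_funs" shows "C_k k g"
proof -
 obtain a b c where g: "g = (%x. a + (\<Sum>i\<in>UNIV. b i * x $ i)
   + (\<Sum>i\<in>UNIV. \<Sum>j\<in>UNIV. c i j * ((x $ i)\<^sup>2 - (x $ j)\<^sup>2)))"
  using assms unfolding rannacher_turek_funs_def by blast
 have n: "C_k k (%x::real^'n. c * x $ i)" for c :: real and i
  using C_k_scaleR[OF C_k_const[of k c] C_k_nth0[of k i]] by simp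
 have "C_k k (%x::real^'n. c * (x $ i * x $ i) + (- c) * (x $ j * x $ j))" for c :: real and i j
 proof -
  have m: "C_k k (%x::real^'n. c * (x $ i * x $ i))" for c :: real and i
   using C_k_scaleR[OF C_k_const[of k c] C_k_scaleR[OF C_k_nth0[of k i] C_k_nth0[of k i]]] by simp
  show ?thesis by (rule C_k_add[OF m m])
 qed
 then have "C_k k (%x. c i j * ((x $ i)\<^sup>2 - (x $ j)\<^sup>2))" for i j
  by (simp add: power2_eq_square right_diff_distrib)
 then show ?thesis unfolding g by (intro C_k_add C_k_const C_k_sum n)
qed

lemma C_k_Q1_map: "C_k k (Q1_map c)"
proof -
 have n: "C_k k (%x::real^'a. 1 - x $ i)" for i
  using C_k_add[OF C_k_const[of k 1] C_k_scaleR[OF C_k_const[of k "-1"] C_k_nth0[of k i]]] by simp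
 have p: "C_k k (%x::real^'a. (\<Prod>i\<in>S. x $ i) * (\<Prod>i\<in>- S. 1 - x $ i))" for S
 proof -
  have "C_k k (%x::real^'a. \<Prod>i\<in>S. x $ i)" by (rule C_k_prod) (rule C_k_nth0)
  moreover have "C_k k (%x::real^'a. \<Prod>i\<in>- S. 1 - x $ i)" by (rule C_k_prod) (rule n)
  ultimately show ?thesis using C_k_scaleR[of k "%x::real^'a. \<Prod>i\<in>S. x $ i" "%x::real^'a. \<Prod>i\<in>- S. 1 - x $ i"] by simp
 qed
 show ?thesis unfolding Q1_map_def[abs_def] by (intro C_k_sum C_k_scaleR p C_k_const)
qed

lemma C_k_1_D:
 assumes "C_k 1 f" shows "f differentiable (at x)" "continuous_on UNIV (%x. frechet_derivative f (at x) v)"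
 using assms C_k_continuous[OF C_k_frechet[of 0 f v]] by simp_all

lemma continuous_on_det:
 fixes A :: "'a::topological_space => real^'n^'n"
 assumes "!!i j. continuous_on S (%x. A x $ i $ j)" shows "continuous_on S (%x. det (A x))"
 unfolding det_def by (intro continuous_intros assms)

text \<open>The derivative of the inverse of the \<open>Q\<^sub>1\<close> mapping is given by Cramer's rule, hence continuous up to
 the boundary.\<close>

lemma bounded_smooth_quad_hex:
 fixes c :: "'n::finite set => real^'n"
 assumes q: "quad_hex K c" and g: "g \<in> rannacher_turek_funs"
 shows "bounded_smooth_on (interior K) (g \<circ> inv_into (cbox 0 1) (Q1_map c))"
proof -
 define Q where "Q = Q1_map c"
 define I where "I = inv_into (cbox 0 1) Q"
 define J where "J x = jacobian Q (at x)" for x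
 have b: "bij_betw Q (cbox 0 1) K" and inv: "!!x. x \<in> cbox 0 1 ==> invertible (J x)"
  using q unfolding quad_hex_def Q_def J_def by blast+
 have QI: "Q (I y) = y" and IQ: "I y \<in> cbox 0 1" if "y \<in> K" for y
  using b that unfolding I_def by (auto simp: bij_betw_def f_inv_into_f inv_into_into)
 have Qd: "Q differentiable (at x)" and Qc: "continuous_on UNIV (%x. frechet_derivative Q (at x) v)" for x v
  using C_k_1_D[OF C_k_Q1_map[of 1 c]] by (simp_all add: Q_def)
 have Jh: "(Q has_derivative (%h. J x *v h)) (at x)" for x
  using jacobian_works[THEN iffD1, OF Qd] by (simp add: J_def)
 have Jc: "continuous_on S (%x. J x $ i $ j)" for S i j
  using continuous_on_subset[OF Qc[of "axis j 1"], of S]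
  by (simp add: J_def jacobian_def matrix_def continuous_on_component)
 have Ic: "continuous_on K I"
 proof -
  have "continuous_on (Q ` cbox 0 1) I"
   by (rule continuous_on_inv) (auto simp: Q_def I_def continuous_Q1_map inv_into_f_f bij_betw_imp_inj_on[OF b[unfolded Q_def]])
  then show ?thesis using b by (simp add: bij_betw_def)
 qed
 have dJ: "det (J x) \<noteq> 0" if "x \<in> cbox 0 1" for x using inv[OF that] by (simp add: invertible_det_nz)
 define z where "z k x = (\<chi> l. det (\<chi> i j. if j = l then axis k 1 $ i else J x $ i $ j) / det (J x))" for k x
 have zc: "continuous_on (cbox 0 1) (z k)" for k
  unfolding z_def
 proof (intro continuous_on_vec_lambda continuous_on_divide continuous_on_det)
  fix l i j
  show "continuous_on (cbox 0 1) (%x. (\<chi> i j. if j = l then axis k 1 $ i else J x $ i $ j) $ i $ j)"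
   using Jc by (cases "j = l") simp_all
 qed (auto simp: dJ Jc)
 have matrix_inv: "J x ** matrix_inv (J x) = mat 1" "matrix_inv (J x) ** J x = mat 1" if "x \<in> cbox 0 1" for x
  using someI_ex[OF inv[OF that, unfolded invertible_def]] unfolding matrix_inv_def by blast+
 have zm: "matrix_inv (J x) *v axis k 1 = z k x" if "x \<in> cbox 0 1" for x k
 proof -
  have "J x ** matrix_inv (J x) = mat 1" by (rule matrix_inv(1)[OF that])
  then have "J x *v (matrix_inv (J x) *v axis k 1) = axis k 1"
   by (simp add: matrix_vector_mul_assoc)
  then show ?thesis using cramer[OF dJ[OF that], of "matrix_inv (J x) *v axis k 1" "axis k 1"] by (simp add: z_def)
 qed
 have gd: "g differentiable (at x)" and gc: "continuous_on UNIV (%x. frechet_derivative g (at x) v)" for x v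
  using C_k_1_D[OF C_k_rannacher_turek[OF g, of 1]] by simp_all
 \<comment> \<open>The gradient of the composition expressed on the reference cube by the chain
   rule; its continuity on the compact cube yields both continuity and boundedness on the
   cell.\<close>
 define \<Phi> where "\<Phi> x = (\<chi> k. \<Sum>i\<in>UNIV. z k x $ i * frechet_derivative g (at x) (axis i 1))" for x
 have Pc: "continuous_on (cbox 0 1) \<Phi>"
  unfolding \<Phi>_def by (intro continuous_on_vec_lambda continuous_on_sum continuous_on_mult continuous_on_component zc
    continuous_on_subset[OF gc]) simp
 have Id: "(I has_derivative (%h. matrix_inv (J (I y)) *v h)) (at y)" if y: "y \<in> interior K" for y
 proof (rule has_derivative_inverse_basic)
  have yK: "y \<in> K" using y interior_subset by blast
  show "(Q has_derivative (%h. J (I y) *v h)) (at (I y))" by (rule Jh)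
  show "bounded_linear (%h. matrix_inv (J (I y)) *v h)" by (rule matrix_vector_mul_bounded_linear)
  show "(%h. matrix_inv (J (I y)) *v h) \<circ> (%h. J (I y) *v h) = id"
   using matrix_inv(2)[OF IQ[OF yK]] by (auto simp: matrix_vector_mul_assoc)
  show "continuous (at y) I" using Ic y by (rule continuous_on_interior)
  show "open (interior K)" "y \<in> interior K" using y by auto
  show "Q (I x) = x" if "x \<in> interior K" for x using QI that interior_subset by blast
 qed
 have fd: "((g \<circ> I) has_derivative (%h. frechet_derivative g (at (I y)) (matrix_inv (J (I y)) *v h))) (at y)"
  if "y \<in> interior K" for y
  using diff_chain_at[OF Id[OF that] frechet_derivative_has[OF gd]] by (simp add: o_def)
 have gr: "grad (g \<circ> I) y = \<Phi> (I y)" if y: "y \<in> interior K" for y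
 proof -
  have x: "I y \<in> cbox 0 1" using IQ y interior_subset by blast
  have lin: "linear (frechet_derivative g (at (I y)))" by (rule linear_frechet_derivative[OF gd])
  have e: "frechet_derivative g (at (I y)) v = (\<Sum>i\<in>UNIV. v $ i * frechet_derivative g (at (I y)) (axis i 1))" for v
  proof -
   have "v = (\<Sum>i\<in>UNIV. v $ i *\<^sub>R axis i 1)" using basis_expansion[of v] by (simp add: scalar_mult_eq_scaleR)
   then have "frechet_derivative g (at (I y)) v = frechet_derivative g (at (I y)) (\<Sum>i\<in>UNIV. v $ i *\<^sub>R axis i 1)" by simp
   then show ?thesis using lin by (simp add: linear_sum linear_scale)
  qed
  have f: "frechet_derivative (g \<circ> I) (at y) = (%h. frechet_derivative g (at (I y)) (matrix_inv (J (I y)) *v h))"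
   by (rule frechet_derivativeI[OF fd[OF y]])
  show ?thesis unfolding grad_def \<Phi>_def f zm[OF x] by (rule arg_cong[of _ _ vec_lambda], rule ext, rule e)
 qed
 have "continuous_on (interior K) (%y. \<Phi> (I y))"
  by (rule continuous_on_compose2[OF Pc continuous_on_subset[OF Ic interior_subset]]) (use IQ interior_subset in blast)
 then have "continuous_on (interior K) (grad (g \<circ> I))"
  by (rule continuous_on_eq) (rule gr[symmetric])
 moreover have "bounded (grad (g \<circ> I) ` interior K)"
 proof (rule bounded_subset[OF compact_imp_bounded[OF compact_continuous_image[OF Pc compact_cbox]]], rule image_subsetI)
  fix y assume y: "y \<in> interior K"
  show "grad (g \<circ> I) y \<in> \<Phi> ` cbox 0 1"
   unfolding gr[OF y] by (rule imageI, rule IQ) (use y interior_subset in blast)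
 qed
 moreover have "g \<circ> I differentiable at y" if "y \<in> interior K" for y by (rule differentiableI[OF fd[OF that]])
 ultimately show ?thesis unfolding bounded_smooth_on_def I_def Q_def by blast
qed

lemma bounded_smooth_affine:
 assumes "f \<in> affine_funs" shows "bounded_smooth_on U f"
proof -
 obtain a b where f: "f = (%x. a + b \<bullet> x)" using assms unfolding affine_funs_def by blast
 have d: "(f has_derivative (%h. b \<bullet> h)) (at x)" for x
  unfolding f by (auto intro!: derivative_eq_intros)
 have "grad f x = b" for x using frechet_derivativeI[OF d] by (simp add: grad_def inner_axis)
 then have "grad f = (%x. b)" by auto
 moreover have "bounded ((%x. b) ` U)" by (rule bounded_subset[of "{b}"]) auto
 ultimately show ?thesis using d by (auto simp: bounded_smooth_on_def differentiable_def)
qed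

section \<open>The viscous bilinear form on the mesh\<close>

locale discretization = mesh X for X :: "('n::finite) staggered_mesh" +
 assumes fluxes: "dual_fluxes X" and shapes: "shape_functions X"
begin

lemma bounded_smooth_shape:
 assumes "K \<in> cells X" "Y \<in> all_faces X"
 shows "bounded_smooth_on (interior K) (shape_fn X K Y)"
proof -
 obtain f where f: "f \<in> local_space X K" "!!x. x \<in> K ==> shape_fn X K Y x = f x"
  using conjunct1[OF bspec[OF bspec[OF shapes[unfolded shape_functions_def] assms(1)] assms(2)]] by (elim bexE) blast
 have "bounded_smooth_on (interior K) f"
 proof (cases "simplicial K")
  case True
  then show ?thesis using f(1) by (simp add: local_space_def bounded_smooth_affine)
 next
  case False
  then have "quad_hex K (corners X K)" using cell_shape[OF assms(1)] by blast
  then have "bounded_smooth_on (interior K) (g \<circ> inv_into (cbox 0 1) (Q1_map (corners X K)))" if "g \<in> rannacher_turek_funs" for g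
   using that by (rule bounded_smooth_quad_hex)
  moreover obtain g where "g \<in> rannacher_turek_funs" "f = g \<circ> inv_into (cbox 0 1) (Q1_map (corners X K))"
   using f(1) False unfolding local_space_def by auto
  ultimately show ?thesis by simp
 qed
 then show ?thesis
  by (rule bounded_smooth_on_cong[OF open_interior, rotated]) (rule f(2), rule subsetD[OF interior_subset])
qed

definition sg :: "(real^'n) set => (real^'n) set => real^'n => real^'n" where
 "sg K Y = grad (shape_fn X K Y)"

lemma sg_in_L2:
 assumes "K \<in> cells X" "Y \<in> all_faces X"
 shows "in_L2 (interior K) (sg K Y)"
proof -
 have s: "bounded_smooth_on (interior K) (shape_fn X K Y)" by (rule bounded_smooth_shape[OF assms])
 have Ks: "interior K \<in> lmeasurable"
  by (rule lmeasurable_open[OF bounded_subset[OF compact_imp_bounded interior_subset] open_interior])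
   (rule full_polytope.compact[OF cell_full[OF assms(1)]])
 have m: "sg K Y \<in> borel_measurable (lebesgue_on (interior K))"
  using s unfolding bounded_smooth_on_def sg_def
  by (intro continuous_imp_measurable_on_sets_lebesgue) (auto simp: lmeasurable_open)
 obtain B where B: "!!x. x \<in> interior K ==> norm (sg K Y x) \<le> B"
  using s unfolding bounded_smooth_on_def sg_def bounded_iff by blast
 show ?thesis
  unfolding in_L2_def
 proof
  show "integrable (lebesgue_on (interior K)) (%x. (norm (sg K Y x))\<^sup>2)"
  proof (rule Bochner_Integration.integrable_bound[where f="%x. B\<^sup>2"])
   show "integrable (lebesgue_on (interior K)) (%x. B\<^sup>2)"
    using Ks by (intro finite_measure.integrable_const finite_measure_lebesgue_on)
   show "AE x in lebesgue_on (interior K). norm ((norm (sg K Y x))\<^sup>2) \<le> norm (B\<^sup>2)"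
    using B by (intro AE_I2) (auto simp: space_restrict_space intro: power_mono)
  qed (use m in auto)
 qed (rule m)
qed

lemma jacobian_reconstruction:
 assumes "K \<in> cells X" "x \<in> interior K"
 shows "jacobian (reconstruction X u K) (at x) = (\<chi> i j. \<Sum>Y\<in>all_faces X. u Y $ i * sg K Y x $ j)"
proof -
 have "((%x. shape_fn X K Y x *\<^sub>R u Y) has_derivative (%h. frechet_derivative (shape_fn X K Y) (at x) h *\<^sub>R u Y)) (at x)"
  if "Y \<in> all_faces X" for Y
  using bounded_smooth_shape[OF assms(1) that] assms(2)
  by (intro has_derivative_scaleR_left frechet_derivative_has) (simp add: bounded_smooth_on_def)
 then have "(reconstruction X u K has_derivative (%h. \<Sum>Y\<in>all_faces X. frechet_derivative (shape_fn X K Y) (at x) h *\<^sub>R u Y)) (at x)"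
  unfolding reconstruction_def[abs_def] by (rule has_derivative_sum)
 from frechet_derivativeI[OF this] show ?thesis
  by (simp add: jacobian_def matrix_def vec_eq_iff sg_def grad_def mult.commute)
qed

text \<open>The coupling of the faces Y' and Y in the viscous bilinear form. With it,
  \<open>div_tau\<close> becomes a finite linear combination of face values, from which linearity,
  continuity and sign are read off.\<close>

definition visc :: "real => real => (real^'n) set => (real^'n) set => real^'n => real^'n" where
 "visc \<mu> lam Y' Y w = (\<Sum>K\<in>cells X. \<mu> *\<^sub>R (LINT x|lebesgue_on (interior K). (sg K Y' x \<bullet> sg K Y x) *\<^sub>R w)
  + (\<mu> + lam) *\<^sub>R (LINT x|lebesgue_on (interior K). (w \<bullet> sg K Y' x) *\<^sub>R sg K Y x))"

lemma visc_integrable: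
 assumes "K \<in> cells X" "Y \<in> all_faces X" "Y' \<in> all_faces X"
 shows "integrable (lebesgue_on (interior K)) (%x. (sg K Y' x \<bullet> sg K Y x) *\<^sub>R (w::real^'n))"
  "integrable (lebesgue_on (interior K)) (%x. (w \<bullet> sg K Y' x) *\<^sub>R sg K Y x)"
proof -
 have "integrable (lebesgue_on (interior K)) (%x. sg K Y' x \<bullet> sg K Y x)"
  by (intro in_L2_inner_integrable sg_in_L2 assms)
 then show "integrable (lebesgue_on (interior K)) (%x. (sg K Y' x \<bullet> sg K Y x) *\<^sub>R w)" by simp
 have "in_L2 (interior K) (%x. w \<bullet> sg K Y' x)"
  by (rule in_L2_bounded_linear[OF sg_in_L2 bounded_linear_inner_right]) (rule assms)+
 then show "integrable (lebesgue_on (interior K)) (%x. (w \<bullet> sg K Y' x) *\<^sub>R sg K Y x)"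
  by (intro in_L2_scaleR_integrable sg_in_L2 assms)
qed

lemma div_tau_eq:
 assumes "Y \<in> all_faces X"
 shows "div_tau X \<mu> lam u Y = - (1 / vol (dual_cell X Y)) *\<^sub>R (\<Sum>Y'\<in>all_faces X. visc \<mu> lam Y' Y (u Y'))"
proof -
 have 1: "(LINT x|lebesgue_on (interior K). jacobian (reconstruction X u K) (at x) *v grad (shape_fn X K Y) x)
  = (\<Sum>Y'\<in>all_faces X. LINT x|lebesgue_on (interior K). (sg K Y' x \<bullet> sg K Y x) *\<^sub>R u Y')" if K: "K \<in> cells X" for K
 proof -
  have "(LINT x|lebesgue_on (interior K). jacobian (reconstruction X u K) (at x) *v grad (shape_fn X K Y) x)
   = (LINT x|lebesgue_on (interior K). (\<Sum>Y'\<in>all_faces X. (sg K Y' x \<bullet> sg K Y x) *\<^sub>R u Y'))"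
  proof (rule Bochner_Integration.integral_cong[OF refl])
   fix x assume "x \<in> space (lebesgue_on (interior K))"
   then have x: "x \<in> interior K" by (simp add: space_restrict_space)
   have "(\<Sum>j\<in>UNIV. (\<Sum>Y'\<in>all_faces X. u Y' $ i * sg K Y' x $ j) * sg K Y x $ j)
    = (\<Sum>Y'\<in>all_faces X. (\<Sum>j\<in>UNIV. sg K Y' x $ j * sg K Y x $ j) * u Y' $ i)" for i
    by (simp add: sum_distrib_left sum_distrib_right ac_simps) (rule sum.swap)
   then show "jacobian (reconstruction X u K) (at x) *v grad (shape_fn X K Y) x = (\<Sum>Y'\<in>all_faces X. (sg K Y' x \<bullet> sg K Y x) *\<^sub>R u Y')"
    unfolding jacobian_reconstruction[OF K x] sg_def[symmetric]
    by (simp add: vec_eq_iff matrix_vector_mult_def inner_vec_def)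
  qed
  also have "... = (\<Sum>Y'\<in>all_faces X. LINT x|lebesgue_on (interior K). (sg K Y' x \<bullet> sg K Y x) *\<^sub>R u Y')"
   by (rule Bochner_Integration.integral_sum) (rule visc_integrable[OF K assms])
  finally show ?thesis .
 qed
 have 2: "(LINT x|lebesgue_on (interior K). trace (jacobian (reconstruction X u K) (at x)) *\<^sub>R grad (shape_fn X K Y) x)
  = (\<Sum>Y'\<in>all_faces X. LINT x|lebesgue_on (interior K). (u Y' \<bullet> sg K Y' x) *\<^sub>R sg K Y x)" if K: "K \<in> cells X" for K
 proof -
  have "(LINT x|lebesgue_on (interior K). trace (jacobian (reconstruction X u K) (at x)) *\<^sub>R grad (shape_fn X K Y) x)
   = (LINT x|lebesgue_on (interior K). (\<Sum>Y'\<in>all_faces X. (u Y' \<bullet> sg K Y' x) *\<^sub>R sg K Y x))"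
  proof (rule Bochner_Integration.integral_cong[OF refl])
   fix x assume "x \<in> space (lebesgue_on (interior K))"
   then have x: "x \<in> interior K" by (simp add: space_restrict_space)
   have "trace (jacobian (reconstruction X u K) (at x)) = (\<Sum>Y'\<in>all_faces X. u Y' \<bullet> sg K Y' x)"
    unfolding jacobian_reconstruction[OF K x] by (simp add: trace_def inner_vec_def) (rule sum.swap)
   then show "trace (jacobian (reconstruction X u K) (at x)) *\<^sub>R grad (shape_fn X K Y) x = (\<Sum>Y'\<in>all_faces X. (u Y' \<bullet> sg K Y' x) *\<^sub>R sg K Y x)"
    by (simp add: scaleR_sum_left sg_def)
  qed
  also have "... = (\<Sum>Y'\<in>all_faces X. LINT x|lebesgue_on (interior K). (u Y' \<bullet> sg K Y' x) *\<^sub>R sg K Y x)"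
   by (rule Bochner_Integration.integral_sum) (rule visc_integrable[OF K assms])
  finally show ?thesis .
 qed
 define V where "V = vol (dual_cell X Y)"
 define S1 where "S1 = (\<Sum>K\<in>cells X. \<Sum>Y'\<in>all_faces X. LINT x|lebesgue_on (interior K). (sg K Y' x \<bullet> sg K Y x) *\<^sub>R u Y')"
 define S2 where "S2 = (\<Sum>K\<in>cells X. \<Sum>Y'\<in>all_faces X. LINT x|lebesgue_on (interior K). (u Y' \<bullet> sg K Y' x) *\<^sub>R sg K Y x)"
 have "div_tau X \<mu> lam u Y = - (\<mu> / V) *\<^sub>R S1 - ((\<mu> + lam) / V) *\<^sub>R S2"
  unfolding div_tau_def S1_def S2_def V_def by (simp add: 1 2)
 also have "... = - (1 / V) *\<^sub>R (\<mu> *\<^sub>R S1 + (\<mu> + lam) *\<^sub>R S2)" by (simp add: scaleR_right_distrib)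
 also have "\<mu> *\<^sub>R S1 + (\<mu> + lam) *\<^sub>R S2 = (\<Sum>Y'\<in>all_faces X. visc \<mu> lam Y' Y (u Y'))"
  unfolding S1_def S2_def visc_def sum.swap[of _ "cells X" "all_faces X"]
  by (simp only: scaleR_sum_right sum.distrib)
 finally show ?thesis by (simp add: V_def)
qed

lemma visc_linear:
 assumes "Y \<in> all_faces X" "Y' \<in> all_faces X" shows "linear (visc \<mu> lam Y' Y)"
proof (rule linearI)
 have i: "integrable (lebesgue_on (interior K)) (%x. (sg K Y' x \<bullet> sg K Y x) *\<^sub>R (w::real^'n))"
  "integrable (lebesgue_on (interior K)) (%x. (w \<bullet> sg K Y' x) *\<^sub>R sg K Y x)" if "K \<in> cells X" for K w
  using visc_integrable[OF that assms] by blast+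
 fix v w :: "real^'n" and c :: real
 show "visc \<mu> lam Y' Y (v + w) = visc \<mu> lam Y' Y v + visc \<mu> lam Y' Y w"
  unfolding visc_def sum.distrib[symmetric]
 proof (rule sum.cong[OF refl])
  fix K assume K: "K \<in> cells X"
  have "(LINT x|lebesgue_on (interior K). (sg K Y' x \<bullet> sg K Y x) *\<^sub>R (v + w)) =
   (LINT x|lebesgue_on (interior K). (sg K Y' x \<bullet> sg K Y x) *\<^sub>R v) + (LINT x|lebesgue_on (interior K). (sg K Y' x \<bullet> sg K Y x) *\<^sub>R w)"
   unfolding scaleR_right_distrib by (rule Bochner_Integration.integral_add[OF i(1)[OF K] i(1)[OF K]])
  moreover have "(LINT x|lebesgue_on (interior K). ((v + w) \<bullet> sg K Y' x) *\<^sub>R sg K Y x) =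
   (LINT x|lebesgue_on (interior K). (v \<bullet> sg K Y' x) *\<^sub>R sg K Y x) + (LINT x|lebesgue_on (interior K). (w \<bullet> sg K Y' x) *\<^sub>R sg K Y x)"
   unfolding inner_add_left scaleR_left_distrib by (rule Bochner_Integration.integral_add[OF i(2)[OF K] i(2)[OF K]])
  ultimately show "\<mu> *\<^sub>R (LINT x|lebesgue_on (interior K). (sg K Y' x \<bullet> sg K Y x) *\<^sub>R (v + w)) +
    (\<mu> + lam) *\<^sub>R (LINT x|lebesgue_on (interior K). ((v + w) \<bullet> sg K Y' x) *\<^sub>R sg K Y x) =
    \<mu> *\<^sub>R (LINT x|lebesgue_on (interior K). (sg K Y' x \<bullet> sg K Y x) *\<^sub>R v) +
    (\<mu> + lam) *\<^sub>R (LINT x|lebesgue_on (interior K). (v \<bullet> sg K Y' x) *\<^sub>R sg K Y x) +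
    (\<mu> *\<^sub>R (LINT x|lebesgue_on (interior K). (sg K Y' x \<bullet> sg K Y x) *\<^sub>R w) +
    (\<mu> + lam) *\<^sub>R (LINT x|lebesgue_on (interior K). (w \<bullet> sg K Y' x) *\<^sub>R sg K Y x))"
   by (simp only: scaleR_right_distrib) (simp add: algebra_simps)
 qed
 show "visc \<mu> lam Y' Y (c *\<^sub>R w) = c *\<^sub>R visc \<mu> lam Y' Y w"
  unfolding visc_def scaleR_sum_right
 proof (rule sum.cong[OF refl])
  fix K assume K: "K \<in> cells X"
  have "(LINT x|lebesgue_on (interior K). (sg K Y' x \<bullet> sg K Y x) *\<^sub>R c *\<^sub>R w) =
   c *\<^sub>R (LINT x|lebesgue_on (interior K). (sg K Y' x \<bullet> sg K Y x) *\<^sub>R w)"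
   unfolding scaleR_left_commute[of _ c] by (rule integral_scaleR_right)
  moreover have "(LINT x|lebesgue_on (interior K). (c *\<^sub>R w \<bullet> sg K Y' x) *\<^sub>R sg K Y x) =
   c *\<^sub>R (LINT x|lebesgue_on (interior K). (w \<bullet> sg K Y' x) *\<^sub>R sg K Y x)"
   unfolding inner_scaleR_left scaleR_scaleR[symmetric] by (rule integral_scaleR_right)
  ultimately show "\<mu> *\<^sub>R (LINT x|lebesgue_on (interior K). (sg K Y' x \<bullet> sg K Y x) *\<^sub>R c *\<^sub>R w) +
    (\<mu> + lam) *\<^sub>R (LINT x|lebesgue_on (interior K). (c *\<^sub>R w \<bullet> sg K Y' x) *\<^sub>R sg K Y x) =
    c *\<^sub>R (\<mu> *\<^sub>R (LINT x|lebesgue_on (interior K). (sg K Y' x \<bullet> sg K Y x) *\<^sub>R w) +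
    (\<mu> + lam) *\<^sub>R (LINT x|lebesgue_on (interior K). (w \<bullet> sg K Y' x) *\<^sub>R sg K Y x))"
   by (simp only:) (simp add: algebra_simps)
 qed
qed

lemma div_tau_diff:
 assumes "Y \<in> all_faces X"
 shows "div_tau X \<mu> lam (%Y. u Y - v Y) Y = div_tau X \<mu> lam u Y - div_tau X \<mu> lam v Y"
 using visc_linear[OF assms]
 by (simp add: div_tau_eq[OF assms] linear_diff sum_subtractf scaleR_right_diff_distrib cong: sum.cong)

lemma tendsto_div_tau:
 assumes "Y \<in> all_faces X" "!!Y'. Y' \<in> all_faces X ==> ((%m. u m Y') \<longlongrightarrow> v Y') F"
 shows "((%m. div_tau X \<mu> lam (u m) Y) \<longlongrightarrow> div_tau X \<mu> lam v Y) F"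
 unfolding div_tau_eq[OF assms(1)]
proof (intro tendsto_scaleR tendsto_const tendsto_sum)
 fix Y' assume s: "Y' \<in> all_faces X"
 have "bounded_linear (visc \<mu> lam Y' Y)" using visc_linear[OF assms(1) s] by (simp add: linear_conv_bounded_linear)
 then show "((%m. visc \<mu> lam Y' Y (u m Y')) \<longlongrightarrow> visc \<mu> lam Y' Y (v Y')) F"
  by (rule bounded_linear.tendsto) (rule assms(2)[OF s])
qed

text \<open>Tested with u itself, the viscous form is, cell by cell, the integral of two squares:
  the full gradient of the reconstruction weighted by \<mu> and its divergence weighted by \<mu> +
  lam.\<close>

lemma div_tau_dissipative:
 assumes \<mu>: "0 \<le> \<mu>" "0 \<le> \<mu> + lam"
 shows "(\<Sum>Y\<in>all_faces X. vol (dual_cell X Y) * (div_tau X \<mu> lam u Y \<bullet> u Y)) \<le> 0"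
proof -
 have nn: "0 \<le> (\<Sum>Y\<in>all_faces X. \<Sum>Y'\<in>all_faces X. (LINT x|lebesgue_on (interior K). (sg K Y' x \<bullet> sg K Y x) *\<^sub>R u Y') \<bullet> u Y)"
  "0 \<le> (\<Sum>Y\<in>all_faces X. \<Sum>Y'\<in>all_faces X. (LINT x|lebesgue_on (interior K). (u Y' \<bullet> sg K Y' x) *\<^sub>R sg K Y x) \<bullet> u Y)"
  if K: "K \<in> cells X" for K
 proof -
  let ?M = "lebesgue_on (interior K)"
  have i: "integrable ?M (%x. ((sg K Y' x \<bullet> sg K Y x) *\<^sub>R u Y') \<bullet> u Y)"
   "integrable ?M (%x. ((u Y' \<bullet> sg K Y' x) *\<^sub>R sg K Y x) \<bullet> u Y)"
   "(LINT x|?M. (sg K Y' x \<bullet> sg K Y x) *\<^sub>R u Y') \<bullet> u Y = (LINT x|?M. ((sg K Y' x \<bullet> sg K Y x) *\<^sub>R u Y') \<bullet> u Y)"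
   "(LINT x|?M. (u Y' \<bullet> sg K Y' x) *\<^sub>R sg K Y x) \<bullet> u Y = (LINT x|?M. ((u Y' \<bullet> sg K Y' x) *\<^sub>R sg K Y x) \<bullet> u Y)"
   if "Y \<in> all_faces X" "Y' \<in> all_faces X" for Y Y'
   by (rule integrable_inner_left, rule visc_integrable[OF K that])+
    (rule integral_inner_left[symmetric], rule visc_integrable[OF K that])+
  have "(\<Sum>Y\<in>all_faces X. \<Sum>Y'\<in>all_faces X. (LINT x|?M. (sg K Y' x \<bullet> sg K Y x) *\<^sub>R u Y') \<bullet> u Y)
    = (\<Sum>Y\<in>all_faces X. \<Sum>Y'\<in>all_faces X. (LINT x|?M. ((sg K Y' x \<bullet> sg K Y x) *\<^sub>R u Y') \<bullet> u Y))"
   by (intro sum.cong refl i(3))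
  also have "... = (LINT x|?M. (\<Sum>Y\<in>all_faces X. \<Sum>Y'\<in>all_faces X. ((sg K Y' x \<bullet> sg K Y x) *\<^sub>R u Y') \<bullet> u Y))"
   by (simp add: Bochner_Integration.integral_sum i(1) Bochner_Integration.integrable_sum del: inner_scaleR_left)
  also have "... \<ge> 0"
  proof (rule Bochner_Integration.integral_nonneg)
   fix x
   have "(\<Sum>Y\<in>all_faces X. \<Sum>Y'\<in>all_faces X. ((sg K Y' x \<bullet> sg K Y x) *\<^sub>R u Y') \<bullet> u Y)
    = (\<Sum>Y\<in>all_faces X. \<Sum>Y'\<in>all_faces X. \<Sum>i\<in>UNIV. \<Sum>j\<in>UNIV. (sg K Y x $ i * u Y $ j) * (sg K Y' x $ i * u Y' $ j))"
    unfolding inner_scaleR_left unfolding inner_vec_def inner_real_def sum_product by (intro sum.cong refl) (simp add: mult_ac)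
   also have "... = (\<Sum>i\<in>UNIV. \<Sum>j\<in>UNIV. \<Sum>Y\<in>all_faces X. \<Sum>Y'\<in>all_faces X. (sg K Y x $ i * u Y $ j) * (sg K Y' x $ i * u Y' $ j))"
    by (simp only: sum.swap[of _ "UNIV::'n set" "all_faces X"])
   also have "... = (\<Sum>i\<in>UNIV. \<Sum>j\<in>UNIV. (\<Sum>Y\<in>all_faces X. sg K Y x $ i * u Y $ j)\<^sup>2)"
    by (simp add: power2_eq_square sum_product)
   finally show "0 \<le> (\<Sum>Y\<in>all_faces X. \<Sum>Y'\<in>all_faces X. ((sg K Y' x \<bullet> sg K Y x) *\<^sub>R u Y') \<bullet> u Y)"
    by (simp add: sum_nonneg)
  qed
  finally show "0 \<le> (\<Sum>Y\<in>all_faces X. \<Sum>Y'\<in>all_faces X. (LINT x|?M. (sg K Y' x \<bullet> sg K Y x) *\<^sub>R u Y') \<bullet> u Y)" .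
  have "(\<Sum>Y\<in>all_faces X. \<Sum>Y'\<in>all_faces X. (LINT x|?M. (u Y' \<bullet> sg K Y' x) *\<^sub>R sg K Y x) \<bullet> u Y)
    = (\<Sum>Y\<in>all_faces X. \<Sum>Y'\<in>all_faces X. (LINT x|?M. ((u Y' \<bullet> sg K Y' x) *\<^sub>R sg K Y x) \<bullet> u Y))"
   by (intro sum.cong refl i(4))
  also have "... = (LINT x|?M. (\<Sum>Y\<in>all_faces X. \<Sum>Y'\<in>all_faces X. ((u Y' \<bullet> sg K Y' x) *\<^sub>R sg K Y x) \<bullet> u Y))"
   by (simp add: Bochner_Integration.integral_sum i(2) Bochner_Integration.integrable_sum del: inner_scaleR_left)
  also have "... \<ge> 0"
  proof (rule Bochner_Integration.integral_nonneg)
   fix x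
   have "(\<Sum>Y\<in>all_faces X. \<Sum>Y'\<in>all_faces X. ((u Y' \<bullet> sg K Y' x) *\<^sub>R sg K Y x) \<bullet> u Y) = (\<Sum>Y\<in>all_faces X. u Y \<bullet> sg K Y x)\<^sup>2"
    by (simp add: power2_eq_square sum_product inner_commute ac_simps)
   then show "0 \<le> (\<Sum>Y\<in>all_faces X. \<Sum>Y'\<in>all_faces X. ((u Y' \<bullet> sg K Y' x) *\<^sub>R sg K Y x) \<bullet> u Y)" by simp
  qed
  finally show "0 \<le> (\<Sum>Y\<in>all_faces X. \<Sum>Y'\<in>all_faces X. (LINT x|?M. (u Y' \<bullet> sg K Y' x) *\<^sub>R sg K Y x) \<bullet> u Y)" .
 qed
 have "(\<Sum>Y\<in>all_faces X. vol (dual_cell X Y) * (div_tau X \<mu> lam u Y \<bullet> u Y))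
  = - (\<Sum>Y\<in>all_faces X. \<Sum>Y'\<in>all_faces X. visc \<mu> lam Y' Y (u Y') \<bullet> u Y)"
  unfolding sum_negf[symmetric]
  by (intro sum.cong refl) (use vol_dual_cell_pos in \<open>force simp: div_tau_eq inner_sum_left sum_negf\<close>)
 also have "(\<Sum>Y\<in>all_faces X. \<Sum>Y'\<in>all_faces X. visc \<mu> lam Y' Y (u Y') \<bullet> u Y)
  = (\<Sum>K\<in>cells X. \<mu> * (\<Sum>Y\<in>all_faces X. \<Sum>Y'\<in>all_faces X. (LINT x|lebesgue_on (interior K). (sg K Y' x \<bullet> sg K Y x) *\<^sub>R u Y') \<bullet> u Y)
   + (\<mu> + lam) * (\<Sum>Y\<in>all_faces X. \<Sum>Y'\<in>all_faces X. (LINT x|lebesgue_on (interior K). (u Y' \<bullet> sg K Y' x) *\<^sub>R sg K Y x) \<bullet> u Y))"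
  unfolding visc_def inner_sum_left inner_add_left inner_scaleR_left
  by (simp only: sum.swap[of _ "all_faces X" "cells X"] sum.distrib sum_distrib_left)
 finally show ?thesis
  by (rule ord_eq_le_trans) (rule neg_le_0_iff_le[THEN iffD2], rule sum_nonneg, rule add_nonneg_nonneg,
   (rule mult_nonneg_nonneg[OF \<mu>(1) nn(1)] mult_nonneg_nonneg[OF \<mu>(2) nn(2)], assumption)+)
qed

end

section \<open>Discrete conservation and energy identities\<close>

context discretization
begin

abbreviation V :: "(real^'n) set => real" where "V Y \<equiv> vol (dual_cell X Y)"

lemma mass_flux_neighbour:
 assumes "K \<in> cells X" "Y \<in> int_face_set K"
 shows "mass_flux X \<rho> u (neighbour X K Y) Y = - mass_flux X \<rho> u K Y"
 using neighbour_props[OF assms(1), of Y] assms(2) by (auto simp: mass_flux_def int_face_set_def)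

lemma mass_flux_eq_0: "Y \<notin> int_faces X ==> mass_flux X \<rho> u K Y = 0"
 by (simp add: mass_flux_def)

lemma sum_mass_flux_faces:
 assumes "K \<in> cells X"
 shows "(\<Sum>Y\<in>faces K. mass_flux X \<rho> u K Y) = (\<Sum>Y\<in>int_face_set K. mass_flux X \<rho> u K Y)"
 using finite_faces[OF assms] by (intro sum.mono_neutral_right) (auto simp: int_face_set_def mass_flux_def)

lemma vol_mass_div:
 assumes "K \<in> cells X"
 shows "vol K * mass_div X \<rho> u K = (\<Sum>Y\<in>int_face_set K. mass_flux X \<rho> u K Y)"
 using vol_pos[OF assms] by (simp add: mass_div_def sum_mass_flux_faces[OF assms])

lemma sum_mass_flux_cells:
 assumes "Y \<in> all_faces X"
 shows "(\<Sum>K\<in>{K\<in>cells X. Y \<in> faces K}. mass_flux X \<rho> u K Y) = 0"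
proof (cases "Y \<in> int_faces X")
 case True
 obtain K where K: "K \<in> cells X" "Y \<in> faces K" using assms by (auto simp: all_faces_def)
 note n = neighbour_props[OF K True]
 have "(\<Sum>M\<in>{K, neighbour X K Y}. mass_flux X \<rho> u M Y) = 0"
  using n(5) mass_flux_neighbour[OF K(1), of Y] K True by (auto simp: int_face_set_def)
 then show ?thesis by (simp only: n(6))
next
 case False
 then show ?thesis by (simp add: mass_flux_eq_0)
qed

text \<open>The flux changes sign between the two cells of a face, so adding the sum to its swapped
  version produces the jump of w; every internal face is then counted twice, hence the factor
  1/2.\<close>

lemma sum_by_parts:
 "(\<Sum>K\<in>cells X. w K * (vol K * mass_div X \<rho> u K))
  = (1/2) * (\<Sum>K\<in>cells X. \<Sum>Y\<in>int_face_set K. mass_flux X \<rho> u K Y * (w K - w (neighbour X K Y)))"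
proof -
 define S where "S = (\<Sum>K\<in>cells X. \<Sum>Y\<in>int_face_set K. w K * mass_flux X \<rho> u K Y)"
 have "S = (\<Sum>K\<in>cells X. \<Sum>Y\<in>int_face_set K. w (neighbour X K Y) * mass_flux X \<rho> u (neighbour X K Y) Y)"
  unfolding S_def by (rule sum_neighbour_swap)
 also have "... = (\<Sum>K\<in>cells X. \<Sum>Y\<in>int_face_set K. - (w (neighbour X K Y) * mass_flux X \<rho> u K Y))"
  by (intro sum.cong refl) (simp add: mass_flux_neighbour)
 finally have "2 * S = S + (\<Sum>K\<in>cells X. \<Sum>Y\<in>int_face_set K. - (w (neighbour X K Y) * mass_flux X \<rho> u K Y))" by simp
 also have "... = (\<Sum>K\<in>cells X. \<Sum>Y\<in>int_face_set K. mass_flux X \<rho> u K Y * (w K - w (neighbour X K Y)))"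
  unfolding S_def sum.distrib[symmetric] by (intro sum.cong refl) (simp add: algebra_simps)
 finally have "2 * S = (\<Sum>K\<in>cells X. \<Sum>Y\<in>int_face_set K. mass_flux X \<rho> u K Y * (w K - w (neighbour X K Y)))" .
 moreover have "S = (\<Sum>K\<in>cells X. w K * (vol K * mass_div X \<rho> u K))"
  unfolding S_def by (intro sum.cong refl) (simp add: vol_mass_div sum_distrib_left)
 ultimately show ?thesis by linarith
qed

lemma total_mass_div: "(\<Sum>K\<in>cells X. vol K * mass_div X \<rho> u K) = 0"
 using sum_by_parts[of "%_. 1" \<rho> u] by simp

text \<open>Splitting the normal velocity into positive and negative parts removes the case
  distinction: signs can be read off, and continuity in the velocity survives a change of the upwind
  cell.\<close>

lemma mass_flux_upwind:
 assumes "Y \<in> int_face_set K"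
 shows "mass_flux X \<rho> u K Y = area Y * (\<rho> K * max (u Y \<bullet> normal K Y) 0 + \<rho> (neighbour X K Y) * min (u Y \<bullet> normal K Y) 0)"
 using assms by (auto simp: mass_flux_def int_face_set_def max_def min_def)

lemma area_nonneg: "0 \<le> area Y"
 by (simp add: area_def)

definition mass_balance :: "real => 'n scalar_field => 'n scalar_field => 'n vector_field => bool" where
 "mass_balance dt \<rho>' \<rho> u \<longleftrightarrow> (\<forall>K\<in>cells X. (1/dt) * (\<rho> K - \<rho>' K) + mass_div X \<rho> u K = 0)"

lemma mass_balance_mass:
 assumes "mass_balance dt \<rho>' \<rho> u" "dt > 0"
 shows "(\<Sum>K\<in>cells X. vol K * \<rho> K) = (\<Sum>K\<in>cells X. vol K * \<rho>' K)"
proof -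
 have "vol K * \<rho> K - vol K * \<rho>' K = - dt * (vol K * mass_div X \<rho> u K)" if "K \<in> cells X" for K
 proof -
  have "mass_div X \<rho> u K = - ((1/dt) * (\<rho> K - \<rho>' K))" using assms(1) that by (simp add: mass_balance_def eq_neg_iff_add_eq_0 add.commute)
  then show ?thesis using assms(2) by (simp add: right_diff_distrib)
 qed
 then have "(\<Sum>K\<in>cells X. vol K * \<rho> K - vol K * \<rho>' K) = (\<Sum>K\<in>cells X. - dt * (vol K * mass_div X \<rho> u K))" by simp
 also have "... = 0" using total_mass_div[of \<rho> u] by (simp only: sum_distrib_left[symmetric] mult_zero_right)
 finally show ?thesis by (simp add: sum_subtractf)
qed

text \<open>Test the balance with the indicator function of the cells where the density is not positive: mass can
 only flow into this set.\<close>

lemma mass_balance_pos: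
 assumes b: "mass_balance dt \<rho>' \<rho> u" "dt > 0" and pos: "!!K. K \<in> cells X ==> \<rho>' K > 0"
  and K: "K \<in> cells X"
 shows "\<rho> K > 0"
proof (rule ccontr)
 assume n: "\<not> \<rho> K > 0"
 define w where "w K = (if \<rho> K \<le> 0 then 1 else 0 :: real)" for K
 have "mass_flux X \<rho> u K Y * (w K - w (neighbour X K Y)) \<le> 0" if "Y \<in> int_face_set K" for K Y
 proof -
  let ?L = "neighbour X K Y" and ?a = "u Y \<bullet> normal K Y"
  consider "\<rho> K \<le> 0" "\<rho> ?L > 0" | "\<rho> K > 0" "\<rho> ?L \<le> 0" | "w K = w ?L" by (fastforce simp: w_def)
  then show ?thesis
  proof cases
   case 1
   then have "\<rho> K * max ?a 0 + \<rho> ?L * min ?a 0 \<le> 0"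
    by (intro add_nonpos_nonpos mult_nonpos_nonneg mult_nonneg_nonpos) auto
   then have "mass_flux X \<rho> u K Y \<le> 0"
    unfolding mass_flux_upwind[OF that] using area_nonneg by (rule mult_nonneg_nonpos[rotated])
   then show ?thesis using 1 by (simp add: w_def)
  next
   case 2
   then have "0 \<le> \<rho> K * max ?a 0 + \<rho> ?L * min ?a 0"
    by (intro add_nonneg_nonneg mult_nonneg_nonneg mult_nonpos_nonpos) auto
   then have "0 \<le> mass_flux X \<rho> u K Y"
    unfolding mass_flux_upwind[OF that] using area_nonneg by (intro mult_nonneg_nonneg)
   then show ?thesis using 2 by (simp add: w_def)
  qed simp
 qed
 then have "(\<Sum>K\<in>cells X. w K * (vol K * mass_div X \<rho> u K)) \<le> 0"
  unfolding sum_by_parts by (simp add: sum_nonpos)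
 moreover have "(\<Sum>K\<in>cells X. w K * (vol K * mass_div X \<rho> u K)) = (\<Sum>K\<in>cells X. w K * vol K * ((1/dt) * (\<rho>' K - \<rho> K)))"
 proof (intro sum.cong refl)
  fix K assume "K \<in> cells X"
  then have "(1/dt) * (\<rho> K - \<rho>' K) + mass_div X \<rho> u K = 0" using b(1) by (simp add: mass_balance_def)
  moreover have "(1/dt) * (\<rho> K - \<rho>' K) = - ((1/dt) * (\<rho>' K - \<rho> K))" by (simp add: right_diff_distrib)
  ultimately have "mass_div X \<rho> u K = (1/dt) * (\<rho>' K - \<rho> K)" by linarith
  then show "w K * (vol K * mass_div X \<rho> u K) = w K * vol K * ((1/dt) * (\<rho>' K - \<rho> K))" by simp
 qed
 moreover have "(\<Sum>K\<in>cells X. w K * vol K * ((1/dt) * (\<rho>' K - \<rho> K))) > 0"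
 proof (rule sum_pos2[OF finite_cells K])
  show "0 < w K * vol K * ((1/dt) * (\<rho>' K - \<rho> K))"
   using n pos[OF K] vol_pos[OF K] b(2) by (auto simp: w_def intro!: mult_pos_pos divide_pos_pos)
  show "0 \<le> w L * vol L * ((1/dt) * (\<rho>' L - \<rho> L))" if "L \<in> cells X" for L
   using pos[OF that] b(2) by (auto simp: w_def intro!: mult_nonneg_nonneg divide_nonneg_nonneg)
 qed
 ultimately show False by linarith
qed

subsection \<open>Convection\<close>

text \<open>Adjacency of faces within a cell is symmetric and the dual fluxes are antisymmetric,
  while the inner product is symmetric, so the sum equals its own negative.\<close>

lemma dual_flux_antisym_sum:
 assumes K: "K \<in> cells X" and u: "u \<in> HE0 X"
 shows "(\<Sum>Y\<in>faces K. \<Sum>Y'\<in>dual_adj K Y. dual_flux X \<rho> u K Y Y' * (w Y \<bullet> (w Y'::real^'n))) = 0"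
proof -
 define R where "R Y Y' \<longleftrightarrow> Y' \<noteq> Y \<and> aff_dim (Y \<inter> Y') = int CARD('n) - 2" for Y Y' :: "(real^'n) set"
 have R: "R Y Y' = R Y' Y" for Y Y' by (auto simp: R_def Int_commute)
 have adj: "dual_adj K Y = {Y'\<in>faces K. R Y Y'}" for Y by (auto simp: dual_adj_def R_def)
 define g where "g Y Y' = dual_flux X \<rho> u K Y Y' * (w Y \<bullet> w Y')" for Y Y'
 have "g Y Y' = - g Y' Y" if "Y \<in> faces K" "Y' \<in> dual_adj K Y" for Y Y'
  using fluxes u K that unfolding dual_fluxes_def g_def by (simp add: inner_commute)
 then have "(\<Sum>Y\<in>faces K. \<Sum>Y'\<in>dual_adj K Y. g Y Y') = (\<Sum>Y\<in>faces K. \<Sum>Y'\<in>dual_adj K Y. - g Y' Y)"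
  by (intro sum.cong refl)
 also have "... = - (\<Sum>Y\<in>faces K. \<Sum>Y'\<in>{Y'\<in>faces K. R Y' Y}. g Y' Y)"
  unfolding adj by (simp add: sum_negf R)
 also have "... = - (\<Sum>Y\<in>faces K. \<Sum>Y'\<in>{Y'\<in>faces K. R Y Y'}. g Y Y')"
  using sum.swap_restrict[OF finite_faces[OF K] finite_faces[OF K], of "%Y Y'. g Y' Y" "%Y Y'. R Y' Y"] by simp
 finally show ?thesis unfolding adj g_def by simp
qed

text \<open>The centred value splits the tested flux into half the square of \<open>w Y\<close>,
  times the flux, and half the mixed product. Mixed products cancel by antisymmetry. The total dual
  flux of a face is a half-diamond share of the cell divergences, since the two primal fluxes
  through the face cancel.\<close>

lemma convection_energy:
 assumes u: "u \<in> HE0 X"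
 shows "(\<Sum>Y\<in>all_faces X. V Y * (convection X \<rho> u w Y \<bullet> w Y))
  = (1/2) * (\<Sum>Y\<in>all_faces X. (norm (w Y))\<^sup>2 * (\<Sum>K\<in>{K\<in>cells X. Y \<in> faces K}. vol (half_diamond X K Y) * mass_div X \<rho> u K))"
proof -
 let ?C = "%Y. {K\<in>cells X. Y \<in> faces K}" and ?F = "dual_flux X \<rho> u"
 have f: "(\<Sum>K\<in>?C Y. \<Sum>Y'\<in>dual_adj K Y. ?F K Y Y') = (\<Sum>K\<in>?C Y. vol (half_diamond X K Y) * mass_div X \<rho> u K)"
  if "Y \<in> all_faces X" for Y
 proof -
  have "(\<Sum>Y'\<in>dual_adj K Y. ?F K Y Y') = vol (half_diamond X K Y) * mass_div X \<rho> u K - mass_flux X \<rho> u K Y" if "K \<in> ?C Y" for K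
  proof -
   have "mass_flux X \<rho> u K Y + (\<Sum>Y'\<in>dual_adj K Y. ?F K Y Y')
    = vol (half_diamond X K Y) / vol K * (\<Sum>Y'\<in>faces K. mass_flux X \<rho> u K Y')"
    using fluxes u that unfolding dual_fluxes_def by blast
   then show ?thesis by (simp add: mass_div_def)
  qed
  then show ?thesis using sum_mass_flux_cells[OF that, of \<rho> u] by (simp add: sum_subtractf)
 qed
 have "V Y * (convection X \<rho> u w Y \<bullet> w Y) = (1/2) * ((norm (w Y))\<^sup>2 * (\<Sum>K\<in>?C Y. \<Sum>Y'\<in>dual_adj K Y. ?F K Y Y'))
  + (1/2) * (\<Sum>K\<in>?C Y. \<Sum>Y'\<in>dual_adj K Y. ?F K Y Y' * (w Y \<bullet> w Y'))" if "Y \<in> all_faces X" for Y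
 proof -
  have "V Y * (convection X \<rho> u w Y \<bullet> w Y) = (\<Sum>K\<in>?C Y. \<Sum>Y'\<in>dual_adj K Y. ?F K Y Y' * ((1/2) * ((w Y + w Y') \<bullet> w Y)))"
   using vol_dual_cell_pos[OF that] by (simp add: convection_def inner_sum_left)
  also have "... = (\<Sum>K\<in>?C Y. \<Sum>Y'\<in>dual_adj K Y. (1/2) * ((norm (w Y))\<^sup>2 * ?F K Y Y') + (1/2) * (?F K Y Y' * (w Y \<bullet> w Y')))"
   by (intro sum.cong refl) (simp add: inner_add_left power2_norm_eq_inner inner_commute algebra_simps)
  finally show ?thesis by (simp only: sum.distrib sum_distrib_left)
 qed
 then have "(\<Sum>Y\<in>all_faces X. V Y * (convection X \<rho> u w Y \<bullet> w Y))
  = (\<Sum>Y\<in>all_faces X. (1/2) * ((norm (w Y))\<^sup>2 * (\<Sum>K\<in>?C Y. vol (half_diamond X K Y) * mass_div X \<rho> u K))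
   + (1/2) * (\<Sum>K\<in>?C Y. \<Sum>Y'\<in>dual_adj K Y. ?F K Y Y' * (w Y \<bullet> w Y')))"
  by (intro sum.cong refl) (simp add: f)
 also have "... = (1/2) * (\<Sum>Y\<in>all_faces X. (norm (w Y))\<^sup>2 * (\<Sum>K\<in>?C Y. vol (half_diamond X K Y) * mass_div X \<rho> u K))
   + (1/2) * (\<Sum>K\<in>cells X. \<Sum>Y\<in>faces K. \<Sum>Y'\<in>dual_adj K Y. ?F K Y Y' * (w Y \<bullet> w Y'))"
  by (simp only: sum.distrib sum_distrib_left[symmetric] sum_all_faces)
 also have "(\<Sum>K\<in>cells X. \<Sum>Y\<in>faces K. \<Sum>Y'\<in>dual_adj K Y. ?F K Y Y' * (w Y \<bullet> w Y')) = 0"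
  by (intro sum.neutral ballI dual_flux_antisym_sum u)
 finally show ?thesis by simp
qed

lemma V_dual_density:
 assumes "Y \<in> all_faces X"
 shows "V Y * dual_density X \<rho> Y = (\<Sum>K\<in>{K\<in>cells X. Y \<in> faces K}. vol (half_diamond X K Y) * \<rho> K)"
 using vol_dual_cell_pos[OF assms] by (simp add: dual_density_def)

text \<open>The dual density is the volume-weighted mean over the half-diamonds, which is what the
  matching combination of the cell balances produces.\<close>

lemma dual_mass_balance:
 assumes "mass_balance dt \<rho>' \<rho> u" and s: "Y \<in> all_faces X"
 shows "(\<Sum>K\<in>{K\<in>cells X. Y \<in> faces K}. vol (half_diamond X K Y) * mass_div X \<rho> u K)
  = - (1/dt) * (V Y * (dual_density X \<rho> Y - dual_density X \<rho>' Y))"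
proof -
 have "(\<Sum>K\<in>{K\<in>cells X. Y \<in> faces K}. vol (half_diamond X K Y) * mass_div X \<rho> u K)
  = (\<Sum>K\<in>{K\<in>cells X. Y \<in> faces K}. - (1/dt) * (vol (half_diamond X K Y) * \<rho> K - vol (half_diamond X K Y) * \<rho>' K))"
 proof (intro sum.cong refl)
  fix K assume "K \<in> {K\<in>cells X. Y \<in> faces K}"
  then have "(1/dt) * (\<rho> K - \<rho>' K) + mass_div X \<rho> u K = 0"
   using assms(1) by (simp add: mass_balance_def)
  then have e: "mass_div X \<rho> u K = - ((1/dt) * (\<rho> K - \<rho>' K))" by linarith
  show "vol (half_diamond X K Y) * mass_div X \<rho> u K = - (1/dt) * (vol (half_diamond X K Y) * \<rho> K - vol (half_diamond X K Y) * \<rho>' K)"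
   unfolding e by (simp add: algebra_simps)
 qed
 also have "... = - (1/dt) * (V Y * dual_density X \<rho> Y - V Y * dual_density X \<rho>' Y)"
  by (simp only: sum_distrib_left[symmetric] sum_subtractf V_dual_density[OF s])
 finally show ?thesis by (simp only: right_diff_distrib)
qed

subsection \<open>Pressure gradient\<close>

lemma press_grad_neighbour:
 assumes "K \<in> cells X" "Y \<in> int_face_set K"
 shows "press_grad X q (neighbour X K Y) Y = press_grad X q K Y"
proof -
 have e: "(c * (a - b)) *\<^sub>R (- n) = (c * (b - a)) *\<^sub>R n" for a b c :: real and n :: "real^'n"
  by (simp add: right_diff_distrib scaleR_diff_left)
 have "Y \<in> faces K" "Y \<in> int_faces X" using assms(2) by (simp_all add: int_face_set_def)
 note p = neighbour_props[OF assms(1) this]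
 show ?thesis unfolding press_grad_def p(3,4) by (rule e)
qed

text \<open>The pressure gradient indexed by the face alone. On an internal face either adjacent
  cell gives the same vector, because the jump and the normal change sign together; see
  \<open>pg_eq\<close>.\<close>

definition pg :: "'n scalar_field => 'n vector_field" where
 "pg q Y = press_grad X q (SOME K. K \<in> cells X \<and> Y \<in> faces K) Y"

lemma pg_eq:
 assumes "K \<in> cells X" "Y \<in> int_face_set K" shows "press_grad X q K Y = pg q Y"
proof -
 define L where "L = (SOME K. K \<in> cells X \<and> Y \<in> faces K)"
 have s: "Y \<in> faces K" "Y \<in> int_faces X" using assms by (auto simp: int_face_set_def)
 have "L \<in> cells X \<and> Y \<in> faces L"
  unfolding L_def by (rule someI[of "%K. K \<in> cells X \<and> Y \<in> faces K" K]) (use assms s in auto)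
 then have "L \<in> {K, neighbour X K Y}" using neighbour_props(6)[OF assms(1) s] by blast
 then show ?thesis using press_grad_neighbour[OF assms, of q] by (auto simp: pg_def simp flip: L_def)
qed

text \<open>Both cells of an internal face contribute the same product of jump and normal velocity,
  hence the factor 1/2.\<close>

lemma pg_work_diff:
 "(\<Sum>Y\<in>int_faces X. V Y * (pg q Y \<bullet> v Y)) =
  (1/2) * (\<Sum>K\<in>cells X. \<Sum>Y\<in>int_face_set K. area Y * ((q (neighbour X K Y) - q K) * (v Y \<bullet> normal K Y)))"
proof -
 have "2 * (V Y * (pg q Y \<bullet> v Y)) = (\<Sum>K\<in>{K\<in>cells X. Y \<in> faces K}. area Y * ((q (neighbour X K Y) - q K) * (v Y \<bullet> normal K Y)))"
  if s: "Y \<in> int_faces X" for Y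
 proof -
  obtain K where K: "K \<in> cells X" "Y \<in> faces K" using s int_faces_subset by (auto simp: all_faces_def)
  have Vp: "V Y \<noteq> 0" using vol_dual_cell_pos[of Y] s int_faces_subset by auto
  have e: "V Y * (pg q Y \<bullet> v Y) = area Y * ((q (neighbour X M Y) - q M) * (v Y \<bullet> normal M Y))"
   if "M \<in> cells X" "Y \<in> faces M" for M
   using pg_eq[OF that(1), of Y q, symmetric] that s Vp by (simp add: int_face_set_def press_grad_def inner_commute)
  have "(\<Sum>K\<in>{K\<in>cells X. Y \<in> faces K}. area Y * ((q (neighbour X K Y) - q K) * (v Y \<bullet> normal K Y)))
   = (\<Sum>K\<in>{K\<in>cells X. Y \<in> faces K}. V Y * (pg q Y \<bullet> v Y))"
   by (intro sum.cong refl) (use e in auto)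
  also have "... = 2 * (V Y * (pg q Y \<bullet> v Y))"
   unfolding neighbour_props(6)[OF K s] using neighbour_props(5)[OF K s] by simp
  finally show ?thesis by simp
 qed
 then have e: "(\<Sum>Y\<in>int_faces X. 2 * (V Y * (pg q Y \<bullet> v Y))) = (\<Sum>Y\<in>int_faces X. \<Sum>K\<in>{K\<in>cells X. Y \<in> faces K}. area Y * ((q (neighbour X K Y) - q K) * (v Y \<bullet> normal K Y)))"
  by (intro sum.cong refl)
 have "2 * (\<Sum>Y\<in>int_faces X. V Y * (pg q Y \<bullet> v Y)) = (\<Sum>Y\<in>int_faces X. 2 * (V Y * (pg q Y \<bullet> v Y)))"
  by (rule sum_distrib_left)
 also note e
 also note sum_int_faces
 finally show ?thesis by linarith
qed

lemma vol_vel_div: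
 assumes "v \<in> HE0 X" "K \<in> cells X"
 shows "vol K * vel_div X v K = (\<Sum>Y\<in>int_face_set K. area Y * (v Y \<bullet> normal K Y))"
proof -
 have "(\<Sum>Y\<in>faces K. area Y * (v Y \<bullet> normal K Y)) = (\<Sum>Y\<in>int_face_set K. area Y * (v Y \<bullet> normal K Y))"
 proof (rule sum.mono_neutral_right)
  show "\<forall>Y\<in>faces K - int_face_set K. area Y * (v Y \<bullet> normal K Y) = 0"
   using HE0_zero[OF assms(1)] assms(2) by (force simp: int_face_set_def all_faces_def)
 qed (use finite_faces[OF assms(2)] in \<open>auto simp: int_face_set_def\<close>)
 then show ?thesis using vol_pos[OF assms(2)] by (simp add: vel_div_def)
qed

text \<open>Discrete duality: up to sign, the gradient is the adjoint of the velocity divergence. No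
  boundary term appears because v vanishes on external faces.\<close>

lemma pg_work:
 assumes "v \<in> HE0 X"
 shows "(\<Sum>Y\<in>int_faces X. V Y * (pg q Y \<bullet> v Y)) = - (\<Sum>K\<in>cells X. q K * (vol K * vel_div X v K))"
proof -
 define S where "S = (\<Sum>K\<in>cells X. \<Sum>Y\<in>int_face_set K. area Y * (q K * (v Y \<bullet> normal K Y)))"
 have "S = (\<Sum>K\<in>cells X. \<Sum>Y\<in>int_face_set K. area Y * (q (neighbour X K Y) * (v Y \<bullet> normal (neighbour X K Y) Y)))"
  unfolding S_def by (rule sum_neighbour_swap)
 also have "... = (\<Sum>K\<in>cells X. \<Sum>Y\<in>int_face_set K. - (area Y * (q (neighbour X K Y) * (v Y \<bullet> normal K Y))))"
  by (intro sum.cong refl) (simp add: int_face_set_def neighbour_props)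
 finally have "- S = (\<Sum>K\<in>cells X. \<Sum>Y\<in>int_face_set K. area Y * (q (neighbour X K Y) * (v Y \<bullet> normal K Y)))"
  by (simp add: sum_negf)
 then have "(\<Sum>K\<in>cells X. \<Sum>Y\<in>int_face_set K. area Y * ((q (neighbour X K Y) - q K) * (v Y \<bullet> normal K Y))) = - S - S"
  unfolding S_def by (simp only: sum_subtractf[symmetric]) (simp add: algebra_simps)
 then have "(\<Sum>Y\<in>int_faces X. V Y * (pg q Y \<bullet> v Y)) = - S" unfolding pg_work_diff by simp
 also have "S = (\<Sum>K\<in>cells X. q K * (vol K * vel_div X v K))"
  unfolding S_def by (intro sum.cong refl) (simp add: vol_vel_div[OF assms] sum_distrib_left mult.left_commute)
 finally show ?thesis .
qed

end

section \<open>Uniform estimates\<close>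

lemma powr_Lipschitz_near_1:
 fixes x \<gamma> :: real
 assumes "\<gamma> \<ge> 1" "1/2 \<le> x" "x \<le> 2"
 shows "\<bar>x powr \<gamma> - 1\<bar> \<le> \<gamma> * 2 powr \<gamma> * \<bar>x - 1\<bar>"
proof -
 have "norm (x powr \<gamma> - 1 powr \<gamma>) \<le> (\<gamma> * 2 powr \<gamma>) * norm (x - 1)"
 proof (rule field_differentiable_bound[where S="{1/2..2}" and f'="%x. \<gamma> * x powr (\<gamma> - 1)"])
  fix z :: real assume z: "z \<in> {1/2..2}"
  show "((%x. x powr \<gamma>) has_field_derivative \<gamma> * z powr (\<gamma> - 1)) (at z within {1/2..2})"
   by (rule has_field_derivative_at_within[OF has_real_derivative_powr]) (use z in auto)
  have "z powr (\<gamma> - 1) \<le> 2 powr (\<gamma> - 1)" using z assms by (intro powr_mono2) auto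
  also have "... \<le> 2 powr \<gamma>" by simp
  finally show "norm (\<gamma> * z powr (\<gamma> - 1)) \<le> \<gamma> * 2 powr \<gamma>" using assms by (simp add: abs_mult)
 qed (use assms in auto)
 then show ?thesis by simp
qed

lemma abs_diff_1_le_powr:
 fixes x \<gamma> :: real
 assumes "\<gamma> \<ge> 1" "x > 0" shows "\<bar>x - 1\<bar> \<le> \<bar>x powr \<gamma> - 1\<bar>"
proof (cases "x \<ge> 1")
 case True
 then have "x powr 1 \<le> x powr \<gamma>" using assms by (intro powr_mono) auto
 with True assms show ?thesis by simp
next
 case False
 then have "x powr \<gamma> \<le> x powr 1" using assms by (intro powr_mono') auto
 with False assms show ?thesis by simp
qed

text \<open>The function \<open>f\<close> with \<open>\<rho> f'(\<rho>) = (\<rho>\<^sup>\<gamma>)'\<close> plays the role of the enthalpy.\<close>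

lemma enthalpy:
 fixes \<gamma> :: real
 assumes "\<gamma> \<ge> 1"
 obtains f :: "real => real" where "f 1 = 0"
  "!!a b. a > 0 ==> b > 0 ==> a powr \<gamma> - b powr \<gamma> \<le> a * (f a - f b)"
proof (cases "\<gamma> = 1")
 case True
 have "a powr \<gamma> - b powr \<gamma> \<le> a * (ln a - ln b)" if "a > 0" "b > 0" for a b :: real
 proof -
  have "ln (b / a) \<le> b / a - 1" using that by (intro ln_le_minus_one) simp
  then have "a * ln (b / a) \<le> a * (b / a - 1)" using that by (intro mult_left_mono) auto
  then show ?thesis using that True by (simp add: ln_div algebra_simps)
 qed
 then show ?thesis using that[of ln] by simp
next
 case False
 then have g: "\<gamma> > 1" using assms by simp
 \<comment> \<open>The primitive of \<gamma> x^(\<gamma>-2) that vanishes at 1. The required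
   inequality for it is Young's inequality with the conjugate exponents \<gamma> and
   \<gamma>/(\<gamma>-1).\<close>
 define f where "f x = \<gamma> / (\<gamma> - 1) * (x powr (\<gamma> - 1) - 1)" for x :: real
 have "a powr \<gamma> - b powr \<gamma> \<le> a * (f a - f b)" if "a > 0" "b > 0" for a b :: real
 proof -
  define q where "q = \<gamma> / (\<gamma> - 1)"
  have q: "q > 1" "1 / \<gamma> + 1 / q = 1" "(\<gamma> - 1) * q = \<gamma>" "\<gamma> / q = \<gamma> - 1" using g by (auto simp: q_def field_simps)
  have "a * b powr (\<gamma> - 1) \<le> a powr \<gamma> / \<gamma> + (b powr (\<gamma> - 1)) powr q / q"
   by (rule Youngs_inequality) (use g q that in auto)
  then have "a * b powr (\<gamma> - 1) \<le> a powr \<gamma> / \<gamma> + b powr \<gamma> / q" by (simp add: powr_powr q)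
  then have "\<gamma> * (a * b powr (\<gamma> - 1)) \<le> \<gamma> * (a powr \<gamma> / \<gamma> + b powr \<gamma> / q)"
   using g by (intro mult_left_mono) auto
  also have "... = a powr \<gamma> + (\<gamma> - 1) * b powr \<gamma>"
   using g by (simp add: distrib_left q(4)[symmetric])
  finally have y: "(\<gamma> - 1) * (a powr \<gamma> - b powr \<gamma>) \<le> \<gamma> * (a powr \<gamma> - a * b powr (\<gamma> - 1))"
   by (simp add: algebra_simps)
  have p: "a * a powr (\<gamma> - 1) = a powr \<gamma>" using that by (simp add: powr_mult_base)
  have "f a - f b = \<gamma> / (\<gamma> - 1) * (a powr (\<gamma> - 1) - b powr (\<gamma> - 1))"
   unfolding f_def right_diff_distrib[symmetric] by simp
  then have "(\<gamma> - 1) * (a * (f a - f b)) = \<gamma> * (a * (a powr (\<gamma> - 1) - b powr (\<gamma> - 1)))"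
   using g by simp
  also have "... = \<gamma> * (a powr \<gamma> - a * b powr (\<gamma> - 1))" by (simp only: right_diff_distrib p)
  finally have "(\<gamma> - 1) * (a * (f a - f b)) = \<gamma> * (a powr \<gamma> - a * b powr (\<gamma> - 1))" .
  with y have "(\<gamma> - 1) * (a powr \<gamma> - b powr \<gamma>) \<le> (\<gamma> - 1) * (a * (f a - f b))" by simp
  then show ?thesis using g by simp
 qed
 then show ?thesis using that[of f] by (simp add: f_def)
qed

lemma Bseq_bound: "Bseq f ==> \<exists>k. \<forall>m. norm (f m) \<le> k"
 by (auto simp: Bseq_def)

lemma Bseq_uniform:
 assumes "finite I" "!!i. i \<in> I ==> Bseq (%m. f m i)"
 obtains C :: real where "C \<ge> 0" "!!m i. i \<in> I ==> norm (f m i) \<le> C"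
proof -
 have "\<forall>i\<in>I. \<exists>k. \<forall>m. norm (f m i) \<le> k" by (intro ballI Bseq_bound assms(2))
 from bchoice[OF this] obtain g where g: "!!i m. i \<in> I ==> norm (f m i) \<le> g i" by blast
 have "norm (f m i) \<le> (\<Sum>i\<in>I. \<bar>g i\<bar>)" if "i \<in> I" for m i
  using g[OF that, of m] member_le_sum[of i I "%i. \<bar>g i\<bar>"] assms(1) that by fastforce
 then show ?thesis using that[of "\<Sum>i\<in>I. \<bar>g i\<bar>"] by (simp add: sum_nonneg)
qed

lemma Bseq_scaleR:
 fixes g :: "nat => 'a::real_normed_vector"
 assumes "Bseq f" "Bseq g" shows "Bseq (%m. f m *\<^sub>R g m)"
proof -
 obtain k where k: "!!m. norm (f m) \<le> k" "0 < k" using assms(1) unfolding Bseq_def by blast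
 obtain l where l: "!!m. norm (g m) \<le> l" using Bseq_bound[OF assms(2)] by blast
 have "norm (f m *\<^sub>R g m) \<le> k * l" for m
  using mult_mono[OF k(1)[of m] l[of m]] k(2) by simp
 then show ?thesis by (rule BseqI')
qed

text \<open>If one x i were large, its quadratic term alone would exceed D by more than all other
  terms can compensate, as each of them is bounded below. The weights are kept because they are the
  volumes of the dual cells.\<close>

lemma quadratic_bound:
 fixes V :: "'i => real"
 assumes S: "finite S" and V: "!!i. i \<in> S ==> V i > 0" and a: "a > 0"
 obtains C where "!!x i. (\<Sum>i\<in>S. V i * (a * (x i)\<^sup>2 - B * x i)) \<le> D ==> i \<in> S ==> x i \<le> C"
proof -
 \<comment> \<open>The largest value of B x - a x^2, so that no term can be less than -M times its
   weight.\<close>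
 define M where "M = B\<^sup>2 / (4 * a)"
 define E where "E = \<bar>D\<bar> + (\<Sum>i\<in>S. V i * M)"
 have M: "M \<ge> 0" using a by (simp add: M_def)
 have E: "E \<ge> 0" unfolding E_def using M V by (intro add_nonneg_nonneg sum_nonneg mult_nonneg_nonneg) (auto intro: less_imp_le)
 \<comment> \<open>Chosen so that x i > C gives both x i > 1 and a * x i - B > E / V i, hence a term
   larger than E. Summing over all indices makes the bound independent of i.\<close>
 define C where "C = 1 + (\<Sum>i\<in>S. (\<bar>B\<bar> + E / V i) / a)"
 have "x i \<le> C" if le: "(\<Sum>i\<in>S. V i * (a * (x i)\<^sup>2 - B * x i)) \<le> D" and i: "i \<in> S" for x i
 proof (rule ccontr)
  assume n: "\<not> x i \<le> C"
  have "(\<bar>B\<bar> + E / V i) / a \<le> (\<Sum>i\<in>S. (\<bar>B\<bar> + E / V i) / a)"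
   using S i E a V by (intro member_le_sum) (auto intro!: divide_nonneg_nonneg add_nonneg_nonneg simp: less_imp_le)
  moreover have "0 \<le> (\<bar>B\<bar> + E / V i) / a" using E a V[OF i] by (auto intro!: divide_nonneg_nonneg add_nonneg_nonneg)
  ultimately have x: "x i > 1 + (\<bar>B\<bar> + E / V i) / a" "x i > 1" using n unfolding C_def by linarith+
  then have "a * x i > a * (1 + (\<bar>B\<bar> + E / V i) / a)" using a by simp
  also have "a * (1 + (\<bar>B\<bar> + E / V i) / a) = a + \<bar>B\<bar> + E / V i" using a by (simp add: field_simps)
  finally have 1: "a * x i - B > E / V i" using a by linarith
  moreover have "E / V i \<ge> 0" using E V[OF i] by simp
  ultimately have "(a * x i - B) * x i \<ge> (a * x i - B) * 1" using x(2) by (intro mult_left_mono) auto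
  with 1 have "E / V i < a * (x i)\<^sup>2 - B * x i" by (simp add: power2_eq_square algebra_simps)
  then have 2: "V i * (a * (x i)\<^sup>2 - B * x i) > E"
   by (simp only: pos_divide_less_eq[OF V[OF i]] mult.commute)
  have t: "V j * (a * (x j)\<^sup>2 - B * x j) \<ge> - (V j * M)" if "j \<in> S" for j
  proof -
   have "a * (x j)\<^sup>2 - B * x j + M = a * (x j - B / (2 * a))\<^sup>2"
    using a by (simp add: M_def power2_eq_square field_simps)
   then have "- M \<le> a * (x j)\<^sup>2 - B * x j" using a by (smt (verit) mult_nonneg_nonneg zero_le_power2)
   from mult_left_mono[OF this less_imp_le[OF V[OF that]]] show ?thesis by simp
  qed
  have "(\<Sum>j\<in>S - {i}. V j * (a * (x j)\<^sup>2 - B * x j)) \<ge> (\<Sum>j\<in>S - {i}. - (V j * M))"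
   by (intro sum_mono) (use t in auto)
  moreover have "(\<Sum>j\<in>S - {i}. V j * M) \<le> (\<Sum>j\<in>S. V j * M)"
   using S M V by (intro sum_mono2) (auto simp: less_imp_le)
  ultimately have "(\<Sum>j\<in>S - {i}. V j * (a * (x j)\<^sup>2 - B * x j)) \<ge> - (\<Sum>j\<in>S. V j * M)" by (simp add: sum_negf)
  moreover have "(\<Sum>j\<in>S. V j * (a * (x j)\<^sup>2 - B * x j))
   = V i * (a * (x i)\<^sup>2 - B * x i) + (\<Sum>j\<in>S - {i}. V j * (a * (x j)\<^sup>2 - B * x j))" by (rule sum.remove[OF S i])
  ultimately show False using 2 le unfolding E_def by linarith
 qed
 then show ?thesis by (rule that)
qed

text \<open>Boundedness of the rescaled sequence is the form in which a = 1 + O(e^2) is carried from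
  one time step to the next.\<close>

lemma tendsto_1_of_Bseq:
 fixes a e :: "nat => real"
 assumes "Bseq (%m. (a m - 1) / (e m)\<^sup>2)" "!!m. e m > 0" "e \<longlonglongrightarrow> 0"
 shows "a \<longlonglongrightarrow> 1"
proof -
 obtain C where C: "!!m. norm ((a m - 1) / (e m)\<^sup>2) \<le> C" using Bseq_bound[OF assms(1)] by blast
 have "(%m. a m - 1) \<longlonglongrightarrow> 0"
 proof (rule Lim_null_comparison)
  show "\<forall>\<^sub>F m in sequentially. norm (a m - 1) \<le> C * (e m)\<^sup>2"
  proof (intro always_eventually allI)
   fix m show "norm (a m - 1) \<le> C * (e m)\<^sup>2"
    using C[of m] assms(2)[of m] by (simp add: abs_divide pos_divide_le_eq)
  qed
  show "(%m. C * (e m)\<^sup>2) \<longlonglongrightarrow> 0" using tendsto_mult[OF tendsto_const[of C] tendsto_power[OF assms(3), of 2]] by simp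
 qed
 then show ?thesis by (simp add: LIM_zero_iff)
qed

lemma Bseq_powr_near_1:
 fixes a e :: "nat => real"
 assumes a: "Bseq (%m. (a m - 1) / (e m)\<^sup>2)" and e: "!!m. e m > 0" "e \<longlonglongrightarrow> 0" and \<gamma>: "\<gamma> \<ge> 1"
 shows "Bseq (%m. (a m powr \<gamma> - 1) / (e m)\<^sup>2)"
proof -
 obtain C where C: "!!m. norm ((a m - 1) / (e m)\<^sup>2) \<le> C" using Bseq_bound[OF a] by blast
 note t = tendsto_1_of_Bseq[OF a e]
 have "\<forall>\<^sub>F m in sequentially. 1/2 < a m" "\<forall>\<^sub>F m in sequentially. a m < 2"
  by (rule order_tendstoD[OF t], simp)+
 then have "\<forall>\<^sub>F m in sequentially. norm ((a m powr \<gamma> - 1) / (e m)\<^sup>2) \<le> \<gamma> * 2 powr \<gamma> * C"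
 proof eventually_elim
  case (elim m)
  have "\<bar>a m powr \<gamma> - 1\<bar> / (e m)\<^sup>2 \<le> \<gamma> * 2 powr \<gamma> * \<bar>a m - 1\<bar> / (e m)\<^sup>2"
   by (rule divide_right_mono[OF powr_Lipschitz_near_1[OF \<gamma>]]) (use elim in auto)
  also have "... = \<gamma> * 2 powr \<gamma> * norm ((a m - 1) / (e m)\<^sup>2)" by simp
  also have "... \<le> \<gamma> * 2 powr \<gamma> * C" using C \<gamma> by (intro mult_left_mono) auto
  finally show ?case by simp
 qed
 then show ?thesis by (rule BfunI)
qed

context discretization
begin

section \<open>Discrete gradients and bounds over one time step\<close>

lemma norm_normal: "K \<in> cells X ==> Y \<in> faces K ==> norm (normal K Y) = 1"
 by (rule full_polytope.normal_offset(1)[OF cell_full])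

lemma norm_pg:
 assumes "K \<in> cells X" "Y \<in> int_face_set K"
 shows "norm (pg q Y) = area Y / V Y * \<bar>q (neighbour X K Y) - q K\<bar>"
 using assms norm_normal[of K Y] area_nonneg[of Y]
 by (simp add: pg_eq[OF assms, symmetric] press_grad_def int_face_set_def abs_mult)

lemma int_face_cell:
 assumes "Y \<in> int_faces X" obtains K where "K \<in> cells X" "Y \<in> int_face_set K"
 using assms int_faces_subset by (auto simp: all_faces_def int_face_set_def)

lemma pg_scale:
 assumes "Y \<in> int_faces X" shows "c *\<^sub>R pg q Y = pg (%K. c * (q K - b)) Y"
proof -
 obtain K where K: "K \<in> cells X" "Y \<in> int_face_set K" by (rule int_face_cell[OF assms])
 have "c * (area Y / V Y * (q L - q M)) = area Y / V Y * (c * (q L - b) - c * (q M - b))" for L M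
  by (simp add: algebra_simps)
 then show ?thesis unfolding pg_eq[OF K, symmetric] press_grad_def by simp
qed

lemma pg_diff:
 assumes "Y \<in> int_faces X" shows "pg (%K. p K - q K) Y = pg p Y - pg q Y"
proof -
 obtain K where K: "K \<in> cells X" "Y \<in> int_face_set K" by (rule int_face_cell[OF assms])
 have "(c * ((a1 - b1) - (a2 - b2))) *\<^sub>R n = (c * (a1 - a2)) *\<^sub>R n - (c * (b1 - b2)) *\<^sub>R n"
  for a1 b1 a2 b2 c and n :: "real^'n"
  unfolding scaleR_diff_left[symmetric] right_diff_distrib[symmetric]
  by (rule arg_cong[where f="%x. (c * x) *\<^sub>R n"]) simp
 then show ?thesis unfolding pg_eq[OF K, symmetric] press_grad_def .
qed

lemma tendsto_pg:
 assumes "Y \<in> int_faces X" "!!K. K \<in> cells X ==> ((%m. q m K) \<longlongrightarrow> p K) F"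
 shows "((%m. pg (q m) Y) \<longlongrightarrow> pg p Y) F"
proof -
 obtain K where K: "K \<in> cells X" "Y \<in> int_face_set K" by (rule int_face_cell[OF assms(1)])
 have N: "neighbour X K Y \<in> cells X" using K neighbour_props(1)[of K Y] by (simp add: int_face_set_def)
 show ?thesis unfolding pg_eq[OF K, symmetric] press_grad_def
  by (intro tendsto_intros assms(2) K(1) N)
qed

lemma Bseq_pg:
 assumes "Y \<in> int_faces X" "!!K. K \<in> cells X ==> Bseq (%m. q m K)"
 shows "Bseq (%m. pg (q m) Y)"
proof -
 obtain K where K: "K \<in> cells X" "Y \<in> int_face_set K" by (rule int_face_cell[OF assms(1)])
 have N: "neighbour X K Y \<in> cells X" using K neighbour_props(1)[of K Y] by (simp add: int_face_set_def)
 obtain C where C: "!!m L. L \<in> cells X ==> norm (q m L) \<le> C"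
  by (rule Bseq_uniform[OF finite_cells, of q, OF assms(2)], assumption, rule that; blast)
 have "norm (pg (q m) Y) \<le> area Y / V Y * (2 * C)" for m
 proof -
  have "\<bar>q m (neighbour X K Y) - q m K\<bar> \<le> 2 * C"
   using C[OF K(1), of m] C[OF N, of m] unfolding real_norm_def by linarith
  then show ?thesis unfolding norm_pg[OF K]
   by (rule mult_left_mono) (intro divide_nonneg_nonneg area_nonneg measure_nonneg)
 qed
 then show ?thesis by (rule BseqI')
qed

text \<open>A discrete Poincare inequality. The existence of a constant for a pair of cells
  propagates across an internal face at the price of one more jump, in both directions. It is
  therefore a truth value that agrees on neighbours, and \<open>constant_of_equal_neighbours\<close>
  extends it to all cells.\<close>

lemma oscillation_bound:
 "\<exists>D. \<forall>q t. t \<ge> 0 \<longrightarrow> (\<forall>Y\<in>int_faces X. norm (pg q Y) \<le> t) \<longrightarrow>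
  (\<forall>K\<in>cells X. \<forall>L\<in>cells X. \<bar>q L - q K\<bar> \<le> D * t)"
proof -
 define small where "small q t \<longleftrightarrow> t \<ge> 0 \<and> (\<forall>K\<in>cells X. \<forall>Y\<in>int_face_set K. \<bar>q (neighbour X K Y) - q K\<bar> \<le> t)"
  for q :: "(real^'n) set => real" and t
 define P where "P K0 K \<longleftrightarrow> (\<exists>D. \<forall>q t. small q t \<longrightarrow> \<bar>q K - q K0\<bar> \<le> D * t)" for K0 K
 have step: "P K0 (neighbour X K Y)" if P: "P K0 K" and "K \<in> cells X" "Y \<in> int_face_set K" for K0 K Y
 proof -
  obtain D where D: "!!q t. small q t ==> \<bar>q K - q K0\<bar> \<le> D * t" using P unfolding P_def by blast
  have "\<bar>q (neighbour X K Y) - q K0\<bar> \<le> (D + 1) * t" if s: "small q t" for q t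
  proof -
   have "\<bar>q (neighbour X K Y) - q K\<bar> \<le> t" using s \<open>K \<in> cells X\<close> \<open>Y \<in> int_face_set K\<close> by (simp add: small_def)
   then show ?thesis using D[OF s] by (simp add: distrib_right)
  qed
  then show ?thesis unfolding P_def by blast
 qed
 have "P K0 (neighbour X K Y) = P K0 K" if "K \<in> cells X" "Y \<in> faces K" "Y \<in> int_faces X" for K0 K Y
  using step[of K0 K Y] step[of K0 "neighbour X K Y" Y] neighbour_props[OF that] that by (auto simp: int_face_set_def)
 then have "P K L = P K K" if "K \<in> cells X" "L \<in> cells X" for K L
  using constant_of_equal_neighbours[of "P K" K L] that by blast
 moreover have "P K K" for K unfolding P_def by (intro exI[of _ 0]) simp
 ultimately have "\<forall>K\<in>cells X. \<forall>L\<in>cells X. \<exists>D. \<forall>q t. small q t \<longrightarrow> \<bar>q L - q K\<bar> \<le> D * t" unfolding P_def by simp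
 then obtain d where d: "!!K L q t. K \<in> cells X ==> L \<in> cells X ==> small q t ==> \<bar>q L - q K\<bar> \<le> d K L * t" by metis
 define D where "D = (\<Sum>K\<in>cells X. \<Sum>L\<in>cells X. \<bar>d K L\<bar>)"
 have D: "d K L \<le> D" if "K \<in> cells X" "L \<in> cells X" for K L
 proof -
  have "d K L \<le> \<bar>d K L\<bar>" by simp
  also have "... \<le> (\<Sum>L\<in>cells X. \<bar>d K L\<bar>)" using that finite_cells by (intro member_le_sum) auto
  also have "... \<le> D" unfolding D_def using that finite_cells by (intro member_le_sum) (auto intro: sum_nonneg)
  finally show ?thesis .
 qed
 \<comment> \<open>Converts norms of the gradient into jumps across faces; the sum serves as a
   common bound for the quotients of all faces.\<close>
 define c where "c = (\<Sum>Y\<in>int_faces X. V Y / area Y)"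
 have c0: "c \<ge> 0" unfolding c_def by (intro sum_nonneg divide_nonneg_nonneg area_nonneg measure_nonneg)
 have fin: "\<bar>q L - q K\<bar> \<le> (D * c) * t"
  if t: "t \<ge> 0" "!!Y. Y \<in> int_faces X ==> norm (pg q Y) \<le> t" and KL: "K \<in> cells X" "L \<in> cells X" for q t K L
 proof -
  have "small q (c * t)" unfolding small_def
  proof (intro conjI ballI)
   show "0 \<le> c * t" using c0 t(1) by simp
   fix K Y assume K: "K \<in> cells X" "Y \<in> int_face_set K"
   have s: "Y \<in> int_faces X" "Y \<in> faces K" using K(2) by (auto simp: int_face_set_def)
   have a: "area Y > 0" "V Y > 0" using area_pos[OF K(1) s(2)] vol_dual_cell_pos int_faces_subset s(1) by auto
   have "\<bar>q (neighbour X K Y) - q K\<bar> = V Y / area Y * norm (pg q Y)" using a by (simp add: norm_pg[OF K])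
   also have "... \<le> V Y / area Y * t" using a t(2)[OF s(1)] by (intro mult_left_mono) auto
   also have "... \<le> c * t" unfolding c_def
    by (intro mult_right_mono member_le_sum divide_nonneg_nonneg measure_nonneg area_nonneg s(1) finite_int_faces t(1))
   finally show "\<bar>q (neighbour X K Y) - q K\<bar> \<le> c * t" .
  qed
  then have "\<bar>q L - q K\<bar> \<le> d K L * (c * t)" by (rule d[OF KL])
  also have "... \<le> D * (c * t)" using D[OF KL] c0 t(1) by (intro mult_right_mono) auto
  finally show ?thesis by (simp add: mult.assoc)
 qed
 show ?thesis
 proof (rule exI[of _ "D * c"], intro allI impI ballI)
  fix q t K L assume "0 \<le> t" "\<forall>Y\<in>int_faces X. norm (pg q Y) \<le> t" "K \<in> cells X" "L \<in> cells X"
  then show "\<bar>q L - q K\<bar> \<le> (D * c) * t" by (intro fin) simp_all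
 qed
qed

text \<open>By the dual mass balance the convection term contributes minus half the time difference
  of the densities times the square of w. This turns the weight of the kinetic energy into the mean
  of both densities; the viscous term has a sign.\<close>

lemma prediction_energy:
 assumes u: "u \<in> HE0 X" and w: "w \<in> HE0 X" and mb: "mass_balance dt \<rho>o \<rho> u" and \<mu>: "0 \<le> \<mu>" "0 \<le> \<mu> + lam"
  and eq: "!!Y. Y \<in> int_faces X ==> (1/dt) *\<^sub>R (dual_density X \<rho> Y *\<^sub>R w Y - z Y) + convection X \<rho> u w Y
   - div_tau X \<mu> lam w Y + G Y = 0"
 shows "(\<Sum>Y\<in>int_faces X. V Y * ((1/dt) * ((1/2) * (dual_density X \<rho> Y + dual_density X \<rho>o Y) * (norm (w Y))\<^sup>2 - z Y \<bullet> w Y) + G Y \<bullet> w Y)) \<le> 0"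
proof -
 let ?r = "dual_density X \<rho>" and ?ro = "dual_density X \<rho>o"
 have all: "(\<Sum>Y\<in>all_faces X. V Y * (g Y \<bullet> w Y)) = (\<Sum>Y\<in>int_faces X. V Y * (g Y \<bullet> w Y))" for g
  by (rule sum.mono_neutral_right[OF finite_all_faces int_faces_subset]) (use HE0_zero[OF w] in auto)
 have c: "(\<Sum>Y\<in>int_faces X. V Y * (convection X \<rho> u w Y \<bullet> w Y)) = (\<Sum>Y\<in>int_faces X. V Y * (((- (1/dt) * (1/2) * (?r Y - ?ro Y)) *\<^sub>R w Y) \<bullet> w Y))"
 proof -
  have "(\<Sum>Y\<in>int_faces X. V Y * (convection X \<rho> u w Y \<bullet> w Y)) =
   (1/2) * (\<Sum>Y\<in>all_faces X. (norm (w Y))\<^sup>2 * (- (1/dt) * (V Y * (?r Y - ?ro Y))))"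
   unfolding all[symmetric] convection_energy[OF u] by (simp add: dual_mass_balance[OF mb])
  also have "... = (\<Sum>Y\<in>all_faces X. V Y * (((- (1/dt) * (1/2) * (?r Y - ?ro Y)) *\<^sub>R w Y) \<bullet> w Y))"
   unfolding sum_distrib_left by (intro sum.cong refl) (simp add: power2_norm_eq_inner mult_ac)
  finally show ?thesis unfolding all .
 qed
 have d: "(\<Sum>Y\<in>int_faces X. V Y * (div_tau X \<mu> lam w Y \<bullet> w Y)) \<le> 0"
  unfolding all[symmetric] by (rule div_tau_dissipative[OF \<mu>])
 have "V Y * ((1/dt) * ((1/2) * (?r Y + ?ro Y) * (norm (w Y))\<^sup>2 - z Y \<bullet> w Y) + G Y \<bullet> w Y)
   = V Y * (div_tau X \<mu> lam w Y \<bullet> w Y) - V Y * (convection X \<rho> u w Y \<bullet> w Y)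
   + V Y * (((- (1/dt) * (1/2) * (?r Y - ?ro Y)) *\<^sub>R w Y) \<bullet> w Y)" if s: "Y \<in> int_faces X" for Y
 proof -
  have "0 = ((1/dt) *\<^sub>R (?r Y *\<^sub>R w Y - z Y) + convection X \<rho> u w Y - div_tau X \<mu> lam w Y + G Y) \<bullet> w Y"
   using eq[OF s] by simp
  also have "... = (1/dt) * (?r Y * (w Y \<bullet> w Y) - z Y \<bullet> w Y) + convection X \<rho> u w Y \<bullet> w Y - div_tau X \<mu> lam w Y \<bullet> w Y + G Y \<bullet> w Y"
   by (simp only: inner_add_left inner_diff_left inner_scaleR_left)
  finally have e: "div_tau X \<mu> lam w Y \<bullet> w Y = (1/dt) * (?r Y * (w Y \<bullet> w Y) - z Y \<bullet> w Y) + convection X \<rho> u w Y \<bullet> w Y + G Y \<bullet> w Y"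
   by linarith
  have "v * (c * (1/2 * (r + ro) * a - b) + g) = v * (c * (r * a - b) + h + g) - v * h + v * ((- c * (1/2) * (r - ro)) * a)"
   for v c r ro a b g h :: real by (simp add: field_simps)
  then show ?thesis unfolding e power2_norm_eq_inner inner_scaleR_left .
 qed
 then have "(\<Sum>Y\<in>int_faces X. V Y * ((1/dt) * ((1/2) * (?r Y + ?ro Y) * (norm (w Y))\<^sup>2 - z Y \<bullet> w Y) + G Y \<bullet> w Y))
  = (\<Sum>Y\<in>int_faces X. V Y * (div_tau X \<mu> lam w Y \<bullet> w Y) - V Y * (convection X \<rho> u w Y \<bullet> w Y)
   + V Y * (((- (1/dt) * (1/2) * (?r Y - ?ro Y)) *\<^sub>R w Y) \<bullet> w Y))" by (intro sum.cong refl)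
 then show ?thesis using c d by (simp only: sum.distrib sum_subtractf)
qed

text \<open>Face by face, the enthalpy inequality compares the pressure work with the mass
  divergence tested with f(\<rho>'). The mass balance turns the latter into a density increment,
  monotonicity of f replaces f(\<rho>') by the small f(\<rho>), and the remaining densities are
  controlled by conservation of mass.\<close>

lemma pressure_work:
 assumes mb: "mass_balance dt \<rho> \<rho>' u" and dt: "dt > 0" and u: "u \<in> HE0 X" and \<gamma>: "\<gamma> \<ge> 1"
  and \<rho>: "!!K. K \<in> cells X ==> 1/2 \<le> \<rho> K \<and> \<rho> K \<le> 2"
  and F: "!!K. K \<in> cells X ==> \<bar>\<rho> K powr \<gamma> - 1\<bar> \<le> F"
 shows "(\<Sum>Y\<in>int_faces X. V Y * (pg (pressure \<gamma> \<rho>') Y \<bullet> u Y)) \<ge> - (8 / dt * F * (\<Sum>K\<in>cells X. vol K))"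
proof -
 obtain f where f1: "f 1 = (0::real)" and f: "!!a b. a > 0 ==> b > 0 ==> a powr \<gamma> - b powr \<gamma> \<le> a * (f a - f b)"
  using enthalpy[OF \<gamma>] by blast
 let ?p = "pressure \<gamma> \<rho>'"
 have pos: "\<rho> K > 0" if "K \<in> cells X" for K using \<rho>[OF that] by linarith
 have pos': "\<rho>' K > 0" if "K \<in> cells X" for K by (rule mass_balance_pos[OF mb dt pos that])
 have fl: "mass_flux X \<rho>' u K Y * (f (\<rho>' K) - f (\<rho>' (neighbour X K Y))) \<ge> - (area Y * ((?p (neighbour X K Y) - ?p K) * (u Y \<bullet> normal K Y)))"
  if K: "K \<in> cells X" "Y \<in> int_face_set K" for K Y
 proof -
  let ?N = "neighbour X K Y" and ?a = "u Y \<bullet> normal K Y"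
  have s: "Y \<in> faces K" "Y \<in> int_faces X" using K(2) by (auto simp: int_face_set_def)
  have N: "?N \<in> cells X" using neighbour_props(1)[OF K(1) s] .
  have "(?p K - ?p ?N) * ?a \<le> (\<rho>' K * max ?a 0 + \<rho>' ?N * min ?a 0) * (f (\<rho>' K) - f (\<rho>' ?N))"
  proof (cases "?a \<ge> 0")
   case True
   have "?p K - ?p ?N \<le> \<rho>' K * (f (\<rho>' K) - f (\<rho>' ?N))"
    unfolding pressure_def by (rule f[OF pos'[OF K(1)] pos'[OF N]])
   then have "(?p K - ?p ?N) * ?a \<le> (\<rho>' K * (f (\<rho>' K) - f (\<rho>' ?N))) * ?a" using True by (rule mult_right_mono)
   then show ?thesis using True by (simp add: max_def min_def mult_ac)
  next
   case False
   have "?p ?N - ?p K \<le> \<rho>' ?N * (f (\<rho>' ?N) - f (\<rho>' K))"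
    unfolding pressure_def by (rule f[OF pos'[OF N] pos'[OF K(1)]])
   then have "(?p ?N - ?p K) * (- ?a) \<le> (\<rho>' ?N * (f (\<rho>' ?N) - f (\<rho>' K))) * (- ?a)" using False by (intro mult_right_mono) auto
   then show ?thesis using False by (simp add: max_def min_def algebra_simps)
  qed
  then have "area Y * ((?p K - ?p ?N) * ?a) \<le> area Y * ((\<rho>' K * max ?a 0 + \<rho>' ?N * min ?a 0) * (f (\<rho>' K) - f (\<rho>' ?N)))"
   by (rule mult_left_mono[OF _ area_nonneg])
  then show ?thesis unfolding mass_flux_upwind[OF K(2)] by (simp add: algebra_simps)
 qed
 have "- (\<Sum>Y\<in>int_faces X. V Y * (pg ?p Y \<bullet> u Y)) \<le> (\<Sum>K\<in>cells X. f (\<rho>' K) * (vol K * mass_div X \<rho>' u K))"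
 proof -
  have "(\<Sum>K\<in>cells X. \<Sum>Y\<in>int_face_set K. - (area Y * ((?p (neighbour X K Y) - ?p K) * (u Y \<bullet> normal K Y))))
   \<le> (\<Sum>K\<in>cells X. \<Sum>Y\<in>int_face_set K. mass_flux X \<rho>' u K Y * (f (\<rho>' K) - f (\<rho>' (neighbour X K Y))))"
   by (intro sum_mono fl)
  then show ?thesis unfolding pg_work_diff sum_by_parts[of "%K. f (\<rho>' K)"] sum_negf by linarith
 qed
 also have "... \<le> (\<Sum>K\<in>cells X. 2 * F * vol K / dt * (\<rho> K + \<rho>' K))"
 proof (rule sum_mono)
  fix K assume K: "K \<in> cells X"
  have "(1/dt) * (\<rho>' K - \<rho> K) + mass_div X \<rho>' u K = 0" using mb K by (simp add: mass_balance_def)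
  then have m: "mass_div X \<rho>' u K = - ((1/dt) * (\<rho>' K - \<rho> K))" by linarith
  \<comment> \<open>A nonnegative value is at most the pressure defect by the enthalpy inequality at
    1 and \<rho>. For a negative one, \<rho> times the value is at least the defect, and \<rho>
    \<ge> 1/2 gives the factor 2.\<close>
  have fa: "\<bar>f (\<rho> K)\<bar> \<le> 2 * F"
  proof -
   have "f (\<rho> K) \<le> \<rho> K powr \<gamma> - 1" using f[of 1 "\<rho> K"] pos[OF K] f1 by simp
   moreover have "\<rho> K powr \<gamma> - 1 \<le> \<rho> K * f (\<rho> K)" using f[of "\<rho> K" 1] pos[OF K] f1 by simp
   moreover have "\<rho> K * f (\<rho> K) \<le> (1/2) * f (\<rho> K)" if "f (\<rho> K) < 0"
    using \<rho>[OF K] that by (intro mult_right_mono_neg) auto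
   ultimately show ?thesis using F[OF K] by (cases "f (\<rho> K) < 0") linarith+
  qed
  have mono: "f b \<le> f a" if "0 < b" "b \<le> a" for a b
  proof -
   have "b powr \<gamma> \<le> a powr \<gamma>" using that \<gamma> by (intro powr_mono2) auto
   then have "0 \<le> a * (f a - f b)" using f[of a b] that by linarith
   then show ?thesis using that by (simp add: zero_le_mult_iff)
  qed
  have "f (\<rho>' K) * (\<rho>' K - \<rho> K) \<ge> f (\<rho> K) * (\<rho>' K - \<rho> K)"
  proof (cases "\<rho> K \<le> \<rho>' K")
   case True
   then show ?thesis using mono[OF pos[OF K] True] by (intro mult_right_mono) auto
  next
   case False
   then show ?thesis using mono[OF pos'[OF K], of "\<rho> K"] by (intro mult_right_mono_neg) auto
  qed
  moreover have "\<bar>f (\<rho> K) * (\<rho>' K - \<rho> K)\<bar> \<le> 2 * F * (\<rho> K + \<rho>' K)"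
   unfolding abs_mult using fa pos[OF K] pos'[OF K] by (intro mult_mono) auto
  ultimately have "- (f (\<rho>' K) * (\<rho>' K - \<rho> K)) \<le> 2 * F * (\<rho> K + \<rho>' K)" by linarith
  then have "vol K / dt * - (f (\<rho>' K) * (\<rho>' K - \<rho> K)) \<le> vol K / dt * (2 * F * (\<rho> K + \<rho>' K))"
   using dt by (intro mult_left_mono) auto
  moreover have "a * (v * - ((1/dt) * d)) = v / dt * - (a * d)" "v / dt * (2 * F * b) = 2 * F * v / dt * b" for a b d v
   by (simp_all add: mult_ac)
  ultimately show "f (\<rho>' K) * (vol K * mass_div X \<rho>' u K) \<le> 2 * F * vol K / dt * (\<rho> K + \<rho>' K)"
   unfolding m by (simp only:)
 qed
 also have "... = 2 * F / dt * ((\<Sum>K\<in>cells X. vol K * \<rho> K) + (\<Sum>K\<in>cells X. vol K * \<rho>' K))"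
  unfolding sum.distrib[symmetric] sum_distrib_left by (intro sum.cong refl) (simp add: algebra_simps add_divide_distrib)
 also have "... = 4 * F / dt * (\<Sum>K\<in>cells X. vol K * \<rho> K)" by (simp add: mass_balance_mass[OF mb dt])
 \<comment> \<open>Conservation of mass has merged the two sums into one; the upper bound 2 for the
   old density completes the constant 8.\<close>
 also have "... \<le> 4 * F / dt * (\<Sum>K\<in>cells X. vol K * 2)"
 proof (intro mult_left_mono sum_mono)
  obtain K where "K \<in> cells X" using cells_nonempty by blast
  then have "F \<ge> 0" using F[of K] by linarith
  then show "0 \<le> 4 * F / dt" using dt by simp
 qed (use \<rho> in auto)
 also have "... = 8 / dt * F * (\<Sum>K\<in>cells X. vol K)" by (simp add: sum_distrib_right[symmetric])
 finally show ?thesis by linarith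
qed

lemma tendsto_dual_density:
 assumes "Y \<in> all_faces X" "!!K. K \<in> cells X ==> ((%m. \<rho> m K) \<longlongrightarrow> 1) F"
 shows "((%m. dual_density X (\<rho> m) Y) \<longlongrightarrow> 1) F"
proof -
 have "((%m. dual_density X (\<rho> m) Y) \<longlongrightarrow> (\<Sum>K\<in>{K\<in>cells X. Y \<in> faces K}. vol (half_diamond X K Y) * 1) / V Y) F"
  unfolding dual_density_def using vol_dual_cell_pos[OF assms(1)] by (intro tendsto_intros assms(2)) auto
 then show ?thesis using vol_dual_cell_pos[OF assms(1)] by (simp add: vol_dual_cell)
qed

text \<open>The index m runs through the sequence of Mach numbers while the time step is fixed. For
  the older density \<open>\<rho>o\<close> mere convergence to 1 is assumed, in contrast to the rate
  for \<rho>, because at the first step it is the density at step -1.\<close>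

lemma step_bounded:
 fixes e :: "nat => real" and \<rho>o \<rho> \<rho>' :: "nat => 'n scalar_field" and u ut u' :: "nat => 'n vector_field"
 assumes \<gamma>: "\<gamma> \<ge> 1" and \<mu>: "0 \<le> \<mu>" "0 \<le> \<mu> + lam" and dt: "dt > 0" and e: "!!m. e m > 0" "e \<longlonglongrightarrow> 0"
  and \<rho>o: "!!K. K \<in> cells X ==> (%m. \<rho>o m K) \<longlonglongrightarrow> 1"
  and \<rho>: "!!K. K \<in> cells X ==> Bseq (%m. (\<rho> m K - 1) / (e m)\<^sup>2)"
  and u: "!!Y. Y \<in> int_faces X ==> Bseq (%m. u m Y)"
  and H: "!!m. u m \<in> HE0 X" "!!m. ut m \<in> HE0 X" "!!m. u' m \<in> HE0 X"
  and mb: "!!m. mass_balance dt (\<rho>o m) (\<rho> m) (u m)" "!!m. mass_balance dt (\<rho> m) (\<rho>' m) (u' m)"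
  and G: "!!m Y. G m Y = (1 / (e m)\<^sup>2) *\<^sub>R (sqrt (dual_density X (\<rho> m) Y / dual_density X (\<rho>o m) Y) *\<^sub>R pg (pressure \<gamma> (\<rho> m)) Y)"
  and pred: "!!m Y. Y \<in> int_faces X ==> (1/dt) *\<^sub>R (dual_density X (\<rho> m) Y *\<^sub>R ut m Y - dual_density X (\<rho>o m) Y *\<^sub>R u m Y)
   + convection X (\<rho> m) (u m) (ut m) Y - div_tau X \<mu> lam (ut m) Y + G m Y = 0"
  and corr: "!!m Y. Y \<in> int_faces X ==> (1/dt) *\<^sub>R (dual_density X (\<rho> m) Y *\<^sub>R (u' m Y - ut m Y))
   + (1 / (e m)\<^sup>2) *\<^sub>R pg (pressure \<gamma> (\<rho>' m)) Y - G m Y = 0"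
 shows "!!Y. Y \<in> int_faces X ==> Bseq (%m. ut m Y)" "!!Y. Y \<in> int_faces X ==> Bseq (%m. u' m Y)"
  "!!K. K \<in> cells X ==> Bseq (%m. (\<rho>' m K - 1) / (e m)\<^sup>2)"
proof -
 let ?r = "%m. dual_density X (\<rho> m)" and ?ro = "%m. dual_density X (\<rho>o m)"
 let ?I = "int_faces X"
 have r1: "(%m. \<rho> m K) \<longlonglongrightarrow> 1" if "K \<in> cells X" for K by (rule tendsto_1_of_Bseq[OF \<rho>[OF that] e])
 have all: "Y \<in> all_faces X" if "Y \<in> ?I" for Y using that int_faces_subset by blast
 have d: "(%m. ?r m Y) \<longlonglongrightarrow> 1" "(%m. ?ro m Y) \<longlonglongrightarrow> 1" if "Y \<in> ?I" for Y
  by (rule tendsto_dual_density[OF all[OF that]], erule r1 \<rho>o)+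
 have GB: "Bseq (%m. G m Y)" if s: "Y \<in> ?I" for Y
 proof -
  have "(%m. sqrt (?r m Y / ?ro m Y)) \<longlonglongrightarrow> sqrt (1 / 1)" by (intro tendsto_intros d[OF s]) simp
  then have 1: "Bseq (%m. sqrt (?r m Y / ?ro m Y))" by (intro convergent_imp_Bseq convergentI)
  have "Bseq (%m. pg (%K. (1 / (e m)\<^sup>2) * (pressure \<gamma> (\<rho> m) K - 1)) Y)"
   by (rule Bseq_pg[OF s]) (use Bseq_powr_near_1[OF \<rho> e \<gamma>] in \<open>simp add: pressure_def\<close>)
  from Bseq_scaleR[OF 1 this] show ?thesis
   unfolding G pg_scale[OF s, symmetric] by (simp add: mult.commute)
 qed
 obtain CG where CG: "CG \<ge> 0" "!!m Y. Y \<in> ?I ==> norm (G m Y) \<le> CG"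
  by (rule Bseq_uniform[OF finite_int_faces, of G, OF GB], assumption, rule that; blast)
 obtain Cu where Cu: "Cu \<ge> 0" "!!m Y. Y \<in> ?I ==> norm (u m Y) \<le> Cu"
  by (rule Bseq_uniform[OF finite_int_faces, of u, OF u], assumption, rule that; blast)
 have Vp: "V Y > 0" if "Y \<in> ?I" for Y using vol_dual_cell_pos[OF all[OF that]] .
 have ev: "\<forall>\<^sub>F m in sequentially. \<forall>Y\<in>?I. 1/2 < ?r m Y \<and> ?r m Y < 2 \<and> 1/2 < ?ro m Y \<and> ?ro m Y < 2"
  by (intro eventually_ball_finite[OF finite_int_faces] ballI eventually_conj; rule order_tendstoD[OF d(1)] order_tendstoD[OF d(2)]; simp)
 \<comment> \<open>A common lower bound for both energies: a kinetic weight at least 1/2, data of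
   size 2 c, namely a density below 2 times a velocity bounded by c, and a force of size k. It
   brings them to the form of \<open>quadratic_bound\<close>.\<close>
 have low: "(1 / (2 * dt)) * x\<^sup>2 - (2 * c / dt + k) * x \<le> (1/dt) * (h - a) + g"
  if "(1/2) * x\<^sup>2 \<le> h" "a \<le> 2 * c * x" "- (k * x) \<le> g" for x h a g c k :: real
 proof -
  have "(1/dt) * ((1/2) * x\<^sup>2 - 2 * c * x) \<le> (1/dt) * (h - a)" using that dt by (intro mult_left_mono) auto
  moreover have "(1/dt) * ((1/2) * x\<^sup>2 - 2 * c * x) - k * x = (1 / (2 * dt)) * x\<^sup>2 - (2 * c / dt + k) * x"
   by (simp add: right_diff_distrib distrib_right)
  ultimately show ?thesis using that(3) by linarith
 qed
 have cs: "- (norm v * norm w) \<le> v \<bullet> w" "v \<bullet> w \<le> norm v * norm w" for v w :: "real^'n"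
  using Cauchy_Schwarz_ineq2[of v w] by (auto simp: abs_le_iff)
 have Gl: "- (CG * norm w) \<le> G m Y \<bullet> w" "- (CG * norm w) \<le> - (G m Y \<bullet> w)" if "Y \<in> ?I" for m Y w
  using cs[of "G m Y" w] mult_right_mono[OF CG(2)[OF that, of m] norm_ge_zero[of w]] by linarith+
 obtain Ct where Ct: "!!x Y. (\<Sum>Y\<in>?I. V Y * ((1 / (2 * dt)) * (x Y)\<^sup>2 - (2 * Cu / dt + CG) * x Y)) \<le> 0 ==> Y \<in> ?I ==> x Y \<le> Ct"
  using quadratic_bound[OF finite_int_faces, of V "1 / (2 * dt)" "2 * Cu / dt + CG" 0] Vp dt by auto
 have ut: "\<forall>\<^sub>F m in sequentially. \<forall>Y\<in>?I. norm (ut m Y) \<le> Ct"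
  using ev
 proof eventually_elim
  case (elim m)
  have "(\<Sum>Y\<in>?I. V Y * ((1 / (2 * dt)) * (norm (ut m Y))\<^sup>2 - (2 * Cu / dt + CG) * norm (ut m Y)))
   \<le> (\<Sum>Y\<in>?I. V Y * ((1/dt) * ((1/2) * (?r m Y + ?ro m Y) * (norm (ut m Y))\<^sup>2 - (?ro m Y *\<^sub>R u m Y) \<bullet> ut m Y) + G m Y \<bullet> ut m Y))"
  proof (intro sum_mono mult_left_mono measure_nonneg low)
   fix Y assume s: "Y \<in> ?I"
   show "1/2 * (norm (ut m Y))\<^sup>2 \<le> 1/2 * (?r m Y + ?ro m Y) * (norm (ut m Y))\<^sup>2"
    using bspec[OF elim s] by (intro mult_right_mono) auto
   have "norm (?ro m Y *\<^sub>R u m Y) \<le> 2 * Cu"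
    unfolding norm_scaleR using bspec[OF elim s] Cu s by (intro mult_mono) auto
   then show "(?ro m Y *\<^sub>R u m Y) \<bullet> ut m Y \<le> 2 * Cu * norm (ut m Y)"
    by (rule order_trans[OF cs(2) mult_right_mono]) simp
   show "- (CG * norm (ut m Y)) \<le> G m Y \<bullet> ut m Y" by (rule Gl[OF s])
  qed
  also have "... \<le> 0" by (rule prediction_energy[OF H(1) H(2) mb(1) \<mu> pred])
  finally show ?case by (intro ballI Ct[of "%Y. norm (ut m Y)"])
 qed
 show utB: "Bseq (%m. ut m Y)" if "Y \<in> ?I" for Y
  by (rule BfunI[where K=Ct], rule eventually_mono[OF ut]) (use that in blast)
 obtain Cq where Cq: "Cq \<ge> 0" "!!m K. K \<in> cells X ==> norm ((\<rho> m K powr \<gamma> - 1) / (e m)\<^sup>2) \<le> Cq"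
  by (rule Bseq_uniform[OF finite_cells, of "%m K. (\<rho> m K powr \<gamma> - 1) / (e m)\<^sup>2", OF Bseq_powr_near_1[OF \<rho> e \<gamma>]], assumption, rule that; blast)
 have Cq': "\<bar>\<rho> m K powr \<gamma> - 1\<bar> \<le> Cq * (e m)\<^sup>2" if "K \<in> cells X" for m K
  using Cq(2)[OF that, of m] e(1)[of m] by (simp add: abs_divide pos_divide_le_eq)
 have evc: "\<forall>\<^sub>F m in sequentially. \<forall>K\<in>cells X. 1/2 < \<rho> m K \<and> \<rho> m K < 2"
  by (intro eventually_ball_finite[OF finite_cells] ballI eventually_conj; rule order_tendstoD[OF r1]; simp)
 define D where "D = 8 / dt * Cq * (\<Sum>K\<in>cells X. vol K)"
 obtain C' where C': "!!x Y. (\<Sum>Y\<in>?I. V Y * ((1 / (2 * dt)) * (x Y)\<^sup>2 - (2 * \<bar>Ct\<bar> / dt + CG) * x Y)) \<le> D ==> Y \<in> ?I ==> x Y \<le> C'"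
  using quadratic_bound[OF finite_int_faces, of V "1 / (2 * dt)" "2 * \<bar>Ct\<bar> / dt + CG" D] Vp dt by auto
 have u': "\<forall>\<^sub>F m in sequentially. \<forall>Y\<in>?I. norm (u' m Y) \<le> C'"
  using ev evc ut
 proof eventually_elim
  case (elim m)
  have e2: "(e m)\<^sup>2 > 0" using e(1)[of m] by simp
  let ?p = "pg (pressure \<gamma> (\<rho>' m))"
  have "(\<Sum>Y\<in>?I. V Y * ((1 / (2 * dt)) * (norm (u' m Y))\<^sup>2 - (2 * \<bar>Ct\<bar> / dt + CG) * norm (u' m Y)))
   \<le> (\<Sum>Y\<in>?I. V Y * ((1/dt) * (?r m Y * (norm (u' m Y))\<^sup>2 - (?r m Y *\<^sub>R ut m Y) \<bullet> u' m Y) + - (G m Y \<bullet> u' m Y)))"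
  proof (intro sum_mono mult_left_mono measure_nonneg low)
   fix Y assume s: "Y \<in> ?I"
   show "1/2 * (norm (u' m Y))\<^sup>2 \<le> ?r m Y * (norm (u' m Y))\<^sup>2"
    using bspec[OF elim(1) s] by (intro mult_right_mono) auto
   have "norm (ut m Y) \<le> \<bar>Ct\<bar>" using bspec[OF elim(3) s] by linarith
   then have "norm (?r m Y *\<^sub>R ut m Y) \<le> 2 * \<bar>Ct\<bar>"
    unfolding norm_scaleR using bspec[OF elim(1) s] by (intro mult_mono) auto
   then show "(?r m Y *\<^sub>R ut m Y) \<bullet> u' m Y \<le> 2 * \<bar>Ct\<bar> * norm (u' m Y)"
    by (rule order_trans[OF cs(2) mult_right_mono]) simp
   show "- (CG * norm (u' m Y)) \<le> - (G m Y \<bullet> u' m Y)" by (rule Gl[OF s])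
  qed
  \<comment> \<open>The correction step tested with the new velocity leaves the work of the new
    pressure divided by e^2. It is bounded below because the pressure defect of the old density is
    of order e^2.\<close>
  also have "... = (\<Sum>Y\<in>?I. - (1 / (e m)\<^sup>2) * (V Y * (?p Y \<bullet> u' m Y)))"
  proof (rule sum.cong[OF refl])
   fix Y assume s: "Y \<in> ?I"
   have "0 = ((1/dt) *\<^sub>R (?r m Y *\<^sub>R (u' m Y - ut m Y)) + (1 / (e m)\<^sup>2) *\<^sub>R ?p Y - G m Y) \<bullet> u' m Y"
    using corr[OF s] by simp
   also have "... = (1/dt) * (?r m Y * (u' m Y \<bullet> u' m Y - ut m Y \<bullet> u' m Y)) + (1 / (e m)\<^sup>2) * (?p Y \<bullet> u' m Y) - G m Y \<bullet> u' m Y"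
    by (simp only: inner_add_left inner_diff_left inner_scaleR_left)
   finally have "(1/dt) * (?r m Y * (u' m Y \<bullet> u' m Y) - ?r m Y * (ut m Y \<bullet> u' m Y)) + - (G m Y \<bullet> u' m Y) = - (1 / (e m)\<^sup>2) * (?p Y \<bullet> u' m Y)"
    by (simp only: right_diff_distrib)
   then show "V Y * ((1/dt) * (?r m Y * (norm (u' m Y))\<^sup>2 - (?r m Y *\<^sub>R ut m Y) \<bullet> u' m Y) + - (G m Y \<bullet> u' m Y))
    = - (1 / (e m)\<^sup>2) * (V Y * (?p Y \<bullet> u' m Y))"
    by (simp only: power2_norm_eq_inner inner_scaleR_left mult.left_commute)
  qed
  also have "... = - (1 / (e m)\<^sup>2) * (\<Sum>Y\<in>?I. V Y * (?p Y \<bullet> u' m Y))" by (simp only: sum_distrib_left)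
  also have "... \<le> D"
  proof -
   have "(\<Sum>Y\<in>?I. V Y * (?p Y \<bullet> u' m Y)) \<ge> - (8 / dt * (Cq * (e m)\<^sup>2) * (\<Sum>K\<in>cells X. vol K))"
    by (rule pressure_work[OF mb(2) dt H(3) \<gamma> _ Cq']) (use elim(2) in force)+
   then have "- (\<Sum>Y\<in>?I. V Y * (?p Y \<bullet> u' m Y)) \<le> D * (e m)\<^sup>2" by (simp add: D_def mult_ac)
   then have "- (\<Sum>Y\<in>?I. V Y * (?p Y \<bullet> u' m Y)) / (e m)\<^sup>2 \<le> D" using e2 by (simp only: pos_divide_le_eq)
   then show ?thesis by simp
  qed
  finally show ?case by (intro ballI C'[of "%Y. norm (u' m Y)"])
 qed
 show "Bseq (%m. u' m Y)" if "Y \<in> ?I" for Y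
  by (rule BfunI[where K=C'], rule eventually_mono[OF u']) (use that in blast)
 \<comment> \<open>A bound, read off from the correction step, for the gradient of the rescaled
   pressure: the explicit gradient plus 1/dt times the velocity increment and a density below
   2.\<close>
 define t where "t = CG + 1 / dt * (2 * (\<bar>C'\<bar> + \<bar>Ct\<bar>))"
 have t0: "t \<ge> 0" using CG dt by (simp add: t_def)
 obtain B where B: "\<forall>q t. t \<ge> 0 \<longrightarrow> (\<forall>Y\<in>?I. norm (pg q Y) \<le> t) \<longrightarrow>
   (\<forall>K\<in>cells X. \<forall>L\<in>cells X. \<bar>q L - q K\<bar> \<le> B * t)"
  by (rule exE[OF oscillation_bound])
 obtain Cr where Cr: "Cr \<ge> 0" "!!m K. K \<in> cells X ==> norm ((\<rho> m K - 1) / (e m)\<^sup>2) \<le> Cr"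
  by (rule Bseq_uniform[OF finite_cells, of "%m K. (\<rho> m K - 1) / (e m)\<^sup>2", OF \<rho>], assumption, rule that; blast)
 have Cr': "\<bar>\<rho> m K - 1\<bar> \<le> Cr * (e m)\<^sup>2" if "K \<in> cells X" for m K
  using Cr(2)[OF that, of m] e(1)[of m] by (simp add: abs_divide pos_divide_le_eq)
 define L where "L = \<gamma> * 2 powr \<gamma> * Cr"
 have eve: "\<forall>\<^sub>F m in sequentially. Cr * (e m)\<^sup>2 < 1/2"
 proof (rule order_tendstoD)
  show "(%m. Cr * (e m)\<^sup>2) \<longlonglongrightarrow> 0" using tendsto_mult[OF tendsto_const[of Cr] tendsto_power[OF e(2), of 2]] by simp
 qed simp
 have fin: "\<forall>\<^sub>F m in sequentially. \<forall>K\<in>cells X. \<bar>(\<rho>' m K - 1) / (e m)\<^sup>2\<bar> \<le> L + B * t"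
  using ev evc ut u' eve
 proof eventually_elim
  case (elim m)
  have e2: "(e m)\<^sup>2 > 0" using e(1)[of m] by simp
  define q where "q K = (1 / (e m)\<^sup>2) * (pressure \<gamma> (\<rho>' m) K - 1)" for K
  have "norm (pg q Y) \<le> t" if s: "Y \<in> ?I" for Y
  proof -
   have "pg q Y = (1 / (e m)\<^sup>2) *\<^sub>R pg (pressure \<gamma> (\<rho>' m)) Y" unfolding q_def by (rule pg_scale[OF s, symmetric])
   also have "... = G m Y - (1/dt) *\<^sub>R (?r m Y *\<^sub>R (u' m Y - ut m Y))"
    using corr[OF s, of m] by (simp add: algebra_simps)
   finally have "norm (pg q Y) \<le> norm (G m Y) + norm ((1/dt) *\<^sub>R (?r m Y *\<^sub>R (u' m Y - ut m Y)))"
    by (simp only: norm_triangle_ineq4)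
   also have "norm ((1/dt) *\<^sub>R (?r m Y *\<^sub>R (u' m Y - ut m Y))) = 1/dt * (\<bar>?r m Y\<bar> * norm (u' m Y - ut m Y))"
    using dt by simp
   also have "... \<le> 1/dt * (2 * (\<bar>C'\<bar> + \<bar>Ct\<bar>))"
   proof (intro mult_left_mono mult_mono)
    show "norm (u' m Y - ut m Y) \<le> \<bar>C'\<bar> + \<bar>Ct\<bar>"
     using norm_triangle_ineq4[of "u' m Y" "ut m Y"] bspec[OF elim(3) s] bspec[OF elim(4) s] by linarith
   qed (use bspec[OF elim(1) s] dt in auto)
   finally show ?thesis using CG(2)[OF s, of m] unfolding t_def by linarith
  qed
  then have osc0: "\<forall>K\<in>cells X. \<forall>L\<in>cells X. \<bar>q L - q K\<bar> \<le> B * t"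
   by (intro mp[OF mp[OF spec[OF spec[OF B]] t0]] ballI)
  have osc: "\<bar>q L - q K\<bar> \<le> B * t" if "K \<in> cells X" "L \<in> cells X" for K L
   by (rule bspec[OF bspec[OF osc0 that(1)] that(2)])
  have pos': "\<rho>' m K > 0" if "K \<in> cells X" for K
   by (rule mass_balance_pos[OF mb(2) dt _ that]) (use elim(2) in force)
  have qv: "\<bar>x powr \<gamma> - 1\<bar> \<le> L * (e m)\<^sup>2" if "\<bar>x - 1\<bar> \<le> Cr * (e m)\<^sup>2" for x
  proof -
   have "\<bar>x powr \<gamma> - 1\<bar> \<le> \<gamma> * 2 powr \<gamma> * \<bar>x - 1\<bar>"
    by (rule powr_Lipschitz_near_1[OF \<gamma>]) (use that elim(5) in linarith)+
   also have "... \<le> \<gamma> * 2 powr \<gamma> * (Cr * (e m)\<^sup>2)" using that \<gamma> by (intro mult_left_mono) auto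
   finally show ?thesis by (simp add: L_def)
  qed
  have mass: "(\<Sum>K\<in>cells X. vol K * \<rho>' m K) = (\<Sum>K\<in>cells X. vol K * \<rho> m K)" by (rule mass_balance_mass[OF mb(2) dt])
  \<comment> \<open>Total mass is conserved, so the new density cannot lie above the range of the
    old one in every cell, nor below it in every cell. The two cells K1 and K2 found this way anchor
    the rescaled pressure, whose oscillation is already bounded.\<close>
  have "\<exists>K\<in>cells X. \<rho>' m K \<le> 1 + Cr * (e m)\<^sup>2"
  proof (rule ccontr)
   assume "\<not> (\<exists>K\<in>cells X. \<rho>' m K \<le> 1 + Cr * (e m)\<^sup>2)"
   then have n: "\<rho>' m K > 1 + Cr * (e m)\<^sup>2" if "K \<in> cells X" for K using that by (simp add: not_le)
   have "(\<Sum>K\<in>cells X. vol K * \<rho> m K) < (\<Sum>K\<in>cells X. vol K * \<rho>' m K)"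
   proof (rule sum_strict_mono[OF finite_cells cells_nonempty])
    fix K assume K: "K \<in> cells X"
    have "\<rho> m K < \<rho>' m K" using n[OF K] Cr'[OF K, of m] by linarith
    then show "vol K * \<rho> m K < vol K * \<rho>' m K" using vol_pos[OF K] by simp
   qed
   then show False using mass by simp
  qed
  then obtain K1 where K1: "K1 \<in> cells X" "\<rho>' m K1 \<le> 1 + Cr * (e m)\<^sup>2" by (rule bexE)
  have "\<exists>K\<in>cells X. \<rho>' m K \<ge> 1 - Cr * (e m)\<^sup>2"
  proof (rule ccontr)
   assume "\<not> (\<exists>K\<in>cells X. \<rho>' m K \<ge> 1 - Cr * (e m)\<^sup>2)"
   then have n: "\<rho>' m K < 1 - Cr * (e m)\<^sup>2" if "K \<in> cells X" for K using that by (simp add: not_le)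
   have "(\<Sum>K\<in>cells X. vol K * \<rho>' m K) < (\<Sum>K\<in>cells X. vol K * \<rho> m K)"
   proof (rule sum_strict_mono[OF finite_cells cells_nonempty])
    fix K assume K: "K \<in> cells X"
    have "\<rho>' m K < \<rho> m K" using n[OF K] Cr'[OF K, of m] by linarith
    then show "vol K * \<rho>' m K < vol K * \<rho> m K" using vol_pos[OF K] by simp
   qed
   then show False using mass by simp
  qed
  then obtain K2 where K2: "K2 \<in> cells X" "\<rho>' m K2 \<ge> 1 - Cr * (e m)\<^sup>2" by (rule bexE)
  have ce: "0 \<le> Cr * (e m)\<^sup>2" using Cr(1) by simp
  have "\<rho>' m K1 powr \<gamma> \<le> (1 + Cr * (e m)\<^sup>2) powr \<gamma>" using K1 pos'[OF K1(1)] \<gamma> by (intro powr_mono2) auto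
  then have "\<rho>' m K1 powr \<gamma> - 1 \<le> L * (e m)\<^sup>2" using qv[of "1 + Cr * (e m)\<^sup>2"] ce by (simp add: abs_le_iff)
  then have q1: "q K1 \<le> L" using e2 by (simp add: q_def pressure_def pos_divide_le_eq)
  have "(1 - Cr * (e m)\<^sup>2) powr \<gamma> \<le> \<rho>' m K2 powr \<gamma>" using K2 elim(5) \<gamma> by (intro powr_mono2) auto
  then have "- (L * (e m)\<^sup>2) \<le> \<rho>' m K2 powr \<gamma> - 1" using qv[of "1 - Cr * (e m)\<^sup>2"] ce by (simp add: abs_le_iff)
  then have q2: "- L \<le> q K2" using e2 by (simp add: q_def pressure_def pos_le_divide_eq)
  show ?case
  proof
   fix K assume K: "K \<in> cells X"
   have "\<bar>(\<rho>' m K - 1) / (e m)\<^sup>2\<bar> \<le> \<bar>q K\<bar>"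
    using divide_right_mono[OF abs_diff_1_le_powr[OF \<gamma> pos'[OF K]] less_imp_le[OF e2]]
    by (simp add: q_def pressure_def abs_divide)
   also have "... \<le> L + B * t" using osc[OF K1(1) K] osc[OF K2(1) K] q1 q2 by linarith
   finally show "\<bar>(\<rho>' m K - 1) / (e m)\<^sup>2\<bar> \<le> L + B * t" .
  qed
 qed
 show "Bseq (%m. (\<rho>' m K - 1) / (e m)\<^sup>2)" if "K \<in> cells X" for K
  by (rule BfunI[where K="L + B * t"], rule eventually_mono[OF fin]) (use that in simp)
qed

end

section \<open>Sequences and norms on the discrete spaces\<close>

lemma convergent_subseq_finite:
 fixes f :: "nat => 'i => 'a::euclidean_space"
 assumes "finite I" "!!i. i \<in> I ==> Bseq (%m. f m i)"
 shows "\<exists>s l. strict_mono s \<and> (\<forall>i\<in>I. (%m. f (s m) i) \<longlonglongrightarrow> l i)"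
 using assms
proof (induction I rule: finite_induct)
 case empty
 have "strict_mono (id :: nat => nat)" by (simp add: strict_mono_def)
 then show ?case by blast
next
 case (insert i F)
 from insert.IH[OF insert.prems, OF insertI2] obtain s l where s: "strict_mono s" "!!j. j \<in> F ==> (%m. f (s m) j) \<longlonglongrightarrow> l j"
  by blast
 have "Bseq (%m. f (s m) i)" by (rule Bseq_subseq[OF insert.prems[OF insertI1]])
 then have "bounded (range (%m. f (s m) i))" by (simp add: Bseq_eq_bounded)
 then obtain k r where r: "strict_mono r" "((%m. f (s m) i) \<circ> r) \<longlonglongrightarrow> k"
  using bounded_imp_convergent_subsequence by blast
 have "(%m. f ((s \<circ> r) m) j) \<longlonglongrightarrow> (l(i := k)) j" if j: "j \<in> insert i F" for j
 proof (cases "j = i")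
  case True
  then show ?thesis using r(2) by (simp add: o_def)
 next
  case False
  then have "j \<in> F" using j by simp
  from LIMSEQ_subseq_LIMSEQ[OF s(2)[OF this] r(1)] False show ?thesis by (simp add: o_def)
 qed
 then show ?case using strict_mono_o[OF s(1) r(1)] by blast
qed

text \<open>This turns compactness together with uniqueness of the limit into convergence of the
  sequence itself.\<close>

lemma LIMSEQ_subseq_principle:
 fixes f :: "nat => 'a::metric_space"
 assumes sub: "!!r :: nat => nat. strict_mono r ==> \<exists>s :: nat => nat. (%m. f (r (s m))) \<longlonglongrightarrow> l"
 shows "f \<longlonglongrightarrow> l"
proof (rule tendstoI, rule ccontr)
 fix e :: real assume e: "e > 0" and n: "\<not> (\<forall>\<^sub>F m in sequentially. dist (f m) l < e)"
 have "infinite {m. \<not> dist (f m) l < e}"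
  using n unfolding eventually_sequentially infinite_nat_iff_unbounded_le by blast
 from infinite_enumerate[OF this] obtain r :: "nat => nat" where r: "strict_mono r" "\<forall>m. r m \<in> {m. \<not> dist (f m) l < e}" by blast
 obtain s :: "nat => nat" where "(%m. f (r (s m))) \<longlonglongrightarrow> l" using sub[OF r(1)] by blast
 from tendstoD[OF this e] have "\<forall>\<^sub>F m in sequentially. False" by (rule eventually_mono) (use r(2) in simp)
 then show False by simp
qed

lemma discrete_normD:
 assumes \<nu>: "discrete_norm X N \<nu>" and v: "v \<in> discrete_velocity X N"
 shows "0 \<le> \<nu> v q"
  "(!!n Y. n \<le> N ==> Y \<in> all_faces X ==> v n Y = 0) ==> (!!n K. n \<le> N ==> K \<in> cells X ==> q n K = 0) ==> \<nu> v q = 0"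
  "\<nu> (%n Y. c *\<^sub>R v n Y) (%n K. c * q n K) = \<bar>c\<bar> * \<nu> v q"
  "v' \<in> discrete_velocity X N ==> \<nu> (%n Y. v n Y + v' n Y) (%n K. q n K + q' n K) \<le> \<nu> v q + \<nu> v' q'"
proof -
 note a = spec[OF bspec[OF \<nu>[unfolded discrete_norm_def] v], of q]
 show "0 \<le> \<nu> v q" using a by (rule conjunct1)
 note b = conjunct2[OF a]
 show "\<nu> v q = 0" if "!!n Y. n \<le> N ==> Y \<in> all_faces X ==> v n Y = 0" "!!n K. n \<le> N ==> K \<in> cells X ==> q n K = 0"
  by (rule iffD2[OF conjunct1[OF b]]) (intro allI impI conjI ballI that)
 note c = conjunct2[OF b]
 show "\<nu> (%n Y. c *\<^sub>R v n Y) (%n K. c * q n K) = \<bar>c\<bar> * \<nu> v q" by (rule spec[OF conjunct1[OF c]])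
 show "\<nu> (%n Y. v n Y + v' n Y) (%n K. q n K + q' n K) \<le> \<nu> v q + \<nu> v' q'" if "v' \<in> discrete_velocity X N"
  by (rule spec[OF bspec[OF conjunct2[OF c] that]])
qed

text \<open>Used for expansions in a finite basis of discrete functions, where it bounds an
  arbitrary norm by the coordinates.\<close>

lemma discrete_norm_sum:
 assumes \<nu>: "discrete_norm X N \<nu>" and "finite I" "!!i. i \<in> I ==> a i \<in> discrete_velocity X N"
 shows "\<nu> (%n Y. \<Sum>i\<in>I. c i *\<^sub>R a i n Y) (%n K. \<Sum>i\<in>I. c i * b i n K) \<le> (\<Sum>i\<in>I. \<bar>c i\<bar> * \<nu> (a i) (b i))
  \<and> (%n Y. \<Sum>i\<in>I. c i *\<^sub>R a i n Y) \<in> discrete_velocity X N"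
 using assms(2,3)
proof (induction I rule: finite_induct)
 case empty
 have z: "(%n Y. 0) \<in> discrete_velocity X N" by (simp add: discrete_velocity_def HE0_def)
 show ?case using discrete_normD(2)[OF \<nu> z, of "%n K. 0"] z by simp
next
 case (insert i F)
 have IH: "\<nu> (%n Y. \<Sum>i\<in>F. c i *\<^sub>R a i n Y) (%n K. \<Sum>i\<in>F. c i * b i n K) \<le> (\<Sum>i\<in>F. \<bar>c i\<bar> * \<nu> (a i) (b i))"
  "(%n Y. \<Sum>i\<in>F. c i *\<^sub>R a i n Y) \<in> discrete_velocity X N"
  using insert.IH[OF insert.prems, OF insertI2] by simp_all
 have ai: "a i \<in> discrete_velocity X N" by (rule insert.prems[OF insertI1])
 then have ci: "(%n Y. c i *\<^sub>R a i n Y) \<in> discrete_velocity X N" by (simp add: discrete_velocity_def HE0_def)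
 have "\<nu> (%n Y. c i *\<^sub>R a i n Y + (\<Sum>i\<in>F. c i *\<^sub>R a i n Y)) (%n K. c i * b i n K + (\<Sum>i\<in>F. c i * b i n K))
  \<le> \<bar>c i\<bar> * \<nu> (a i) (b i) + (\<Sum>i\<in>F. \<bar>c i\<bar> * \<nu> (a i) (b i))"
  using discrete_normD(4)[OF \<nu> ci IH(2), of "%n K. c i * b i n K" "%n K. \<Sum>i\<in>F. c i * b i n K"] IH(1)
  unfolding discrete_normD(3)[OF \<nu> ai, of "c i" "b i"] by linarith
 moreover have "(%n Y. c i *\<^sub>R a i n Y + (\<Sum>i\<in>F. c i *\<^sub>R a i n Y)) \<in> discrete_velocity X N"
  using ci IH(2) by (simp add: discrete_velocity_def HE0_def)
 ultimately show ?case unfolding sum.insert[OF insert.hyps] by blast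
qed

lemma Linf_Lq_nrm_nonneg: "0 \<le> Linf_Lq_nrm X N q w"
proof -
 have "0 \<le> Lq_nrm (domain X) q (cell_fun X (w 0))" by (simp add: Lq_nrm_def)
 also have "... \<le> Linf_Lq_nrm X N q w" unfolding Linf_Lq_nrm_def by (rule Max_ge) auto
 finally show ?thesis .
qed

lemma (in mesh) Linf_Lq_nrm_le:
 assumes w: "!!n K. n \<le> N ==> K \<in> cells X ==> \<bar>w n K\<bar> \<le> d" and d: "0 \<le> d" and q: "0 < q"
 shows "Linf_Lq_nrm X N q w \<le> vol (domain X) powr (1 / q) * d"
proof -
 have le: "Lq_nrm (domain X) q (cell_fun X (w n)) \<le> vol (domain X) powr (1 / q) * d" if n: "n \<le> N" for n
 proof -
  have c: "\<bar>cell_fun X (w n) x\<bar> \<le> d" for x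
  proof (cases "\<exists>K\<in>cells X. x \<in> interior K")
   case True
   then obtain K where K: "K \<in> cells X" "x \<in> interior K" by blast
   have "indicator (interior L) x = (0::real)" if "L \<in> cells X" "L \<noteq> K" for L
    using interior_disjoint[OF that(1) K(1) that(2)] K(2) by (auto simp: indicator_def)
   then have "cell_fun X (w n) x = (\<Sum>L\<in>cells X. if L = K then w n K else 0)"
    unfolding cell_fun_def by (intro sum.cong refl) (use K in auto)
   then show ?thesis using w[OF n K(1)] K(1) finite_cells by simp
  next
   case False
   then have "cell_fun X (w n) x = 0" unfolding cell_fun_def by (intro sum.neutral) (auto simp: indicator_def)
   then show ?thesis using d by simp
  qed
  have D: "domain X \<in> lmeasurable" by (rule lmeasurable_open[OF bounded_domain open_domain])
  have "(LINT x|lebesgue_on (domain X). \<bar>cell_fun X (w n) x\<bar> powr q) \<le> (LINT x|lebesgue_on (domain X). d powr q)"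
   using c q by (intro integral_mono' finite_measure.integrable_const[OF finite_measure_lebesgue_on[OF D]] powr_mono2) auto
  also have "... = vol (domain X) * d powr q"
   using D by (simp add: measure_restrict_space space_restrict_space fmeasurableD)
  finally have "(LINT x|lebesgue_on (domain X). \<bar>cell_fun X (w n) x\<bar> powr q) powr (1 / q) \<le> (vol (domain X) * d powr q) powr (1 / q)"
   using q by (intro powr_mono2) (auto intro: Bochner_Integration.integral_nonneg)
  also have "... = vol (domain X) powr (1 / q) * d" using q d by (simp add: powr_mult powr_powr)
  finally show ?thesis unfolding Lq_nrm_def .
 qed
 have "Max ((%n. Lq_nrm (domain X) q (cell_fun X (w n))) ` {..N}) \<le> vol (domain X) powr (1 / q) * d"
  by (rule Max.boundedI) (use le in auto)
 then show ?thesis unfolding Linf_Lq_nrm_def .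
qed

section \<open>Well-prepared data\<close>

lemma ereal_abs_mult_le:
 assumes "ereal a + ereal k * S \<le> ereal C" "0 \<le> a" "0 \<le> k" "ereal x \<le> S"
 shows "k * x \<le> C"
proof -
 have "ereal (k * x) \<le> ereal k * S" using ereal_mult_left_mono[OF assms(4), of "ereal k"] assms(3) by simp
 also have "... \<le> ereal a + ereal k * S" using assms(2) by (intro add_increasing) auto
 also note assms(1)
 finally show ?thesis by simp
qed

text \<open>Test functions supported inside W vanish on such a facet. Hence the zero boundary values
  of a discrete velocity agree with mean traces, and the divergence estimate for mean traces covers
  external faces as well.\<close>

lemma (in full_polytope) trace_mean_frontier:
 assumes card: "CARD('n) = 2 \<or> CARD('n) = 3" and W: "open W" "bounded W" and u: "u \<in> H10 W"
  and Y: "Y \<in> faces K" "Y \<subseteq> frontier W"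
 shows "trace_mean W Y u = 0"
proof -
 obtain \<phi> where \<phi>: "H1_approx W \<phi> u" using u by (auto simp: H10_def)
 have u1: "u \<in> H1 W" using u by (simp add: H10_def)
 have fm: "face_mean Y (\<phi> k) = 0" for k
 proof -
  have "\<phi> k \<in> test_fun W" using \<phi> by (simp add: H1_approx_def)
  then have s: "closure {x. \<phi> k x \<noteq> 0} \<subseteq> W" by (simp add: test_fun_def)
  have "face_integral Y (\<phi> k) = face_integral Y (%x. 0)"
  proof (rule face_integral_cong[OF Y(1)])
   fix x assume "x \<in> Y"
   then have n: "x \<notin> W" using Y(2) W(1) by (auto simp: frontier_def interior_open)
   show "\<phi> k x = 0"
   proof (rule ccontr)
    assume "\<phi> k x \<noteq> 0"
    then have "x \<in> closure {x. \<phi> k x \<noteq> 0}" by (intro subsetD[OF closure_subset] CollectI)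
    from subsetD[OF s this] n show False by contradiction
   qed
  qed
  then show ?thesis by (simp add: face_mean_def face_integral_def)
 qed
 have "(%k. 0) \<longlonglongrightarrow> trace_mean W Y u"
  using trace_mean_LIMSEQ[OF card W Y(1) u1 \<phi>] unfolding fm .
 then show ?thesis by (rule LIMSEQ_unique[OF _ tendsto_const])
qed

context mesh
begin

lemma well_preparedD:
 fixes e :: "nat => real"
 assumes wp: "well_prepared (domain X) e r0 w0 wl" and e: "!!m. e m > 0"
 shows "\<exists>C. 0 \<le> C \<and> (\<forall>m. (AE x in lebesgue_on (domain X). \<bar>r0 m x - 1\<bar> \<le> C * (e m)\<^sup>2)
  \<and> L2_nrm (domain X) (weak_jacobian (domain X) (w0 m)) \<le> C \<and> L2_nrm (domain X) (weak_div (domain X) (w0 m)) \<le> C * e m)"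
proof -
 let ?D = "domain X" and ?M = "lebesgue_on (domain X)"
 define S where "S m = esssup ?M (%x. ereal \<bar>r0 m x - 1\<bar>)" for m
 define a where "a m = H1_nrm ?D (w0 m) + 1 / e m * L2_nrm ?D (weak_div ?D (w0 m))" for m
 obtain C where C: "!!m. ereal (a m) + ereal (1 / (e m)\<^sup>2) * S m \<le> ereal C"
  using wp unfolding well_prepared_def S_def a_def by blast
 have L2: "0 \<le> L2_nrm ?D f" for f :: "real^'n => 'c::euclidean_space" by (simp add: L2_nrm_def)
 have H1: "L2_nrm ?D (weak_jacobian ?D f) \<le> H1_nrm ?D f" for f by (simp add: H1_nrm_def)
 have a1: "L2_nrm ?D (weak_jacobian ?D (w0 m)) \<le> a m" "1 / e m * L2_nrm ?D (weak_div ?D (w0 m)) \<le> a m" for m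
 proof -
  have "0 \<le> 1 / e m * L2_nrm ?D (weak_div ?D (w0 m))" using L2 e[of m] by (intro mult_nonneg_nonneg) auto
  then show "L2_nrm ?D (weak_jacobian ?D (w0 m)) \<le> a m" "1 / e m * L2_nrm ?D (weak_div ?D (w0 m)) \<le> a m"
   using H1[of "w0 m"] L2[of "weak_jacobian ?D (w0 m)"] unfolding a_def by linarith+
 qed
 then have a0: "0 \<le> a m" for m using L2[of "weak_jacobian ?D (w0 m)"] order_trans by blast
 have ae: "AE x in ?M. ereal \<bar>r0 m x - 1\<bar> \<le> S m" for m unfolding S_def by (rule esssup_AE)
 have pt: "1 / (e m)\<^sup>2 * \<bar>r0 m x - 1\<bar> \<le> C" if "ereal \<bar>r0 m x - 1\<bar> \<le> S m" for m x
  by (rule ereal_abs_mult_le[OF C a0 _ that]) simp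
 \<comment> \<open>The essential supremum of a nonnegative function over a set of positive measure
   is nonnegative. This sign allows the velocity part to be bounded separately from the density
   part.\<close>
 have S0: "0 \<le> S m" for m
 proof (rule ccontr)
  assume n: "\<not> 0 \<le> S m"
  have "AE x in ?M. False" using ae[of m]
  proof (rule eventually_mono)
   fix x assume "ereal \<bar>r0 m x - 1\<bar> \<le> S m"
   then have "0 \<le> S m" by (rule order_trans[rotated]) simp
   then show False using n by simp
  qed
  then have "emeasure ?M (space ?M) = 0" by (subst (asm) AE_iff_measurable[of "space ?M"]) auto
  then have "emeasure lebesgue ?D = 0"
   using lmeasurable_open[OF bounded_domain open_domain] by (simp add: emeasure_restrict_space space_restrict_space fmeasurableD)
  then show False using vol_domain_pos by (simp add: measure_def)
 qed
 have aC: "a m \<le> C" for m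
 proof -
  have "0 \<le> ereal (1 / (e m)\<^sup>2) * S m" using S0 by (intro ereal_0_le_mult) auto
  then have "ereal (a m) + 0 \<le> ereal (a m) + ereal (1 / (e m)\<^sup>2) * S m" by (intro add_left_mono)
  also note C
  finally show ?thesis by simp
 qed
 show ?thesis
 proof (intro exI[of _ C] conjI allI)
  show "0 \<le> C" using a0[of 0] aC[of 0] by linarith
  fix m
  have e2: "(e m)\<^sup>2 > 0" using e[of m] by simp
  show "AE x in ?M. \<bar>r0 m x - 1\<bar> \<le> C * (e m)\<^sup>2"
   using ae[of m]
  proof (rule eventually_mono)
   fix x assume "ereal \<bar>r0 m x - 1\<bar> \<le> S m"
   then have "\<bar>r0 m x - 1\<bar> / (e m)\<^sup>2 \<le> C" using pt[of m x] by simp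
   then show "\<bar>r0 m x - 1\<bar> \<le> C * (e m)\<^sup>2" by (simp only: pos_divide_le_eq[OF e2])
  qed
  show "L2_nrm ?D (weak_jacobian ?D (w0 m)) \<le> C" using a1(1)[of m] aC[of m] by linarith
  have "1 / e m * L2_nrm ?D (weak_div ?D (w0 m)) \<le> C" using a1(2)[of m] aC[of m] by linarith
  then show "L2_nrm ?D (weak_div ?D (w0 m)) \<le> C * e m" using e[of m] by (simp add: pos_divide_le_eq)
 qed
qed

text \<open>A closed cell exceeds the open domain only by part of its frontier, a null set, so
  measurability and the bound are transferred from the interior of the cell.\<close>

lemma cell_mean_close:
 assumes K: "K \<in> cells X" and f: "f \<in> borel_measurable (lebesgue_on (domain X))"
  and ae: "AE x in lebesgue_on (domain X). \<bar>f x - 1\<bar> \<le> c" and c: "0 \<le> c"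
 shows "\<bar>(1 / vol K) * (LINT x|lebesgue_on K. f x) - 1\<bar> \<le> c"
proof -
 let ?M = "lebesgue_on K"
 have L: "K \<in> lmeasurable" by (rule lmeasurable_cell[OF K])
 have N: "negligible (frontier K)"
  by (rule negligible_convex_frontier[OF full_polytope.convex[OF cell_full[OF K]]])
 have i: "interior K \<in> sets lebesgue" by (intro lmeasurable_open[THEN fmeasurableD] bounded_subset[OF _ interior_subset] compact_imp_bounded full_polytope.compact[OF cell_full[OF K]] open_interior)
 have "f \<in> borel_measurable (lebesgue_on (interior K))"
  by (rule measurable_restrict_mono[OF f interior_cell_subset[OF K]])
 then have "f measurable_on interior K" using measurable_on_iff_borel_measurable[OF i] by blast
 then have "f measurable_on K"
  by (rule measurable_on_spike_set, intro negligible_subset[OF N]) (use interior_subset closure_subset[of K] in \<open>auto simp: frontier_def\<close>)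
 then have m: "f \<in> borel_measurable ?M" using measurable_on_iff_borel_measurable[OF fmeasurableD[OF L]] by blast
 have "AE x in lebesgue. x \<in> domain X \<longrightarrow> \<bar>f x - 1\<bar> \<le> c"
  using ae lmeasurable_open[OF bounded_domain open_domain] by (simp add: AE_restrict_space_iff fmeasurableD)
 moreover have "AE x in lebesgue. x \<notin> frontier K" using N by (intro AE_not_in) (simp add: negligible_iff_null_sets)
 ultimately have "AE x in lebesgue. x \<in> K \<longrightarrow> \<bar>f x - 1\<bar> \<le> c"
 proof eventually_elim
  case (elim x)
  then show ?case using interior_cell_subset[OF K] closure_subset[of K] by (auto simp: frontier_def)
 qed
 then have aeK: "AE x in ?M. \<bar>f x - 1\<bar> \<le> c" using L by (simp add: AE_restrict_space_iff fmeasurableD)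
 have ic: "integrable ?M (%x. k)" for k :: real
  by (rule finite_measure.integrable_const[OF finite_measure_lebesgue_on[OF L]])
 have int: "integrable ?M f"
 proof (rule Bochner_Integration.integrable_bound[OF ic m])
  show "AE x in ?M. norm (f x) \<le> norm (1 + c)"
   using aeK by (rule eventually_mono) (use c in auto)
 qed
 have lk: "(LINT x|?M. k) = k * vol K" for k :: real
  using L by (simp add: measure_restrict_space space_restrict_space fmeasurableD)
 have "(LINT x|?M. f x) \<le> (LINT x|?M. 1 + c)"
  by (rule integral_mono_AE[OF int ic]) (rule eventually_mono[OF aeK], linarith)
 moreover have "(LINT x|?M. 1 - c) \<le> (LINT x|?M. f x)"
  by (rule integral_mono_AE[OF ic int]) (rule eventually_mono[OF aeK], linarith)
 ultimately have "1 - c \<le> (LINT x|?M. f x) / vol K" "(LINT x|?M. f x) / vol K \<le> 1 + c"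
  using vol_pos[OF K] unfolding lk by (simp_all add: pos_le_divide_eq pos_divide_le_eq)
 then show ?thesis by (simp add: abs_le_iff)
qed

lemma vel_div_trace_mean:
 assumes v: "v \<in> HE0 X" "!!Y. Y \<in> int_faces X ==> v Y = trace_mean (domain X) Y w" and w: "w \<in> H10 (domain X)" and K: "K \<in> cells X"
 shows "\<bar>vel_div X v K\<bar> \<le> 1 / vol K * (sqrt (vol K) * L2_nrm (domain X) (weak_div (domain X) w))"
proof -
 have "v Y = trace_mean (domain X) Y w" if s: "Y \<in> faces K" for Y
 proof (cases "Y \<in> int_faces X")
  case False
  then have "Y \<in> ext_faces X" using all_faces_cases[OF K s] by blast
  then have "v Y = 0" "Y \<subseteq> frontier (domain X)" using v(1) by (auto simp: HE0_def ext_faces_def)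
  then show ?thesis
   using full_polytope.trace_mean_frontier[OF cell_full[OF K] card open_domain bounded_domain w s] by simp
 qed (rule v(2))
 then have "vel_div X v K = 1 / vol K * (\<Sum>Y\<in>faces K. area Y * (trace_mean (domain X) Y w \<bullet> normal K Y))"
  unfolding vel_div_def by (intro arg_cong2[where f="(*)"] refl sum.cong) simp
 then have "\<bar>vel_div X v K\<bar> = 1 / vol K * \<bar>\<Sum>Y\<in>faces K. area Y * (trace_mean (domain X) Y w \<bullet> normal K Y)\<bar>"
  using vol_pos[OF K] by (simp add: abs_mult)
 also have "... \<le> 1 / vol K * (sqrt (vol K) * L2_nrm (domain X) (weak_div (domain X) w))"
  using vol_pos[OF K] full_polytope.trace_mean_divergence[OF cell_full[OF K] card open_domain bounded_domain w]
  by (intro mult_left_mono) auto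
 finally show ?thesis .
qed

text \<open>In finite dimension every norm is bounded by coordinates. The norm acts on functions of
  arbitrary sets, so a basis expansion reproduces the difference only on the mesh; the remainder
  vanishes there and therefore has norm zero.\<close>

lemma tends_in_discrete_normsI:
 assumes U: "!!m n. n \<le> N ==> U m n \<in> HE0 X" and u: "!!n. n \<le> N ==> u n \<in> HE0 X"
  and cu: "!!n Y. n \<le> N ==> Y \<in> all_faces X ==> (%m. U m n Y) \<longlonglongrightarrow> u n Y"
  and cq: "!!n K. n \<le> N ==> K \<in> cells X ==> (%m. Q m n K) \<longlonglongrightarrow> q n K"
 shows "tends_in_discrete_norms X N U Q u q"
 unfolding tends_in_discrete_norms_def
proof (intro allI impI)
 fix \<nu> assume \<nu>: "discrete_norm X N \<nu>"
 define d where "d m n Y = U m n Y - u n Y" for m n Y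
 define s where "s m n K = Q m n K - q n K" for m n K
 \<comment> \<open>External faces are left out so that every basis function satisfies the boundary
   condition of \<open>HE0\<close>.\<close>
 define J where "J = all_faces X - ext_faces X"
 have fJ: "finite J" unfolding J_def using finite_all_faces by blast
 define I1 where "I1 = {..N} \<times> (J \<times> (Basis :: (real^'n) set))"
 define I2 where "I2 = {..N} \<times> cells X"
 define E1 where "E1 = (%(k::nat, \<tau>::(real^'n) set, b) (n::nat) Y. if k = n \<and> \<tau> = Y then b else (0 :: real^'n))"
 define E2 where "E2 = (%(k::nat, L::(real^'n) set) (n::nat) K. if k = n \<and> L = K then 1 else (0 :: real))"
 define c1 where "c1 m = (%(k, \<tau>, b). d m k \<tau> \<bullet> b)" for m
 define c2 where "c2 m = (%(k, L). s m k L)" for m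
 have f1: "finite I1" and f2: "finite I2" unfolding I1_def I2_def using fJ finite_cells by auto
 have dv: "d m \<in> discrete_velocity X N" for m
  using U u by (auto simp: discrete_velocity_def HE0_def d_def)
 have E1v: "E1 i \<in> discrete_velocity X N" if "i \<in> I1" for i
  using that by (auto simp: I1_def J_def E1_def discrete_velocity_def HE0_def)
 have Z: "(%n Y. 0) \<in> discrete_velocity X N" by (simp add: discrete_velocity_def HE0_def)
 have A: "(\<Sum>i\<in>I1. c1 m i *\<^sub>R E1 i n Y) = d m n Y" if n: "n \<le> N" and Y: "Y \<in> all_faces X" for m n Y
 proof -
  have "(\<Sum>i\<in>I1. c1 m i *\<^sub>R E1 i n Y) = (\<Sum>k\<in>{..N}. \<Sum>\<tau>\<in>J. \<Sum>b\<in>Basis. (d m k \<tau> \<bullet> b) *\<^sub>R (if k = n \<and> \<tau> = Y then b else 0))"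
   unfolding I1_def sum.cartesian_product by (intro sum.cong refl) (auto simp: c1_def E1_def)
  also have "... = (\<Sum>k\<in>{..N}. \<Sum>\<tau>\<in>J. if k = n \<and> \<tau> = Y then d m n Y else 0)"
  proof (intro sum.cong refl)
   fix k \<tau>
   show "(\<Sum>b\<in>Basis. (d m k \<tau> \<bullet> b) *\<^sub>R (if k = n \<and> \<tau> = Y then b else 0)) = (if k = n \<and> \<tau> = Y then d m n Y else 0)"
   proof (cases "k = n \<and> \<tau> = Y")
    case True
    then have "k = n" "\<tau> = Y" by simp_all
    then show ?thesis by (simp add: euclidean_representation)
   next
    case False
    show ?thesis unfolding if_not_P[OF False] by simp
   qed
  qed
  also have "... = (\<Sum>k\<in>{..N}. if k = n then (if Y \<in> J then d m n Y else 0) else 0)"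
   by (intro sum.cong refl) (auto simp: fJ)
  also have "... = d m n Y"
   using n U[OF n, of m] u[OF n] Y by (auto simp: d_def J_def HE0_def)
  finally show ?thesis .
 qed
 have B: "(\<Sum>i\<in>I2. c2 m i * E2 i n K) = s m n K" if n: "n \<le> N" and K: "K \<in> cells X" for m n K
 proof -
  have "(\<Sum>i\<in>I2. c2 m i * E2 i n K) = (\<Sum>k\<in>{..N}. \<Sum>L\<in>cells X. if k = n \<and> L = K then s m n K else 0)"
   unfolding I2_def sum.cartesian_product by (intro sum.cong refl) (auto simp: c2_def E2_def)
  also have "... = (\<Sum>k\<in>{..N}. if k = n then s m n K else 0)"
   using K by (intro sum.cong refl) (auto simp: finite_cells)
  also have "... = s m n K" using n by simp
  finally show ?thesis .
 qed
 define a1 where "a1 m n Y = (\<Sum>i\<in>I1. c1 m i *\<^sub>R E1 i n Y)" for m n Y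
 define b2 where "b2 m n K = (\<Sum>i\<in>I2. c2 m i * E2 i n K)" for m n K
 have ds1: "\<nu> (%n Y. \<Sum>i\<in>I1. c1 m i *\<^sub>R E1 i n Y) (%n K. \<Sum>i\<in>I1. c1 m i * 0) \<le> (\<Sum>i\<in>I1. \<bar>c1 m i\<bar> * \<nu> (E1 i) (%n K. 0))
  \<and> (%n Y. \<Sum>i\<in>I1. c1 m i *\<^sub>R E1 i n Y) \<in> discrete_velocity X N" for m
  by (rule discrete_norm_sum[where b="%i n K. 0", OF \<nu> f1]) (rule E1v)
 have ds2: "\<nu> (%n Y. \<Sum>i\<in>I2. c2 m i *\<^sub>R 0) (%n K. \<Sum>i\<in>I2. c2 m i * E2 i n K) \<le> (\<Sum>i\<in>I2. \<bar>c2 m i\<bar> * \<nu> (%n Y. 0) (E2 i))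
  \<and> (%n Y. \<Sum>i\<in>I2. c2 m i *\<^sub>R 0) \<in> discrete_velocity X N" for m
  by (rule discrete_norm_sum[where a="%i n Y. 0", OF \<nu> f2]) (rule Z)
 have n1: "\<nu> (a1 m) (%n K. 0) \<le> (\<Sum>i\<in>I1. \<bar>c1 m i\<bar> * \<nu> (E1 i) (%n K. 0))" and a1v: "a1 m \<in> discrete_velocity X N" for m
  using ds1[of m] unfolding a1_def[abs_def] by simp_all
 have n2: "\<nu> (%n Y. 0) (b2 m) \<le> (\<Sum>i\<in>I2. \<bar>c2 m i\<bar> * \<nu> (%n Y. 0) (E2 i))" for m
  using ds2[of m] unfolding b2_def[abs_def] by simp
 have le: "\<nu> (d m) (s m) \<le> (\<Sum>i\<in>I1. \<bar>c1 m i\<bar> * \<nu> (E1 i) (%n K. 0)) + (\<Sum>i\<in>I2. \<bar>c2 m i\<bar> * \<nu> (%n Y. 0) (E2 i))" for m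
 proof -
  \<comment> \<open>The discrepancy at indices outside the mesh or beyond step N, about which the
    expansion says nothing.\<close>
  define r where "r n Y = d m n Y - a1 m n Y" for n Y
  define t where "t n K = s m n K - b2 m n K" for n K
  have rv: "r \<in> discrete_velocity X N" using dv[of m] a1v[of m] by (simp add: discrete_velocity_def HE0_def r_def)
  have z: "\<nu> r t = 0" by (rule discrete_normD(2)[OF \<nu> rv]) (simp_all add: r_def t_def a1_def b2_def A B)
  have "\<nu> (%n Y. a1 m n Y + r n Y) (%n K. b2 m n K + t n K) \<le> \<nu> (a1 m) (b2 m) + \<nu> r t"
   by (rule discrete_normD(4)[OF \<nu> a1v rv])
  moreover have "\<nu> (%n Y. a1 m n Y + 0) (%n K. 0 + b2 m n K) \<le> \<nu> (a1 m) (%n K. 0) + \<nu> (%n Y. 0) (b2 m)"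
   by (rule discrete_normD(4)[OF \<nu> a1v Z])
  moreover have "(%n Y. a1 m n Y + r n Y) = d m" "(%n K. b2 m n K + t n K) = s m" by (simp_all add: r_def t_def)
  ultimately show ?thesis using n1[of m] n2[of m] z by simp
 qed
 have "(%m. (\<Sum>i\<in>I1. \<bar>c1 m i\<bar> * \<nu> (E1 i) (%n K. 0)) + (\<Sum>i\<in>I2. \<bar>c2 m i\<bar> * \<nu> (%n Y. 0) (E2 i))) \<longlonglongrightarrow> 0"
 proof (rule tendsto_add_zero; rule tendsto_null_sum; rule tendsto_mult_left_zero; rule tendsto_rabs_zero)
  fix i assume "i \<in> I1"
  then obtain k \<tau> b where i: "i = (k, \<tau>, b)" "k \<le> N" "\<tau> \<in> all_faces X" by (auto simp: I1_def J_def)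
  have "(%m. d m k \<tau>) \<longlonglongrightarrow> 0" unfolding d_def by (rule LIM_zero[OF cu[OF i(2,3)]])
  from tendsto_inner[OF this tendsto_const[of b]] show "(%m. c1 m i) \<longlonglongrightarrow> 0" unfolding c1_def i(1) by simp
 next
  fix i assume "i \<in> I2"
  then obtain k L where i: "i = (k, L)" "k \<le> N" "L \<in> cells X" by (auto simp: I2_def)
  have "(%m. s m k L) \<longlonglongrightarrow> 0" unfolding s_def by (rule LIM_zero[OF cq[OF i(2,3)]])
  then show "(%m. c2 m i) \<longlonglongrightarrow> 0" unfolding c2_def i(1) by simp
 qed
 then have "(%m. \<nu> (d m) (s m)) \<longlonglongrightarrow> 0"
 proof (rule Lim_null_comparison[rotated], intro always_eventually allI)
  fix m
  show "norm (\<nu> (d m) (s m)) \<le> (\<Sum>i\<in>I1. \<bar>c1 m i\<bar> * \<nu> (E1 i) (%n K. 0)) + (\<Sum>i\<in>I2. \<bar>c2 m i\<bar> * \<nu> (%n Y. 0) (E2 i))"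
   using le[of m] by (simp only: real_norm_def abs_of_nonneg[OF discrete_normD(1)[OF \<nu> dv]])
 qed
 then show "(%m. \<nu> (%n Y. U m n Y - u n Y) (%n K. Q m n K - q n K)) \<longlonglongrightarrow> 0"
  unfolding d_def[abs_def] s_def[abs_def] .
qed

end

section \<open>Limit of the pressure correction scheme\<close>

context discretization
begin

section \<open>Passage to the limit and uniqueness in one time step\<close>

lemma mass_flux_cong:
 assumes "!!Y. Y \<in> int_faces X ==> u Y = v Y" shows "mass_flux X \<rho> u = mass_flux X \<rho> v"
 by (intro ext) (use assms in \<open>simp add: mass_flux_def\<close>)

lemma convection_cong:
 assumes "!!Y. Y \<in> int_faces X ==> u Y = v Y" shows "convection X \<rho> u = convection X \<rho> v"
 by (intro ext) (simp add: convection_def dual_flux_def mass_flux_cong[OF assms])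

lemma convection_diff:
 "convection X \<rho> u (%Y. v Y - w Y) Y = convection X \<rho> u v Y - convection X \<rho> u w Y"
proof -
 have "(1/2) *\<^sub>R ((v Y - w Y) + (v \<tau> - w \<tau>)) = (1/2) *\<^sub>R (v Y + v \<tau>) - (1/2) *\<^sub>R (w Y + w \<tau>)" for \<tau>
  unfolding scaleR_right_diff_distrib[symmetric] by (rule arg_cong[where f="%x. (1/2) *\<^sub>R x"]) simp
 then show ?thesis unfolding convection_def by (simp only: scaleR_right_diff_distrib sum_subtractf)
qed

lemma mass_div_1:
 assumes "v \<in> HE0 X" "K \<in> cells X" shows "mass_div X (%_. 1) v K = vel_div X v K"
 unfolding mass_div_def vel_div_def
proof (intro arg_cong2[where f="(*)"] refl sum.cong)
 fix Y assume "Y \<in> faces K"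
 then have "Y \<in> all_faces X" using assms(2) by (auto simp: all_faces_def)
 from HE0_zero[OF assms(1) this] show "mass_flux X (%_. 1) v K Y = area Y * (v Y \<bullet> normal K Y)"
  by (auto simp: mass_flux_def)
qed

text \<open>The form with \<open>max\<close> and \<open>min\<close> is continuous, so the upwind
  cell may change along the sequence.\<close>

lemma tendsto_mass_flux:
 assumes "K \<in> cells X" "Y \<in> faces K" "!!K. K \<in> cells X ==> ((%m. \<rho> m K) \<longlongrightarrow> 1) F"
  "!!Y. Y \<in> int_faces X ==> ((%m. u m Y) \<longlongrightarrow> v Y) F"
 shows "((%m. mass_flux X (\<rho> m) (u m) K Y) \<longlongrightarrow> mass_flux X (%_. 1) v K Y) F"
proof (cases "Y \<in> int_faces X")
 case True
 then have s: "Y \<in> int_face_set K" using assms(2) by (simp add: int_face_set_def)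
 show ?thesis unfolding mass_flux_upwind[OF s]
  by (intro tendsto_intros tendsto_max tendsto_min assms(3,4) assms(1) neighbour_props(1)[OF assms(1,2) True] True)
qed (simp add: mass_flux_def)

lemma tendsto_mass_div:
 assumes "K \<in> cells X" "!!K. K \<in> cells X ==> ((%m. \<rho> m K) \<longlongrightarrow> 1) F"
  "!!Y. Y \<in> int_faces X ==> ((%m. u m Y) \<longlongrightarrow> v Y) F"
 shows "((%m. mass_div X (\<rho> m) (u m) K) \<longlongrightarrow> mass_div X (%_. 1) v K) F"
 unfolding mass_div_def by (intro tendsto_mult_left tendsto_sum tendsto_mass_flux assms)

lemma tendsto_convection:
 assumes s: "Y \<in> all_faces X" and r: "!!K. K \<in> cells X ==> ((%m. \<rho> m K) \<longlongrightarrow> 1) F"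
  and u: "!!Y. Y \<in> int_faces X ==> ((%m. u m Y) \<longlongrightarrow> v Y) F"
  and w: "!!Y. Y \<in> all_faces X ==> ((%m. w m Y) \<longlongrightarrow> z Y) F"
 shows "((%m. convection X (\<rho> m) (u m) (w m) Y) \<longlongrightarrow> convection X (%_. 1) v z Y) F"
 unfolding convection_def
proof (intro tendsto_scaleR tendsto_const tendsto_sum tendsto_add)
 fix K \<tau> assume K: "K \<in> {K \<in> cells X. Y \<in> faces K}" and t: "\<tau> \<in> dual_adj K Y"
 have c: "K \<in> cells X" using K by simp
 show "((%m. dual_flux X (\<rho> m) (u m) K Y \<tau>) \<longlongrightarrow> dual_flux X (%_. 1) v K Y \<tau>) F"
  unfolding dual_flux_def by (intro tendsto_mult_left tendsto_sum tendsto_mass_flux c r u)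
 show "((%m. w m Y) \<longlongrightarrow> z Y) F" by (rule w[OF s])
 show "((%m. w m \<tau>) \<longlongrightarrow> z \<tau>) F" by (rule w) (use c t in \<open>auto simp: dual_adj_def all_faces_def\<close>)
qed

lemma zero_mean_const:
 assumes "!!K L. K \<in> cells X ==> L \<in> cells X ==> q L = q K" "(\<Sum>K\<in>cells X. vol K * q K) = (0::real)" "K \<in> cells X"
 shows "q K = 0"
proof -
 have "(\<Sum>L\<in>cells X. vol L * q L) = (\<Sum>L\<in>cells X. vol L * q K)" 
 proof (rule sum.cong[OF refl])
  fix L assume "L \<in> cells X"
  from assms(1)[OF assms(3) this] show "vol L * q L = vol L * q K" by (rule arg_cong)
 qed
 also have "... = vol (domain X) * q K" by (simp add: vol_domain sum_distrib_right)
 finally show ?thesis using assms(2) vol_domain_pos by simp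
qed

text \<open>One time step with equations indexed by internal faces alone;
  \<open>PC_solution_iff\<close> reconciles this with the scheme, where each equation is written
  from both sides of the face.\<close>

definition PC_step ::
  "real => real => real => real => real => 'n scalar_field => 'n scalar_field => 'n scalar_field =>
  'n vector_field => 'n vector_field => 'n vector_field => bool" where
 "PC_step \<gamma> \<mu> lam dt e \<rho>o \<rho> \<rho>' u ut u' \<longleftrightarrow> ut \<in> HE0 X \<and>
  (\<forall>Y\<in>int_faces X. (1/dt) *\<^sub>R (dual_density X \<rho> Y *\<^sub>R ut Y - dual_density X \<rho>o Y *\<^sub>R u Y)
   + convection X \<rho> u ut Y - div_tau X \<mu> lam ut Y
   + (1/e\<^sup>2) *\<^sub>R (sqrt (dual_density X \<rho> Y / dual_density X \<rho>o Y) *\<^sub>R pg (pressure \<gamma> \<rho>) Y) = 0) \<and>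
  (\<forall>Y\<in>int_faces X. (1/dt) *\<^sub>R (dual_density X \<rho> Y *\<^sub>R (u' Y - ut Y)) + (1/e\<^sup>2) *\<^sub>R pg (pressure \<gamma> \<rho>') Y
   - (1/e\<^sup>2) *\<^sub>R (sqrt (dual_density X \<rho> Y / dual_density X \<rho>o Y) *\<^sub>R pg (pressure \<gamma> \<rho>) Y) = 0) \<and>
  mass_balance dt \<rho> \<rho>' u'"

definition incompressible_step ::
  "real => real => real => 'n vector_field => 'n vector_field => 'n vector_field =>
  'n scalar_field => 'n scalar_field => bool" where
 "incompressible_step \<mu> lam dt v vt v' p p' \<longleftrightarrow> vt \<in> HE0 X \<and>
  (\<forall>Y\<in>int_faces X. (1/dt) *\<^sub>R (vt Y - v Y) + convection X (%_. 1) v vt Y - div_tau X \<mu> lam vt Y + pg p Y = 0) \<and>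
  (\<forall>Y\<in>int_faces X. (1/dt) *\<^sub>R (v' Y - vt Y) + pg p' Y - pg p Y = 0) \<and>
  (\<forall>K\<in>cells X. vel_div X v' K = 0)"

lemma ball_int_faces:
 assumes "!!K Y. K \<in> cells X ==> Y \<in> int_face_set K ==> P K Y \<longleftrightarrow> Q Y"
 shows "(\<forall>K\<in>cells X. \<forall>Y\<in>faces K \<inter> int_faces X. P K Y) \<longleftrightarrow> (\<forall>Y\<in>int_faces X. Q Y)"
proof
 assume l: "\<forall>K\<in>cells X. \<forall>Y\<in>faces K \<inter> int_faces X. P K Y"
 show "\<forall>Y\<in>int_faces X. Q Y"
 proof
  fix Y assume "Y \<in> int_faces X"
  then obtain K where K: "K \<in> cells X" "Y \<in> int_face_set K" by (rule int_face_cell)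
  then have "P K Y" using l by (simp add: int_face_set_def)
  then show "Q Y" using assms[OF K] by simp
 qed
next
 assume r: "\<forall>Y\<in>int_faces X. Q Y"
 show "\<forall>K\<in>cells X. \<forall>Y\<in>faces K \<inter> int_faces X. P K Y"
 proof (intro ballI)
  fix K Y assume K: "K \<in> cells X" "Y \<in> faces K \<inter> int_faces X"
  then have "Y \<in> int_face_set K" by (simp add: int_face_set_def)
  then show "P K Y" using assms[OF K(1)] r K(2) by simp
 qed
qed

lemma PC_solution_iff:
 "PC_solution X \<gamma> \<mu> lam dt N e r0 w0 \<rho> u \<longleftrightarrow>
  (\<forall>K\<in>cells X. \<rho> 0 K = (1 / vol K) * (LINT x|lebesgue_on K. r0 x)) \<and>
  (\<forall>n\<le>N. u n \<in> HE0 X) \<and>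
  (\<forall>Y\<in>int_faces X. u 0 Y = trace_mean (domain X) Y w0) \<and>
  mass_balance dt (\<rho> (- 1)) (\<rho> 0) (u 0) \<and>
  (\<exists>ut. \<forall>n<N. PC_step \<gamma> \<mu> lam dt e (\<rho> (int n - 1)) (\<rho> (int n)) (\<rho> (int n + 1)) (u n) (ut (Suc n)) (u (Suc n)))"
proof -
 have 1: "(\<forall>K\<in>cells X. \<forall>Y\<in>faces K \<inter> int_faces X. A Y + (1/e\<^sup>2) *\<^sub>R scaled_grad X \<gamma> \<rho>1 \<rho>2 K Y = 0) \<longleftrightarrow>
  (\<forall>Y\<in>int_faces X. A Y + (1/e\<^sup>2) *\<^sub>R (sqrt (dual_density X \<rho>1 Y / dual_density X \<rho>2 Y) *\<^sub>R pg (pressure \<gamma> \<rho>1) Y) = 0)" for A \<rho>1 \<rho>2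
  by (rule ball_int_faces) (simp add: scaled_grad_def pg_eq)
 have 2: "(\<forall>K\<in>cells X. \<forall>Y\<in>faces K \<inter> int_faces X. A Y + (1/e\<^sup>2) *\<^sub>R press_grad X q K Y - (1/e\<^sup>2) *\<^sub>R scaled_grad X \<gamma> \<rho>1 \<rho>2 K Y = 0) \<longleftrightarrow>
  (\<forall>Y\<in>int_faces X. A Y + (1/e\<^sup>2) *\<^sub>R pg q Y - (1/e\<^sup>2) *\<^sub>R (sqrt (dual_density X \<rho>1 Y / dual_density X \<rho>2 Y) *\<^sub>R pg (pressure \<gamma> \<rho>1) Y) = 0)" for A q \<rho>1 \<rho>2
  by (rule ball_int_faces) (simp add: scaled_grad_def pg_eq)
 show ?thesis unfolding PC_solution_def PC_step_def mass_balance_def 1 2 ..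
qed

lemma incompressible_solution_iff:
 "incompressible_solution X \<mu> lam dt N w0 p0 v p \<longleftrightarrow>
  (\<forall>n\<le>N. v n \<in> HE0 X \<and> (\<Sum>K\<in>cells X. vol K * p n K) = 0) \<and>
  (\<forall>Y\<in>int_faces X. v 0 Y = trace_mean (domain X) Y w0) \<and>
  (\<forall>K\<in>cells X. p 0 K = p0 K) \<and>
  (\<exists>vt. \<forall>n<N. incompressible_step \<mu> lam dt (v n) (vt (Suc n)) (v (Suc n)) (p n) (p (Suc n)))"
proof -
 have 1: "(\<forall>K\<in>cells X. \<forall>Y\<in>faces K \<inter> int_faces X. A Y + press_grad X q K Y = 0) \<longleftrightarrow> (\<forall>Y\<in>int_faces X. A Y + pg q Y = 0)" for A q
  by (rule ball_int_faces) (simp add: pg_eq)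
 have 2: "(\<forall>K\<in>cells X. \<forall>Y\<in>faces K \<inter> int_faces X. A Y + press_grad X q K Y - press_grad X r K Y = 0) \<longleftrightarrow> (\<forall>Y\<in>int_faces X. A Y + pg q Y - pg r Y = 0)" for A q r
  by (rule ball_int_faces) (simp add: pg_eq)
 show ?thesis unfolding incompressible_solution_def incompressible_step_def 1 2 ..
qed

lemma dual_density_1: "Y \<in> all_faces X ==> dual_density X (%_. 1) Y = 1"
 using vol_dual_cell_pos[of Y] by (simp add: dual_density_def vol_dual_cell)

lemma pg_cong:
 assumes "Y \<in> int_faces X" "!!K. K \<in> cells X ==> p K = q K" shows "pg p Y = pg q Y"
proof -
 \<comment> \<open>On the cells, the constant sequence p converges to q, so continuity of
   \<open>pg\<close> yields equality.\<close>
 have "(%m::nat. pg p Y) \<longlonglongrightarrow> pg q Y" by (rule tendsto_pg[OF assms(1)]) (simp add: assms(2))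
 then show ?thesis by (rule LIMSEQ_unique[OF tendsto_const])
qed

text \<open>The transporting velocity is known, so differences of two steps satisfy linear equations
  without forcing. The energy inequality identifies the predicted velocities. The corrected
  difference is divergence-free, hence orthogonal to pressure gradients, and vanishes; then the
  pressure difference has zero gradient and zero mean.\<close>

lemma incompressible_step_unique:
 assumes dt: "dt > 0" and \<mu>: "0 \<le> \<mu>" "0 \<le> \<mu> + lam"
  and s1: "incompressible_step \<mu> lam dt v vt v' p p'" and s2: "incompressible_step \<mu> lam dt w wt w' q q'"
  and H: "v \<in> HE0 X" "v' \<in> HE0 X" "w' \<in> HE0 X"
  and vw: "!!Y. Y \<in> all_faces X ==> v Y = w Y" and pq: "!!K. K \<in> cells X ==> p K = q K"
  and div: "!!K. K \<in> cells X ==> vel_div X v K = 0"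
  and mean: "(\<Sum>K\<in>cells X. vol K * p' K) = 0" "(\<Sum>K\<in>cells X. vol K * q' K) = 0"
 shows "!!Y. Y \<in> all_faces X ==> v' Y = w' Y" "!!K. K \<in> cells X ==> p' K = q' K"
proof -
 note S1 = s1[unfolded incompressible_step_def] and S2 = s2[unfolded incompressible_step_def]
 let ?I = "int_faces X"
 have all: "Y \<in> all_faces X" if "Y \<in> ?I" for Y using that int_faces_subset by blast
 have Vp: "V Y > 0" if "Y \<in> ?I" for Y using vol_dual_cell_pos[OF all[OF that]] .
 have pp: "pg p Y = pg q Y" if "Y \<in> ?I" for Y using that pq by (rule pg_cong)
 have vwi: "v Y = w Y" if "Y \<in> ?I" for Y by (rule vw[OF all[OF that]])
 define d where "d Y = vt Y - wt Y" for Y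
 have dH: "d \<in> HE0 X" using S1 S2 by (simp add: HE0_def d_def)
 have zero: "x Y = 0" if "(\<Sum>Y\<in>?I. V Y * ((1/dt) * (norm (x Y))\<^sup>2)) \<le> 0" "Y \<in> ?I" for x :: "(real^'n) set => real^'n" and Y
 proof (rule ccontr)
  assume n: "x Y \<noteq> 0"
  have "0 < (\<Sum>Y\<in>?I. V Y * ((1/dt) * (norm (x Y))\<^sup>2))"
  proof (rule sum_pos2[OF finite_int_faces that(2)])
   show "0 < V Y * ((1/dt) * (norm (x Y))\<^sup>2)" using n Vp[OF that(2)] dt by simp
  qed (use dt in simp)
  then show False using that(1) by simp
 qed
 have cc: "convection X (%_. 1) v = convection X (%_. 1) w" by (rule convection_cong) (rule vwi)
 \<comment> \<open>A divergence-free transporting velocity keeps the constant density 1 in balance,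
   so the compressible energy inequality applies with both densities equal to 1.\<close>
 have mb: "mass_balance dt (%_. 1) (%_. 1) v" using div mass_div_1[OF H(1)] by (simp add: mass_balance_def)
 have "(1/dt) *\<^sub>R (dual_density X (%_. 1) Y *\<^sub>R d Y - 0) + convection X (%_. 1) v d Y - div_tau X \<mu> lam d Y + 0 = 0" if s: "Y \<in> ?I" for Y
 proof -
  have e: "(1/dt) *\<^sub>R (vt Y - v Y) + convection X (%_. 1) v vt Y - div_tau X \<mu> lam vt Y + pg p Y = 0"
   "(1/dt) *\<^sub>R (wt Y - w Y) + convection X (%_. 1) w wt Y - div_tau X \<mu> lam wt Y + pg q Y = 0"
   using S1 S2 s by blast+
  have "(1/dt) *\<^sub>R d Y = (1/dt) *\<^sub>R (vt Y - v Y) - (1/dt) *\<^sub>R (wt Y - w Y)"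
   unfolding scaleR_right_diff_distrib[symmetric] by (rule arg_cong[where f="%x. (1/dt) *\<^sub>R x"]) (simp add: d_def vwi[OF s])
  moreover have "convection X (%_. 1) v d Y = convection X (%_. 1) v vt Y - convection X (%_. 1) w wt Y"
   unfolding d_def convection_diff by (simp only: cc)
  moreover have "div_tau X \<mu> lam d Y = div_tau X \<mu> lam vt Y - div_tau X \<mu> lam wt Y"
   unfolding d_def by (rule div_tau_diff[OF all[OF s]])
  moreover have "(a1 - a2) + (b1 - b2) - (c1 - c2) = (a1 + b1 - c1 + g) - (a2 + b2 - c2 + g)" for a1 a2 b1 b2 c1 c2 g :: "real^'n" by simp
  ultimately have "(1/dt) *\<^sub>R d Y + convection X (%_. 1) v d Y - div_tau X \<mu> lam d Y = 0 - 0"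
   using e unfolding pp[OF s] by metis
  then show ?thesis by (simp add: dual_density_1[OF all[OF s]])
 qed
 from prediction_energy[OF H(1) dH mb \<mu>, where z="%_. 0" and G="%_. 0", OF this]
 have "(\<Sum>Y\<in>?I. V Y * ((1/dt) * (norm (d Y))\<^sup>2)) \<le> 0"
  by (simp add: dual_density_1[OF all] cong: sum.cong)
 then have d0: "vt Y = wt Y" if "Y \<in> ?I" for Y using zero[of d Y] that by (simp add: d_def)
 define x where "x Y = v' Y - w' Y" for Y
 define r where "r K = p' K - q' K" for K
 have xH: "x \<in> HE0 X" using H by (simp add: HE0_def x_def)
 have eq: "(1/dt) *\<^sub>R x Y + pg r Y = 0" if s: "Y \<in> ?I" for Y
 proof -
  have e: "(1/dt) *\<^sub>R (v' Y - vt Y) + pg p' Y - pg p Y = 0" "(1/dt) *\<^sub>R (w' Y - wt Y) + pg q' Y - pg q Y = 0"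
   using S1 S2 s by blast+
  have 1: "(1/dt) *\<^sub>R x Y = (1/dt) *\<^sub>R (v' Y - vt Y) - (1/dt) *\<^sub>R (w' Y - wt Y)"
   unfolding scaleR_right_diff_distrib[symmetric] by (rule arg_cong[where f="%x. (1/dt) *\<^sub>R x"]) (simp add: x_def d0[OF s])
  have 2: "pg r Y = pg p' Y - pg q' Y" unfolding r_def by (rule pg_diff[OF s])
  have "(a1 - a2) + (b1 - b2) = (a1 + b1 - g) - (a2 + b2 - g)" for a1 a2 b1 b2 g :: "real^'n" by simp
  then have "(1/dt) *\<^sub>R x Y + pg r Y = 0 - 0" unfolding 1 2 using e unfolding pp[OF s] by metis
  then show ?thesis by simp
 qed
 have dx: "vel_div X x K = 0" if "K \<in> cells X" for K
 proof -
  have "vel_div X x K = vel_div X v' K - vel_div X w' K"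
   unfolding vel_div_def x_def inner_diff_left right_diff_distrib sum_subtractf by (rule refl)
  then show ?thesis using S1 S2 that by simp
 qed
 have "(\<Sum>Y\<in>?I. V Y * ((1/dt) * (norm (x Y))\<^sup>2)) = (\<Sum>Y\<in>?I. - (V Y * (pg r Y \<bullet> x Y)))"
 proof (rule sum.cong[OF refl])
  fix Y assume s: "Y \<in> ?I"
  have "0 = ((1/dt) *\<^sub>R x Y + pg r Y) \<bullet> x Y" using eq[OF s] by simp
  then have "(1/dt) * (norm (x Y))\<^sup>2 = - (pg r Y \<bullet> x Y)"
   unfolding inner_add_left inner_scaleR_left power2_norm_eq_inner by linarith
  then show "V Y * ((1/dt) * (norm (x Y))\<^sup>2) = - (V Y * (pg r Y \<bullet> x Y))" by (simp only: mult_minus_right)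
 qed
 also have "... = 0" unfolding sum_negf pg_work[OF xH] by (simp add: dx cong: sum.cong)
 finally have x0: "x Y = 0" if "Y \<in> ?I" for Y using zero[of x Y] that by simp
 show "v' Y = w' Y" if s: "Y \<in> all_faces X" for Y
 proof (cases "Y \<in> ?I")
  case True
  then show ?thesis using x0[OF True] by (simp add: x_def)
 next
  case False
  then show ?thesis using HE0_zero[OF H(2) s] HE0_zero[OF H(3) s] by simp
 qed
 have pr: "norm (pg r Y) \<le> 0" if "Y \<in> ?I" for Y using eq[OF that] x0[OF that] by simp
 obtain D where D: "\<forall>q t. t \<ge> 0 \<longrightarrow> (\<forall>Y\<in>?I. norm (pg q Y) \<le> t) \<longrightarrow> (\<forall>K\<in>cells X. \<forall>L\<in>cells X. \<bar>q L - q K\<bar> \<le> D * t)"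
  by (rule exE[OF oscillation_bound])
 have osc: "\<forall>K\<in>cells X. \<forall>L\<in>cells X. \<bar>r L - r K\<bar> \<le> D * 0"
  by (intro mp[OF mp[OF spec[OF spec[OF D]]]] ballI pr) simp
 have "r K = 0" if "K \<in> cells X" for K
 proof (rule zero_mean_const[OF _ _ that])
  show "r L = r K" if "K \<in> cells X" "L \<in> cells X" for K L using bspec[OF bspec[OF osc that(1)] that(2)] by simp
  show "(\<Sum>K\<in>cells X. vol K * r K) = 0" using mean by (simp add: r_def right_diff_distrib sum_subtractf)
 qed
 then show "p' K = q' K" if "K \<in> cells X" for K using that by (simp add: r_def)
qed

text \<open>The constant 1 may be subtracted before the mean is formed, which expresses
  \<open>delta_p\<close> by the rescaled pressure defects known to be bounded.\<close>

lemma delta_p_eq: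
 assumes "e \<noteq> 0"
 shows "delta_p X \<gamma> e \<rho> n K = (\<rho> (int n) K powr \<gamma> - 1) / e\<^sup>2 - 1 / vol (domain X) * (\<Sum>L\<in>cells X. vol L * ((\<rho> (int n) L powr \<gamma> - 1) / e\<^sup>2))"
proof -
 let ?p = "%L. \<rho> (int n) L powr \<gamma>"
 have "(\<Sum>L\<in>cells X. vol L * ((?p L - 1) / e\<^sup>2)) = ((\<Sum>L\<in>cells X. vol L * ?p L) - vol (domain X)) / e\<^sup>2"
  unfolding vol_domain sum_subtractf[symmetric] sum_divide_distrib by (intro sum.cong refl) (simp add: right_diff_distrib)
 moreover have "1 / vol (domain X) * (((\<Sum>L\<in>cells X. vol L * ?p L) - vol (domain X)) / e\<^sup>2) = (mean_value X ?p - 1) / e\<^sup>2"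
  using vol_domain_pos by (simp add: mean_value_def diff_divide_distrib)
 moreover have "pressure \<gamma> (\<rho> (int n)) = ?p" by (rule ext) (simp add: pressure_def)
 ultimately show ?thesis unfolding delta_p_def by (simp add: diff_divide_distrib)
qed

lemma delta_p_mean: "(\<Sum>K\<in>cells X. vol K * delta_p X \<gamma> e \<rho> n K) = 0"
proof -
 let ?p = "pressure \<gamma> (\<rho> (int n))"
 have "(\<Sum>K\<in>cells X. vol K * delta_p X \<gamma> e \<rho> n K) = ((\<Sum>K\<in>cells X. vol K * ?p K) - vol (domain X) * mean_value X ?p) / e\<^sup>2"
  unfolding vol_domain sum_distrib_right sum_subtractf[symmetric] sum_divide_distrib delta_p_def
  by (intro sum.cong refl) (simp add: right_diff_distrib)
 then show ?thesis using vol_domain_pos by (simp add: mean_value_def)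
qed

lemma pg_delta_p:
 assumes "Y \<in> int_faces X" shows "(1/e\<^sup>2) *\<^sub>R pg (pressure \<gamma> (\<rho> (int n))) Y = pg (delta_p X \<gamma> e \<rho> n) Y"
proof -
 have "delta_p X \<gamma> e \<rho> n = (%K. (1/e\<^sup>2) * (pressure \<gamma> (\<rho> (int n)) K - mean_value X (pressure \<gamma> (\<rho> (int n)))))"
  by (rule ext) (simp add: delta_p_def)
 then show ?thesis by (simp only: pg_scale[OF assms, symmetric])
qed

text \<open>Constants drop out of the gradient, so the pressure gradient divided by the square of
  the Mach number is that of \<open>delta_p\<close>. No singular term remains, and every term of the
  step has a limit.\<close>

lemma PC_step_limit:
 assumes st: "!!m. PC_step \<gamma> \<mu> lam dt (e m) (\<rho> m (int n - 1)) (\<rho> m (int n)) (\<rho> m (int n + 1)) (u m) (ut m) (u' m)"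
  and r: "!!K. K \<in> cells X ==> (%m. \<rho> m (int n - 1) K) \<longlonglongrightarrow> 1" "!!K. K \<in> cells X ==> (%m. \<rho> m (int n) K) \<longlonglongrightarrow> 1"
   "!!K. K \<in> cells X ==> (%m. \<rho> m (int n + 1) K) \<longlonglongrightarrow> 1"
  and u: "!!Y. Y \<in> all_faces X ==> (%m. u m Y) \<longlonglongrightarrow> v Y" and ut: "!!Y. Y \<in> all_faces X ==> (%m. ut m Y) \<longlonglongrightarrow> vt Y"
  and u': "!!Y. Y \<in> all_faces X ==> (%m. u' m Y) \<longlonglongrightarrow> v' Y" and H: "vt \<in> HE0 X" "v' \<in> HE0 X"
  and p: "!!K. K \<in> cells X ==> (%m. delta_p X \<gamma> (e m) (\<rho> m) n K) \<longlonglongrightarrow> p K"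
   "!!K. K \<in> cells X ==> (%m. delta_p X \<gamma> (e m) (\<rho> m) (Suc n) K) \<longlonglongrightarrow> p' K"
 shows "incompressible_step \<mu> lam dt v vt v' p p'"
proof -
 note S = st[unfolded PC_step_def]
 have all: "Y \<in> all_faces X" if "Y \<in> int_faces X" for Y using that int_faces_subset by blast
 have dd: "(%m. dual_density X (\<rho> m (int n)) Y) \<longlonglongrightarrow> 1" "(%m. dual_density X (\<rho> m (int n - 1)) Y) \<longlonglongrightarrow> 1" if "Y \<in> int_faces X" for Y
  by (rule tendsto_dual_density[OF all[OF that]], erule r)+
 define G where "G m Y = (1/(e m)\<^sup>2) *\<^sub>R (sqrt (dual_density X (\<rho> m (int n)) Y / dual_density X (\<rho> m (int n - 1)) Y) *\<^sub>R pg (pressure \<gamma> (\<rho> m (int n))) Y)" for m Y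
 have G: "(%m. G m Y) \<longlonglongrightarrow> pg p Y" if s: "Y \<in> int_faces X" for Y
 proof -
  have "(%m. sqrt (dual_density X (\<rho> m (int n)) Y / dual_density X (\<rho> m (int n - 1)) Y) *\<^sub>R pg (delta_p X \<gamma> (e m) (\<rho> m) n) Y) \<longlonglongrightarrow> sqrt (1 / 1) *\<^sub>R pg p Y"
   by (intro tendsto_scaleR tendsto_real_sqrt tendsto_divide dd[OF s] tendsto_pg[OF s] p(1)) simp
  moreover have "G m Y = sqrt (dual_density X (\<rho> m (int n)) Y / dual_density X (\<rho> m (int n - 1)) Y) *\<^sub>R pg (delta_p X \<gamma> (e m) (\<rho> m) n) Y" for m
   unfolding G_def pg_delta_p[OF s, symmetric] by (rule scaleR_left_commute)
  ultimately show ?thesis by simp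
 qed
 have P: "(1/dt) *\<^sub>R (vt Y - v Y) + convection X (%_. 1) v vt Y - div_tau X \<mu> lam vt Y + pg p Y = 0" if s: "Y \<in> int_faces X" for Y
 proof -
  have "(%m. (1/dt) *\<^sub>R (dual_density X (\<rho> m (int n)) Y *\<^sub>R ut m Y - dual_density X (\<rho> m (int n - 1)) Y *\<^sub>R u m Y)
   + convection X (\<rho> m (int n)) (u m) (ut m) Y - div_tau X \<mu> lam (ut m) Y + G m Y)
   \<longlonglongrightarrow> (1/dt) *\<^sub>R (1 *\<^sub>R vt Y - 1 *\<^sub>R v Y) + convection X (%_. 1) v vt Y - div_tau X \<mu> lam vt Y + pg p Y"
  proof (intro tendsto_add tendsto_diff tendsto_scaleR tendsto_const dd[OF s] G[OF s] ut[OF all[OF s]] u[OF all[OF s]])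
   show "(%m. convection X (\<rho> m (int n)) (u m) (ut m) Y) \<longlonglongrightarrow> convection X (%_. 1) v vt Y"
    by (rule tendsto_convection[OF all[OF s]]; (erule r(2) ut | rule u, erule all))
   show "(%m. div_tau X \<mu> lam (ut m) Y) \<longlonglongrightarrow> div_tau X \<mu> lam vt Y"
    by (rule tendsto_div_tau[OF all[OF s]]) (erule ut)
  qed
  moreover have "(1/dt) *\<^sub>R (dual_density X (\<rho> m (int n)) Y *\<^sub>R ut m Y - dual_density X (\<rho> m (int n - 1)) Y *\<^sub>R u m Y)
   + convection X (\<rho> m (int n)) (u m) (ut m) Y - div_tau X \<mu> lam (ut m) Y + G m Y = 0" for m
   unfolding G_def by (rule bspec[OF conjunct1[OF conjunct2[OF S]] s])
  ultimately have "(%m. 0) \<longlonglongrightarrow> (1/dt) *\<^sub>R (1 *\<^sub>R vt Y - 1 *\<^sub>R v Y) + convection X (%_. 1) v vt Y - div_tau X \<mu> lam vt Y + pg p Y"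
   by (simp only:)
  from LIMSEQ_unique[OF this tendsto_const] show ?thesis by (simp only: scaleR_one)
 qed
 have C: "(1/dt) *\<^sub>R (v' Y - vt Y) + pg p' Y - pg p Y = 0" if s: "Y \<in> int_faces X" for Y
 proof -
  have "(%m. (1/dt) *\<^sub>R (dual_density X (\<rho> m (int n)) Y *\<^sub>R (u' m Y - ut m Y)) + pg (delta_p X \<gamma> (e m) (\<rho> m) (Suc n)) Y - G m Y)
   \<longlonglongrightarrow> (1/dt) *\<^sub>R (1 *\<^sub>R (v' Y - vt Y)) + pg p' Y - pg p Y"
   by (intro tendsto_add tendsto_diff tendsto_scaleR tendsto_const dd[OF s] ut u' all[OF s] G[OF s] tendsto_pg[OF s] p(2))
  moreover have "int (Suc n) = int n + 1" by simp
  then have "(1/dt) *\<^sub>R (dual_density X (\<rho> m (int n)) Y *\<^sub>R (u' m Y - ut m Y)) + pg (delta_p X \<gamma> (e m) (\<rho> m) (Suc n)) Y - G m Y = 0" for m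
   unfolding G_def pg_delta_p[OF s, symmetric] by (simp only: bspec[OF conjunct1[OF conjunct2[OF conjunct2[OF S]]] s])
  ultimately have "(%m. 0) \<longlonglongrightarrow> (1/dt) *\<^sub>R (1 *\<^sub>R (v' Y - vt Y)) + pg p' Y - pg p Y" by (simp only:)
  from LIMSEQ_unique[OF this tendsto_const] show ?thesis by (simp only: scaleR_one)
 qed
 have "vel_div X v' K = 0" if K: "K \<in> cells X" for K
 proof -
  have "(%m. (1/dt) * (\<rho> m (int n + 1) K - \<rho> m (int n) K) + mass_div X (\<rho> m (int n + 1)) (u' m) K) \<longlonglongrightarrow> (1/dt) * (1 - 1) + mass_div X (%_. 1) v' K"
   by (intro tendsto_add tendsto_mult tendsto_diff tendsto_const r K tendsto_mass_div u' all)
  moreover have "(1/dt) * (\<rho> m (int n + 1) K - \<rho> m (int n) K) + mass_div X (\<rho> m (int n + 1)) (u' m) K = 0" for m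
   by (rule bspec[OF conjunct2[OF conjunct2[OF conjunct2[OF S, unfolded mass_balance_def]]] K])
  ultimately have "(%m. 0) \<longlonglongrightarrow> (1/dt) * (1 - 1) + mass_div X (%_. 1) v' K" by (simp only:)
  from LIMSEQ_unique[OF this tendsto_const] show ?thesis unfolding mass_div_1[OF H(2) K] by simp
 qed
 then show ?thesis unfolding incompressible_step_def using H(1) P C by blast
qed

end

section \<open>The sequence of compressible solutions\<close>

locale low_Mach = discretization X for X :: "('n::finite) staggered_mesh" +
 fixes \<gamma> \<mu> lam dt :: real and N :: nat and e :: "nat => real" and r0 :: "nat => real^'n => real"
  and w0 :: "nat => real^'n => real^'n" and wl :: "real^'n => real^'n"
  and \<rho> :: "nat => int => 'n scalar_field" and u :: "nat => nat => 'n vector_field"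
 assumes \<gamma>: "\<gamma> \<ge> 1" and \<mu>: "0 \<le> \<mu>" "0 \<le> \<mu> + lam" and dt: "dt > 0" and e: "!!m. e m > 0" "e \<longlonglongrightarrow> 0"
  and wp: "well_prepared (domain X) e r0 w0 wl"
  and PC: "!!m. PC_solution X \<gamma> \<mu> lam dt N (e m) (r0 m) (w0 m) (\<rho> m) (u m)"
begin

lemma H: "n \<le> N ==> u m n \<in> HE0 X"
 and mb0: "mass_balance dt (\<rho> m (- 1)) (\<rho> m 0) (u m 0)"
 and u0: "Y \<in> int_faces X ==> u m 0 Y = trace_mean (domain X) Y (w0 m)"
 and rho0: "K \<in> cells X ==> \<rho> m 0 K = (1 / vol K) * (LINT x|lebesgue_on K. r0 m x)"
 using PC[of m] unfolding PC_solution_iff by blast+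

lemma prediction_ex:
 "\<exists>ut. \<forall>m. \<forall>n<N. PC_step \<gamma> \<mu> lam dt (e m) (\<rho> m (int n - 1)) (\<rho> m (int n)) (\<rho> m (int n + 1)) (u m n) (ut m (Suc n)) (u m (Suc n))"
proof -
 have "\<exists>t. \<forall>n<N. PC_step \<gamma> \<mu> lam dt (e m) (\<rho> m (int n - 1)) (\<rho> m (int n)) (\<rho> m (int n + 1)) (u m n) (t (Suc n)) (u m (Suc n))" for m
  using PC[of m] unfolding PC_solution_iff by (elim conjE)
 then show ?thesis by (intro choice allI)
qed

definition ut :: "nat => nat => 'n vector_field" where
 "ut = (SOME t. \<forall>m. \<forall>n<N. PC_step \<gamma> \<mu> lam dt (e m) (\<rho> m (int n - 1)) (\<rho> m (int n)) (\<rho> m (int n + 1)) (u m n) (t m (Suc n)) (u m (Suc n)))"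

lemma step:
 assumes n: "n < N"
 shows "PC_step \<gamma> \<mu> lam dt (e m) (\<rho> m (int n - 1)) (\<rho> m (int n)) (\<rho> m (int n + 1)) (u m n) (ut m (Suc n)) (u m (Suc n))"
proof -
 have s: "\<forall>m. \<forall>n<N. PC_step \<gamma> \<mu> lam dt (e m) (\<rho> m (int n - 1)) (\<rho> m (int n)) (\<rho> m (int n + 1)) (u m n) (ut m (Suc n)) (u m (Suc n))"
  unfolding ut_def by (rule someI_ex[OF prediction_ex])
 show ?thesis by (rule mp[OF spec[OF spec[OF s]] n])
qed

lemma w0: "w0 m \<in> H10 (domain X)" and r0: "r0 m \<in> borel_measurable (lebesgue_on (domain X))"
 and wl: "in_L2 (domain X) wl" "(%m. L2_nrm (domain X) (%x. w0 m x - wl x)) \<longlonglongrightarrow> 0"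
 using wp unfolding well_prepared_def by blast+

lemma rho0_bounded:
 assumes "K \<in> cells X" shows "Bseq (%m. (\<rho> m 0 K - 1) / (e m)\<^sup>2)"
proof -
 obtain C where C: "0 \<le> C" "!!m. AE x in lebesgue_on (domain X). \<bar>r0 m x - 1\<bar> \<le> C * (e m)\<^sup>2"
  using well_preparedD[OF wp e(1)] by blast
 have "norm ((\<rho> m 0 K - 1) / (e m)\<^sup>2) \<le> C" for m
 proof -
  have "\<bar>\<rho> m 0 K - 1\<bar> \<le> C * (e m)\<^sup>2"
   unfolding rho0[OF assms] by (rule cell_mean_close[OF assms r0 C(2)]) (use C(1) in simp)
  then show ?thesis using e(1)[of m] by (simp add: abs_divide pos_divide_le_eq)
 qed
 then show ?thesis by (rule BseqI')
qed

lemma u0_limit: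
 assumes "Y \<in> int_faces X" shows "(%m. u m 0 Y) \<longlonglongrightarrow> trace_mean (domain X) Y wl"
proof -
 obtain C where C: "!!m. L2_nrm (domain X) (weak_jacobian (domain X) (w0 m)) \<le> C"
  using well_preparedD[OF wp e(1)] by blast
 obtain K where K: "K \<in> cells X" "Y \<in> int_face_set K" by (rule int_face_cell[OF assms])
 then have s: "Y \<in> faces K" by (simp add: int_face_set_def)
 show ?thesis unfolding u0[OF assms]
  by (rule trace_mean_weak_limit[OF card open_domain bounded_domain w0 C wl cell_full[OF K(1)] s])
qed

lemma vel_div_u0_limit:
 assumes K: "K \<in> cells X" shows "(%m. vel_div X (u m 0) K) \<longlonglongrightarrow> 0"
proof -
 obtain C where C: "!!m. L2_nrm (domain X) (weak_div (domain X) (w0 m)) \<le> C * e m"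
  using well_preparedD[OF wp e(1)] by blast
 show ?thesis
 proof (rule Lim_null_comparison)
  show "\<forall>\<^sub>F m in sequentially. norm (vel_div X (u m 0) K) \<le> 1 / vol K * (sqrt (vol K) * (C * e m))"
  proof (intro always_eventually allI)
   fix m
   have "\<bar>vel_div X (u m 0) K\<bar> \<le> 1 / vol K * (sqrt (vol K) * L2_nrm (domain X) (weak_div (domain X) (w0 m)))"
    by (rule vel_div_trace_mean[OF H u0 w0 K]) simp
   also have "... \<le> 1 / vol K * (sqrt (vol K) * (C * e m))"
    using C[of m] by (intro mult_left_mono) auto
   finally show "norm (vel_div X (u m 0) K) \<le> 1 / vol K * (sqrt (vol K) * (C * e m))" by simp
  qed
  show "(%m. 1 / vol K * (sqrt (vol K) * (C * e m))) \<longlonglongrightarrow> 0"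
   by (intro tendsto_mult_right_zero e(2))
 qed
qed

text \<open>The limit of the initial velocities, set to zero off the internal faces. Removing
  \<open>ext_faces X\<close> explicitly makes the boundary condition immediate.\<close>

definition v0 :: "'n vector_field" where
 "v0 Y = (if Y \<in> int_faces X - ext_faces X then trace_mean (domain X) Y wl else 0)"

lemma v0_HE0: "v0 \<in> HE0 X" by (simp add: HE0_def v0_def)

lemma u0_v0:
 assumes "Y \<in> all_faces X" shows "(%m. u m 0 Y) \<longlonglongrightarrow> v0 Y"
proof (cases "Y \<in> int_faces X - ext_faces X")
 case True
 then show ?thesis using u0_limit[of Y] by (simp add: v0_def)
next
 case False
 then have "u m 0 Y = 0" for m using H[of 0 m] HE0_zero[OF H[of 0 m] assms] by (auto simp: HE0_def)
 moreover have "v0 Y = 0" unfolding v0_def by (rule if_not_P[OF False])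
 ultimately show ?thesis by simp
qed

text \<open>The discrete divergence of the initial velocities is of order \<epsilon> for
  well-prepared data. The limit being divergence-free is used for the density at step -1 and for
  uniqueness in the first step.\<close>

lemma v0_div: assumes K: "K \<in> cells X" shows "vel_div X v0 K = 0"
proof -
 have "(%m. vel_div X (u m 0) K) \<longlonglongrightarrow> vel_div X v0 K"
  unfolding vel_div_def using K by (intro tendsto_intros u0_v0) (auto simp: all_faces_def)
 then show ?thesis using vel_div_u0_limit[OF K] by (rule LIMSEQ_unique)
qed

text \<open>The densities at steps -1 and 0 differ by dt times a mass divergence, which tends to the
  divergence of \<open>v0\<close>, that is, to zero.\<close>

lemma rho_old_limit:
 assumes K: "K \<in> cells X" shows "(%m. \<rho> m (- 1) K) \<longlonglongrightarrow> 1"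
proof -
 have r: "(%m. \<rho> m 0 K) \<longlonglongrightarrow> 1" if "K \<in> cells X" for K by (rule tendsto_1_of_Bseq[OF rho0_bounded[OF that] e])
 have eq: "\<rho> m (- 1) K = \<rho> m 0 K + dt * mass_div X (\<rho> m 0) (u m 0) K" for m
 proof -
  have "(1/dt) * (\<rho> m 0 K - \<rho> m (- 1) K) + mass_div X (\<rho> m 0) (u m 0) K = 0" using mb0 K by (simp add: mass_balance_def)
  then have "dt * ((1/dt) * (\<rho> m 0 K - \<rho> m (- 1) K) + mass_div X (\<rho> m 0) (u m 0) K) = 0" by simp
  then show ?thesis using dt by (simp add: distrib_left)
 qed
 have "(%m. \<rho> m 0 K + dt * mass_div X (\<rho> m 0) (u m 0) K) \<longlonglongrightarrow> 1 + dt * mass_div X (%_. 1) v0 K"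
  by (intro tendsto_add tendsto_mult tendsto_const r K tendsto_mass_div u0_v0) (assumption | erule subsetD[OF int_faces_subset])+
 then show ?thesis unfolding eq mass_div_1[OF v0_HE0 K] v0_div[OF K] by simp
qed

text \<open>The limit of the preceding density is carried separately from the rate for the current
  one, since at n = 0 it concerns step -1. Predicted velocities exist for positive n only.\<close>

lemma bounds:
 "n \<le> N ==> (\<forall>K\<in>cells X. Bseq (%m. (\<rho> m (int n) K - 1) / (e m)\<^sup>2)) \<and> (\<forall>K\<in>cells X. (%m. \<rho> m (int n - 1) K) \<longlonglongrightarrow> 1)
  \<and> (\<forall>Y\<in>int_faces X. Bseq (%m. u m n Y)) \<and> (\<forall>m. mass_balance dt (\<rho> m (int n - 1)) (\<rho> m (int n)) (u m n))
  \<and> (n > 0 \<longrightarrow> (\<forall>Y\<in>int_faces X. Bseq (%m. ut m n Y)))"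
proof (induction n)
 case 0
 show ?case using rho0_bounded rho_old_limit mb0 convergent_imp_Bseq[OF convergentI[OF u0_limit]] by simp
next
 case (Suc n)
 then have n: "n < N" "n \<le> N" "Suc n \<le> N" by simp_all
 note IH = Suc.IH[OF n(2)]
 note r = bspec[OF conjunct1[OF IH]] and ro = bspec[OF conjunct1[OF conjunct2[OF IH]]]
  and ub = bspec[OF conjunct1[OF conjunct2[OF conjunct2[OF IH]]]]
  and mb = spec[OF conjunct1[OF conjunct2[OF conjunct2[OF conjunct2[OF IH]]]]]
 note S = step[OF n(1), unfolded PC_step_def]
 note b = step_bounded[OF \<gamma> \<mu> dt e ro r ub H[OF n(2)] conjunct1[OF S] H[OF n(3)] mb
   conjunct2[OF conjunct2[OF conjunct2[OF S]]] refl bspec[OF conjunct1[OF conjunct2[OF S]]]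
   bspec[OF conjunct1[OF conjunct2[OF conjunct2[OF S]]]]]
 have i: "int (Suc n) = int n + 1" "int n + 1 - 1 = int n" by simp_all
 have "(%m. \<rho> m (int n) K) \<longlonglongrightarrow> 1" if "K \<in> cells X" for K by (rule tendsto_1_of_Bseq[OF r[OF that] e])
 then show ?case unfolding i using b(1) b(2) b(3) conjunct2[OF conjunct2[OF conjunct2[OF S]]] by blast
qed

lemma rho_bounded: "n \<le> N ==> K \<in> cells X ==> Bseq (%m. (\<rho> m (int n) K - 1) / (e m)\<^sup>2)"
 by (rule bspec[OF conjunct1[OF bounds]])

lemma rho_previous_limit: "n \<le> N ==> K \<in> cells X ==> (%m. \<rho> m (int n - 1) K) \<longlonglongrightarrow> 1"
 by (rule bspec[OF conjunct1[OF conjunct2[OF bounds]]])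

lemma u_bounded: "n \<le> N ==> Y \<in> int_faces X ==> Bseq (%m. u m n Y)"
 by (rule bspec[OF conjunct1[OF conjunct2[OF conjunct2[OF bounds]]]])

lemma ut_bounded: "n \<le> N ==> 0 < n ==> Y \<in> int_faces X ==> Bseq (%m. ut m n Y)"
 by (rule bspec[OF mp[OF conjunct2[OF conjunct2[OF conjunct2[OF conjunct2[OF bounds]]]]]])

lemma rho_limit: "n \<le> N ==> K \<in> cells X ==> (%m. \<rho> m (int n) K) \<longlonglongrightarrow> 1"
 by (rule tendsto_1_of_Bseq[OF rho_bounded e])

lemma delta_p_bounded:
 assumes n: "n \<le> N" and K: "K \<in> cells X" shows "Bseq (%m. delta_p X \<gamma> (e m) (\<rho> m) n K)"
proof -
 let ?q = "%m K. (\<rho> m (int n) K powr \<gamma> - 1) / (e m)\<^sup>2"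
 have q: "Bseq (%m. ?q m K)" if "K \<in> cells X" for K by (rule Bseq_powr_near_1[OF rho_bounded[OF n that] e \<gamma>])
 obtain C where C: "C \<ge> 0" "!!m K. K \<in> cells X ==> norm (?q m K) \<le> C"
  by (rule Bseq_uniform[OF finite_cells, of ?q, OF q], assumption, rule that; blast)
 have "norm (delta_p X \<gamma> (e m) (\<rho> m) n K) \<le> C + 1 / vol (domain X) * (\<Sum>L\<in>cells X. vol L * C)" for m
 proof -
  have "norm (\<Sum>L\<in>cells X. vol L * ?q m L) \<le> (\<Sum>L\<in>cells X. vol L * C)"
  proof (rule sum_norm_le)
   fix L assume "L \<in> cells X"
   from mult_left_mono[OF C(2)[OF this, of m] measure_nonneg[of lebesgue L]]
   show "norm (vol L * ?q m L) \<le> vol L * C" by (simp add: abs_mult)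
  qed
  then have "norm (1 / vol (domain X) * (\<Sum>L\<in>cells X. vol L * ?q m L)) \<le> 1 / vol (domain X) * (\<Sum>L\<in>cells X. vol L * C)"
   using vol_domain_pos unfolding norm_mult by (intro mult_mono) auto
  moreover have "e m \<noteq> 0" using e(1)[of m] by simp
  ultimately show ?thesis unfolding delta_p_eq[OF \<open>e m \<noteq> 0\<close>]
   using C(2)[OF K, of m] norm_triangle_ineq4[of "?q m K" "1 / vol (domain X) * (\<Sum>L\<in>cells X. vol L * ?q m L)"] by linarith
 qed
 then show ?thesis by (rule BseqI')
qed

lemma compactness:
 fixes r :: "nat => nat"
 assumes r: "strict_mono r" and p0: "\<forall>K\<in>cells X. (%m. delta_p X \<gamma> (e (r m)) (\<rho> (r m)) 0 K) \<longlonglongrightarrow> p0 K"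
 shows "\<exists>s v p. strict_mono s \<and> incompressible_solution X \<mu> lam dt N wl p0 v p
  \<and> (\<forall>n\<le>N. \<forall>Y\<in>all_faces X. (%m. u (r (s m)) n Y) \<longlonglongrightarrow> v n Y)
  \<and> (\<forall>n\<le>N. \<forall>K\<in>cells X. (%m. delta_p X \<gamma> (e (r (s m))) (\<rho> (r (s m))) n K) \<longlonglongrightarrow> p n K)"
proof -
 \<comment> \<open>All unknowns at all times are packed into one finite family, so that a single
   extraction makes every component converge. At n = 0 there is no predicted velocity, and zero
   stands in for it.\<close>
 define f where "f m i = (case i of Inl (n, Y) => (u (r m) n Y, if n = 0 then 0 else ut (r m) n Y, 0::real)
   | Inr (n, K) => (0, 0, delta_p X \<gamma> (e (r m)) (\<rho> (r m)) n K))" for m and i :: "nat \<times> (real^'n) set + nat \<times> (real^'n) set"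
 define I where "I = ({..N} \<times> int_faces X) <+> ({..N} \<times> cells X)"
 have P: "Bseq (%m. (a m, b m, c m))" if abc: "Bseq a" "Bseq b" "Bseq c"
  for a b :: "nat => real^'n" and c :: "nat => real"
 proof -
  obtain A B D where "!!m. norm (a m) \<le> A" "!!m. norm (b m) \<le> B" "!!m. norm (c m) \<le> D"
   using Bseq_bound[OF abc(1)] Bseq_bound[OF abc(2)] Bseq_bound[OF abc(3)] by blast
  then have "norm (a m, b m, c m) \<le> A + (B + D)" for m
   using norm_Pair_le[of "a m" "(b m, c m)"] norm_Pair_le[of "b m" "c m"] by (smt (verit))
  then show ?thesis by (rule BseqI')
 qed
 have c0: "Bseq (%m. 0 :: 'z::real_normed_vector)" by (rule BseqI'[of _ 0]) simp
 have fB: "Bseq (%m. f m i)" if i: "i \<in> I" for i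
 proof (cases i)
  case (Inl k)
  obtain n Y where k: "k = (n, Y)" by (cases k)
  have nk: "n \<le> N" "Y \<in> int_faces X" using i unfolding I_def Inl k by auto
  have 1: "Bseq (%m. u (r m) n Y)"
   by (rule Bseq_subseq[OF u_bounded[OF nk], of r])
  have 2: "Bseq (%m. if n = 0 then 0 else ut (r m) n Y)"
  proof (cases "n = 0")
   case False
   then have "Bseq (%m. ut m n Y)" by (intro ut_bounded nk) simp
   from Bseq_subseq[OF this, of r] False show ?thesis by simp
  qed (simp add: c0)
  show ?thesis unfolding f_def Inl k using P[OF 1 2 c0] by simp
 next
  case (Inr k)
  obtain n K where k: "k = (n, K)" by (cases k)
  have nk: "n \<le> N" "K \<in> cells X" using i unfolding I_def Inr k by auto
  show ?thesis unfolding f_def Inr k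
   using P[OF c0 c0 Bseq_subseq[OF delta_p_bounded[OF nk], of r]] by simp
 qed
 have fI: "finite I" unfolding I_def by (intro finite_Plus finite_cartesian_product finite_atMost finite_int_faces finite_cells)
 have "\<exists>s l. strict_mono s \<and> (\<forall>i\<in>I. (%m. f (s m) i) \<longlonglongrightarrow> l i)" by (rule convergent_subseq_finite[OF fI fB])
 then obtain s l where s: "strict_mono s" "\<forall>i\<in>I. (%m. f (s m) i) \<longlonglongrightarrow> l i" by (elim exE conjE)
 define v where "v n Y = (if Y \<in> int_faces X then fst (l (Inl (n, Y))) else 0)" for n Y
 define vt where "vt n Y = (if Y \<in> int_faces X then fst (snd (l (Inl (n, Y)))) else 0)" for n Y
 define p where "p n K = snd (snd (l (Inr (n, K))))" for n K
 have rs: "strict_mono (%m. r (s m))" using strict_mono_o[OF r s(1)] by (simp add: o_def)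
 have sub: "(%m. g (r (s m))) \<longlonglongrightarrow> x" if "g \<longlonglongrightarrow> x" for g :: "nat => 'z::topological_space" and x
  using LIMSEQ_subseq_LIMSEQ[OF that rs] by (simp add: o_def)
 have lu: "(%m. u (r (s m)) n Y) \<longlonglongrightarrow> v n Y" and lt: "n > 0 ==> (%m. ut (r (s m)) n Y) \<longlonglongrightarrow> vt n Y"
  if n: "n \<le> N" and Y: "Y \<in> all_faces X" for n Y
 proof -
  have t0: "ut m n Y = 0" if np: "Y \<notin> int_faces X" "n > 0" for m
  proof -
   obtain k where k: "n = Suc k" using np(2) by (cases n) auto
   then have kN: "k < N" using n by simp
   have "ut m n \<in> HE0 X" unfolding k by (rule conjunct1[OF step[OF kN, unfolded PC_step_def]])
   then show ?thesis by (rule HE0_zero[OF _ Y np(1)])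
  qed
  have "(%m. u (r (s m)) n Y) \<longlonglongrightarrow> v n Y \<and> (n > 0 \<longrightarrow> (%m. ut (r (s m)) n Y) \<longlonglongrightarrow> vt n Y)"
  proof (cases "Y \<in> int_faces X")
   case True
   then have "Inl (n, Y) \<in> I" using n by (auto simp: I_def)
   from bspec[OF s(2) this] have c: "(%m. f (s m) (Inl (n, Y))) \<longlonglongrightarrow> l (Inl (n, Y))" .
   show ?thesis using tendsto_fst[OF c] tendsto_fst[OF tendsto_snd[OF c]] True by (cases "n = 0") (simp_all add: f_def v_def vt_def)
  next
   case False
   then show ?thesis using HE0_zero[OF H[OF n] Y False] t0[OF False] by (simp add: v_def vt_def)
  qed
  then show "(%m. u (r (s m)) n Y) \<longlonglongrightarrow> v n Y" "n > 0 ==> (%m. ut (r (s m)) n Y) \<longlonglongrightarrow> vt n Y" by blast+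
 qed
 have lp: "(%m. delta_p X \<gamma> (e (r (s m))) (\<rho> (r (s m))) n K) \<longlonglongrightarrow> p n K" if n: "n \<le> N" and K: "K \<in> cells X" for n K
 proof -
  have "Inr (n, K) \<in> I" using n K by (auto simp: I_def)
  from bspec[OF s(2) this] have c: "(%m. f (s m) (Inr (n, K))) \<longlonglongrightarrow> l (Inr (n, K))" .
  show ?thesis using tendsto_snd[OF tendsto_snd[OF c]] by (simp add: f_def p_def)
 qed
 have ext: "Y \<in> all_faces X" if "Y \<in> ext_faces X" for Y using that by (simp add: ext_faces_def)
 have vH: "v n \<in> HE0 X" if n: "n \<le> N" for n
  unfolding HE0_def
 proof (intro CollectI ballI)
  fix Y assume x: "Y \<in> ext_faces X"
  have "u m n Y = 0" for m using H[OF n, of m] x by (simp add: HE0_def)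
  then have "(%m. 0) \<longlonglongrightarrow> v n Y" using lu[OF n ext[OF x]] by simp
  then show "v n Y = 0" by (rule LIMSEQ_unique[OF _ tendsto_const])
 qed
 have vtH: "vt (Suc n) \<in> HE0 X" if n: "n < N" for n
  unfolding HE0_def
 proof (intro CollectI ballI)
  fix Y assume x: "Y \<in> ext_faces X"
  have "ut m (Suc n) Y = 0" for m using conjunct1[OF step[OF n, of m, unfolded PC_step_def]] x by (simp add: HE0_def)
  then have "(%m. 0) \<longlonglongrightarrow> vt (Suc n) Y" using lt[of "Suc n", OF _ ext[OF x]] n by simp
  then show "vt (Suc n) Y = 0" by (rule LIMSEQ_unique[OF _ tendsto_const])
 qed
 have mean: "(\<Sum>K\<in>cells X. vol K * p n K) = 0" if n: "n \<le> N" for n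
 proof -
  have "(%m. \<Sum>K\<in>cells X. vol K * delta_p X \<gamma> (e (r (s m))) (\<rho> (r (s m))) n K) \<longlonglongrightarrow> (\<Sum>K\<in>cells X. vol K * p n K)"
   by (intro tendsto_sum tendsto_mult_left lp[OF n])
  then have "(%m. 0) \<longlonglongrightarrow> (\<Sum>K\<in>cells X. vol K * p n K)" by (simp only: delta_p_mean)
  then show ?thesis by (rule LIMSEQ_unique[OF _ tendsto_const])
 qed
 have "incompressible_solution X \<mu> lam dt N wl p0 v p"
  unfolding incompressible_solution_iff
 proof (intro conjI allI impI ballI exI[of _ vt])
  show "v 0 Y = trace_mean (domain X) Y wl" if "Y \<in> int_faces X" for Y
   by (rule LIMSEQ_unique[OF lu[OF _ subsetD[OF int_faces_subset that]] sub[OF u0_limit[OF that]]]) simp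
  show "p 0 K = p0 K" if "K \<in> cells X" for K
   by (rule LIMSEQ_unique[OF lp[OF _ that]]) (use LIMSEQ_subseq_LIMSEQ[OF bspec[OF p0 that] s(1)] in \<open>simp_all add: o_def\<close>)
  show "incompressible_step \<mu> lam dt (v n) (vt (Suc n)) (v (Suc n)) (p n) (p (Suc n))" if n: "n < N" for n
  proof (rule PC_step_limit[where u="%m. u (r (s m)) n" and ut="%m. ut (r (s m)) (Suc n)" and u'="%m. u (r (s m)) (Suc n)"])
   have n': "n \<le> N" "Suc n \<le> N" using n by simp_all
   show "PC_step \<gamma> \<mu> lam dt (e (r (s m))) (\<rho> (r (s m)) (int n - 1)) (\<rho> (r (s m)) (int n)) (\<rho> (r (s m)) (int n + 1)) (u (r (s m)) n) (ut (r (s m)) (Suc n)) (u (r (s m)) (Suc n))" for m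
    by (rule step[OF n])
   show "(%m. \<rho> (r (s m)) (int n - 1) K) \<longlonglongrightarrow> 1" if "K \<in> cells X" for K
    by (rule sub[OF rho_previous_limit[OF n'(1) that]])
   show "(%m. \<rho> (r (s m)) (int n) K) \<longlonglongrightarrow> 1" if "K \<in> cells X" for K by (rule sub[OF rho_limit[OF n'(1) that]])
   show "(%m. \<rho> (r (s m)) (int n + 1) K) \<longlonglongrightarrow> 1" if "K \<in> cells X" for K
    using sub[OF rho_limit[OF n'(2) that]] by (simp add: add.commute)
   show "(%m. ut (r (s m)) (Suc n) Y) \<longlonglongrightarrow> vt (Suc n) Y" if "Y \<in> all_faces X" for Y by (rule lt[OF n'(2) that]) simp
  qed (use n in \<open>simp_all add: lu lp vH vtH\<close>)
 qed (simp_all add: vH mean)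
 then show ?thesis
  by (intro exI[of _ s] exI[of _ v] exI[of _ p] conjI allI impI ballI s(1) lu lp)
qed

text \<open>Induction over the steps. The argument for one step requires a divergence-free
  transporting velocity; the scheme provides it after each correction, and for the first step it
  comes from the well-prepared data through \<open>v0_div\<close>.\<close>

lemma incompressible_unique:
 assumes s1: "incompressible_solution X \<mu> lam dt N wl p0 v p" and s2: "incompressible_solution X \<mu> lam dt N wl p0 w q"
 shows "n \<le> N ==> (\<forall>Y\<in>all_faces X. v n Y = w n Y) \<and> (\<forall>K\<in>cells X. p n K = q n K)"
proof -
 note S1 = s1[unfolded incompressible_solution_iff] and S2 = s2[unfolded incompressible_solution_iff]
 have H1: "v n \<in> HE0 X" "(\<Sum>K\<in>cells X. vol K * p n K) = 0" if "n \<le> N" for n using S1 that by blast+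
 have H2: "w n \<in> HE0 X" "(\<Sum>K\<in>cells X. vol K * q n K) = 0" if "n \<le> N" for n using S2 that by blast+
 obtain vt where vt: "\<forall>n<N. incompressible_step \<mu> lam dt (v n) (vt (Suc n)) (v (Suc n)) (p n) (p (Suc n))" using S1 by (elim conjE exE)
 obtain wt where wt: "\<forall>n<N. incompressible_step \<mu> lam dt (w n) (wt (Suc n)) (w (Suc n)) (q n) (q (Suc n))" using S2 by (elim conjE exE)
 have i: "x 0 Y = v0 Y" if x: "x 0 \<in> HE0 X" "\<forall>Y\<in>int_faces X. x 0 Y = trace_mean (domain X) Y wl" and Y: "Y \<in> all_faces X"
  for x :: "nat => 'n vector_field" and Y
 proof (cases "Y \<in> int_faces X - ext_faces X")
  case True
  then show ?thesis using x(2) by (simp add: v0_def)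
 next
  case False
  then have "x 0 Y = 0" using x(1) HE0_zero[OF x(1) Y] by (auto simp: HE0_def)
  moreover have "v0 Y = 0" unfolding v0_def by (rule if_not_P[OF False])
  ultimately show ?thesis by simp
 qed
 have iv: "v 0 Y = v0 Y" "w 0 Y = v0 Y" if "Y \<in> all_faces X" for Y
 proof -
  have "v 0 \<in> HE0 X" "w 0 \<in> HE0 X" by (rule H1(1) H2(1), simp)+
  moreover have "\<forall>Y\<in>int_faces X. v 0 Y = trace_mean (domain X) Y wl" "\<forall>Y\<in>int_faces X. w 0 Y = trace_mean (domain X) Y wl"
   using S1 S2 by blast+
  ultimately show "v 0 Y = v0 Y" "w 0 Y = v0 Y" using i[of v Y] i[of w Y] that by blast+
 qed
 have dv: "vel_div X (v n) K = 0" if n: "n \<le> N" and K: "K \<in> cells X" for n K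
 proof (cases n)
  case 0
  have f: "v 0 Y = v0 Y" if "Y \<in> faces K" for Y
   by (rule iv(1)) (use that K in \<open>auto simp: all_faces_def\<close>)
  have "vel_div X (v 0) K = vel_div X v0 K"
   unfolding vel_div_def by (intro arg_cong2[where f="(*)"] refl sum.cong) (simp add: f)
  then show ?thesis using v0_div[OF K] 0 by simp
 next
  case (Suc k)
  then have "k < N" using n by simp
  note conjunct2[OF conjunct2[OF conjunct2[OF mp[OF spec[OF vt] this, unfolded incompressible_step_def]]]]
  from bspec[OF this K] show ?thesis unfolding Suc .
 qed
 show "n \<le> N ==> (\<forall>Y\<in>all_faces X. v n Y = w n Y) \<and> (\<forall>K\<in>cells X. p n K = q n K)" for n
 proof (induction n)
  case 0
  have "\<forall>K\<in>cells X. p 0 K = p0 K" "\<forall>K\<in>cells X. q 0 K = p0 K" using S1 S2 by blast+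
  with iv show ?case by simp
 next
  case (Suc n)
  then have n: "n < N" "n \<le> N" "Suc n \<le> N" by simp_all
  note IH = Suc.IH[OF n(2)]
  note un = incompressible_step_unique[OF dt \<mu> vt[rule_format, OF n(1)] wt[rule_format, OF n(1)] H1(1)[OF n(2)] H1(1)[OF n(3)] H2(1)[OF n(3)]
    bspec[OF conjunct1[OF IH]] bspec[OF conjunct2[OF IH]] dv[OF n(2)] H1(2)[OF n(3)] H2(2)[OF n(3)]]
  show ?case using un by (intro conjI ballI)
 qed
qed

text \<open>Every further subsequence contains one that converges to some solution of the limit
  scheme with the same initial pressure, and by uniqueness this solution agrees with the given one
  on the mesh.\<close>

lemma convergence:
 fixes r :: "nat => nat"
 assumes r: "strict_mono r" and p0: "\<forall>K\<in>cells X. (%m. delta_p X \<gamma> (e (r m)) (\<rho> (r m)) 0 K) \<longlonglongrightarrow> p0 K"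
  and sol: "incompressible_solution X \<mu> lam dt N wl p0 v p"
 shows "tends_in_discrete_norms X N (%m. u (r m)) (%m. delta_p X \<gamma> (e (r m)) (\<rho> (r m))) v p"
 unfolding tends_in_discrete_norms_def
proof (intro allI impI LIMSEQ_subseq_principle)
 fix \<nu> and k :: "nat => nat" assume \<nu>: "discrete_norm X N \<nu>" and k: "strict_mono k"
 have rk: "strict_mono (%m. r (k m))" using strict_mono_o[OF r k] by (simp add: o_def)
 have p0k: "\<forall>K\<in>cells X. (%m. delta_p X \<gamma> (e (r (k m))) (\<rho> (r (k m))) 0 K) \<longlonglongrightarrow> p0 K"
 proof
  fix K assume "K \<in> cells X"
  from LIMSEQ_subseq_LIMSEQ[OF bspec[OF p0 this] k]
  show "(%m. delta_p X \<gamma> (e (r (k m))) (\<rho> (r (k m))) 0 K) \<longlonglongrightarrow> p0 K" by (simp add: o_def)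
 qed
 obtain s w q where s: "incompressible_solution X \<mu> lam dt N wl p0 w q"
  "\<forall>n\<le>N. \<forall>Y\<in>all_faces X. (%m. u (r (k (s m))) n Y) \<longlonglongrightarrow> w n Y"
  "\<forall>n\<le>N. \<forall>K\<in>cells X. (%m. delta_p X \<gamma> (e (r (k (s m)))) (\<rho> (r (k (s m)))) n K) \<longlonglongrightarrow> q n K"
  using compactness[OF rk p0k] by (elim exE conjE)
 note un = incompressible_unique[OF s(1) sol]
 have vH: "v n \<in> HE0 X" if "n \<le> N" for n using sol that unfolding incompressible_solution_def by blast
 have "tends_in_discrete_norms X N (%m. u (r (k (s m)))) (%m. delta_p X \<gamma> (e (r (k (s m)))) (\<rho> (r (k (s m))))) v p"
 proof (rule tends_in_discrete_normsI[OF H vH])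
  show "(%m. u (r (k (s m))) n Y) \<longlonglongrightarrow> v n Y" if "n \<le> N" "Y \<in> all_faces X" for n Y
   using bspec[OF mp[OF spec[OF s(2)] that(1)] that(2)] bspec[OF conjunct1[OF un[OF that(1)]] that(2)] by simp
  show "(%m. delta_p X \<gamma> (e (r (k (s m)))) (\<rho> (r (k (s m)))) n K) \<longlonglongrightarrow> p n K" if "n \<le> N" "K \<in> cells X" for n K
   using bspec[OF mp[OF spec[OF s(3)] that(1)] that(2)] bspec[OF conjunct2[OF un[OF that(1)]] that(2)] by simp
 qed
 from mp[OF spec[OF this[unfolded tends_in_discrete_norms_def]] \<nu>]
 show "\<exists>s :: nat => nat. (%m. \<nu> (%n Y. u (r (k (s m))) n Y - v n Y)
   (%n K. delta_p X \<gamma> (e (r (k (s m)))) (\<rho> (r (k (s m)))) n K - p n K)) \<longlonglongrightarrow> 0" by (rule exI[where x=s])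
qed

text \<open>The cellwise bound on the density defect is uniform over the finitely many cells and
  steps and has order \<epsilon>^2; the volume of the domain converts it into any exponent
  q.\<close>

lemma density_error:
 assumes "0 < q"
 shows "\<exists>C>0. \<forall>m. Linf_Lq_nrm X N q (%n K. \<rho> m (int n) K - 1) \<le> C * (e m)\<^sup>2"
proof -
 have fin: "finite ({..N} \<times> cells X)" using finite_cells by simp
 have B: "Bseq (%m. (\<rho> m (int (fst i)) (snd i) - 1) / (e m)\<^sup>2)" if "i \<in> {..N} \<times> cells X" for i
  by (rule rho_bounded) (use that in auto)
 obtain C where C: "C \<ge> 0" "!!m i. i \<in> {..N} \<times> cells X ==> norm ((\<rho> m (int (fst i)) (snd i) - 1) / (e m)\<^sup>2) \<le> C"
  by (rule Bseq_uniform[OF fin, of "%m i. (\<rho> m (int (fst i)) (snd i) - 1) / (e m)\<^sup>2", OF B], assumption, rule that; blast)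
 have "Linf_Lq_nrm X N q (%n K. \<rho> m (int n) K - 1) \<le> (vol (domain X) powr (1 / q) * C + 1) * (e m)\<^sup>2" for m
 proof -
  have "Linf_Lq_nrm X N q (%n K. \<rho> m (int n) K - 1) \<le> vol (domain X) powr (1 / q) * (C * (e m)\<^sup>2)"
  proof (rule Linf_Lq_nrm_le[OF _ _ assms])
   show "\<bar>\<rho> m (int n) K - 1\<bar> \<le> C * (e m)\<^sup>2" if "n \<le> N" "K \<in> cells X" for n K
    using C(2)[of "(n, K)" m] that e(1)[of m] by (simp add: abs_divide pos_divide_le_eq)
  qed (use C(1) in simp)
  also have "... \<le> (vol (domain X) powr (1 / q) * C + 1) * (e m)\<^sup>2" by (simp add: algebra_simps)
  finally show ?thesis .
 qed
 moreover have "vol (domain X) powr (1 / q) * C + 1 > 0" using C(1) by (simp add: add_nonneg_pos)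
 ultimately show ?thesis by blast
qed

end

theorem theorem6p8:
  fixes X :: "('n::finite) staggered_mesh"
    and \<gamma> \<mu> lam T dt :: real and N :: nat
    and \<epsilon> :: "nat \<Rightarrow> real"
    and \<rho>0 :: "nat \<Rightarrow> real^'n \<Rightarrow> real"
    and u0 :: "nat \<Rightarrow> real^'n \<Rightarrow> real^'n"
    and u0_lim :: "real^'n \<Rightarrow> real^'n"
    and \<rho> :: "nat \<Rightarrow> int \<Rightarrow> 'n scalar_field"
    and u :: "nat \<Rightarrow> nat \<Rightarrow> 'n vector_field"
  assumes "staggered_discretization X"
    and "\<gamma> \<ge> 1" and "\<mu> > 0" and "\<mu> + lam > 0"
    and "T > 0" and "dt > 0" and "N = nat \<lfloor>T / dt\<rfloor>"
    and "\<And>m. \<epsilon> m > 0" and "\<epsilon> \<longlonglongrightarrow> 0"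
    and "well_prepared (domain X) \<epsilon> \<rho>0 u0 u0_lim"
    and "\<And>m. PC_solution X \<gamma> \<mu> lam dt N (\<epsilon> m) (\<rho>0 m) (u0 m) (\<rho> m) (u m)"
  shows
    "(\<lambda>m. Linf_Lq_nrm X N \<gamma> (\<lambda>n K. \<rho> m (int n) K - 1)) \<longlonglongrightarrow> 0 \<and>
     (\<forall>q. 1 \<le> q \<and> q \<le> min 2 \<gamma> \<longrightarrow>
        (\<exists>C>0. \<forall>\<^sub>F m in sequentially.
           Linf_Lq_nrm X N q (\<lambda>n K. \<rho> m (int n) K - 1) \<le> C * \<epsilon> m)) \<and>
     (\<forall>r p0. strict_mono r \<and>
          (\<forall>K\<in>cells X. (\<lambda>m. delta_p X \<gamma> (\<epsilon> (r m)) (\<rho> (r m)) 0 K) \<longlonglongrightarrow> p0 K) \<longrightarrow>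
        (\<exists>v p. incompressible_solution X \<mu> lam dt N u0_lim p0 v p) \<and>
        (\<forall>v p. incompressible_solution X \<mu> lam dt N u0_lim p0 v p \<longrightarrow>
           tends_in_discrete_norms X N (\<lambda>m. u (r m))
             (\<lambda>m. delta_p X \<gamma> (\<epsilon> (r m)) (\<rho> (r m))) v p)) \<and>
     (\<forall>r. strict_mono (r :: nat \<Rightarrow> nat) \<longrightarrow> (\<exists>s p0. strict_mono (s :: nat \<Rightarrow> nat) \<and>
        (\<forall>K\<in>cells X. (\<lambda>m. delta_p X \<gamma> (\<epsilon> (r (s m))) (\<rho> (r (s m))) 0 K) \<longlonglongrightarrow> p0 K)))"
proof -
 interpret low_Mach X \<gamma> \<mu> lam dt N \<epsilon> \<rho>0 u0 u0_lim \<rho> u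
  by unfold_locales (use assms in \<open>simp_all add: staggered_discretization_def\<close>)
 show ?thesis
 proof (intro conjI allI impI)
  obtain C where C: "C > 0" "!!m. Linf_Lq_nrm X N \<gamma> (%n K. \<rho> m (int n) K - 1) \<le> C * (\<epsilon> m)\<^sup>2"
   using density_error[of \<gamma>] \<gamma> by auto
  show "(%m. Linf_Lq_nrm X N \<gamma> (%n K. \<rho> m (int n) K - 1)) \<longlonglongrightarrow> 0"
  proof (rule Lim_null_comparison)
   show "\<forall>\<^sub>F m in sequentially. norm (Linf_Lq_nrm X N \<gamma> (%n K. \<rho> m (int n) K - 1)) \<le> C * (\<epsilon> m)\<^sup>2"
    using C(2) by (intro always_eventually allI) (simp only: real_norm_def abs_of_nonneg[OF Linf_Lq_nrm_nonneg])
   show "(%m. C * (\<epsilon> m)\<^sup>2) \<longlonglongrightarrow> 0" using tendsto_mult[OF tendsto_const[of C] tendsto_power[OF e(2), of 2]] by simp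
  qed
 next
  fix q :: real assume "1 \<le> q \<and> q \<le> min 2 \<gamma>"
  then obtain C where C: "C > 0" "!!m. Linf_Lq_nrm X N q (%n K. \<rho> m (int n) K - 1) \<le> C * (\<epsilon> m)\<^sup>2"
   using density_error[of q] by auto
  \<comment> \<open>The estimate has order \<epsilon>^2, which is at most \<epsilon> once \<epsilon>
    < 1; this is where m has to be large.\<close>
  have "\<forall>\<^sub>F m in sequentially. \<epsilon> m < 1" using order_tendstoD(2)[OF e(2)] by simp
  then have "\<forall>\<^sub>F m in sequentially. Linf_Lq_nrm X N q (%n K. \<rho> m (int n) K - 1) \<le> C * \<epsilon> m"
  proof eventually_elim
   case (elim m)
   have "(\<epsilon> m)\<^sup>2 \<le> \<epsilon> m" using elim e(1)[of m] mult_left_mono[of "\<epsilon> m" 1 "\<epsilon> m"] by (simp add: power2_eq_square)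
   then have "C * (\<epsilon> m)\<^sup>2 \<le> C * \<epsilon> m" using C(1) by simp
   then show ?case using C(2)[of m] by linarith
  qed
  then show "\<exists>C>0. \<forall>\<^sub>F m in sequentially. Linf_Lq_nrm X N q (%n K. \<rho> m (int n) K - 1) \<le> C * \<epsilon> m" using C(1) by blast
 next
  fix r :: "nat => nat" and p0
  assume a: "strict_mono r \<and> (\<forall>K\<in>cells X. (%m. delta_p X \<gamma> (\<epsilon> (r m)) (\<rho> (r m)) 0 K) \<longlonglongrightarrow> p0 K)"
  show "\<exists>v p. incompressible_solution X \<mu> lam dt N u0_lim p0 v p"
   using compactness[OF conjunct1[OF a] conjunct2[OF a]] by (elim exE conjE) (intro exI)
  show "tends_in_discrete_norms X N (%m. u (r m)) (%m. delta_p X \<gamma> (\<epsilon> (r m)) (\<rho> (r m))) v p"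
   if "incompressible_solution X \<mu> lam dt N u0_lim p0 v p" for v p
   by (rule convergence[OF conjunct1[OF a] conjunct2[OF a] that])
 next
  fix r :: "nat => nat" assume r: "strict_mono r"
  show "\<exists>s p0. strict_mono (s :: nat => nat) \<and> (\<forall>K\<in>cells X. (%m. delta_p X \<gamma> (\<epsilon> (r (s m))) (\<rho> (r (s m))) 0 K) \<longlonglongrightarrow> p0 K)"
   by (rule convergent_subseq_finite[OF finite_cells, of "%m K. delta_p X \<gamma> (\<epsilon> (r m)) (\<rho> (r m)) 0 K"])
    (rule Bseq_subseq[OF delta_p_bounded], simp_all)
 qed
qed

end
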